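(* Let $m,n\ge 1$ and $1\le m_1<m$ be integers, let $A^0,A^1,\dots,A^n,L$ be real constant $m\times m$ matrices, and let $Q^1,\dots,Q^n,R$ be real constant $m_1\times m$ matrices. Suppose that conditions (A), (C), (S), (S* )$_2$ and (K* ) (all spelled out in the context; (S) and (S* )$_2$ are required for one and the same matrix $S$) hold. Let $s\ge 0$ be an integer, and suppose that $u_0\in H^s(\mathbb{R}^n)\cap L^1(\mathbb{R}^n)$ satisfies the constraint $$\sum_{j=1}^nQ^ju_{x_j}+Ru=0\qquad(\ast)$$ (with $u=u_0$). Then the solution $u=u(t,x)\in\mathbb{R}^m$ of the Cauchy problem $$A^0u_t+\sum_{j=1}^nA^ju_{x_j}+Lu=0\quad(t>0,\ x\in\mathbb{R}^n),\qquad u|_{t=0}=u_0,$$ satisfies $(\ast)$ for all $t>0$. Moreover, there are constants $C,c>0$ (independent of $t,\xi,u_0$) such that the solution satisfies the pointwise estimate $$|\hat u(t,\xi)|\le Ce^{-c\,\rho(\xi)t}|\hat u_0(\xi)|,\qquad \rho(\xi):=\frac{|\xi|^2}{1+|\xi|^2},$$ for $t\ge 0$, $\xi\in\mathbb{R}^n$, and the decay estimate $$\|\partial_x^ku(t)\|_{L^2}\le C(1+t)^{-n/4-k/2}\|u_0\|_{L^1}+Ce^{-ct}\|\partial_x^ku_0\|_{L^2}$$ for all $t\ge 0$ and all nonnegative integers $k\le s$.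
   Context: Notation. $\langle\cdot,\cdot\rangle$ is the standard complex inner product. For a matrix $X$ and a subspace $V$, "$X\ge 0$ on $V$" means $\mathrm{Re}\,\langle Xz,z\rangle\ge 0$ for all $z\in V$, and "$X>0$ on $V$" means $\mathrm{Re}\,\langle Xz,z\rangle>0$ for all $0\ne z\in V$. For a real square matrix $X$, $X_1:=(X+X^T)/2$ and $X_2:=(X-X^T)/2$ are its symmetric and skew-symmetric parts. Kernels are taken in $\mathbb{C}^m$. For $\omega\in S^{n-1}$, $A(\omega):=\sum_{j=1}^nA^j\omega_j$ and $Q(\omega):=\sum_{j=1}^nQ^j\omega_j$. $\partial_x^k$ denotes the totality of all $k$-th order $x$-derivatives, and $H^s$ is the $L^2$-based Sobolev space. $\hat u(t,\xi)$ is the Fourier transform in $x$ of $u$; it solves $A^0\hat u_t+i|\xi|A(\omega)\hat u+L\hat u=0$, $\hat u(0,\xi)=\hat u_0(\xi)$, with $\omega=\xi/|\xi|$. In Fourier variables the constraint $(\ast)$ reads $i|\xi|Q(\omega)\hat u+R\hat u=0$. $\mathrm{Image}(R):=\{R\phi:\phi\in\mathbb{C}^m\}\subset\mathbb{C}^{m_1}$; $\Pi_1$ is the orthogonal projection of $\mathbb{C}^{m_1}$ onto $\mathrm{Image}(R)$ and $\Pi_2:=I-\Pi_1$ (both are real symmetric $m_1\times m_1$ matrices). For $\omega\in S^{n-1}$, $X_\omega:=\{\phi\in\mathbb{C}^m:\Pi_2Q(\omega)\phi=0\}$. Condition (A): $A^0,A^1,\dots,A^n$ are real symmetric, $A^0>0$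 on $\mathbb{C}^m$, $L$ is real (not necessarily symmetric) with $L\ge 0$ on $\mathbb{C}^m$, and $\mathrm{Ker}(L)\ne\{0\}$. Condition (C): for each $\omega\in S^{n-1}$, $Q(\omega)(A^0)^{-1}A(\omega)=0$, $R(A^0)^{-1}L=0$, and $Q(\omega)(A^0)^{-1}L+R(A^0)^{-1}A(\omega)=0$. Condition (S): there is a real constant matrix $S$ such that $(SA^0)^T=SA^0$, $(SL)_1+L_1\ge 0$ on $\mathbb{C}^m$, and $\mathrm{Ker}((SL)_1+L_1)=\mathrm{Ker}(L)$. Condition (S* )$_2$: the matrix $S$ in condition (S) satisfies $i(SA(\omega)-T(\omega))_2\ge 0$ on $\mathbb{C}^m$ for each $\omega\in S^{n-1}$, where $T(\omega):=(\Pi_1Q(\omega))^T\tilde S R$ with $\tilde S$ a real $m_1\times m_1$ matrix such that $\tilde S_1\ge 0$ on $\mathrm{Image}(R)$. Condition (K* ): there is a real matrix-valued function $K(\omega)\in C^\infty(S^{n-1})$ such that for each $\omega\in S^{n-1}$: $K(-\omega)=-K(\omega)$, $(K(\omega)A^0)^T=-K(\omega)A^0$, and $(K(\omega)A(\omega))_1>0$ on $X_\omega\cap\mathrm{Ker}(L)$. *)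

theory Defs
  imports "HOL-Analysis.Analysis"
begin

section \<open>Complexified real matrices, definiteness on subspaces\<close>

abbreviation cmat :: "real^'a^'b \<Rightarrow> complex^'a^'b" where
  "cmat \<equiv> map_matrix complex_of_real"

definition cinner :: "complex^'a \<Rightarrow> complex^'a \<Rightarrow> complex" where
  "cinner z w = (\<Sum>i\<in>UNIV. z $ i * cnj (w $ i))"

definition nonneg_on :: "complex^'a^'a \<Rightarrow> (complex^'a) set \<Rightarrow> bool" where
  "nonneg_on X V \<longleftrightarrow> (\<forall>z\<in>V. Re (cinner (X *v z) z) \<ge> 0)"

definition pos_on :: "complex^'a^'a \<Rightarrow> (complex^'a) set \<Rightarrow> bool" where
  "pos_on X V \<longleftrightarrow> (\<forall>z\<in>V. z \<noteq> 0 \<longrightarrow> Re (cinner (X *v z) z) > 0)"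

definition sym_part :: "real^'a^'a \<Rightarrow> real^'a^'a" where
  "sym_part X = (1/2) *\<^sub>R (X + transpose X)"

definition skew_part :: "real^'a^'a \<Rightarrow> real^'a^'a" where
  "skew_part X = (1/2) *\<^sub>R (X - transpose X)"

definition kerC :: "real^'a^'b \<Rightarrow> (complex^'a) set" where
  "kerC X = {z. cmat X *v z = 0}"

definition imageC :: "real^'a^'b \<Rightarrow> (complex^'b) set" where
  "imageC X = range (\<lambda>z. cmat X *v z)"

text \<open>The symbol of a family of matrices; used for \<open>A(\<omega>)\<close> and \<open>Q(\<omega>)\<close>.\<close>

definition symbol :: "('n \<Rightarrow> real^'a^'b) \<Rightarrow> real^'n \<Rightarrow> real^'a^'b" where
  "symbol A \<omega> = (\<Sum>j\<in>UNIV. \<omega> $ j *\<^sub>R A j)"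

text \<open>The orthogonal projection of complex space onto the image of the real matrix \<open>R\<close>
  has a real matrix, so it is described as a real matrix here.\<close>

definition Pi1 :: "real^'m^'p \<Rightarrow> real^'p^'p" where
  "Pi1 R = (THE P. \<forall>y. cmat P *v y \<in> imageC R \<and>
                       (\<forall>w\<in>imageC R. cinner (y - cmat P *v y) w = 0))"

definition Pi2 :: "real^'m^'p \<Rightarrow> real^'p^'p" where
  "Pi2 R = mat 1 - Pi1 R"

definition Xspace :: "('n \<Rightarrow> real^'m^'p) \<Rightarrow> real^'m^'p \<Rightarrow> real^'n \<Rightarrow> (complex^'m) set" where
  "Xspace Q R \<omega> = {\<phi>. cmat (Pi2 R ** symbol Q \<omega>) *v \<phi> = 0}"


section \<open>Smooth functions\<close>

fun Ck_on :: "'a::real_normed_vector set \<Rightarrow> ('a \<Rightarrow> 'b::real_normed_vector) \<Rightarrow> nat \<Rightarrow> bool" where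
  "Ck_on U f 0 \<longleftrightarrow> continuous_on U f"
| "Ck_on U f (Suc k) \<longleftrightarrow>
     (\<forall>x\<in>U. f differentiable (at x)) \<and> (\<forall>v. Ck_on U (\<lambda>x. frechet_derivative f (at x) v) k)"

definition smooth_on :: "'a::real_normed_vector set \<Rightarrow> ('a \<Rightarrow> 'b::real_normed_vector) \<Rightarrow> bool" where
  "smooth_on U f \<longleftrightarrow> (\<forall>k. Ck_on U f k)"

text \<open>Smoothness on the unit sphere as an embedded submanifold: there is a smooth extension to an
  open neighbourhood.\<close>

definition smooth_on_unit_sphere :: "(real^'n \<Rightarrow> 'b::real_normed_vector) \<Rightarrow> bool" where
  "smooth_on_unit_sphere f \<longleftrightarrow>
     (\<exists>U g. open U \<and> sphere 0 1 \<subseteq> U \<and> smooth_on U g \<and> (\<forall>\<omega>\<in>sphere 0 1. g \<omega> = f \<omega>))"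


section \<open>The structural conditions\<close>

definition condition_A :: "real^'m^'m \<Rightarrow> ('n::finite \<Rightarrow> real^'m^'m) \<Rightarrow> real^'m^'m \<Rightarrow> bool" where
  "condition_A A0 A L \<longleftrightarrow>
     transpose A0 = A0 \<and> (\<forall>j. transpose (A j) = A j) \<and>
     pos_on (cmat A0) UNIV \<and> nonneg_on (cmat L) UNIV \<and> kerC L \<noteq> {0}"

definition condition_C ::
  "real^'m^'m \<Rightarrow> ('n::finite \<Rightarrow> real^'m^'m) \<Rightarrow> real^'m^'m \<Rightarrow> ('n \<Rightarrow> real^'m^'p) \<Rightarrow> real^'m^'p \<Rightarrow> bool"
where
  "condition_C A0 A L Q R \<longleftrightarrow>
     (\<forall>\<omega>\<in>sphere 0 1.
        symbol Q \<omega> ** matrix_inv A0 ** symbol A \<omega> = 0 \<and>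
        R ** matrix_inv A0 ** L = 0 \<and>
        symbol Q \<omega> ** matrix_inv A0 ** L + R ** matrix_inv A0 ** symbol A \<omega> = 0)"

definition condition_S :: "real^'m^'m \<Rightarrow> real^'m^'m \<Rightarrow> real^'m^'m \<Rightarrow> bool" where
  "condition_S S A0 L \<longleftrightarrow>
     transpose (S ** A0) = S ** A0 \<and>
     nonneg_on (cmat (sym_part (S ** L) + sym_part L)) UNIV \<and>
     kerC (sym_part (S ** L) + sym_part L) = kerC L"

definition T_matrix ::
  "('n::finite \<Rightarrow> real^'m^'p) \<Rightarrow> real^'m^'p \<Rightarrow> real^'p^'p \<Rightarrow> real^'n \<Rightarrow> real^'m^'m" where
  "T_matrix Q R St \<omega> = transpose (Pi1 R ** symbol Q \<omega>) ** St ** R"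

definition condition_S2 ::
  "real^'m^'m \<Rightarrow> ('n::finite \<Rightarrow> real^'m^'m) \<Rightarrow> ('n \<Rightarrow> real^'m^'p) \<Rightarrow> real^'m^'p \<Rightarrow> bool" where
  "condition_S2 S A Q R \<longleftrightarrow>
     (\<exists>St :: real^'p^'p.
        nonneg_on (cmat (sym_part St)) (imageC R) \<and>
        (\<forall>\<omega>\<in>sphere 0 1.
           nonneg_on (map_matrix (\<lambda>x. \<i> * complex_of_real x)
                        (skew_part (S ** symbol A \<omega> - T_matrix Q R St \<omega>))) UNIV))"

definition condition_K ::
  "real^'m^'m \<Rightarrow> ('n::finite \<Rightarrow> real^'m^'m) \<Rightarrow> real^'m^'m \<Rightarrow> ('n \<Rightarrow> real^'m^'p) \<Rightarrow> real^'m^'p \<Rightarrow> bool"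
where
  "condition_K A0 A L Q R \<longleftrightarrow>
     (\<exists>K :: real^'n \<Rightarrow> real^'m^'m.
        smooth_on_unit_sphere K \<and>
        (\<forall>\<omega>\<in>sphere 0 1.
           K (- \<omega>) = - K \<omega> \<and>
           transpose (K \<omega> ** A0) = - (K \<omega> ** A0) \<and>
           pos_on (cmat (sym_part (K \<omega> ** symbol A \<omega>))) (Xspace Q R \<omega> \<inter> kerC L)))"


section \<open>Function spaces\<close>

definition in_L2 :: "(real^'n \<Rightarrow> 'b::euclidean_space) \<Rightarrow> bool" where
  "in_L2 u \<longleftrightarrow> u \<in> borel_measurable lborel \<and> integrable lborel (\<lambda>x. (norm (u x))\<^sup>2)"

definition L2_norm :: "(real^'n \<Rightarrow> 'b::euclidean_space) \<Rightarrow> real" where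
  "L2_norm u = sqrt (LINT x|lborel. (norm (u x))\<^sup>2)"

definition L1_norm :: "(real^'n \<Rightarrow> 'b::euclidean_space) \<Rightarrow> real" where
  "L1_norm u = (LINT x|lborel. norm (u x))"

text \<open>The extended integral is used because the Bochner integral of a non-integrable
  function is 0.\<close>

definition L2_tendsto ::
  "('i \<Rightarrow> real^'n \<Rightarrow> 'b::euclidean_space) \<Rightarrow> (real^'n \<Rightarrow> 'b) \<Rightarrow> 'i filter \<Rightarrow> bool" where
  "L2_tendsto f g F \<longleftrightarrow>
     ((\<lambda>i. \<integral>\<^sup>+x. ennreal ((norm (f i x - g x))\<^sup>2) \<partial>lborel) \<longlongrightarrow> 0) F"

definition test_function :: "(real^'n \<Rightarrow> real) \<Rightarrow> bool" where
  "test_function \<phi> \<longleftrightarrow> smooth_on UNIV \<phi> \<and> compact (closure {x. \<phi> x \<noteq> 0})"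

text \<open>Iterated partial derivatives; a \<open>k\<close>-th order derivative is indexed by a list of \<open>k\<close>
  coordinate directions, i.e. by a position in the tensor of all \<open>k\<close>-th order derivatives.\<close>

fun partials :: "'n list \<Rightarrow> (real^'n \<Rightarrow> real) \<Rightarrow> real^'n \<Rightarrow> real" where
  "partials [] \<phi> = \<phi>"
| "partials (j # js) \<phi> = (\<lambda>x. frechet_derivative (partials js \<phi>) (at x) (axis j 1))"

definition is_weak_deriv ::
  "'n::finite list \<Rightarrow> (real^'n \<Rightarrow> 'b::euclidean_space) \<Rightarrow> (real^'n \<Rightarrow> 'b) \<Rightarrow> bool" where
  "is_weak_deriv js u v \<longleftrightarrow>
     (\<forall>\<phi>. test_function \<phi> \<longrightarrow>
        (LINT x|lborel. \<phi> x *\<^sub>R v x) =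
        (-1) ^ length js *\<^sub>R (LINT x|lborel. partials js \<phi> x *\<^sub>R u x))"

definition in_Hs :: "nat \<Rightarrow> (real^'n \<Rightarrow> 'b::euclidean_space) \<Rightarrow> bool" where
  "in_Hs s u \<longleftrightarrow>
     in_L2 u \<and> (\<forall>js. length js \<le> s \<longrightarrow> (\<exists>v. in_L2 v \<and> is_weak_deriv js u v))"

text \<open>A representative of the weak derivative, which is unique almost everywhere; meaningful
  only if \<open>u\<close> has such a derivative in \<open>L\<^sup>2\<close>.\<close>

definition weak_deriv ::
  "'n::finite list \<Rightarrow> (real^'n \<Rightarrow> 'b::euclidean_space) \<Rightarrow> real^'n \<Rightarrow> 'b" where
  "weak_deriv js u = (SOME v. in_L2 v \<and> is_weak_deriv js u v)"

text \<open>The \<open>L\<^sup>2\<close> norm of the totality of the \<open>k\<close>-th order derivatives.\<close>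

definition deriv_L2_norm :: "nat \<Rightarrow> (real^'n \<Rightarrow> 'b::euclidean_space) \<Rightarrow> real" where
  "deriv_L2_norm k u = sqrt (\<Sum>js | length js = k. (L2_norm (weak_deriv js u))\<^sup>2)"


section \<open>Fourier transform\<close>

text \<open>The normalisation is without a factor in front of the integral.\<close>

definition fourier :: "(real^'n \<Rightarrow> real^'m) \<Rightarrow> real^'n \<Rightarrow> complex^'m" where
  "fourier u \<xi> = (LINT x|lborel. cis (- (x \<bullet> \<xi>)) *s (\<chi> i. complex_of_real (u x $ i)))"

text \<open>The Fourier--Plancherel transform on \<open>L\<^sup>2\<close>: the \<open>L\<^sup>2\<close> limit of the transforms of the
  truncations to balls. It is determined only almost everywhere, hence a relation.\<close>

definition is_L2_fourier :: "(real^'n \<Rightarrow> real^'m) \<Rightarrow> (real^'n \<Rightarrow> complex^'m) \<Rightarrow> bool" where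
  "is_L2_fourier u v \<longleftrightarrow>
     in_L2 v \<and>
     L2_tendsto (\<lambda>r::real. fourier (\<lambda>x. indicator (cball 0 r) x *\<^sub>R u x)) v at_top"


section \<open>Constraint and Cauchy problem\<close>

text \<open>The constraint \<open>\<Sum>\<^sub>j Q\<^sup>j u\<^bsub>x\<^sub>j\<^esub> + R u = 0\<close> in the sense of distributions.\<close>

definition satisfies_constraint ::
  "('n \<Rightarrow> real^'m^'p) \<Rightarrow> real^'m^'p \<Rightarrow> (real^'n \<Rightarrow> real^'m) \<Rightarrow> bool" where
  "satisfies_constraint Q R u \<longleftrightarrow>
     (\<forall>\<phi>. test_function \<phi> \<longrightarrow>
        (LINT x|lborel. \<phi> x *\<^sub>R (R *v u x)
                        - (\<Sum>j\<in>UNIV. partials [j] \<phi> x *\<^sub>R (Q j *v u x))) = 0)"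

text \<open>Solutions in \<open>C([0,\<infinity>); L\<^sup>2)\<close> of \<open>A\<^sup>0 u\<^sub>t + \<Sum>\<^sub>j A\<^sup>j u\<^bsub>x\<^sub>j\<^esub> + L u = 0\<close>, \<open>u(0) = u\<^sub>0\<close>, the equation
  being understood in the sense of distributions in \<open>x\<close> for each \<open>t > 0\<close>. For this class
  the symmetric hyperbolic problem is well posed for data in \<open>L\<^sup>2\<close>, and it contains the usual
  solutions in \<open>C([0,\<infinity>); H\<^sup>s)\<close>.\<close>

definition is_solution ::
  "real^'m^'m \<Rightarrow> ('n \<Rightarrow> real^'m^'m) \<Rightarrow> real^'m^'m \<Rightarrow>
   (real^'n \<Rightarrow> real^'m) \<Rightarrow> (real \<Rightarrow> real^'n \<Rightarrow> real^'m) \<Rightarrow> bool" where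
  "is_solution A0 A L u0 u \<longleftrightarrow>
     (\<forall>t\<ge>0. in_L2 (u t)) \<and>
     (\<forall>t\<ge>0. L2_tendsto u (u t) (at t within {0..})) \<and>
     (AE x in lborel. u 0 x = u0 x) \<and>
     (\<forall>\<phi>. test_function \<phi> \<longrightarrow>
        (\<forall>t>0. ((\<lambda>\<tau>. LINT x|lborel. \<phi> x *\<^sub>R (A0 *v u \<tau> x)) has_vector_derivative
                 (LINT x|lborel. (\<Sum>j\<in>UNIV. partials [j] \<phi> x *\<^sub>R (A j *v u t x))
                                 - \<phi> x *\<^sub>R (L *v u t x))) (at t)))"

definition rho :: "real^'n \<Rightarrow> real" where
  "rho \<xi> = (norm \<xi>)\<^sup>2 / (1 + (norm \<xi>)\<^sup>2)"

end

theory Submission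
  imports Defs "HOL-Probability.Probability"
begin

text \<open>
  On the Fourier side the system becomes, for each frequency \<open>\<xi>\<close>, a linear ordinary differential
  equation whose flow preserves the constraint because of condition (C).  For constrained data,
  a functional of the form
  \[ M \langle A^0 w, w\rangle + \langle S A^0 w, w\rangle
     - \varepsilon\,\frac{|\xi|}{1+|\xi|^2}\,\mathrm{Re}\,\langle i K(\omega) A^0 w, w\rangle \]
  is equivalent to \<open>|w|\<^sup>2\<close> and decays at rate \<open>\<rho>(\<xi>)\<close>: the term with \<open>S\<close> controls the component of
  \<open>w\<close> outside \<open>Ker L\<close>, the constraint turning the contribution of \<open>T(\<omega>)\<close> into one of good sign,
  and the term with \<open>K\<close> controls the rest.
  To identify the transform of an arbitrary solution with this flow, the equation is
  tested with \<open>exp(-i x \<xi>)\<close> times a cut-off at scale \<open>1/\<delta>\<close>; the localised transforms solve the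
  same differential equation up to an error of order \<open>\<delta>\<close>, and Plancherel's theorem allows the
  limit \<open>\<delta> \<rightarrow> 0\<close>.  Splitting at \<open>|\<xi>| = 1\<close> then gives the decay estimate: low frequencies are
  bounded by \<open>\<parallel>u\<^sub>0\<parallel>\<close> in \<open>L\<^sup>1\<close> and a Gaussian moment, high ones decay exponentially.
\<close>

section \<open>Square-integrable functions\<close>

text \<open>The obstacle is the weak notion of solution: \<open>u t\<close> is only square
  integrable, and the equation holds only against compactly supported real test functions, which
  exclude \<open>exp(-i x \<xi>)\<close>. So cut-off cosines and sines replace the exponential, and
  all control is in L2, hence Plancherel's theorem. The datum is integrable, so its transform is
  continuous; the flow preserves this, and that continuous representative makes an estimate at every
  \<xi> meaningful. Membership of \<open>u t\<close> in H^s is itself read off from the transform.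
  The weight \<open>r / (1 + r^2)\<close> of the K-term, with r = |\<xi>|, is bounded, which keeps
  the functional equivalent to |w|^2 uniformly in \<xi>, while its product with the factor r in
  front of A(\<omega>) is exactly \<rho>. Uniformity in the direction \<omega> comes from
  compactness of the set of pairs of unit vectors (\<omega>, x) with x in X_\<omega>.\<close>

definition L2_sq :: "(real^'n \<Rightarrow> 'b::euclidean_space) \<Rightarrow> ennreal" where
  "L2_sq f = (\<integral>\<^sup>+x. ennreal ((norm (f x))\<^sup>2) \<partial>lborel)"

lemma L2_tendsto_L2_sq: "L2_tendsto f g F \<longleftrightarrow> ((\<lambda>i. L2_sq (\<lambda>x. f i x - g x)) \<longlongrightarrow> 0) F"
  by (simp add: L2_tendsto_def L2_sq_def)

lemma in_L2_iff: "in_L2 f \<longleftrightarrow> f \<in> borel_measurable borel \<and> L2_sq f < \<infinity>"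
  unfolding in_L2_def L2_sq_def
  by (auto simp: integrable_iff_bounded)

lemma in_L2_measurable [measurable_dest]: "in_L2 f \<Longrightarrow> f \<in> borel_measurable borel"
  by (simp add: in_L2_iff)

lemma in_L2_finite: "in_L2 f \<Longrightarrow> L2_sq f < \<infinity>"
  by (simp add: in_L2_iff)

lemma L2_norm_sq:
  assumes "in_L2 f" shows "ennreal ((L2_norm f)\<^sup>2) = L2_sq f"
  using assms unfolding in_L2_def L2_norm_def L2_sq_def
  by (simp add: nn_integral_eq_integral)

lemma L2_norm_nonneg [simp]: "0 \<le> L2_norm f"
  by (simp add: L2_norm_def)

lemma L2_sq_mono:
  assumes "\<And>x. norm (f x) \<le> norm (g x)" shows "L2_sq f \<le> L2_sq g"
  unfolding L2_sq_def using assms by (intro nn_integral_mono ennreal_leI power_mono) auto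

lemma L2_sq_mono_scale:
  assumes "\<And>x. norm (f x) \<le> c * norm (g x)" "g \<in> borel_measurable borel"
  shows "L2_sq f \<le> ennreal (c\<^sup>2) * L2_sq g"
proof -
  have [measurable]: "g \<in> borel_measurable borel" by fact
  have "L2_sq f \<le> (\<integral>\<^sup>+x. ennreal (c\<^sup>2) * ennreal ((norm (g x))\<^sup>2) \<partial>lborel)"
    unfolding L2_sq_def
  proof (intro nn_integral_mono)
    fix x
    have "(norm (f x))\<^sup>2 \<le> (c * norm (g x))\<^sup>2" by (intro power_mono assms) auto
    then show "ennreal ((norm (f x))\<^sup>2) \<le> ennreal (c\<^sup>2) * ennreal ((norm (g x))\<^sup>2)"
      by (simp add: ennreal_mult'[symmetric] power_mult_distrib ennreal_leI)
  qed
  also have "\<dots> = ennreal (c\<^sup>2) * L2_sq g" unfolding L2_sq_def by (intro nn_integral_cmult) simp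
  finally show ?thesis .
qed

lemma L2_sq_cong_AE:
  assumes "AE x in lborel. f x = g x" shows "L2_sq f = L2_sq g"
  unfolding L2_sq_def using assms by (intro nn_integral_cong_AE) auto

lemma sq_norm_add_le: "(norm (a + b))\<^sup>2 \<le> 2 * (norm a)\<^sup>2 + 2 * (norm b)\<^sup>2" for a :: "'a::real_normed_vector"
proof -
  have "(norm (a + b))\<^sup>2 \<le> (norm a + norm b)\<^sup>2"
    by (intro power_mono norm_triangle_ineq) auto
  also have "\<dots> \<le> 2 * (norm a)\<^sup>2 + 2 * (norm b)\<^sup>2"
    using sum_squares_bound[of "norm a" "norm b"] by (simp add: power2_sum)
  finally show ?thesis .
qed

lemma L2_sq_add_le:
  assumes [measurable]: "f \<in> borel_measurable borel" "g \<in> borel_measurable borel"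
  shows "L2_sq (\<lambda>x. f x + g x) \<le> 2 * L2_sq f + 2 * L2_sq g"
proof -
  have "L2_sq (\<lambda>x. f x + g x) \<le> (\<integral>\<^sup>+x. 2 * ennreal ((norm (f x))\<^sup>2) + 2 * ennreal ((norm (g x))\<^sup>2) \<partial>lborel)"
    unfolding L2_sq_def
  proof (intro nn_integral_mono)
    fix x
    have "ennreal ((norm (f x + g x))\<^sup>2) \<le> ennreal (2 * (norm (f x))\<^sup>2 + 2 * (norm (g x))\<^sup>2)"
      by (intro ennreal_leI sq_norm_add_le)
    also have "\<dots> = 2 * ennreal ((norm (f x))\<^sup>2) + 2 * ennreal ((norm (g x))\<^sup>2)"
      by (simp add: ennreal_plus ennreal_mult')
    finally show "ennreal ((norm (f x + g x))\<^sup>2) \<le> 2 * ennreal ((norm (f x))\<^sup>2) + 2 * ennreal ((norm (g x))\<^sup>2)" .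
  qed
  also have "\<dots> = 2 * L2_sq f + 2 * L2_sq g"
    unfolding L2_sq_def by (subst nn_integral_add) (auto simp: nn_integral_cmult)
  finally show ?thesis .
qed

lemma L2_sq_uminus: "L2_sq (\<lambda>x. - f x) = L2_sq f"
  by (simp add: L2_sq_def)

lemma L2_sq_minus_commute: "L2_sq (\<lambda>x. f x - g x) = L2_sq (\<lambda>x. g x - f x)"
  by (simp add: L2_sq_def norm_minus_commute)

lemma L2_sq_diff_le:
  assumes [measurable]: "f \<in> borel_measurable borel" "g \<in> borel_measurable borel"
  shows "L2_sq (\<lambda>x. f x - g x) \<le> 2 * L2_sq f + 2 * L2_sq g"
  using L2_sq_add_le[of f "\<lambda>x. - g x"] by (simp add: L2_sq_uminus)

lemma in_L2_add: "in_L2 f \<Longrightarrow> in_L2 g \<Longrightarrow> in_L2 (\<lambda>x. f x + g x)"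
  using L2_sq_add_le[of f g] by (auto simp: in_L2_iff ennreal_mult_less_top intro: order.strict_trans1)

lemma in_L2_diff: "in_L2 f \<Longrightarrow> in_L2 g \<Longrightarrow> in_L2 (\<lambda>x. f x - g x)"
  using L2_sq_diff_le[of f g] by (auto simp: in_L2_iff ennreal_mult_less_top intro: order.strict_trans1)

lemma in_L2_bound:
  assumes "in_L2 g" "f \<in> borel_measurable borel" "\<And>x. norm (f x) \<le> c * norm (g x)"
  shows "in_L2 f"
  using L2_sq_mono_scale[of f c g] assms
  by (auto simp: in_L2_iff ennreal_mult_less_top intro: order.strict_trans1)

lemma in_L2_0: "in_L2 (\<lambda>x. 0)"
  by (simp add: in_L2_iff L2_sq_def)

lemma in_L2_sum: "finite I \<Longrightarrow> (\<And>i. i \<in> I \<Longrightarrow> in_L2 (f i)) \<Longrightarrow> in_L2 (\<lambda>x. \<Sum>i\<in>I. f i x)"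
  by (induction I rule: finite_induct) (auto intro: in_L2_add in_L2_0)

lemma norm_vec_sq: "(norm (x :: 'a::real_normed_vector^'m))\<^sup>2 = (\<Sum>i\<in>UNIV. (norm (x $ i))\<^sup>2)"
  by (simp add: norm_vec_def L2_set_def sum_nonneg)

lemma L2_sq_vec:
  fixes f :: "real^'n \<Rightarrow> ('b::euclidean_space)^'m"
  assumes [measurable]: "\<And>i. (\<lambda>x. f x $ i) \<in> borel_measurable borel"
  shows "L2_sq f = (\<Sum>i\<in>UNIV. L2_sq (\<lambda>x. f x $ i))"
  unfolding L2_sq_def norm_vec_sq
  by (simp add: sum_nonneg flip: nn_integral_sum sum_ennreal)

lemma borel_measurable_vec_iff:
  fixes f :: "'a \<Rightarrow> ('b::euclidean_space)^'m"
  shows "f \<in> borel_measurable M \<longleftrightarrow> (\<forall>i. (\<lambda>x. f x $ i) \<in> borel_measurable M)"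
proof
  assume f: "f \<in> borel_measurable M"
  show "\<forall>i. (\<lambda>x. f x $ i) \<in> borel_measurable M"
  proof
    fix i :: 'm
    have "continuous_on UNIV (\<lambda>x::'b^'m. x $ i)" by (intro continuous_intros)
    from measurable_compose[OF f borel_measurable_continuous_onI[OF this]]
    show "(\<lambda>x. f x $ i) \<in> borel_measurable M" .
  qed
next
  assume *: "\<forall>i. (\<lambda>x. f x $ i) \<in> borel_measurable M"
  show "f \<in> borel_measurable M"
  proof (subst borel_measurable_euclidean_space, intro ballI)
    fix b :: "'b^'m" assume "b \<in> Basis"
    then obtain i u where "b = axis i u" by (auto simp: Basis_vec_def)
    then show "(\<lambda>x. f x \<bullet> b) \<in> borel_measurable M"
      using *[rule_format, THEN borel_measurable_inner, OF borel_measurable_const] by (simp add: inner_axis)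
  qed
qed

lemma in_L2_vec_iff:
  fixes f :: "real^'n \<Rightarrow> ('b::euclidean_space)^'m"
  shows "in_L2 f \<longleftrightarrow> (\<forall>i. in_L2 (\<lambda>x. f x $ i))"
proof (cases "\<forall>i. (\<lambda>x. f x $ i) \<in> borel_measurable borel")
  case True
  then show ?thesis using L2_sq_vec[of f]
    by (auto simp: in_L2_iff borel_measurable_vec_iff less_top)
qed (auto simp: in_L2_iff borel_measurable_vec_iff)

section \<open>Limits, truncation and Cauchy-Schwarz in L2\<close>

lemma tendsto_0_ennreal_squeeze:
  fixes f g :: "'a \<Rightarrow> ennreal"
  assumes "eventually (\<lambda>x. f x \<le> g x) F" "(g \<longlongrightarrow> 0) F" shows "(f \<longlongrightarrow> 0) F"
  by (rule tendsto_sandwich[OF _ assms(1) _ assms(2)]) auto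

lemma tendsto_0_ennreal_cmult:
  fixes f :: "'a \<Rightarrow> ennreal"
  assumes "(f \<longlongrightarrow> 0) F" "c < \<infinity>" shows "((\<lambda>x. c * f x) \<longlongrightarrow> 0) F"
  using ennreal_tendsto_cmult[of c f 0 F] assms by simp

lemma L2_sq_dominated:
  fixes f :: "nat \<Rightarrow> real^'n \<Rightarrow> 'b::euclidean_space" and g :: "real^'n \<Rightarrow> 'c::euclidean_space"
  assumes [measurable]: "\<And>k. f k \<in> borel_measurable borel" and g: "in_L2 g"
    and lim: "AE x in lborel. (\<lambda>k. f k x) \<longlonglongrightarrow> 0"
    and le: "\<And>k x. norm (f k x) \<le> c * norm (g x)"
  shows "(\<lambda>k. L2_sq (f k)) \<longlonglongrightarrow> 0"
proof -
  have [measurable]: "g \<in> borel_measurable borel" using g by (simp add: in_L2_iff)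
  have "(\<lambda>k. \<integral>\<^sup>+x. ennreal ((norm (f k x))\<^sup>2) \<partial>lborel) \<longlonglongrightarrow> (\<integral>\<^sup>+(x::real^'n). 0 \<partial>lborel)"
  proof (rule nn_integral_dominated_convergence[where w="\<lambda>x. ennreal (c\<^sup>2) * ennreal ((norm (g x))\<^sup>2)"])
    show "(\<integral>\<^sup>+x. ennreal (c\<^sup>2) * ennreal ((norm (g x))\<^sup>2) \<partial>lborel) < \<infinity>"
      using g by (simp add: nn_integral_cmult in_L2_iff L2_sq_def ennreal_mult_less_top)
    show "AE x in lborel. (\<lambda>i. ennreal ((norm (f i x))\<^sup>2)) \<longlonglongrightarrow> 0"
      using lim
    proof eventually_elim
      case (elim x)
      then have "(\<lambda>k. ennreal ((norm (f k x))\<^sup>2)) \<longlonglongrightarrow> ennreal (0\<^sup>2)"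
        by (intro tendsto_ennrealI tendsto_power tendsto_norm_zero)
      then show ?case by simp
    qed
    show "AE x in lborel. ennreal ((norm (f j x))\<^sup>2) \<le> ennreal (c\<^sup>2) * ennreal ((norm (g x))\<^sup>2)" for j
    proof (intro AE_I2)
      fix x
      have "(norm (f j x))\<^sup>2 \<le> (c * norm (g x))\<^sup>2" by (intro power_mono le) auto
      then show "ennreal ((norm (f j x))\<^sup>2) \<le> ennreal (c\<^sup>2) * ennreal ((norm (g x))\<^sup>2)"
        by (simp add: ennreal_mult'[symmetric] power_mult_distrib ennreal_leI)
    qed
  qed auto
  then show ?thesis by (simp add: L2_sq_def)
qed

lemma L2_truncate:
  fixes f :: "real^'n \<Rightarrow> 'b::euclidean_space"
  assumes f: "in_L2 f"
  shows "((\<lambda>r::real. L2_sq (\<lambda>x. indicator (cball 0 r) x *\<^sub>R f x - f x)) \<longlongrightarrow> 0) at_top"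
proof (rule tendsto_at_topI_sequentially)
  fix X :: "nat \<Rightarrow> real" assume X: "filterlim X at_top sequentially"
  have [measurable]: "f \<in> borel_measurable borel" using f by (simp add: in_L2_iff)
  show "(\<lambda>n. L2_sq (\<lambda>x. indicator (cball 0 (X n)) x *\<^sub>R f x - f x)) \<longlonglongrightarrow> 0"
  proof (rule L2_sq_dominated[where g=f and c=1])
    show "AE x in lborel. (\<lambda>k. indicator (cball 0 (X k)) x *\<^sub>R f x - f x) \<longlonglongrightarrow> 0"
    proof (intro AE_I2)
      fix x :: "real^'n"
      have "eventually (\<lambda>k. norm x \<le> X k) sequentially"
        using X by (simp add: filterlim_at_top)
      then have "eventually (\<lambda>k. indicator (cball 0 (X k)) x *\<^sub>R f x - f x = 0) sequentially"
        by eventually_elim (auto simp: dist_norm)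
      then show "(\<lambda>k. indicator (cball 0 (X k)) x *\<^sub>R f x - f x) \<longlonglongrightarrow> 0" by (rule tendsto_eventually)
    qed
  qed (use f in \<open>auto simp: indicator_def\<close>)
qed

text \<open>On a set of finite measure the bound |f| \<le> 1 + |f|^2 supplies an integrable
  majorant. Hence the integral transform is available for every truncation of an L2
  function.\<close>

lemma integrable_truncate:
  fixes f :: "real^'n \<Rightarrow> 'b::euclidean_space"
  assumes f: "in_L2 f" and A: "A \<in> sets borel" "bounded A"
  shows "integrable lborel (\<lambda>x. indicator A x *\<^sub>R f x)"
proof -
  have [measurable]: "f \<in> borel_measurable borel" using f by (simp add: in_L2_iff)
  note [measurable] = A(1)
  obtain r where "\<forall>x\<in>A. norm x \<le> r" using A(2) unfolding bounded_iff ..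
  then have "A \<subseteq> cball 0 r" by auto
  then have fin: "emeasure lborel A < \<infinity>"
    by (rule order.strict_trans1[OF emeasure_mono[OF _ ] emeasure_lborel_cball_finite]) simp
  have "integrable lborel (\<lambda>x. indicator A x + (norm (f x))\<^sup>2)"
    using f fin by (intro Bochner_Integration.integrable_add) (auto simp: in_L2_def)
  then show ?thesis
  proof (rule Bochner_Integration.integrable_bound)
    show "AE x in lborel. norm (indicator A x *\<^sub>R f x) \<le> norm (indicator A x + (norm (f x))\<^sup>2)"
    proof (intro AE_I2)
      fix x
      have "norm (f x) \<le> 1 + (norm (f x))\<^sup>2"
        using zero_le_power2[of "norm (f x) - 1"] unfolding power2_diff power_one mult_1_right
        using norm_ge_zero[of "f x"] by linarith
      then show "norm (indicator A x *\<^sub>R f x) \<le> norm (indicator A x + (norm (f x))\<^sup>2)"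
        by (auto simp: indicator_def)
    qed
  qed measurable
qed

lemma in_L2_truncate:
  fixes f :: "real^'n \<Rightarrow> 'b::euclidean_space"
  assumes f: "in_L2 f" and A: "A \<in> sets borel"
  shows "in_L2 (\<lambda>x. indicator A x *\<^sub>R f x)"
proof -
  have [measurable]: "f \<in> borel_measurable borel" using f by (simp add: in_L2_iff)
  note [measurable] = A(1)
  show ?thesis by (rule in_L2_bound[OF f, where c=1]) (auto simp: indicator_def)
qed

lemma L2_Cauchy_Schwarz_nn:
  fixes f g :: "real^'n \<Rightarrow> complex"
  assumes [measurable]: "f \<in> borel_measurable borel" "g \<in> borel_measurable borel"
  shows "(\<integral>\<^sup>+x. ennreal (norm (f x * g x)) \<partial>lborel)\<^sup>2 \<le> L2_sq f * L2_sq g"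
  using Cauchy_Schwarz_nn_integral[of "\<lambda>x. ennreal (norm (f x))" lborel "\<lambda>x. ennreal (norm (g x))"]
  by (simp add: L2_sq_def norm_mult ennreal_mult ennreal_power)

lemma L2_prod_integrable:
  fixes f g :: "real^'n \<Rightarrow> complex"
  assumes "in_L2 f" "in_L2 g" shows "integrable lborel (\<lambda>x. f x * g x)"
proof -
  have [measurable]: "f \<in> borel_measurable borel" "g \<in> borel_measurable borel"
    using assms by (simp_all add: in_L2_iff)
  have "(\<integral>\<^sup>+x. ennreal (norm (f x * g x)) \<partial>lborel)\<^sup>2 < \<infinity>"
    using L2_Cauchy_Schwarz_nn[of f g] assms
    by (auto simp: in_L2_iff ennreal_mult_less_top intro: order.strict_trans1)
  then show ?thesis by (auto simp: integrable_iff_bounded power_less_top_ennreal)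
qed

lemma L2_Cauchy_Schwarz:
  fixes f g :: "real^'n \<Rightarrow> complex"
  assumes [measurable]: "f \<in> borel_measurable borel" "g \<in> borel_measurable borel"
  shows "ennreal ((norm (LINT x|lborel. f x * g x))\<^sup>2) \<le> L2_sq f * L2_sq g"
proof (cases "integrable lborel (\<lambda>x. f x * g x)")
  case True
  have "ennreal ((norm (LINT x|lborel. f x * g x))\<^sup>2) = (ennreal (norm (LINT x|lborel. f x * g x)))\<^sup>2"
    by (simp add: ennreal_power)
  also have "\<dots> \<le> (\<integral>\<^sup>+x. ennreal (norm (f x * g x)) \<partial>lborel)\<^sup>2"
    by (intro power_mono integral_norm_bound_ennreal True) auto
  also have "\<dots> \<le> L2_sq f * L2_sq g" by (intro L2_Cauchy_Schwarz_nn) auto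
  finally show ?thesis .
qed (simp add: not_integrable_integral_eq)

lemma L2_sq_limit_finite:
  assumes "(\<lambda>k. L2_sq (\<lambda>x. f k x - g x)) \<longlonglongrightarrow> 0" "\<And>k. in_L2 (f k)" "g \<in> borel_measurable borel"
  shows "in_L2 g"
proof -
  have [measurable]: "f k \<in> borel_measurable borel" for k using assms(2) by (simp add: in_L2_iff)
  note [measurable] = assms(3)
  have "eventually (\<lambda>k. L2_sq (\<lambda>x. f k x - g x) < 1) sequentially"
    using assms(1) by (rule order_tendstoD) simp
  then obtain k where k: "L2_sq (\<lambda>x. f k x - g x) < 1" by (auto simp: eventually_sequentially)
  then have "in_L2 (\<lambda>x. f k x - g x)"
    using order.strict_trans[OF k, of \<infinity>] by (simp add: in_L2_iff)
  from in_L2_diff[OF assms(2)[of k] this] show ?thesis by simp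
qed

text \<open>Expanding the product around the limits leaves three terms, each with a factor that
  tends to 0 in L2 while the other stays bounded, so Cauchy-Schwarz applies. The pairing is
  bilinear; for the inner product one sequence is conjugated beforehand.\<close>

lemma L2_pairing_tendsto:
  fixes f g :: "nat \<Rightarrow> real^'n \<Rightarrow> complex"
  assumes L: "\<And>k. in_L2 (f k)" "\<And>k. in_L2 (g k)" "in_L2 f'" "in_L2 g'"
    and f: "(\<lambda>k. L2_sq (\<lambda>x. f k x - f' x)) \<longlonglongrightarrow> 0"
    and g: "(\<lambda>k. L2_sq (\<lambda>x. g k x - g' x)) \<longlonglongrightarrow> 0"
  shows "(\<lambda>k. LINT x|lborel. f k x * g k x) \<longlonglongrightarrow> (LINT x|lborel. f' x * g' x)"
proof -
  note [measurable] = L[THEN in_L2_measurable]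
  have null: "(\<lambda>k. LINT x|lborel. F k x * G k x) \<longlonglongrightarrow> 0"
    if F: "\<And>k. in_L2 (F k)" "(\<lambda>k. L2_sq (F k)) \<longlonglongrightarrow> 0"
      and G: "\<And>k. in_L2 (G k)" "(\<lambda>k. L2_sq (G k)) \<longlonglongrightarrow> c" "c < \<infinity>"
    for F G :: "nat \<Rightarrow> real^'n \<Rightarrow> complex" and c
  proof -
    have "(\<lambda>k. L2_sq (F k) * L2_sq (G k)) \<longlonglongrightarrow> 0 * c"
      using F G by (intro tendsto_mult_ennreal) (auto simp: zero_ennreal.rep_eq)
    then have "(\<lambda>k. ennreal ((norm (LINT x|lborel. F k x * G k x))\<^sup>2)) \<longlonglongrightarrow> 0"
      using F(1) G(1) by (intro tendsto_0_ennreal_squeeze[OF always_eventually[OF allI[OF L2_Cauchy_Schwarz]]])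
        (auto simp: in_L2_iff)
    then have "(\<lambda>k. (norm (LINT x|lborel. F k x * G k x))\<^sup>2) \<longlonglongrightarrow> 0"
      by (subst (asm) ennreal_0[symmetric], subst (asm) tendsto_ennreal_iff) auto
    then have "(\<lambda>k. norm (LINT x|lborel. F k x * G k x)) \<longlonglongrightarrow> 0"
      using tendsto_real_sqrt by fastforce
    then show ?thesis by (rule tendsto_norm_zero_cancel)
  qed
  have a: "(\<lambda>k. LINT x|lborel. (f k x - f' x) * (g k x - g' x)) \<longlonglongrightarrow> 0"
    by (rule null[where c=0]) (auto intro!: in_L2_diff L f g)
  have b: "(\<lambda>k. LINT x|lborel. (f k x - f' x) * g' x) \<longlonglongrightarrow> 0"
    by (rule null[where c="L2_sq g'"]) (use in_L2_finite[OF L(4)] in \<open>auto intro!: in_L2_diff L f g\<close>)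
  have c: "(\<lambda>k. LINT x|lborel. (g k x - g' x) * f' x) \<longlonglongrightarrow> 0"
    by (rule null[where c="L2_sq f'"]) (use in_L2_finite[OF L(3)] in \<open>auto intro!: in_L2_diff L f g\<close>)
  have eq: "(LINT x|lborel. f k x * g k x) = (LINT x|lborel. (f k x - f' x) * (g k x - g' x))
       + (LINT x|lborel. (f k x - f' x) * g' x) + (LINT x|lborel. (g k x - g' x) * f' x)
       + (LINT x|lborel. f' x * g' x)" for k
  proof -
    have i: "integrable lborel (\<lambda>x. (f k x - f' x) * (g k x - g' x))"
       "integrable lborel (\<lambda>x. (f k x - f' x) * g' x)" "integrable lborel (\<lambda>x. (g k x - g' x) * f' x)"
       "integrable lborel (\<lambda>x. f' x * g' x)"
      by (auto intro!: L2_prod_integrable in_L2_diff L)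
    show ?thesis
      unfolding Bochner_Integration.integral_add[OF i(1,2), symmetric]
        Bochner_Integration.integral_add[OF Bochner_Integration.integrable_add[OF i(1,2)] i(3), symmetric]
        Bochner_Integration.integral_add[OF Bochner_Integration.integrable_add[OF Bochner_Integration.integrable_add[OF i(1,2)] i(3)] i(4), symmetric]
      by (intro Bochner_Integration.integral_cong) (auto simp: algebra_simps)
  qed
  have "(\<lambda>k. LINT x|lborel. f k x * g k x) \<longlonglongrightarrow> 0 + 0 + 0 + (LINT x|lborel. f' x * g' x)"
    unfolding eq by (intro tendsto_add a b c tendsto_const)
  then show ?thesis by simp
qed

subsection \<open>Completeness\<close>

text \<open>The squared increments are at most \<open>(1/4)^k\<close>, so weighting them by
  \<open>2^k\<close> still leaves a series \<open>G\<close> with integral at most 2. Where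
  \<open>G\<close> is finite the k-th increment is at most \<open>sqrt G\<close> times
  \<open>sqrt (1/2) ^ k\<close>; this gives pointwise convergence and, after squaring the geometric
  tail and integrating, convergence in L2.\<close>

lemma L2_Cauchy_fast_limit:
  fixes f :: "nat \<Rightarrow> real^'n \<Rightarrow> 'b::euclidean_space"
  assumes L: "\<And>k. in_L2 (f k)"
    and fast: "\<And>k. L2_sq (\<lambda>x. f (Suc k) x - f k x) \<le> ennreal ((1/4)^k)"
  shows "\<exists>g. in_L2 g \<and> (\<lambda>k. L2_sq (\<lambda>x. f k x - g x)) \<longlonglongrightarrow> 0"
proof -
  note [measurable] = L[THEN in_L2_measurable]
  define D where "D k x = ennreal (norm (f (Suc k) x - f k x))" for k x
  have [measurable]: "D k \<in> borel_measurable borel" for k unfolding D_def by measurable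
  \<comment> \<open>Weighted Cauchy--Schwarz: \<open>(\<Sum>d\<^sub>k)\<^sup>2 \<le> (\<Sum>w\<^sup>k) (\<Sum>d\<^sub>k\<^sup>2/w\<^sup>k)\<close> with \<open>w = 1/2\<close>.\<close>
  define G where "G x = (\<Sum>k. ennreal (2^k) * (D k x)\<^sup>2)" for x
  have [measurable]: "G \<in> borel_measurable borel" unfolding G_def by measurable
  have G_tail: "(\<integral>\<^sup>+x. G x \<partial>lborel) \<le> 2"
  proof -
    have "(\<integral>\<^sup>+x. G x \<partial>lborel) = (\<Sum>k. \<integral>\<^sup>+x. ennreal (2^k) * (D k x)\<^sup>2 \<partial>lborel)"
      unfolding G_def by (intro nn_integral_suminf) measurable
    also have "\<dots> = (\<Sum>k. ennreal (2^k) * L2_sq (\<lambda>x. f (Suc k) x - f k x))"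
      by (simp add: nn_integral_cmult L2_sq_def D_def ennreal_power)
    also have "\<dots> \<le> (\<Sum>k. ennreal ((1/2)^k))"
    proof (intro suminf_le)
      fix k
      have "ennreal (2^k) * L2_sq (\<lambda>x. f (Suc k) x - f k x) \<le> ennreal (2^k) * ennreal ((1/4)^k)"
        by (intro mult_left_mono fast) auto
      also have "\<dots> = ennreal ((1/2)^k)"
        by (simp add: ennreal_mult'[symmetric] power_mult_distrib[symmetric])
      finally show "ennreal (2^k) * L2_sq (\<lambda>x. f (Suc k) x - f k x) \<le> ennreal ((1/2)^k)" .
    qed auto
    also have "\<dots> = ennreal 2"
      using geometric_sums[of "1/2::real"] by (intro suminf_ennreal_eq) auto
    finally show ?thesis by simp
  qed
  have AEG: "AE x in lborel. G x \<noteq> \<infinity>"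
    using G_tail by (intro nn_integral_PInf_AE) (auto simp: top_unique)
  have bnd: "norm (f (Suc k) x - f k x) \<le> sqrt (enn2real (G x)) * (sqrt (1/2))^k"
    if "G x \<noteq> \<infinity>" for k x
  proof -
    have "ennreal (2^k) * (D k x)\<^sup>2 \<le> G x"
      unfolding G_def using sum_le_suminf[of "\<lambda>k. ennreal (2^k) * (D k x)\<^sup>2" "{k}"] by auto
    also have "\<dots> = ennreal (enn2real (G x))" using that by (simp add: less_top)
    finally have "2^k * (norm (f (Suc k) x - f k x))\<^sup>2 \<le> enn2real (G x)"
      by (simp add: D_def ennreal_power ennreal_mult'[symmetric])
    then have "(norm (f (Suc k) x - f k x))\<^sup>2 \<le> enn2real (G x) * (1/2)^k"
      by (simp add: field_simps power_one_over)
    then have "sqrt ((norm (f (Suc k) x - f k x))\<^sup>2) \<le> sqrt (enn2real (G x) * (1/2)^k)"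
      by (rule real_sqrt_le_mono)
    then show ?thesis by (simp add: real_sqrt_mult real_sqrt_power)
  qed
  \<comment> \<open>\<open>lim\<close> is total, so \<open>g\<close> is measurable everywhere
    although convergence is known only where \<open>G\<close> is finite.\<close>
  define g where "g x = lim (\<lambda>k. f k x)" for x
  have [measurable]: "g \<in> borel_measurable borel" unfolding g_def by measurable
  have conv: "(\<lambda>k. f k x) \<longlonglongrightarrow> g x" if "G x \<noteq> \<infinity>" for x
  proof -
    have "summable (\<lambda>k. f (Suc k) x - f k x)"
    proof (rule summable_comparison_test'[where N=0])
      show "summable (\<lambda>k. sqrt (enn2real (G x)) * (sqrt (1/2))^k)"
        by (intro summable_mult summable_geometric) (simp add: real_sqrt_divide)
      show "norm (f (Suc k) x - f k x) \<le> sqrt (enn2real (G x)) * (sqrt (1/2))^k" for k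
        by (rule bnd[OF that])
    qed
    then have "(\<lambda>n. \<Sum>k<n. f (Suc k) x - f k x) \<longlonglongrightarrow> (\<Sum>k. f (Suc k) x - f k x)"
      by (rule summable_LIMSEQ)
    then have "(\<lambda>n. f n x - f 0 x) \<longlonglongrightarrow> (\<Sum>k. f (Suc k) x - f k x)"
      using sum_lessThan_telescope[of "\<lambda>k. f k x"] by simp
    then have "(\<lambda>n. f n x - f 0 x + f 0 x) \<longlonglongrightarrow> (\<Sum>k. f (Suc k) x - f k x) + f 0 x"
      by (intro tendsto_add tendsto_const)
    then have "convergent (\<lambda>n. f n x)" by (auto simp: convergent_def)
    then show ?thesis by (simp add: g_def convergent_LIMSEQ_iff)
  qed
  \<comment> \<open>The square of the geometric sum with ratio \<open>sqrt (1/2)\<close>.\<close>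
  define C where "C = (1 / (1 - sqrt (1/2)))\<^sup>2"
  have dist: "(norm (f k x - g x))\<^sup>2 \<le> C * (1/2)^k * enn2real (G x)" if Gx: "G x \<noteq> \<infinity>" for k x
  proof -
    let ?q = "sqrt (1/2) :: real"
    have q: "0 < ?q" "?q < 1" by (auto simp: real_sqrt_divide)
    have part: "norm (f (k + n) x - f k x) \<le> sqrt (enn2real (G x)) * ?q^k * (1 / (1 - ?q))" for n
    proof -
      have "f (k + n) x - f k x = (\<Sum>j<n. f (Suc (k + j)) x - f (k + j) x)"
        using sum_lessThan_telescope[of "\<lambda>j. f (k + j) x" n] by simp
      also have "norm \<dots> \<le> (\<Sum>j<n. sqrt (enn2real (G x)) * ?q^(k+j))"
        by (intro sum_norm_le bnd Gx)
      also have "\<dots> = sqrt (enn2real (G x)) * ?q^k * (\<Sum>j<n. ?q^j)"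
        by (simp add: power_add sum_distrib_left mult.assoc)
      also have "\<dots> \<le> sqrt (enn2real (G x)) * ?q^k * (1 / (1 - ?q))"
      proof (intro mult_left_mono)
        have "(\<Sum>j<n. ?q^j) \<le> (\<Sum>j. ?q^j)"
          using q by (intro sum_le_suminf summable_geometric) auto
        then show "(\<Sum>j<n. ?q^j) \<le> 1 / (1 - ?q)" using q suminf_geometric[of ?q] by simp
      qed (use q in auto)
      finally show ?thesis .
    qed
    have "(\<lambda>n. norm (f (n + k) x - f k x)) \<longlonglongrightarrow> norm (g x - f k x)"
      by (intro tendsto_norm tendsto_diff tendsto_const LIMSEQ_ignore_initial_segment conv Gx)
    then have "norm (g x - f k x) \<le> sqrt (enn2real (G x)) * ?q^k * (1 / (1 - ?q))"
      by (rule LIMSEQ_le_const2) (use part in \<open>auto simp: add.commute\<close>)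
    then have "(norm (f k x - g x))\<^sup>2 \<le> (sqrt (enn2real (G x)) * ?q^k * (1 / (1 - ?q)))\<^sup>2"
      by (intro power_mono) (auto simp: norm_minus_commute)
    also have "\<dots> = C * (1/2)^k * enn2real (G x)"
    proof -
      have "(?q^k)\<^sup>2 = (?q\<^sup>2)^k" by (simp only: power_mult[symmetric] mult.commute)
      also have "\<dots> = (1/2)^k" by simp
      finally show ?thesis by (simp only: power_mult_distrib C_def) (simp add: mult_ac)
    qed
    finally show ?thesis .
  qed
  have lim_le: "L2_sq (\<lambda>x. f k x - g x) \<le> ennreal (C * 2 * (1/2)^k)" for k
  proof -
    have "L2_sq (\<lambda>x. f k x - g x) \<le> (\<integral>\<^sup>+x. ennreal (C * (1/2)^k) * G x \<partial>lborel)"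
      unfolding L2_sq_def
    proof (rule nn_integral_mono_AE)
      show "AE x in lborel. ennreal ((norm (f k x - g x))\<^sup>2) \<le> ennreal (C * (1/2)^k) * G x"
        using AEG
      proof eventually_elim
        case (elim x)
        have "ennreal ((norm (f k x - g x))\<^sup>2) \<le> ennreal (C * (1/2)^k * enn2real (G x))"
          by (intro ennreal_leI dist elim)
        also have "\<dots> = ennreal (C * (1/2)^k) * ennreal (enn2real (G x))"
          by (intro ennreal_mult) (auto simp: C_def)
        also have "ennreal (enn2real (G x)) = G x" using elim by (simp add: less_top)
        finally show ?case .
      qed
    qed
    also have "\<dots> = ennreal (C * (1/2)^k) * (\<integral>\<^sup>+x. G x \<partial>lborel)" by (intro nn_integral_cmult) simp
    also have "\<dots> \<le> ennreal (C * (1/2)^k) * 2" by (intro mult_left_mono G_tail) auto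
    also have "\<dots> = ennreal (C * (1/2)^k * 2)"
      by (subst ennreal_mult) (auto simp: C_def)
    finally show ?thesis by (simp add: mult_ac)
  qed
  have lim: "(\<lambda>k. L2_sq (\<lambda>x. f k x - g x)) \<longlonglongrightarrow> 0"
  proof (rule tendsto_0_ennreal_squeeze[OF always_eventually[OF allI[OF lim_le]]])
    have "(\<lambda>k. C * 2 * (1/2)^k) \<longlonglongrightarrow> C * 2 * 0"
      by (intro tendsto_mult tendsto_const LIMSEQ_power_zero) auto
    then show "(\<lambda>k. ennreal (C * 2 * (1/2)^k)) \<longlonglongrightarrow> 0"
      using tendsto_ennrealI by fastforce
  qed
  moreover have "in_L2 g" by (rule L2_sq_limit_finite[OF lim L]) simp
  ultimately show ?thesis by blast
qed

text \<open>A subsequence with increments below \<open>(1/4)^i\<close> converges by the preceding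
  lemma, and the Cauchy property carries the whole sequence along.\<close>

lemma L2_complete:
  fixes f :: "nat \<Rightarrow> real^'n \<Rightarrow> 'b::euclidean_space"
  assumes L: "\<And>k. in_L2 (f k)"
    and Cauchy: "\<And>e. e > 0 \<Longrightarrow> \<exists>N. \<forall>k\<ge>N. \<forall>l\<ge>N. L2_sq (\<lambda>x. f k x - f l x) \<le> ennreal e"
  shows "\<exists>g. in_L2 g \<and> (\<lambda>k. L2_sq (\<lambda>x. f k x - g x)) \<longlonglongrightarrow> 0"
proof -
  note [measurable] = L[THEN in_L2_measurable]
  have "\<exists>N. \<forall>i. (\<forall>k\<ge>N i. \<forall>l\<ge>N i. L2_sq (\<lambda>x. f k x - f l x) \<le> ennreal ((1/4)^i))"
    using Cauchy[of "(1/4)^_"] by (intro choice) auto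
  then obtain N where N: "\<And>i k l. k \<ge> N i \<Longrightarrow> l \<ge> N i \<Longrightarrow> L2_sq (\<lambda>x. f k x - f l x) \<le> ennreal ((1/4)^i)"
    by blast
  \<comment> \<open>Summing the thresholds makes the chosen indices monotone, so that two
    consecutive ones both lie beyond \<open>N i\<close>.\<close>
  define M where "M i = (\<Sum>j\<le>i. N j)" for i
  have M: "N i \<le> M i" "M i \<le> M (Suc i)" for i
    unfolding M_def by (auto intro: member_le_sum)
  have "\<exists>g. in_L2 g \<and> (\<lambda>i. L2_sq (\<lambda>x. f (M i) x - g x)) \<longlonglongrightarrow> 0"
    by (intro L2_Cauchy_fast_limit L N) (meson M order_trans)+
  then obtain g where g: "in_L2 g" "(\<lambda>i. L2_sq (\<lambda>x. f (M i) x - g x)) \<longlonglongrightarrow> 0" by blast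
  have [measurable]: "g \<in> borel_measurable borel" using g by (simp add: in_L2_iff)
  have "(\<lambda>k. L2_sq (\<lambda>x. f k x - g x)) \<longlonglongrightarrow> 0"
  proof (rule tendsto_zero_ennreal)
    fix e :: real assume "e > 0"
    have "eventually (\<lambda>i. L2_sq (\<lambda>x. f (M i) x - g x) < ennreal (e/5)) sequentially"
      using g(2) by (rule order_tendstoD) (use \<open>e > 0\<close> in simp)
    moreover have "eventually (\<lambda>i. (1/4::real)^i < e/5) sequentially"
      using LIMSEQ_power_zero[of "1/4::real"] by (rule order_tendstoD) (use \<open>e > 0\<close> in auto)
    ultimately have "eventually (\<lambda>i. L2_sq (\<lambda>x. f (M i) x - g x) < ennreal (e/5) \<and> (1/4::real)^i < e/5) sequentially"
      by (rule eventually_conj)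
    then obtain i where i: "L2_sq (\<lambda>x. f (M i) x - g x) < ennreal (e/5)" "(1/4::real)^i < e/5"
      by (auto simp: eventually_sequentially)
    have "L2_sq (\<lambda>x. f k x - g x) < ennreal e" if "k \<ge> N i" for k
    proof -
      have "L2_sq (\<lambda>x. f k x - g x) \<le> 2 * L2_sq (\<lambda>x. f k x - f (M i) x) + 2 * L2_sq (\<lambda>x. f (M i) x - g x)"
        using L2_sq_add_le[of "\<lambda>x. f k x - f (M i) x" "\<lambda>x. f (M i) x - g x"] by simp
      also have "\<dots> \<le> 2 * ennreal ((1/4)^i) + 2 * L2_sq (\<lambda>x. f (M i) x - g x)"
        by (intro add_mono mult_left_mono N that M order_refl) auto
      also have "\<dots> \<le> 2 * ennreal (e/5) + 2 * ennreal (e/5)"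
        using i \<open>e > 0\<close> by (intro add_mono mult_left_mono) (auto intro: ennreal_leI)
      also have "\<dots> = ennreal (4 * e / 5)"
      proof -
        have "2 * ennreal (e/5) = ennreal (2 * (e/5))" using \<open>e > 0\<close> by (subst ennreal_numeral[symmetric], subst ennreal_mult[symmetric]) auto
        then show ?thesis using \<open>e > 0\<close> by (simp flip: ennreal_plus)
      qed
      also have "\<dots> < ennreal e" using \<open>e > 0\<close> by (simp add: ennreal_less_iff)
      finally show ?thesis .
    qed
    then show "eventually (\<lambda>k. L2_sq (\<lambda>x. f k x - g x) < ennreal e) sequentially"
      by (auto simp: eventually_sequentially)
  qed
  with g show ?thesis by blast
qed

subsection \<open>Affine substitution and continuity of translation\<close>

lemma nn_integral_lborel_affine:
  fixes f :: "'a::euclidean_space \<Rightarrow> ennreal"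
  assumes [measurable]: "f \<in> borel_measurable borel" and c: "c \<noteq> 0"
  shows "(\<integral>\<^sup>+x. f x \<partial>lborel) = ennreal (\<bar>c\<bar> ^ DIM('a)) * (\<integral>\<^sup>+x. f (t + c *\<^sub>R x) \<partial>lborel)"
  by (subst lborel_affine[OF c, of t], subst nn_integral_density, simp, simp)
     (simp add: nn_integral_distr nn_integral_cmult)

lemma nn_integral_lborel_shift:
  fixes f :: "'a::euclidean_space \<Rightarrow> ennreal"
  assumes "f \<in> borel_measurable borel"
  shows "(\<integral>\<^sup>+x. f (x + t) \<partial>lborel) = (\<integral>\<^sup>+x. f x \<partial>lborel)"
  using nn_integral_lborel_affine[OF assms, of 1 t] by (simp add: add.commute)

lemma integral_lborel_affine:
  fixes f :: "'a::euclidean_space \<Rightarrow> 'b::{banach, second_countable_topology}"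
  assumes [measurable]: "f \<in> borel_measurable borel" and c: "c \<noteq> 0"
  shows "(LINT x|lborel. f x) = (\<bar>c\<bar> ^ DIM('a)) *\<^sub>R (LINT x|lborel. f (t + c *\<^sub>R x))"
  by (subst lborel_affine[OF c, of t], subst integral_density) (auto simp: integral_distr)

lemma integrable_lborel_affine:
  fixes f :: "'a::euclidean_space \<Rightarrow> 'b::{banach, second_countable_topology}"
  assumes "integrable lborel f" and c: "c \<noteq> 0"
  shows "integrable lborel (\<lambda>x. f (t + c *\<^sub>R x))"
proof -
  have [measurable]: "f \<in> borel_measurable borel" using assms(1) by auto
  show ?thesis
    using assms nn_integral_lborel_affine[of "\<lambda>x. ennreal (norm (f x))" c t]
    by (auto simp: integrable_iff_bounded ennreal_mult_less_top)
qed

lemma integral_lborel_shift: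
  fixes f :: "'a::euclidean_space \<Rightarrow> 'b::{banach, second_countable_topology}"
  assumes "f \<in> borel_measurable borel"
  shows "(LINT x|lborel. f (x + t)) = (LINT x|lborel. f x)"
  using integral_lborel_affine[OF assms, of 1 t] by (simp add: add.commute)

lemma integrable_lborel_shift:
  fixes f :: "'a::euclidean_space \<Rightarrow> 'b::{banach, second_countable_topology}"
  assumes "integrable lborel f" shows "integrable lborel (\<lambda>x. f (x + t))"
  using integrable_lborel_affine[OF assms, of 1 t] by (simp add: add.commute)

lemma L2_sq_shift:
  assumes [measurable]: "f \<in> borel_measurable borel"
  shows "L2_sq (\<lambda>x. f (x + t)) = L2_sq f"
  unfolding L2_sq_def by (rule nn_integral_lborel_shift[where f="\<lambda>x. ennreal ((norm (f x))\<^sup>2)"]) simp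

lemma in_L2_shift: "in_L2 f \<Longrightarrow> in_L2 (\<lambda>x. f (x + t))"
  by (auto simp: in_L2_iff L2_sq_shift intro: measurable_compose[of "\<lambda>x. x + t" borel borel f])

text \<open>Phrased along sequences because the proofs rest on dominated convergence. The property
  is what makes correlations continuous at 0.\<close>

definition L2_translation_continuous :: "(real^'n \<Rightarrow> 'b::euclidean_space) \<Rightarrow> bool" where
  "L2_translation_continuous f \<longleftrightarrow>
     (\<forall>h. h \<longlonglongrightarrow> 0 \<longrightarrow> (\<lambda>k::nat. L2_sq (\<lambda>x. f (x + h k) - f x)) \<longlonglongrightarrow> 0)"

lemma L2_translation_continuous_add:
  assumes "L2_translation_continuous f" "L2_translation_continuous g"
    and [measurable]: "f \<in> borel_measurable borel" "g \<in> borel_measurable borel"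
  shows "L2_translation_continuous (\<lambda>x. f x + g x)"
  unfolding L2_translation_continuous_def
proof (intro allI impI)
  fix h :: "nat \<Rightarrow> real^'a" assume h: "h \<longlonglongrightarrow> 0"
  show "(\<lambda>k. L2_sq (\<lambda>x. f (x + h k) + g (x + h k) - (f x + g x))) \<longlonglongrightarrow> 0"
  proof (rule tendsto_0_ennreal_squeeze)
    show "\<forall>\<^sub>F k in sequentially. L2_sq (\<lambda>x. f (x + h k) + g (x + h k) - (f x + g x))
        \<le> 2 * L2_sq (\<lambda>x. f (x + h k) - f x) + 2 * L2_sq (\<lambda>x. g (x + h k) - g x)"
    proof (intro always_eventually allI)
      fix k
      show "L2_sq (\<lambda>x. f (x + h k) + g (x + h k) - (f x + g x))
        \<le> 2 * L2_sq (\<lambda>x. f (x + h k) - f x) + 2 * L2_sq (\<lambda>x. g (x + h k) - g x)"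
        using L2_sq_add_le[of "\<lambda>x. f (x + h k) - f x" "\<lambda>x. g (x + h k) - g x"] by (simp add: algebra_simps)
    qed
    have "(\<lambda>k. 2 * L2_sq (\<lambda>x. f (x + h k) - f x) + 2 * L2_sq (\<lambda>x. g (x + h k) - g x)) \<longlonglongrightarrow> 0 + 0"
      using assms(1,2) h by (intro tendsto_add tendsto_0_ennreal_cmult) (auto simp: L2_translation_continuous_def)
    then show "(\<lambda>k. 2 * L2_sq (\<lambda>x. f (x + h k) - f x) + 2 * L2_sq (\<lambda>x. g (x + h k) - g x)) \<longlonglongrightarrow> 0"
      by simp
  qed
qed

text \<open>Translation preserves the L2 norm, so replacing \<open>g\<close> by \<open>f i\<close>
  costs the same before and after the shift; only the middle difference uses the continuity of
  \<open>f i\<close>.\<close>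

lemma L2_translation_continuous_limit:
  assumes f: "\<And>i. L2_translation_continuous (f i)" and lim: "(\<lambda>i::nat. L2_sq (\<lambda>x. f i x - g x)) \<longlonglongrightarrow> 0"
    and [measurable]: "\<And>i. f i \<in> borel_measurable borel" "g \<in> borel_measurable borel"
  shows "L2_translation_continuous g"
  unfolding L2_translation_continuous_def
proof (intro allI impI tendsto_zero_ennreal)
  fix h :: "nat \<Rightarrow> real^'a" and e :: real assume h: "h \<longlonglongrightarrow> 0" and e: "e > 0"
  \<comment> \<open>Two applications of \<open>|a + b|^2 \<le> 2 |a|^2 + 2 |b|^2\<close> give the
    weights 2, 4 and 4, hence a total of \<open>10 * e / 16\<close>.\<close>
  have "eventually (\<lambda>i. L2_sq (\<lambda>x. f i x - g x) < ennreal (e/16)) sequentially"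
    using lim by (rule order_tendstoD) (use \<open>e > 0\<close> in simp)
  then obtain i where i: "L2_sq (\<lambda>x. f i x - g x) < ennreal (e/16)"
    by (auto simp: eventually_sequentially)
  have "eventually (\<lambda>k. L2_sq (\<lambda>x. f i (x + h k) - f i x) < ennreal (e/16)) sequentially"
    by (rule order_tendstoD(2)[of _ 0]) (use f[of i] h e in \<open>auto simp: L2_translation_continuous_def\<close>)
  then show "eventually (\<lambda>k. L2_sq (\<lambda>x. g (x + h k) - g x) < ennreal e) sequentially"
  proof eventually_elim
    case (elim k)
    have "L2_sq (\<lambda>x. g (x + h k) - g x) \<le> 2 * L2_sq (\<lambda>x. g (x + h k) - f i (x + h k)) + 2 * L2_sq (\<lambda>x. f i (x + h k) - g x)"
      using L2_sq_add_le[of "\<lambda>x. g (x + h k) - f i (x + h k)" "\<lambda>x. f i (x + h k) - g x"] by simp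
    also have "L2_sq (\<lambda>x. g (x + h k) - f i (x + h k)) = L2_sq (\<lambda>x. f i x - g x)"
      using L2_sq_shift[of "\<lambda>x. g x - f i x" "h k"] by (simp add: L2_sq_minus_commute)
    also have "L2_sq (\<lambda>x. f i (x + h k) - g x) \<le> 2 * L2_sq (\<lambda>x. f i (x + h k) - f i x) + 2 * L2_sq (\<lambda>x. f i x - g x)"
      using L2_sq_add_le[of "\<lambda>x. f i (x + h k) - f i x" "\<lambda>x. f i x - g x"] by simp
    also have "2 * L2_sq (\<lambda>x. f i x - g x) + 2 * (2 * L2_sq (\<lambda>x. f i (x + h k) - f i x) + 2 * L2_sq (\<lambda>x. f i x - g x))
       \<le> 2 * ennreal (e/16) + 2 * (2 * ennreal (e/16) + 2 * ennreal (e/16))"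
      using elim i by (intro add_mono mult_left_mono) auto
    also have "\<dots> = ennreal (10 * e / 16)"
    proof -
      have *: "2 * ennreal a = ennreal (2 * a)" if "a \<ge> 0" for a
        using that by (subst ennreal_numeral[symmetric], subst ennreal_mult[symmetric]) auto
      show ?thesis using e by (simp add: * flip: ennreal_plus)
    qed
    also have "\<dots> < ennreal e" using e by (simp add: ennreal_less_iff)
    finally show ?case by (simp add: add_mono mult_left_mono)
  qed
qed

text \<open>A point of an open set stays in it under small shifts, so the points that leave
  \<open>U\<close> contribute a null sequence by dominated convergence. The points that enter
  \<open>U\<close> become leaving points after substituting the opposite shift.\<close>

lemma L2_translation_continuous_open:
  fixes c :: "'b::euclidean_space" and U :: "(real^'n) set"
  assumes U: "open U" and fin: "emeasure lborel U < \<infinity>"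
  shows "L2_translation_continuous (\<lambda>x. indicator U x *\<^sub>R c)"
  unfolding L2_translation_continuous_def
proof (intro allI impI)
  fix h :: "nat \<Rightarrow> real^'n" assume h: "h \<longlonglongrightarrow> 0"
  have [measurable]: "U \<in> sets borel" using U by auto
  have one: "(\<lambda>k. L2_sq (\<lambda>x. indicator U x *\<^sub>R (indicator (- U) (x + h k) *\<^sub>R c))) \<longlonglongrightarrow> 0"
    if h: "h \<longlonglongrightarrow> 0" for h :: "nat \<Rightarrow> real^'n"
  proof (rule L2_sq_dominated[where g="\<lambda>x. indicator U x *\<^sub>R c" and c=1])
    show "in_L2 (\<lambda>x. indicator U x *\<^sub>R c)"
    proof -
      have "L2_sq (\<lambda>x. indicator U x *\<^sub>R c) = (\<integral>\<^sup>+x. ennreal ((norm c)\<^sup>2) * indicator U x \<partial>lborel)"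
        unfolding L2_sq_def by (intro nn_integral_cong) (auto simp: indicator_def)
      also have "\<dots> < \<infinity>" using fin by (simp add: nn_integral_cmult ennreal_mult_less_top)
      finally show ?thesis by (simp add: in_L2_iff)
    qed
    show "AE x in lborel. (\<lambda>k. indicator U x *\<^sub>R (indicator (- U) (x + h k) *\<^sub>R c)) \<longlonglongrightarrow> 0"
    proof (intro AE_I2)
      fix x
      show "(\<lambda>k. indicator U x *\<^sub>R (indicator (- U) (x + h k) *\<^sub>R c)) \<longlonglongrightarrow> 0"
      proof (cases "x \<in> U")
        case True
        have "(\<lambda>k. x + h k) \<longlonglongrightarrow> x + 0" by (intro tendsto_intros h)
        then have "eventually (\<lambda>k. x + h k \<in> U) sequentially"
          using U True by (intro topological_tendstoD) auto
        then show ?thesis by (intro tendsto_eventually) (auto elim!: eventually_mono)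
      qed simp
    qed
  qed (auto simp: indicator_def)
  show "(\<lambda>k. L2_sq (\<lambda>x. indicator U (x + h k) *\<^sub>R c - indicator U x *\<^sub>R c)) \<longlonglongrightarrow> 0"
  proof (rule tendsto_0_ennreal_squeeze)
    show "\<forall>\<^sub>F k in sequentially. L2_sq (\<lambda>x. indicator U (x + h k) *\<^sub>R c - indicator U x *\<^sub>R c)
      \<le> 2 * L2_sq (\<lambda>x. indicator U x *\<^sub>R (indicator (- U) (x + - h k) *\<^sub>R c))
        + 2 * L2_sq (\<lambda>x. indicator U x *\<^sub>R (indicator (- U) (x + h k) *\<^sub>R c))"
    proof (intro always_eventually allI)
      fix k
      have "(\<lambda>x. indicator U (x + h k) *\<^sub>R c - indicator U x *\<^sub>R c) =
         (\<lambda>x. indicator U (x + h k) *\<^sub>R (indicator (- U) (x + h k + - h k) *\<^sub>R c)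
              - indicator U x *\<^sub>R (indicator (- U) (x + h k) *\<^sub>R c))"
        by (auto simp: indicator_def fun_eq_iff)
      then show "L2_sq (\<lambda>x. indicator U (x + h k) *\<^sub>R c - indicator U x *\<^sub>R c)
      \<le> 2 * L2_sq (\<lambda>x. indicator U x *\<^sub>R (indicator (- U) (x + - h k) *\<^sub>R c))
        + 2 * L2_sq (\<lambda>x. indicator U x *\<^sub>R (indicator (- U) (x + h k) *\<^sub>R c))"
        using L2_sq_diff_le[of "\<lambda>x. indicator U (x + h k) *\<^sub>R (indicator (- U) (x + h k + - h k) *\<^sub>R c)"
             "\<lambda>x. indicator U x *\<^sub>R (indicator (- U) (x + h k) *\<^sub>R c)"]
          L2_sq_shift[of "\<lambda>x. indicator U x *\<^sub>R (indicator (- U) (x + - h k) *\<^sub>R c)" "h k"]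
        by simp
    qed
    have "(\<lambda>k. - h k) \<longlonglongrightarrow> 0" using tendsto_minus[OF h] by simp
    then have "(\<lambda>k. 2 * L2_sq (\<lambda>x. indicator U x *\<^sub>R (indicator (- U) (x + - h k) *\<^sub>R c))
        + 2 * L2_sq (\<lambda>x. indicator U x *\<^sub>R (indicator (- U) (x + h k) *\<^sub>R c))) \<longlonglongrightarrow> 0 + 0"
      by (intro tendsto_add tendsto_0_ennreal_cmult one h) auto
    then show "(\<lambda>k. 2 * L2_sq (\<lambda>x. indicator U x *\<^sub>R (indicator (- U) (x + - h k) *\<^sub>R c))
        + 2 * L2_sq (\<lambda>x. indicator U x *\<^sub>R (indicator (- U) (x + h k) *\<^sub>R c))) \<longlonglongrightarrow> 0" by simp
  qed
qed

text \<open>Outer regularity replaces the set by open supersets; the L2 error is |c|^2 times the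
  measure of the difference.\<close>

lemma L2_translation_continuous_set:
  fixes c :: "'b::euclidean_space" and B :: "(real^'n) set"
  assumes B: "B \<in> sets borel" and fin: "emeasure lborel B < \<infinity>"
  shows "L2_translation_continuous (\<lambda>x. indicator B x *\<^sub>R c)"
proof -
  note [measurable] = B
  have "\<exists>U. open U \<and> B \<subseteq> U \<and> emeasure lborel (U - B) < ennreal (1 / real (Suc i))" for i
    using outer_regular_lborel[OF B, of "1 / real (Suc i)"] by (metis of_nat_0_less_iff zero_less_Suc zero_less_divide_1_iff)
  then obtain U where U: "\<And>i. open (U i)" "\<And>i. B \<subseteq> U i" "\<And>i. emeasure lborel (U i - B) < ennreal (1 / real (Suc i))"
    by metis
  have [measurable]: "U i \<in> sets borel" for i using U(1) by auto
  show ?thesis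
  proof (rule L2_translation_continuous_limit)
    fix i
    have "emeasure lborel (U i) = emeasure lborel (B \<union> (U i - B))"
      using U(2)[of i] by (simp add: Un_absorb1)
    also have "\<dots> \<le> emeasure lborel B + emeasure lborel (U i - B)" by (intro emeasure_subadditive) auto
    also have "\<dots> < \<infinity>" using fin order.strict_trans[OF U(3)[of i], of \<infinity>] by simp
    finally show "L2_translation_continuous (\<lambda>x. indicator (U i) x *\<^sub>R c)"
      by (intro L2_translation_continuous_open U)
  next
    show "(\<lambda>i. L2_sq (\<lambda>x. indicator (U i) x *\<^sub>R c - indicator B x *\<^sub>R c)) \<longlonglongrightarrow> 0"
    proof (rule tendsto_0_ennreal_squeeze)
      show "\<forall>\<^sub>F i in sequentially. L2_sq (\<lambda>x. indicator (U i) x *\<^sub>R c - indicator B x *\<^sub>R c)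
          \<le> ennreal ((norm c)\<^sup>2) * ennreal (1 / real (Suc i))"
      proof (intro always_eventually allI)
        fix i
        have "L2_sq (\<lambda>x. indicator (U i) x *\<^sub>R c - indicator B x *\<^sub>R c)
           = (\<integral>\<^sup>+x. ennreal ((norm c)\<^sup>2) * indicator (U i - B) x \<partial>lborel)"
          unfolding L2_sq_def using U(2)[of i] by (intro nn_integral_cong) (auto simp: indicator_def)
        also have "\<dots> = ennreal ((norm c)\<^sup>2) * emeasure lborel (U i - B)"
          by (simp add: nn_integral_cmult)
        also have "\<dots> \<le> ennreal ((norm c)\<^sup>2) * ennreal (1 / real (Suc i))"
          using U(3)[of i] by (intro mult_left_mono) auto
        finally show "L2_sq (\<lambda>x. indicator (U i) x *\<^sub>R c - indicator B x *\<^sub>R c)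
          \<le> ennreal ((norm c)\<^sup>2) * ennreal (1 / real (Suc i))" .
      qed
      have "(\<lambda>i. ennreal (1 / real (Suc i))) \<longlonglongrightarrow> ennreal 0"
        by (intro tendsto_ennrealI) (rule LIMSEQ_Suc[OF lim_1_over_n])
      then show "(\<lambda>i. ennreal ((norm c)\<^sup>2) * ennreal (1 / real (Suc i))) \<longlonglongrightarrow> 0"
        by (intro tendsto_0_ennreal_cmult) auto
    qed
  qed auto
qed

lemma L2_translation_continuous:
  fixes f :: "real^'n \<Rightarrow> 'b::euclidean_space"
  assumes f: "in_L2 f" shows "L2_translation_continuous f"
proof -
  have [measurable]: "f \<in> borel_measurable borel" using f by (simp add: in_L2_iff)
  from borel_measurable_implies_sequence_metric[of f lborel 0] obtain s where
    s: "\<And>i. simple_function lborel (s i)" and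
    lim: "\<And>x. (\<lambda>i. s i x) \<longlonglongrightarrow> f x" and
    bound: "\<And>i x. norm (s i x) \<le> 2 * norm (f x)"
    by simp metis
  have [measurable]: "s i \<in> borel_measurable borel" for i
    using borel_measurable_simple_function[OF s[of i]] by simp
  show ?thesis
  proof (rule L2_translation_continuous_limit)
    show "(\<lambda>i. L2_sq (\<lambda>x. s i x - f x)) \<longlonglongrightarrow> 0"
    proof (rule L2_sq_dominated[OF _ f, where c=3])
      show "AE x in lborel. (\<lambda>k. s k x - f x) \<longlonglongrightarrow> 0"
        using lim by (simp add: LIM_zero)
      show "norm (s k x - f x) \<le> 3 * norm (f x)" for k x
        using bound[of k x] norm_triangle_ineq4[of "s k x" "f x"] by linarith
    qed simp
    fix i
    have fin: "finite (range (s i))" using simple_functionD(1)[OF s[of i]] by simp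
    have L2s: "in_L2 (s i)" by (rule in_L2_bound[OF f _ bound]) simp
    have m [measurable]: "s i -` {y} \<in> sets borel" for y
      using measurable_sets[of "s i" borel borel "{y}"] by simp
    \<comment> \<open>The value 0 is left out because its level set may have infinite measure; every
      other level set has finite measure since \<open>s i\<close> is square integrable.\<close>
    have tc: "L2_translation_continuous (\<lambda>x. \<Sum>y\<in>Y. indicator (s i -` {y}) x *\<^sub>R y)"
      if "finite Y" "0 \<notin> Y" for Y
      using that
    proof (induction Y rule: finite_induct)
      case empty
      then show ?case by (simp add: L2_translation_continuous_def L2_sq_def)
    next
      case (insert y Y)
      have "ennreal ((norm y)\<^sup>2) * emeasure lborel (s i -` {y})
          = (\<integral>\<^sup>+x. ennreal ((norm y)\<^sup>2) * indicator (s i -` {y}) x \<partial>lborel)"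
        by (simp add: nn_integral_cmult)
      also have "\<dots> \<le> L2_sq (s i)" unfolding L2_sq_def
        by (intro nn_integral_mono) (auto simp: indicator_def)
      also have "\<dots> < \<infinity>" using L2s by (simp add: in_L2_iff)
      finally have "emeasure lborel (s i -` {y}) < \<infinity>"
        using insert.prems by (auto simp: ennreal_mult_less_top)
      then have "L2_translation_continuous (\<lambda>x. indicator (s i -` {y}) x *\<^sub>R y)"
        by (intro L2_translation_continuous_set m)
      moreover have "L2_translation_continuous (\<lambda>x. \<Sum>y\<in>Y. indicator (s i -` {y}) x *\<^sub>R y)"
        using insert by auto
      ultimately have "L2_translation_continuous (\<lambda>x. indicator (s i -` {y}) x *\<^sub>R y
          + (\<Sum>y\<in>Y. indicator (s i -` {y}) x *\<^sub>R y))"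
        by (rule L2_translation_continuous_add) measurable
      then show ?case by (simp only: sum.insert[OF insert.hyps])
    qed
    have "s i = (\<lambda>x. \<Sum>y\<in>range (s i) - {0}. indicator (s i -` {y}) x *\<^sub>R y)"
    proof
      fix x
      have "(\<Sum>y\<in>range (s i) - {0}. indicator (s i -` {y}) x *\<^sub>R y)
         = (\<Sum>y\<in>range (s i) - {0}. if y = s i x then s i x else 0)"
        by (intro sum.cong) (auto simp: indicator_def)
      also have "\<dots> = s i x" using fin by (auto simp: sum.delta')
      finally show "s i x = (\<Sum>y\<in>range (s i) - {0}. indicator (s i -` {y}) x *\<^sub>R y)" by simp
    qed
    then show "L2_translation_continuous (s i)" using tc[of "range (s i) - {0}"] fin by simp
  qed auto
qed

section \<open>The Fourier transform of scalar functions\<close>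

text \<open>Complex-valued input allows functions of frequency to be transformed again, as in the
  multiplication formula and in the inversion. The components of \<open>fourier\<close> are values
  of \<open>ft\<close> on real data.\<close>

definition ft :: "(real^'n \<Rightarrow> complex) \<Rightarrow> real^'n \<Rightarrow> complex" where
  "ft f \<xi> = (LINT x|lborel. cis (- (x \<bullet> \<xi>)) * f x)"

lemma cis_measurable [measurable]: "cis \<in> borel_measurable borel"
  by (intro borel_measurable_continuous_onI continuous_intros)

lemma cnj_measurable [measurable]: "cnj \<in> borel_measurable borel"
  by (intro borel_measurable_continuous_onI continuous_intros)

lemma integrable_cis_mult:
  fixes f :: "'a \<Rightarrow> complex"
  assumes "integrable M f" and [measurable]: "h \<in> borel_measurable M"
  shows "integrable M (\<lambda>x. cis (h x) * f x)"
  by (rule Bochner_Integration.integrable_bound[OF assms(1)]) (use assms(1) in \<open>auto simp: norm_mult\<close>)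

lemma ft_bound:
  assumes "integrable lborel f" shows "norm (ft f \<xi>) \<le> (LINT x|lborel. norm (f x))"
  unfolding ft_def
  by (rule order_trans[OF integral_norm_bound]) (simp add: norm_mult)

lemma continuous_on_ft:
  fixes f :: "real^'n \<Rightarrow> complex"
  assumes f: "integrable lborel f" shows "continuous_on UNIV (ft f)"
proof (rule continuous_at_imp_continuous_on, intro ballI continuous_at_sequentiallyI)
  fix \<xi> :: "real^'n" and u assume u: "u \<longlonglongrightarrow> \<xi>"
  have [measurable]: "f \<in> borel_measurable borel" using f by auto
  show "(\<lambda>k. ft f (u k)) \<longlonglongrightarrow> ft f \<xi>"
    unfolding ft_def
  proof (rule integral_dominated_convergence[where w="\<lambda>x. norm (f x)"])
    show "AE x in lborel. (\<lambda>i. cis (- (x \<bullet> u i)) * f x) \<longlonglongrightarrow> cis (- (x \<bullet> \<xi>)) * f x"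
    proof (intro AE_I2 tendsto_mult tendsto_const)
      fix x :: "real^'n"
      have "isCont cis (- (x \<bullet> \<xi>))" using continuous_on_cis[OF continuous_on_id, of UNIV] by (simp add: continuous_on_eq_continuous_at)
      then show "(\<lambda>i. cis (- (x \<bullet> u i))) \<longlonglongrightarrow> cis (- (x \<bullet> \<xi>))"
        by (rule isCont_tendsto_compose) (intro tendsto_intros u)
    qed
  qed (use f in \<open>auto simp: norm_mult\<close>)
qed

lemma ft_measurable [measurable]:
  "integrable lborel f \<Longrightarrow> ft f \<in> borel_measurable borel"
  by (intro borel_measurable_continuous_onI continuous_on_ft)

lemma ft_diff: "integrable lborel f \<Longrightarrow> integrable lborel g \<Longrightarrow> ft (\<lambda>x. f x - g x) \<xi> = ft f \<xi> - ft g \<xi>"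
  unfolding ft_def by (subst Bochner_Integration.integral_diff[symmetric]) (auto intro!: integrable_cis_mult simp: right_diff_distrib)

lemma ft_cmult: "ft (\<lambda>x. c * f x) \<xi> = c * ft f \<xi>"
  unfolding ft_def by (subst integral_mult_right_zero[symmetric]) (simp add: mult_ac)

lemma ft_shift:
  assumes "integrable lborel f"
  shows "ft (\<lambda>x. f (x + t)) \<xi> = cis (t \<bullet> \<xi>) * ft f \<xi>"
proof -
  have [measurable]: "f \<in> borel_measurable borel" using assms by auto
  have "ft (\<lambda>x. f (x + t)) \<xi> = (LINT x|lborel. cis (t \<bullet> \<xi>) * (cis (- ((x + t) \<bullet> \<xi>)) * f (x + t)))"
    unfolding ft_def by (intro Bochner_Integration.integral_cong refl) (simp add: mult.assoc[symmetric] cis_mult inner_add_left)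
  also have "\<dots> = (LINT x|lborel. cis (t \<bullet> \<xi>) * (cis (- (x \<bullet> \<xi>)) * f x))"
    by (rule integral_lborel_shift[where f="\<lambda>x. cis (t \<bullet> \<xi>) * (cis (- (x \<bullet> \<xi>)) * f x)"]) measurable
  finally show ?thesis by (simp add: ft_def)
qed

lemma ft_cnj: "ft (\<lambda>x. cnj (f x)) \<xi> = cnj (ft f (- \<xi>))"
  unfolding ft_def Bochner_Integration.integral_cnj[symmetric]
  by (intro Bochner_Integration.integral_cong refl) (simp add: cis_cnj)

subsection \<open>The Gaussian\<close>

lemma integral_lborel_prod_Basis:
  fixes h :: "'a::euclidean_space \<Rightarrow> real \<Rightarrow> complex"
  assumes h: "\<And>b. b \<in> Basis \<Longrightarrow> integrable lborel (h b)"
  shows "integrable lborel (\<lambda>x. \<Prod>b\<in>Basis. h b (x \<bullet> b))"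
    and "(LINT x|lborel. (\<Prod>b\<in>Basis. h b (x \<bullet> b))) = (\<Prod>b\<in>Basis. LINT t|lborel. h b t)"
proof -
  interpret product_sigma_finite "\<lambda>_::'a. lborel :: real measure" ..
  have hm: "h b \<in> borel_measurable borel" if "b \<in> Basis" for b using h[OF that] by auto
  have m: "(\<lambda>f. \<Sum>b\<in>Basis. f b *\<^sub>R b) \<in> measurable (\<Pi>\<^sub>M b\<in>Basis. lborel) (borel :: 'a measure)"
    by measurable
  have m2: "(\<lambda>x::'a. \<Prod>b\<in>Basis. h b (x \<bullet> b)) \<in> borel_measurable borel"
    by (intro borel_measurable_prod measurable_compose[OF _ hm]) auto
  have eq: "(\<Prod>b\<in>Basis. h b ((\<Sum>b'\<in>Basis. f b' *\<^sub>R b') \<bullet> b)) = (\<Prod>b\<in>Basis. h b (f b))" for f :: "'a \<Rightarrow> real"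
    by (intro prod.cong refl) (simp add: inner_sum_left inner_Basis if_distrib sum.delta cong: if_cong)
  show "integrable lborel (\<lambda>x. \<Prod>b\<in>Basis. h b (x \<bullet> b))"
    unfolding lborel_eq[where 'a='a] integrable_distr_eq[OF m m2] eq
    by (intro product_integrable_prod h) auto
  show "(LINT x|lborel. (\<Prod>b\<in>Basis. h b (x \<bullet> b))) = (\<Prod>b\<in>Basis. LINT t|lborel. h b t)"
    unfolding lborel_eq[where 'a='a] integral_distr[OF m m2] eq
    by (subst product_integral_prod) (auto intro: h simp: lborel_eq[symmetric])
qed

text \<open>The standard normal density on the whole space. It factors into one-dimensional
  densities, so its transform is a product of characteristic functions and hence a multiple of the
  density itself.\<close>

definition gauss :: "real^'n \<Rightarrow> real" where
  "gauss x = (1 / sqrt (2 * pi)) ^ CARD('n) * exp (- (norm x)\<^sup>2 / 2)"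

lemma gauss_prod: "gauss (x :: real^'n) = (\<Prod>b\<in>Basis. std_normal_density (x \<bullet> b))"
proof -
  have "(norm x)\<^sup>2 = (\<Sum>b\<in>Basis. (x \<bullet> b)\<^sup>2)"
    unfolding power2_norm_eq_inner by (subst euclidean_inner) (simp add: power2_eq_square)
  then have "exp (- (norm x)\<^sup>2 / 2) = (\<Prod>b\<in>Basis. exp (- (x \<bullet> b)\<^sup>2 / 2))"
    by (simp add: sum_negf sum_divide_distrib flip: exp_sum)
  then show ?thesis by (simp add: gauss_def std_normal_density_def prod.distrib power_one_over prod_dividef)
qed

lemma gauss_pos: "0 < gauss x" by (simp add: gauss_def)

lemma abs_gauss [simp]: "\<bar>gauss x\<bar> = gauss x" using gauss_pos[of x] by simp

lemma gauss_le: "gauss x \<le> gauss (0 :: real^'n)" for x :: "real^'n" by (simp add: gauss_def)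

lemma continuous_gauss: "continuous_on UNIV gauss"
  unfolding gauss_def by (intro continuous_intros) auto

lemma gauss_measurable [measurable]: "gauss \<in> borel_measurable borel"
  by (intro borel_measurable_continuous_onI continuous_gauss)

lemma gauss_scaled_tendsto:
  fixes \<xi> :: "real^'n"
  assumes "e \<longlonglongrightarrow> 0" shows "(\<lambda>k::nat. gauss (e k *\<^sub>R \<xi>)) \<longlonglongrightarrow> gauss (0 :: real^'n)"
proof (rule isCont_tendsto_compose[of 0 gauss])
  show "isCont gauss (0 :: real^'n)" by (rule continuous_on_interior[OF continuous_gauss]) simp
  show "(\<lambda>k. e k *\<^sub>R \<xi>) \<longlonglongrightarrow> 0" using tendsto_scaleR[OF assms tendsto_const[of \<xi>]] by simp
qed

lemma ft_std_normal_density: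
  "integrable lborel (\<lambda>t. cis (- (t * s)) * complex_of_real (std_normal_density t))"
  "(LINT t|lborel. cis (- (t * s)) * complex_of_real (std_normal_density t)) = exp (- s\<^sup>2 / 2)"
proof -
  have i: "integrable lborel (\<lambda>t. complex_of_real (std_normal_density t))"
    by (intro integrable_of_real) (simp add: integrable_normal_density)
  show "integrable lborel (\<lambda>t. cis (- (t * s)) * complex_of_real (std_normal_density t))"
    by (intro integrable_cis_mult i) simp
  have "(LINT t|lborel. cis (- (t * s)) * complex_of_real (std_normal_density t)) = char std_normal_distribution (- s)"
    unfolding char_def
    by (subst integral_density) (auto simp: scaleR_conv_of_real cis_conv_exp mult_ac intro!: Bochner_Integration.integral_cong)
  also have "\<dots> = exp (- s\<^sup>2 / 2)" by (simp add: char_std_normal_distribution exp_of_real[symmetric])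
  finally show "(LINT t|lborel. cis (- (t * s)) * complex_of_real (std_normal_density t)) = exp (- s\<^sup>2 / 2)" .
qed

lemma
  fixes \<xi> :: "real^'n"
  shows ft_gauss: "ft (\<lambda>x. complex_of_real (gauss x)) \<xi> = complex_of_real (sqrt (2 * pi) ^ CARD('n) * gauss \<xi>)"
  and integrable_ft_gauss: "integrable lborel (\<lambda>x::real^'n. complex_of_real (gauss x))"
proof -
  have cis_prod: "cis (- (x \<bullet> z)) * complex_of_real (gauss x)
    = (\<Prod>b\<in>Basis. cis (- ((x \<bullet> b) * (z \<bullet> b))) * complex_of_real (std_normal_density (x \<bullet> b)))"
    for x z :: "real^'n"
  proof -
    have "cis (- (x \<bullet> z)) = exp (\<Sum>b\<in>Basis. \<i> * complex_of_real (- ((x \<bullet> b) * (z \<bullet> b))))"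
      by (subst euclidean_inner) (simp add: cis_conv_exp sum_negf sum_distrib_left)
    also have "\<dots> = (\<Prod>b\<in>Basis. cis (- ((x \<bullet> b) * (z \<bullet> b))))"
      by (subst exp_sum) (auto simp: cis_conv_exp)
    finally show ?thesis by (simp add: gauss_prod prod.distrib)
  qed
  note * = integral_lborel_prod_Basis[of "\<lambda>b t. cis (- (t * (z \<bullet> b))) * complex_of_real (std_normal_density t)" for z :: "real^'n",
      OF ft_std_normal_density(1), folded cis_prod]
  from *(1)[of 0] show "integrable lborel (\<lambda>x::real^'n. complex_of_real (gauss x))" by simp
  have "ft (\<lambda>x. complex_of_real (gauss x)) \<xi> = (\<Prod>b\<in>Basis. complex_of_real (exp (- (\<xi> \<bullet> b)\<^sup>2 / 2)))"
    unfolding ft_def *(2) ft_std_normal_density(2) ..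
  also have "\<dots> = complex_of_real (\<Prod>b\<in>Basis. sqrt (2 * pi) * std_normal_density (\<xi> \<bullet> b))"
    by (subst of_real_prod) (simp add: std_normal_density_def)
  also have "\<dots> = complex_of_real (sqrt (2 * pi) ^ CARD('n) * gauss \<xi>)"
    by (simp only: prod.distrib gauss_prod) simp
  finally show "ft (\<lambda>x. complex_of_real (gauss x)) \<xi> = complex_of_real (sqrt (2 * pi) ^ CARD('n) * gauss \<xi>)" .
qed

lemma integrable_gauss: "integrable lborel gauss"
  using integrable_ft_gauss by (simp only: complex_of_real_integrable_eq)

lemma integral_gauss: "(LINT x|lborel. gauss (x :: real^'n)) = 1"
proof -
  have "complex_of_real (LINT x|lborel. gauss (x :: real^'n)) = ft (\<lambda>x. complex_of_real (gauss x)) (0 :: real^'n)"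
    by (simp add: ft_def)
  also have "\<dots> = 1" by (simp only: ft_gauss) (simp add: gauss_def flip: of_real_power power_mult_distrib)
  finally show ?thesis by (simp only: of_real_eq_1_iff)
qed

text \<open>For small \<open>e\<close> a wide Gaussian in frequency turns into a narrow one in
  space; this is the approximate identity behind Plancherel's theorem.\<close>

lemma ft_gauss_scaled:
  fixes z :: "real^'n"
  assumes e: "e > 0"
  shows "ft (\<lambda>\<xi>. complex_of_real (gauss (e *\<^sub>R \<xi>))) z
     = complex_of_real (sqrt (2 * pi) ^ CARD('n) / e ^ CARD('n) * gauss (z /\<^sub>R e))"
proof -
  let ?h = "\<lambda>x. cis (- (x \<bullet> (z /\<^sub>R e))) * complex_of_real (gauss x)"
  have "ft (\<lambda>x. complex_of_real (gauss x)) (z /\<^sub>R e) = (\<bar>e\<bar> ^ DIM(real^'n)) *\<^sub>R (LINT x|lborel. ?h (0 + e *\<^sub>R x))"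
    unfolding ft_def using e by (intro integral_lborel_affine) auto
  also have "(LINT x|lborel. ?h (0 + e *\<^sub>R x)) = ft (\<lambda>\<xi>. complex_of_real (gauss (e *\<^sub>R \<xi>))) z"
    unfolding ft_def using e by (simp add: mult.assoc[symmetric])
  finally have "complex_of_real (e ^ CARD('n)) * ft (\<lambda>\<xi>. complex_of_real (gauss (e *\<^sub>R \<xi>))) z
      = complex_of_real (sqrt (2 * pi) ^ CARD('n) * gauss (z /\<^sub>R e))"
    unfolding ft_gauss using e by (simp add: scaleR_conv_of_real)
  then have "ft (\<lambda>\<xi>. complex_of_real (gauss (e *\<^sub>R \<xi>))) z
      = complex_of_real (sqrt (2 * pi) ^ CARD('n) * gauss (z /\<^sub>R e)) / complex_of_real (e ^ CARD('n))"
    using e by (simp add: field_simps)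
  then show ?thesis by simp
qed

subsection \<open>Plancherel's theorem for integrable functions\<close>

interpretation lborel_pair: pair_sigma_finite "lborel :: ('a::euclidean_space) measure" "lborel :: ('b::euclidean_space) measure" ..

text \<open>The kernel is symmetric in x and \<xi>, so Fubini's theorem moves the transform from one
  factor to the other; integrability of both functions makes the double integral absolutely
  convergent.\<close>

lemma ft_multiplication:
  fixes f g :: "real^'n \<Rightarrow> complex"
  assumes f: "integrable lborel f" and g: "integrable lborel g"
  shows "(LINT \<xi>|lborel. ft f \<xi> * g \<xi>) = (LINT x|lborel. f x * ft g x)"
proof -
  have [measurable]: "f \<in> borel_measurable borel" "g \<in> borel_measurable borel" using f g by auto
  have i: "integrable (lborel \<Otimes>\<^sub>M lborel) (\<lambda>(x, \<xi>). cis (- (x \<bullet> \<xi>)) * f x * g \<xi>)"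
  proof (rule lborel_pair.Fubini_integrable)
    show "integrable lborel (\<lambda>x. LINT y|lborel. norm (case (x, y) of (x, \<xi>) \<Rightarrow> cis (- (x \<bullet> \<xi>)) * f x * g \<xi>))"
      using f by (simp add: norm_mult)
    show "AE x in lborel. integrable lborel (\<lambda>y. case (x, y) of (x, \<xi>) \<Rightarrow> cis (- (x \<bullet> \<xi>)) * f x * g \<xi>)"
      using g by (auto intro!: integrable_cis_mult integrable_mult_right simp: mult.assoc)
  qed measurable
  have "(LINT \<xi>|lborel. ft f \<xi> * g \<xi>) = (LINT \<xi>|lborel. (LINT x|lborel. cis (- (x \<bullet> \<xi>)) * f x * g \<xi>))"
    by (simp add: ft_def)
  also have "\<dots> = (LINT x|lborel. (LINT \<xi>|lborel. cis (- (x \<bullet> \<xi>)) * f x * g \<xi>))"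
    using lborel_pair.Fubini_integral[OF i] by simp
  also have "\<dots> = (LINT x|lborel. f x * ft g x)"
  proof (intro Bochner_Integration.integral_cong refl)
    fix x :: "real^'n"
    have "(LINT \<xi>|lborel. cis (- (x \<bullet> \<xi>)) * f x * g \<xi>) = (LINT \<xi>|lborel. f x * (cis (- (\<xi> \<bullet> x)) * g \<xi>))"
      by (intro Bochner_Integration.integral_cong refl) (simp add: inner_commute mult_ac)
    then show "(LINT \<xi>|lborel. cis (- (x \<bullet> \<xi>)) * f x * g \<xi>) = f x * ft g x"
      by (simp add: ft_def)
  qed
  finally show ?thesis .
qed

text \<open>The convolution of \<open>f\<close> with the reflected conjugate of \<open>g\<close>:
  its value at 0 is the L2 inner product, and its transform is the product that occurs in
  Plancherel's identity.\<close>

definition correlation :: "(real^'n \<Rightarrow> complex) \<Rightarrow> (real^'n \<Rightarrow> complex) \<Rightarrow> real^'n \<Rightarrow> complex" where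
  "correlation f g z = (LINT x|lborel. f x * cnj (g (x - z)))"

lemma
  fixes f g :: "real^'n \<Rightarrow> complex"
  assumes f: "integrable lborel f" and g: "integrable lborel g"
  shows integrable_correlation: "integrable lborel (correlation f g)"
    and ft_correlation: "ft (correlation f g) \<xi> = ft f \<xi> * cnj (ft g \<xi>)"
proof -
  have [measurable]: "f \<in> borel_measurable borel" "g \<in> borel_measurable borel" using f g by auto
  have sub: "(LINT z|lborel. h (x - z)) = (LINT z|lborel. h z)" if [measurable]: "h \<in> borel_measurable borel"
    for h :: "real^'n \<Rightarrow> 'b::{banach,second_countable_topology}" and x
    using integral_lborel_affine[OF that, of "-1" x] by simp
  have isub: "integrable lborel (\<lambda>z. g (x - z))" for x
    using integrable_lborel_affine[OF g, of "-1" x] by simp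
  have i: "integrable (lborel \<Otimes>\<^sub>M lborel) (\<lambda>(x, z). cis (- (z \<bullet> w)) * (f x * cnj (g (x - z))))" for w
  proof (rule lborel_pair.Fubini_integrable)
    have "(LINT y|lborel. norm (g (x - y))) = (LINT y|lborel. norm (g y))" for x
      by (rule sub[of "\<lambda>y. norm (g y)" x]) simp
    then show "integrable lborel (\<lambda>x. LINT y|lborel. norm (case (x, y) of (x, z) \<Rightarrow> cis (- (z \<bullet> w)) * (f x * cnj (g (x - z)))))"
      using f by (simp add: norm_mult)
    show "AE x in lborel. integrable lborel (\<lambda>y. case (x, y) of (x, z) \<Rightarrow> cis (- (z \<bullet> w)) * (f x * cnj (g (x - z))))"
      using isub by (auto intro!: integrable_cis_mult integrable_mult_right)
  qed measurable
  have "integrable lborel (\<lambda>z. LINT x|lborel. cis (- (z \<bullet> 0)) * (f x * cnj (g (x - z))))"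
    using lborel_pair.integrable_snd[OF i[of 0]] by simp
  then show "integrable lborel (correlation f g)" by (simp add: correlation_def[abs_def])
  have "ft (correlation f g) \<xi> = (LINT z|lborel. (LINT x|lborel. cis (- (z \<bullet> \<xi>)) * (f x * cnj (g (x - z)))))"
    by (simp add: ft_def correlation_def)
  also have "\<dots> = (LINT x|lborel. (LINT z|lborel. cis (- (z \<bullet> \<xi>)) * (f x * cnj (g (x - z)))))"
    using lborel_pair.Fubini_integral[OF i] by simp
  also have "\<dots> = (LINT x|lborel. (LINT z|lborel. cis (- ((x - z) \<bullet> \<xi>)) * (f x * cnj (g z))))"
  proof (rule Bochner_Integration.integral_cong[OF refl])
    fix x :: "real^'n"
    show "(LINT z|lborel. cis (- (z \<bullet> \<xi>)) * (f x * cnj (g (x - z)))) = (LINT z|lborel. cis (- ((x - z) \<bullet> \<xi>)) * (f x * cnj (g z)))"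
      using sub[of "\<lambda>z. cis (- ((x - z) \<bullet> \<xi>)) * (f x * cnj (g z))" x] by simp
  qed
  also have "\<dots> = (LINT x|lborel. cis (- (x \<bullet> \<xi>)) * f x * (LINT z|lborel. cnj (cis (- (z \<bullet> \<xi>)) * g z)))"
  proof (intro Bochner_Integration.integral_cong refl)
    fix x :: "real^'n"
    have "(LINT z|lborel. cis (- ((x - z) \<bullet> \<xi>)) * (f x * cnj (g z))) = (LINT z|lborel. (cis (- (x \<bullet> \<xi>)) * f x) * cnj (cis (- (z \<bullet> \<xi>)) * g z))"
    proof (rule Bochner_Integration.integral_cong[OF refl])
      fix z :: "real^'n"
      have "cis (- ((x - z) \<bullet> \<xi>)) = cis (- (x \<bullet> \<xi>)) * cis (z \<bullet> \<xi>)"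
        by (simp add: cis_mult inner_diff_left)
      then show "cis (- ((x - z) \<bullet> \<xi>)) * (f x * cnj (g z)) = cis (- (x \<bullet> \<xi>)) * f x * cnj (cis (- (z \<bullet> \<xi>)) * g z)"
        by (simp add: cis_cnj)
    qed
    then show "(LINT z|lborel. cis (- ((x - z) \<bullet> \<xi>)) * (f x * cnj (g z))) = cis (- (x \<bullet> \<xi>)) * f x * (LINT z|lborel. cnj (cis (- (z \<bullet> \<xi>)) * g z))"
      by simp
  qed
  also have "\<dots> = ft f \<xi> * cnj (ft g \<xi>)" by (simp add: ft_def del: complex_cnj_mult)
  finally show "ft (correlation f g) \<xi> = ft f \<xi> * cnj (ft g \<xi>)" .
qed

lemma in_L2_cnj: "in_L2 f \<Longrightarrow> in_L2 (\<lambda>x. cnj (f x))"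
  by (auto simp: in_L2_iff L2_sq_def)

text \<open>The continuity of translation in L2, applied to \<open>g\<close>, is all that stands
  behind this limit.\<close>

lemma correlation_tendsto:
  fixes f g :: "real^'n \<Rightarrow> complex"
  assumes f: "in_L2 f" and g: "in_L2 g" and h: "h \<longlonglongrightarrow> 0"
  shows "(\<lambda>k::nat. correlation f g (h k)) \<longlonglongrightarrow> correlation f g 0"
  unfolding correlation_def
proof (rule L2_pairing_tendsto[OF f _ f])
  show "in_L2 (\<lambda>x. cnj (g (x - h k)))" for k
    using in_L2_cnj[OF in_L2_shift[OF g, of "- h k"]] by simp
  show "in_L2 (\<lambda>x. cnj (g (x - 0)))" using in_L2_cnj[OF g] by simp
  show "(\<lambda>k. L2_sq (\<lambda>x. f x - f x)) \<longlonglongrightarrow> 0" by (simp add: L2_sq_def)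
  have "(\<lambda>k. - h k) \<longlonglongrightarrow> 0" using tendsto_minus[OF h] by simp
  then have "(\<lambda>k. L2_sq (\<lambda>x. g (x + - h k) - g x)) \<longlonglongrightarrow> 0"
    using L2_translation_continuous[OF g] unfolding L2_translation_continuous_def by blast
  then show "(\<lambda>k. L2_sq (\<lambda>x. cnj (g (x - h k)) - cnj (g (x - 0)))) \<longlonglongrightarrow> 0"
    by (simp add: L2_sq_def flip: complex_cnj_diff)
qed

lemma correlation_bound:
  fixes f g :: "real^'n \<Rightarrow> complex"
  assumes f: "in_L2 f" and g: "in_L2 g"
  shows "\<exists>B. \<forall>z. norm (correlation f g z) \<le> B"
proof -
  have [measurable]: "f \<in> borel_measurable borel" "g \<in> borel_measurable borel" using f g by (simp_all add: in_L2_iff)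
  have "ennreal ((norm (correlation f g z))\<^sup>2) \<le> ennreal ((L2_norm f)\<^sup>2 * (L2_norm g)\<^sup>2)" for z
  proof -
    have "ennreal ((norm (correlation f g z))\<^sup>2) \<le> L2_sq f * L2_sq (\<lambda>x. cnj (g (x - z)))"
      unfolding correlation_def by (intro L2_Cauchy_Schwarz) measurable
    also have "L2_sq (\<lambda>x. cnj (g (x - z))) = L2_sq (\<lambda>x. g (x + - z))" by (simp add: L2_sq_def)
    also have "\<dots> = L2_sq g" by (rule L2_sq_shift) measurable
    also have "L2_sq f * L2_sq g = ennreal ((L2_norm f)\<^sup>2 * (L2_norm g)\<^sup>2)"
      using f g by (simp add: L2_norm_sq ennreal_mult)
    finally show ?thesis .
  qed
  then have "(norm (correlation f g z))\<^sup>2 \<le> (L2_norm f * L2_norm g)\<^sup>2" for z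
    by (simp add: power_mult_distrib)
  then have "norm (correlation f g z) \<le> L2_norm f * L2_norm g" for z
    using power2_le_imp_le by (metis L2_norm_nonneg mult_nonneg_nonneg)
  then show ?thesis by blast
qed

text \<open>The product of two transforms is not yet known to be integrable, so it is damped by a
  wide Gaussian. The multiplication formula converts the damped integral into an average of the
  correlation against a narrow Gaussian, which tends to the value at 0.\<close>

lemma ft_gauss_regularised:
  fixes f g :: "real^'n \<Rightarrow> complex"
  assumes f: "integrable lborel f" "in_L2 f" and g: "integrable lborel g" "in_L2 g"
  shows "(\<lambda>k. LINT \<xi>|lborel. ft f \<xi> * cnj (ft g \<xi>) * complex_of_real (gauss ((1 / real (Suc k)) *\<^sub>R \<xi>)))
     \<longlonglongrightarrow> complex_of_real (sqrt (2 * pi) ^ CARD('n)) * correlation f g 0"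
proof -
  define e where "e k = 1 / real (Suc k)" for k
  have e: "e k > 0" for k by (simp add: e_def)
  have lim_e: "e \<longlonglongrightarrow> 0" unfolding e_def by (rule LIMSEQ_Suc[OF lim_1_over_n])
  let ?c = "correlation f g"
  have c: "integrable lborel ?c" by (intro integrable_correlation f g)
  then have [measurable]: "?c \<in> borel_measurable borel" by auto
  obtain B where B: "\<And>z. norm (?c z) \<le> B" using correlation_bound[OF f(2) g(2)] by blast
  have eq: "(LINT \<xi>|lborel. ft f \<xi> * cnj (ft g \<xi>) * complex_of_real (gauss (e k *\<^sub>R \<xi>)))
     = complex_of_real (sqrt (2 * pi) ^ CARD('n)) * (LINT z|lborel. ?c (e k *\<^sub>R z) * complex_of_real (gauss z))" for k
  proof -
    have ig: "integrable lborel (\<lambda>\<xi>. complex_of_real (gauss (e k *\<^sub>R \<xi>)))"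
      using integrable_lborel_affine[OF integrable_ft_gauss, of "e k" 0] e[of k] by simp
    have "(LINT \<xi>|lborel. ft f \<xi> * cnj (ft g \<xi>) * complex_of_real (gauss (e k *\<^sub>R \<xi>)))
      = (LINT \<xi>|lborel. ft ?c \<xi> * complex_of_real (gauss (e k *\<^sub>R \<xi>)))"
      by (simp add: ft_correlation f g)
    also have "\<dots> = (LINT z|lborel. ?c z * ft (\<lambda>\<xi>. complex_of_real (gauss (e k *\<^sub>R \<xi>))) z)"
      by (rule ft_multiplication[OF c ig])
    \<comment> \<open>Rescaling by \<open>e k\<close> freezes the Gaussian and moves the parameter
      into the correlation, which is bounded; dominated convergence then applies.\<close>
    also have "\<dots> = (\<bar>e k\<bar> ^ DIM(real^'n)) *\<^sub>R (LINT z|lborel. ?c (0 + e k *\<^sub>R z) *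
         ft (\<lambda>\<xi>. complex_of_real (gauss (e k *\<^sub>R \<xi>))) (0 + e k *\<^sub>R z))"
      using e[of k] by (intro integral_lborel_affine borel_measurable_times ft_measurable ig) auto
    also have "\<dots> = (\<bar>e k\<bar> ^ CARD('n)) *\<^sub>R (LINT z|lborel. complex_of_real (sqrt (2 * pi) ^ CARD('n) / e k ^ CARD('n))
        * (?c (e k *\<^sub>R z) * complex_of_real (gauss z)))"
      using e[of k] by (simp add: ft_gauss_scaled mult_ac)
    also have "\<dots> = complex_of_real (sqrt (2 * pi) ^ CARD('n)) * (LINT z|lborel. ?c (e k *\<^sub>R z) * complex_of_real (gauss z))"
      using e[of k] by (simp add: scaleR_conv_of_real)
    finally show ?thesis .
  qed
  have "(\<lambda>k. LINT z|lborel. ?c (e k *\<^sub>R z) * complex_of_real (gauss z))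
      \<longlonglongrightarrow> (LINT z|lborel. ?c 0 * complex_of_real (gauss (z :: real^'n)))"
  proof (rule integral_dominated_convergence[where w="\<lambda>z. B * gauss z"])
    show "AE x in lborel. (\<lambda>i. ?c (e i *\<^sub>R x) * complex_of_real (gauss x)) \<longlonglongrightarrow> ?c 0 * complex_of_real (gauss x)"
    proof (intro AE_I2 tendsto_mult tendsto_const correlation_tendsto f g)
      fix x :: "real^'n"
      show "(\<lambda>k. e k *\<^sub>R x) \<longlonglongrightarrow> 0" using tendsto_scaleR[OF lim_e tendsto_const[of x]] by simp
    qed
    show "AE x in lborel. norm (?c (e i *\<^sub>R x) * complex_of_real (gauss x)) \<le> B * gauss x" for i
      using B less_imp_le[OF gauss_pos] by (intro AE_I2) (auto simp: norm_mult intro!: mult_right_mono)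
  qed (use integrable_gauss in auto)
  also have "(LINT z|lborel. ?c 0 * complex_of_real (gauss (z :: real^'n))) = ?c 0"
    by (simp add: integral_gauss)
  finally show ?thesis
    unfolding e_def[symmetric] eq by (intro tendsto_mult tendsto_const)
qed

text \<open>For \<open>g = f\<close> the regularised integrand is nonnegative, so Fatou's lemma
  bounds the full integral by the limit of the regularised ones. This precedes Plancherel's
  identity, whose dominated convergence needs an integrable product.\<close>

lemma in_L2_ft:
  fixes f :: "real^'n \<Rightarrow> complex"
  assumes f: "integrable lborel f" "in_L2 f"
  shows "in_L2 (ft f)"
proof -
  have [measurable]: "ft f \<in> borel_measurable borel" by (intro ft_measurable f)
  define e where "e k = 1 / real (Suc k)" for k
  have lim_e: "e \<longlonglongrightarrow> 0" unfolding e_def by (rule LIMSEQ_Suc[OF lim_1_over_n])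
  define F where "F k \<xi> = (norm (ft f \<xi>))\<^sup>2 * gauss (e k *\<^sub>R \<xi>)" for k and \<xi> :: "real^'n"
  have F0: "0 \<le> F k \<xi>" for k \<xi> using gauss_pos[of "e k *\<^sub>R \<xi>"] by (simp add: F_def)
  have [measurable]: "F k \<in> borel_measurable borel" for k unfolding F_def by measurable
  have B: "norm (ft f \<xi>) \<le> (LINT x|lborel. norm (f x))" for \<xi> by (rule ft_bound[OF f(1)])
  have iF: "integrable lborel (F k)" for k
  proof (rule Bochner_Integration.integrable_bound)
    show "integrable lborel (\<lambda>\<xi>::real^'n. (LINT x|lborel. norm (f x))\<^sup>2 * gauss (e k *\<^sub>R \<xi>))"
      using integrable_lborel_affine[OF integrable_gauss, of "e k" 0]
      by (intro integrable_mult_right) (simp add: e_def)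
    show "AE x in lborel. norm (F k x) \<le> norm ((LINT x|lborel. norm (f x))\<^sup>2 * gauss (e k *\<^sub>R x))"
      using B less_imp_le[OF gauss_pos] by (intro AE_I2) (auto simp: F_def abs_mult intro!: mult_right_mono power_mono)
  qed simp
  have "(\<lambda>k. complex_of_real (LINT \<xi>|lborel. F k \<xi>)) \<longlonglongrightarrow> complex_of_real (sqrt (2 * pi) ^ CARD('n)) * correlation f f 0"
    using ft_gauss_regularised[OF f f]
    by (simp add: F_def e_def complex_norm_square[symmetric] flip: of_real_mult of_real_power)
  then have "(\<lambda>k. LINT \<xi>|lborel. F k \<xi>) \<longlonglongrightarrow> Re (complex_of_real (sqrt (2 * pi) ^ CARD('n)) * correlation f f 0)" (is "_ \<longlonglongrightarrow> ?r")
    by (auto dest: tendsto_Re)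
  then have "(\<lambda>k. ennreal (LINT \<xi>|lborel. F k \<xi>)) \<longlonglongrightarrow> ennreal ?r" by (rule tendsto_ennrealI)
  then have lim: "(\<lambda>k. \<integral>\<^sup>+\<xi>. ennreal (F k \<xi>) \<partial>lborel) \<longlonglongrightarrow> ennreal ?r"
    using iF F0 by (simp add: nn_integral_eq_integral)
  have "(\<integral>\<^sup>+\<xi>. ennreal ((norm (ft f \<xi>))\<^sup>2 * gauss (0 :: real^'n)) \<partial>lborel) = (\<integral>\<^sup>+\<xi>. liminf (\<lambda>k. ennreal (F k \<xi>)) \<partial>lborel)"
  proof (intro nn_integral_cong)
    fix \<xi> :: "real^'n"
    have "(\<lambda>k. ennreal (F k \<xi>)) \<longlonglongrightarrow> ennreal ((norm (ft f \<xi>))\<^sup>2 * gauss (0 :: real^'n))"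
      unfolding F_def by (intro tendsto_ennrealI tendsto_mult tendsto_const gauss_scaled_tendsto lim_e)
    then show "ennreal ((norm (ft f \<xi>))\<^sup>2 * gauss (0 :: real^'n)) = liminf (\<lambda>k. ennreal (F k \<xi>))"
      by (simp add: lim_imp_Liminf)
  qed
  also have "\<dots> \<le> liminf (\<lambda>k. \<integral>\<^sup>+\<xi>. ennreal (F k \<xi>) \<partial>lborel)" by (intro nn_integral_liminf) measurable
  also have "\<dots> = ennreal ?r" using lim by (simp add: lim_imp_Liminf)
  finally have "(\<integral>\<^sup>+\<xi>. ennreal ((norm (ft f \<xi>))\<^sup>2 * gauss (0 :: real^'n)) \<partial>lborel) \<le> ennreal ?r" .
  then have le: "ennreal (gauss (0 :: real^'n)) * L2_sq (ft f) \<le> ennreal ?r"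
    using less_imp_le[OF gauss_pos[of "0::real^'n"]]
    by (subst (asm) nn_integral_cong[where v="\<lambda>\<xi>. ennreal (gauss (0 :: real^'n)) * ennreal ((norm (ft f \<xi>))\<^sup>2)"])
      (auto simp: L2_sq_def ennreal_mult' mult.commute nn_integral_cmult)
  have "L2_sq (ft f) < \<infinity>"
  proof (rule ccontr)
    assume "\<not> L2_sq (ft f) < \<infinity>"
    then have "ennreal (gauss (0 :: real^'n)) * L2_sq (ft f) = top"
      using gauss_pos[of "0::real^'n"] by (simp add: less_top[symmetric] ennreal_mult_top)
    then show False using le by (simp add: top_unique)
  qed
  then show ?thesis by (simp add: in_L2_iff)
qed

text \<open>Once the product of the transforms is integrable, dominated convergence gives a second
  value for the limit of the regularised integrals, carrying the factor \<open>gauss 0\<close>.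
  Comparison with the first value yields the constant, because \<open>gauss 0\<close> is the inverse
  of \<open>sqrt (2 * pi) ^ CARD('n)\<close>.\<close>

theorem Plancherel_L1_L2:
  fixes f g :: "real^'n \<Rightarrow> complex"
  assumes f: "integrable lborel f" "in_L2 f" and g: "integrable lborel g" "in_L2 g"
  shows "(LINT \<xi>|lborel. ft f \<xi> * cnj (ft g \<xi>)) = complex_of_real ((2 * pi) ^ CARD('n)) * (LINT x|lborel. f x * cnj (g x))"
proof -
  define e where "e k = 1 / real (Suc k)" for k
  have lim_e: "e \<longlonglongrightarrow> 0" unfolding e_def by (rule LIMSEQ_Suc[OF lim_1_over_n])
  have [measurable]: "ft f \<in> borel_measurable borel" "ft g \<in> borel_measurable borel" by (intro ft_measurable f g)+
  have i: "integrable lborel (\<lambda>\<xi>. ft f \<xi> * cnj (ft g \<xi>))"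
    by (intro L2_prod_integrable in_L2_ft in_L2_cnj f g)
  have "(\<lambda>k. LINT \<xi>|lborel. ft f \<xi> * cnj (ft g \<xi>) * complex_of_real (gauss (e k *\<^sub>R \<xi>)))
     \<longlonglongrightarrow> (LINT \<xi>|lborel. ft f \<xi> * cnj (ft g \<xi>) * complex_of_real (gauss (0 :: real^'n)))"
  proof (rule integral_dominated_convergence[where w="\<lambda>\<xi>. norm (ft f \<xi> * cnj (ft g \<xi>)) * gauss (0 :: real^'n)"])
    show "AE x in lborel. (\<lambda>i. ft f x * cnj (ft g x) * complex_of_real (gauss (e i *\<^sub>R x))) \<longlonglongrightarrow> ft f x * cnj (ft g x) * complex_of_real (gauss (0::real^'n))"
      by (intro AE_I2 tendsto_mult tendsto_const tendsto_of_real gauss_scaled_tendsto lim_e)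
    show "AE x in lborel. norm (ft f x * cnj (ft g x) * complex_of_real (gauss (e i *\<^sub>R x))) \<le> norm (ft f x * cnj (ft g x)) * gauss (0 :: real^'n)" for i
      by (intro AE_I2) (auto simp: norm_mult intro!: mult_left_mono gauss_le)
    show "integrable lborel (\<lambda>\<xi>. norm (ft f \<xi> * cnj (ft g \<xi>)) * gauss (0 :: real^'n))"
      using i by (intro integrable_mult_left integrable_norm)
  qed auto
  from LIMSEQ_unique[OF this ft_gauss_regularised[OF f g, folded e_def]]
  have *: "(LINT \<xi>|lborel. ft f \<xi> * cnj (ft g \<xi>)) * complex_of_real (gauss (0 :: real^'n))
      = complex_of_real (sqrt (2 * pi) ^ CARD('n)) * (LINT x|lborel. f x * cnj (g x))"
    by (simp add: correlation_def)
  have g0: "gauss (0 :: real^'n) * sqrt (2 * pi) ^ CARD('n) = 1"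
    by (simp add: gauss_def flip: power_mult_distrib)
  have "(2 * pi) ^ CARD('n) = sqrt (2 * pi) ^ CARD('n) * sqrt (2 * pi) ^ CARD('n)"
    by (subst power_mult_distrib[symmetric]) simp
  then have "complex_of_real ((2 * pi) ^ CARD('n)) * (LINT x|lborel. f x * cnj (g x))
     = complex_of_real (sqrt (2 * pi) ^ CARD('n)) * ((LINT \<xi>|lborel. ft f \<xi> * cnj (ft g \<xi>)) * complex_of_real (gauss (0 :: real^'n)))"
    unfolding * by simp
  also have "\<dots> = (LINT \<xi>|lborel. ft f \<xi> * cnj (ft g \<xi>)) * complex_of_real (gauss (0 :: real^'n) * sqrt (2 * pi) ^ CARD('n))"
    by (simp add: mult_ac)
  finally show ?thesis unfolding g0 by simp
qed

lemma L2_sq_integral: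
  fixes f :: "real^'n \<Rightarrow> complex"
  assumes "in_L2 f" shows "L2_sq f = ennreal (Re (LINT x|lborel. f x * cnj (f x)))"
proof -
  have "(LINT x|lborel. f x * cnj (f x)) = complex_of_real (LINT x|lborel. (norm (f x))\<^sup>2)"
    by (simp add: complex_norm_square[symmetric] del: of_real_power)
  then show ?thesis using assms by (simp add: L2_norm_sq[symmetric] L2_norm_def)
qed

lemma L2_sq_ft:
  fixes f :: "real^'n \<Rightarrow> complex"
  assumes f: "integrable lborel f" "in_L2 f"
  shows "L2_sq (ft f) = ennreal ((2 * pi) ^ CARD('n)) * L2_sq f"
  unfolding L2_sq_integral[OF in_L2_ft[OF f]] L2_sq_integral[OF f(2)] Plancherel_L1_L2[OF f f]
  by (subst ennreal_mult'[symmetric]) (auto simp del: of_real_power)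

subsection \<open>The Fourier transform on square-integrable functions\<close>

definition fourier_L2 :: "(real^'n \<Rightarrow> complex) \<Rightarrow> (real^'n \<Rightarrow> complex) \<Rightarrow> bool" where
  "fourier_L2 f V \<longleftrightarrow> in_L2 f \<and> in_L2 V \<and>
     (\<exists>g. (\<forall>k::nat. integrable lborel (g k) \<and> in_L2 (g k)) \<and>
          (\<lambda>k. L2_sq (\<lambda>x. g k x - f x)) \<longlonglongrightarrow> 0 \<and> (\<lambda>k. L2_sq (\<lambda>\<xi>. ft (g k) \<xi> - V \<xi>)) \<longlonglongrightarrow> 0)"

lemma fourier_L2_L1:
  assumes "integrable lborel f" "in_L2 f" shows "fourier_L2 f (ft f)"
  unfolding fourier_L2_def
  using assms by (auto intro!: exI[of _ "\<lambda>_. f"] in_L2_ft simp: L2_sq_def)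

theorem Plancherel_L2:
  fixes f g :: "real^'n \<Rightarrow> complex"
  assumes "fourier_L2 f V" "fourier_L2 g W"
  shows "(LINT \<xi>|lborel. V \<xi> * cnj (W \<xi>)) = complex_of_real ((2 * pi) ^ CARD('n)) * (LINT x|lborel. f x * cnj (g x))"
proof -
  from assms obtain F G where F: "\<And>k::nat. integrable lborel (F k)" "\<And>k. in_L2 (F k)"
      "(\<lambda>k. L2_sq (\<lambda>x. F k x - f x)) \<longlonglongrightarrow> 0" "(\<lambda>k. L2_sq (\<lambda>\<xi>. ft (F k) \<xi> - V \<xi>)) \<longlonglongrightarrow> 0"
    and G: "\<And>k::nat. integrable lborel (G k)" "\<And>k. in_L2 (G k)"
      "(\<lambda>k. L2_sq (\<lambda>x. G k x - g x)) \<longlonglongrightarrow> 0" "(\<lambda>k. L2_sq (\<lambda>\<xi>. ft (G k) \<xi> - W \<xi>)) \<longlonglongrightarrow> 0"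
    and L: "in_L2 f" "in_L2 V" "in_L2 g" "in_L2 W"
    unfolding fourier_L2_def by blast
  have cnj_lim: "(\<lambda>k. L2_sq (\<lambda>x. cnj (A k x) - cnj (B x))) \<longlonglongrightarrow> 0" if "(\<lambda>k. L2_sq (\<lambda>x. A k x - B x)) \<longlonglongrightarrow> 0"
    for A :: "nat \<Rightarrow> real^'n \<Rightarrow> complex" and B
    using that by (simp add: L2_sq_def flip: complex_cnj_diff)
  have "(\<lambda>k. LINT x|lborel. F k x * cnj (G k x)) \<longlonglongrightarrow> (LINT x|lborel. f x * cnj (g x))"
    by (rule L2_pairing_tendsto[OF F(2) in_L2_cnj[OF G(2)] L(1) in_L2_cnj[OF L(3)] F(3) cnj_lim[OF G(3)]])
  then have "(\<lambda>k. complex_of_real ((2 * pi) ^ CARD('n)) * (LINT x|lborel. F k x * cnj (G k x)))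
      \<longlonglongrightarrow> complex_of_real ((2 * pi) ^ CARD('n)) * (LINT x|lborel. f x * cnj (g x))"
    by (intro tendsto_mult tendsto_const)
  then have "(\<lambda>k. LINT x|lborel. ft (F k) x * cnj (ft (G k) x))
      \<longlonglongrightarrow> complex_of_real ((2 * pi) ^ CARD('n)) * (LINT x|lborel. f x * cnj (g x))"
    unfolding Plancherel_L1_L2[OF F(1,2) G(1,2)] .
  moreover have "(\<lambda>k. LINT x|lborel. ft (F k) x * cnj (ft (G k) x)) \<longlonglongrightarrow> (LINT x|lborel. V x * cnj (W x))"
    by (rule L2_pairing_tendsto[OF in_L2_ft[OF F(1,2)] in_L2_cnj[OF in_L2_ft[OF G(1,2)]] L(2) in_L2_cnj[OF L(4)] F(4) cnj_lim[OF G(4)]])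
  ultimately show ?thesis by (rule LIMSEQ_unique[rotated])
qed

lemma L2_sq_fourier_L2:
  fixes f :: "real^'n \<Rightarrow> complex"
  assumes f: "fourier_L2 f V"
  shows "L2_sq V = ennreal ((2 * pi) ^ CARD('n)) * L2_sq f"
proof -
  have L: "in_L2 f" "in_L2 V" using f by (auto simp: fourier_L2_def)
  show ?thesis
    unfolding L2_sq_integral[OF L(1)] L2_sq_integral[OF L(2)] Plancherel_L2[OF f f]
    by (subst ennreal_mult'[symmetric]) (auto simp del: of_real_power)
qed

text \<open>Plancherel's theorem makes the transforms of the truncations a Cauchy sequence, and
  completeness supplies the limit.\<close>

lemma fourier_L2_exists:
  fixes f :: "real^'n \<Rightarrow> complex"
  assumes f: "in_L2 f" shows "\<exists>V. fourier_L2 f V"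
proof -
  define g where "g k x = indicator (cball 0 (real k)) x *\<^sub>R f x" for k x
  have g: "integrable lborel (g k)" "in_L2 (g k)" for k
    unfolding g_def by (intro integrable_truncate in_L2_truncate f; simp)+
  have [measurable]: "f \<in> borel_measurable borel" "\<And>k. g k \<in> borel_measurable borel"
    using f g(2) by (auto simp: in_L2_iff)
  have lim: "(\<lambda>k. L2_sq (\<lambda>x. g k x - f x)) \<longlonglongrightarrow> 0"
    using filterlim_compose[OF L2_truncate[OF f] filterlim_real_sequentially] by (simp add: g_def)
  define \<kappa> where "\<kappa> = ennreal ((2 * pi) ^ CARD('n))"
  have "\<exists>V. in_L2 V \<and> (\<lambda>k. L2_sq (\<lambda>x. ft (g k) x - V x)) \<longlonglongrightarrow> 0"
  proof (rule L2_complete)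
    show "in_L2 (ft (g k))" for k by (intro in_L2_ft g)
    fix e :: real assume e: "e > 0"
    have "(\<lambda>k. \<kappa> * L2_sq (\<lambda>x. g k x - f x)) \<longlonglongrightarrow> 0"
      by (intro tendsto_0_ennreal_cmult lim) (simp add: \<kappa>_def)
    then have "eventually (\<lambda>k. \<kappa> * L2_sq (\<lambda>x. g k x - f x) < ennreal (e/4)) sequentially"
      by (rule order_tendstoD) (use e in simp)
    then obtain N where N: "\<And>k. k \<ge> N \<Longrightarrow> \<kappa> * L2_sq (\<lambda>x. g k x - f x) < ennreal (e/4)"
      by (auto simp: eventually_sequentially)
    show "\<exists>N. \<forall>k\<ge>N. \<forall>l\<ge>N. L2_sq (\<lambda>x. ft (g k) x - ft (g l) x) \<le> ennreal e"
    proof (intro exI allI impI)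
      fix k l assume kl: "k \<ge> N" "l \<ge> N"
      have "L2_sq (\<lambda>x. ft (g k) x - ft (g l) x) = L2_sq (ft (\<lambda>x. g k x - g l x))"
        using ft_diff[OF g(1) g(1)] by (intro arg_cong[where f=L2_sq] ext) simp
      also have "\<dots> = \<kappa> * L2_sq (\<lambda>x. g k x - g l x)"
        unfolding \<kappa>_def by (intro L2_sq_ft in_L2_diff g Bochner_Integration.integrable_diff)
      also have "\<dots> \<le> \<kappa> * (2 * L2_sq (\<lambda>x. g k x - f x) + 2 * L2_sq (\<lambda>x. g l x - f x))"
        using L2_sq_diff_le[of "\<lambda>x. g k x - f x" "\<lambda>x. g l x - f x"] by (intro mult_left_mono) auto
      also have "\<dots> = 2 * (\<kappa> * L2_sq (\<lambda>x. g k x - f x)) + 2 * (\<kappa> * L2_sq (\<lambda>x. g l x - f x))"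
        by (simp add: distrib_left mult_ac)
      also have "\<dots> \<le> 2 * ennreal (e/4) + 2 * ennreal (e/4)"
        using N kl by (intro add_mono mult_left_mono less_imp_le) auto
      also have "\<dots> = ennreal e"
      proof -
        have "2 * ennreal (e/4) = ennreal (2 * (e/4))" using \<open>e > 0\<close> by (subst ennreal_numeral[symmetric], subst ennreal_mult[symmetric]) auto
        then show ?thesis using \<open>e > 0\<close> by (simp flip: ennreal_plus)
      qed
      finally show "L2_sq (\<lambda>x. ft (g k) x - ft (g l) x) \<le> ennreal e" .
    qed
  qed
  then show ?thesis using f g lim unfolding fourier_L2_def by blast
qed

text \<open>The multiplication formula survives the L2 limit in one factor; this identifies the
  inverse transform when it is paired with test functions.\<close>

lemma fourier_L2_multiplication:
  fixes g V :: "real^'n \<Rightarrow> complex"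
  assumes V: "fourier_L2 V W" and g: "integrable lborel g" "in_L2 g"
  shows "(LINT \<xi>|lborel. ft g \<xi> * V \<xi>) = (LINT x|lborel. g x * W x)"
proof -
  from V obtain F where F: "\<And>k::nat. integrable lborel (F k)" "\<And>k. in_L2 (F k)"
      "(\<lambda>k. L2_sq (\<lambda>x. F k x - V x)) \<longlonglongrightarrow> 0" "(\<lambda>k. L2_sq (\<lambda>\<xi>. ft (F k) \<xi> - W \<xi>)) \<longlonglongrightarrow> 0"
    and L: "in_L2 V" "in_L2 W"
    unfolding fourier_L2_def by blast
  have "(\<lambda>k. LINT \<xi>|lborel. ft g \<xi> * F k \<xi>) \<longlonglongrightarrow> (LINT \<xi>|lborel. ft g \<xi> * V \<xi>)"
    by (rule L2_pairing_tendsto[OF in_L2_ft[OF g] F(2) in_L2_ft[OF g] L(1) _ F(3)]) (simp add: L2_sq_def)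
  then have "(\<lambda>k. LINT x|lborel. g x * ft (F k) x) \<longlonglongrightarrow> (LINT \<xi>|lborel. ft g \<xi> * V \<xi>)"
    unfolding ft_multiplication[OF g(1) F(1)] .
  moreover have "(\<lambda>k. LINT x|lborel. g x * ft (F k) x) \<longlonglongrightarrow> (LINT x|lborel. g x * W x)"
    by (rule L2_pairing_tendsto[OF g(2) in_L2_ft[OF F(1,2)] g(2) L(2) _ F(4)]) (simp add: L2_sq_def)
  ultimately show ?thesis by (rule LIMSEQ_unique)
qed

section \<open>Test functions\<close>

text \<open>The index \<open>m\<close> makes the family closed under differentiation: the derivative
  of a member is a linear combination of the members with index \<open>m + 2\<close> and
  \<open>m + 1\<close>. Smoothness at 0 is thus settled for all orders by one first-order
  argument.\<close>

definition bump_profile :: "nat \<Rightarrow> real \<Rightarrow> real" where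
  "bump_profile m t = (if t > 0 then exp (- (1 / t)) / t ^ m else 0)"

lemma bump_profile_nonneg: "0 \<le> bump_profile m t"
  by (simp add: bump_profile_def)

text \<open>A single term of the exponential series bounds \<open>exp (1 / t)\<close> below by
  \<open>(1 / t) ^ (m + 2) / fact (m + 2)\<close>. Quadratic vanishing is what gives the derivative
  0 at the origin, for every \<open>m\<close>.\<close>

lemma bump_profile_small:
  assumes "t > 0" shows "bump_profile m t \<le> fact (m + 2) * t\<^sup>2"
proof -
  define F :: real where "F = fact (m + 2)"
  have F: "F > 0" by (simp add: F_def)
  have "(1 / t) ^ (m + 2) / F \<le> exp (1 / t)"
    using sum_le_suminf[OF summable_exp_generic[of "1/t"], of "{m+2}"] assms
    by (simp add: exp_def divide_inverse_commute F_def del: fact_Suc add_2_eq_Suc')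
  then have "1 \<le> F * t\<^sup>2 * (exp (1 / t) * t ^ m)"
    using assms F by (simp add: field_simps power_add power2_eq_square)
  then show ?thesis unfolding F_def[symmetric]
    using assms F by (simp add: bump_profile_def exp_minus field_simps)
qed

lemma bump_profile_deriv:
  "(bump_profile m has_real_derivative bump_profile (m + 2) t - real m * bump_profile (m + 1) t) (at t)"
proof -
  consider "t > 0" | "t < 0" | "t = 0" by linarith
  then show ?thesis
  proof cases
    case 1
    have "((\<lambda>t. exp (- (1 / t)) / t ^ m) has_real_derivative bump_profile (m + 2) t - real m * bump_profile (m + 1) t) (at t)"
    proof -
      have E: "((\<lambda>t. exp (- (1 / t))) has_real_derivative exp (- (1 / t)) / t\<^sup>2) (at t)"
        using 1 by (auto intro!: derivative_eq_intros simp: power2_eq_square)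
      show ?thesis
        by (rule DERIV_cong[OF DERIV_divide[OF E DERIV_pow]], use 1 in simp)
          (use 1 in \<open>cases m; simp add: bump_profile_def field_simps power2_eq_square\<close>)
    qed
    then show ?thesis
    proof (rule DERIV_cong_ev[THEN iffD1, rotated -1])
      have "eventually (\<lambda>x. x \<in> {0<..}) (nhds t)" using 1 by (intro eventually_nhds_in_open) auto
      then show "eventually (\<lambda>x. exp (- (1 / x)) / x ^ m = bump_profile m x) (nhds t)"
        by eventually_elim (simp add: bump_profile_def)
    qed auto
  next
    case 2
    have "((\<lambda>_. 0) has_real_derivative bump_profile (m + 2) t - real m * bump_profile (m + 1) t) (at t)"
      using 2 by (simp add: bump_profile_def)
    then show ?thesis
    proof (rule DERIV_cong_ev[THEN iffD1, rotated -1])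
      have "eventually (\<lambda>x. x \<in> {..<0}) (nhds t)" using 2 by (intro eventually_nhds_in_open) auto
      then show "eventually (\<lambda>x. 0 = bump_profile m x) (nhds t)"
        by eventually_elim (simp add: bump_profile_def)
    qed auto
  next
    case 3
    have "((\<lambda>s. (bump_profile m s - bump_profile m 0) / (s - 0)) \<longlongrightarrow> 0) (at 0)"
    proof (rule Lim_null_comparison)
      show "\<forall>\<^sub>F s in at 0. norm ((bump_profile m s - bump_profile m 0) / (s - 0)) \<le> fact (m + 2) * \<bar>s\<bar>"
      proof (rule always_eventually, rule allI)
        fix s :: real
        show "norm ((bump_profile m s - bump_profile m 0) / (s - 0)) \<le> fact (m + 2) * \<bar>s\<bar>"
        proof (cases "s > 0")
          case True
          then show ?thesis using bump_profile_small[OF True, of m] bump_profile_nonneg[of m s]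
            by (simp add: bump_profile_def field_simps power2_eq_square)
        next
          case False
          have "0 \<le> fact (m + 2) * \<bar>s\<bar>" by (intro mult_nonneg_nonneg) auto
          moreover have "(bump_profile m s - bump_profile m 0) / (s - 0) = 0" using False by (simp add: bump_profile_def)
          ultimately show ?thesis by (simp only: norm_zero)
        qed
      qed
      show "((\<lambda>s::real. fact (m + 2) * \<bar>s\<bar>) \<longlongrightarrow> 0) (at 0)"
        by (auto intro!: tendsto_eq_intros)
    qed
    then show ?thesis using 3 by (simp add: has_field_derivative_iff bump_profile_def)
  qed
qed

text \<open>A class of explicit functions closed under directional derivatives, large enough for the
  cut-offs and for their products with cosines and sines. Smoothness of its members then needs no
  separate computation.\<close>

inductive_set smooth_alg :: "(real^'n \<Rightarrow> real) set" where
  const: "(\<lambda>x. c) \<in> smooth_alg"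
| linear: "(\<lambda>x. x \<bullet> a) \<in> smooth_alg"
| cos: "(\<lambda>x. cos (x \<bullet> a)) \<in> smooth_alg"
| sin: "(\<lambda>x. sin (x \<bullet> a)) \<in> smooth_alg"
| bump: "(\<lambda>x. bump_profile m (1 - d\<^sup>2 * ((x - a) \<bullet> (x - a)))) \<in> smooth_alg"
| add: "f \<in> smooth_alg \<Longrightarrow> g \<in> smooth_alg \<Longrightarrow> (\<lambda>x. f x + g x) \<in> smooth_alg"
| mult: "f \<in> smooth_alg \<Longrightarrow> g \<in> smooth_alg \<Longrightarrow> (\<lambda>x. f x * g x) \<in> smooth_alg"

lemma smooth_alg_deriv:
  "f \<in> smooth_alg \<Longrightarrow> \<exists>D. (\<forall>x. (f has_derivative D x) (at x)) \<and> (\<forall>v. (\<lambda>x. D x v) \<in> smooth_alg)"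
proof (induction rule: smooth_alg.induct)
  case (const c)
  show ?case by (rule exI[of _ "\<lambda>x v. 0"]) (auto intro: smooth_alg.const)
next
  case (linear a)
  show ?case by (rule exI[of _ "\<lambda>x v. v \<bullet> a"]) (auto intro!: smooth_alg.const derivative_eq_intros)
next
  case (cos a)
  show ?case
  proof (rule exI[of _ "\<lambda>x v. (- (v \<bullet> a)) * sin (x \<bullet> a)"], safe)
    show "((\<lambda>x. cos (x \<bullet> a)) has_derivative (\<lambda>v. - (v \<bullet> a) * sin (x \<bullet> a))) (at x)" for x
      by (auto intro!: derivative_eq_intros)
  qed (intro smooth_alg.intros)
next
  case (sin a)
  show ?case
  proof (rule exI[of _ "\<lambda>x v. (v \<bullet> a) * cos (x \<bullet> a)"], safe)
    show "((\<lambda>x. sin (x \<bullet> a)) has_derivative (\<lambda>v. (v \<bullet> a) * cos (x \<bullet> a))) (at x)" for x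
      by (auto intro!: derivative_eq_intros)
  qed (intro smooth_alg.intros)
next
  case (bump m d a)
  let ?q = "\<lambda>x. 1 - d\<^sup>2 * ((x - a) \<bullet> (x - a))"
  \<comment> \<open>The derivative is written as a polynomial in \<open>x \<bullet> v\<close>,
    constants and bump profiles, so that the introduction rules of \<open>smooth_alg\<close> apply
    to it directly.\<close>
  let ?D = "\<lambda>x v. (bump_profile (m + 2) (?q x) + (- real m) * bump_profile (m + 1) (?q x)) * ((x \<bullet> v) * (- 2 * d\<^sup>2) + 2 * d\<^sup>2 * (a \<bullet> v))"
  show ?case
  proof (rule exI[of _ ?D], safe)
    fix x
    have q: "(?q has_derivative (\<lambda>v. - d\<^sup>2 * (2 * ((x - a) \<bullet> v)))) (at x)"
      by (auto intro!: derivative_eq_intros simp: inner_commute)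
    have "((\<lambda>x. bump_profile m (?q x)) has_derivative
       (\<lambda>v. (- d\<^sup>2 * (2 * ((x - a) \<bullet> v))) * (bump_profile (m + 2) (?q x) - real m * bump_profile (m + 1) (?q x)))) (at x)"
      using has_derivative_compose[OF q bump_profile_deriv[unfolded has_field_derivative_def]]
      by (simp add: mult.commute)
    then show "((\<lambda>x. bump_profile m (?q x)) has_derivative ?D x) (at x)"
      by (rule has_derivative_eq_rhs) (auto simp: algebra_simps inner_diff_left)
  qed (intro smooth_alg.intros)
next
  case (add f g)
  then obtain D E where D: "\<And>x. (f has_derivative D x) (at x)" "\<And>v. (\<lambda>x. D x v) \<in> smooth_alg"
    and E: "\<And>x. (g has_derivative E x) (at x)" "\<And>v. (\<lambda>x. E x v) \<in> smooth_alg" by blast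
  then show ?case
    by (intro exI[of _ "\<lambda>x v. D x v + E x v"]) (auto intro!: has_derivative_add smooth_alg.add)
next
  case (mult f g)
  then obtain D E where D: "\<And>x. (f has_derivative D x) (at x)" "\<And>v. (\<lambda>x. D x v) \<in> smooth_alg"
    and E: "\<And>x. (g has_derivative E x) (at x)" "\<And>v. (\<lambda>x. E x v) \<in> smooth_alg" by blast
  then show ?case using mult.hyps
    by (intro exI[of _ "\<lambda>x v. f x * E x v + D x v * g x"])
      (auto intro!: has_derivative_mult smooth_alg.add smooth_alg.mult)
qed

text \<open>Closure under directional derivatives lets the induction on the order run with the
  function left arbitrary.\<close>

lemma smooth_alg_smooth:
  fixes f :: "real^'n \<Rightarrow> real"
  assumes "f \<in> smooth_alg" shows "smooth_on UNIV f"
proof -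
  have "Ck_on UNIV f k" if "f \<in> smooth_alg" for k and f :: "real^'n \<Rightarrow> real"
    using that
  proof (induction k arbitrary: f)
    case 0
    obtain D where "\<And>x. (f has_derivative D x) (at x)" using smooth_alg_deriv[OF 0] by blast
    then show ?case by (auto intro!: has_derivative_continuous_on)
  next
    case (Suc k)
    obtain D where D: "\<And>x. (f has_derivative D x) (at x)" "\<And>v. (\<lambda>x. D x v) \<in> smooth_alg"
      using smooth_alg_deriv[OF Suc.prems] by blast
    have "frechet_derivative f (at x) = D x" for x
      using frechet_derivative_at[OF D(1)] by simp
    then show ?case using Suc.IH[OF D(2)] D(1) by (auto simp: differentiable_def)
  qed
  with assms show ?thesis by (simp add: smooth_on_def)
qed

text \<open>\<open>d\<close> is the inverse of the radius, so wide cut-offs correspond to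
  \<open>d\<close> tending to 0.\<close>

definition bump :: "real \<Rightarrow> real^'n \<Rightarrow> real^'n \<Rightarrow> real" where
  "bump d a x = bump_profile 0 (1 - d\<^sup>2 * ((x - a) \<bullet> (x - a)))"

lemma bump_pos_iff: "d > 0 \<Longrightarrow> bump d a x > 0 \<longleftrightarrow> norm (x - a) < 1 / d"
  and bump_eq_0_iff: "d > 0 \<Longrightarrow> bump d a x = 0 \<longleftrightarrow> norm (x - a) \<ge> 1 / d"
proof -
  assume d: "d > 0"
  have "1 - d\<^sup>2 * ((x - a) \<bullet> (x - a)) > 0 \<longleftrightarrow> (d * norm (x - a))\<^sup>2 < 1\<^sup>2"
    by (simp add: power2_norm_eq_inner power_mult_distrib)
  also have "\<dots> \<longleftrightarrow> d * norm (x - a) < 1"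
    using d abs_square_less_1[of "d * norm (x - a)"] by (simp add: abs_mult)
  also have "\<dots> \<longleftrightarrow> norm (x - a) < 1 / d" using d by (simp add: field_simps)
  finally have *: "1 - d\<^sup>2 * ((x - a) \<bullet> (x - a)) > 0 \<longleftrightarrow> norm (x - a) < 1 / d" .
  show "bump d a x > 0 \<longleftrightarrow> norm (x - a) < 1 / d" "bump d a x = 0 \<longleftrightarrow> norm (x - a) \<ge> 1 / d"
    unfolding bump_def bump_profile_def * by auto
qed

lemma bump_nonneg: "0 \<le> bump d a x" by (simp add: bump_def bump_profile_nonneg)

lemma test_function_mult_bump:
  assumes f: "f \<in> smooth_alg" and d: "d > 0"
  shows "test_function (\<lambda>x. f x * bump d a x)"
proof -
  have "(\<lambda>x. f x * bump d a x) \<in> smooth_alg"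
    unfolding bump_def by (intro smooth_alg.mult smooth_alg.bump f)
  moreover have "{x. f x * bump d a x \<noteq> 0} \<subseteq> cball a (1 / d)"
    by (clarsimp simp: bump_eq_0_iff[OF d] dist_norm) (simp add: norm_minus_commute)
  then have "bounded {x. f x * bump d a x \<noteq> 0}" by (rule bounded_subset[OF bounded_cball])
  ultimately show ?thesis by (simp add: test_function_def smooth_alg_smooth)
qed

lemma test_function_bump: "d > 0 \<Longrightarrow> test_function (bump d a)"
  using test_function_mult_bump[OF smooth_alg.const[of 1]] by simp

section \<open>General test functions: derivatives, supports, transforms\<close>

lemma test_function_deriv:
  assumes "test_function \<phi>"
  shows "(\<phi> has_derivative frechet_derivative \<phi> (at x)) (at x)"
proof -
  have "Ck_on UNIV \<phi> (Suc 0)" using assms by (simp add: test_function_def smooth_on_def del: Ck_on.simps)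
  then show ?thesis by (simp add: frechet_derivative_works)
qed

lemma test_function_continuous: "test_function \<phi> \<Longrightarrow> continuous_on UNIV \<phi>"
  unfolding test_function_def smooth_on_def by (metis Ck_on.simps(1))

text \<open>Off the closed support the function vanishes locally, hence so does its derivative; the
  support cannot grow.\<close>

lemma test_function_frechet:
  assumes t: "test_function \<phi>"
  shows "test_function (\<lambda>x. frechet_derivative \<phi> (at x) v)"
proof -
  have "Ck_on UNIV (\<lambda>x. frechet_derivative \<phi> (at x) v) k" for k
  proof -
    have "Ck_on UNIV \<phi> (Suc k)" using t by (simp add: test_function_def smooth_on_def del: Ck_on.simps)
    then show ?thesis by simp
  qed
  moreover have "frechet_derivative \<phi> (at x) v = 0" if "x \<notin> closure {x. \<phi> x \<noteq> 0}" for x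
  proof -
    have "((\<lambda>_. 0) has_derivative (\<lambda>_. 0)) (at x)" by simp
    then have "(\<phi> has_derivative (\<lambda>_. 0)) (at x)"
    proof (rule has_derivative_transform_within_open[of _ _ _ _ "- closure {x. \<phi> x \<noteq> 0}"])
      show "0 = \<phi> y" if "y \<in> - closure {x. \<phi> x \<noteq> 0}" for y
        using that closure_subset[of "{x. \<phi> x \<noteq> 0}"] by auto
    qed (use that in auto)
    from frechet_derivative_at[OF this] show ?thesis by metis
  qed
  then have "{x. frechet_derivative \<phi> (at x) v \<noteq> 0} \<subseteq> closure {x. \<phi> x \<noteq> 0}" by blast
  then have "closure {x. frechet_derivative \<phi> (at x) v \<noteq> 0} \<subseteq> closure {x. \<phi> x \<noteq> 0}"
    by (rule closure_minimal) simp
  then have "compact (closure {x. frechet_derivative \<phi> (at x) v \<noteq> 0})"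
    using t bounded_subset unfolding test_function_def compact_eq_bounded_closed by blast
  ultimately show ?thesis by (simp add: test_function_def smooth_on_def)
qed

lemma test_function_partials: "test_function \<phi> \<Longrightarrow> test_function (partials js \<phi>)"
  by (induction js) (auto intro: test_function_frechet)

lemma test_function_bounded_support:
  assumes t: "test_function \<phi>"
  shows "\<exists>B r. r > 0 \<and> B > 0 \<and> (\<forall>x. \<bar>\<phi> x\<bar> \<le> B) \<and> (\<forall>x. \<phi> x \<noteq> 0 \<longrightarrow> norm x \<le> r)"
proof -
  have c: "compact (closure {x. \<phi> x \<noteq> 0})" using t by (simp add: test_function_def)
  obtain r where r: "r > 0" "\<And>x. x \<in> closure {x. \<phi> x \<noteq> 0} \<Longrightarrow> norm x \<le> r"
    using compact_imp_bounded[OF c] unfolding bounded_pos by blast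
  have "compact (\<phi> ` closure {x. \<phi> x \<noteq> 0})"
    by (intro compact_continuous_image continuous_on_subset[OF test_function_continuous[OF t]] c) auto
  from compact_imp_bounded[OF this] obtain B
    where "B > 0" "\<forall>y\<in>\<phi> ` closure {x. \<phi> x \<noteq> 0}. norm y \<le> B" unfolding bounded_pos by blast
  then have B: "B > 0" "\<And>x. x \<in> closure {x. \<phi> x \<noteq> 0} \<Longrightarrow> \<bar>\<phi> x\<bar> \<le> B" by auto
  show ?thesis
  proof (rule exI[of _ B], rule exI[of _ r], intro conjI allI impI r(1) B(1))
    show "\<bar>\<phi> x\<bar> \<le> B" for x
      using B closure_subset[of "{x. \<phi> x \<noteq> 0}"] by (cases "\<phi> x = 0") auto
    show "norm x \<le> r" if "\<phi> x \<noteq> 0" for x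
      using r closure_subset[of "{x. \<phi> x \<noteq> 0}"] that by auto
  qed
qed

lemma test_function_measurable: "test_function \<phi> \<Longrightarrow> \<phi> \<in> borel_measurable borel"
  by (intro borel_measurable_continuous_onI test_function_continuous)

lemma integrable_bounded_support:
  fixes f :: "real^'n \<Rightarrow> 'b::euclidean_space"
  assumes [measurable]: "f \<in> borel_measurable borel" and B: "\<And>x. norm (f x) \<le> B" and r: "\<And>x. f x \<noteq> 0 \<Longrightarrow> norm x \<le> r"
  shows "integrable lborel f" "in_L2 f"
proof -
  have i: "integrable lborel (\<lambda>x::real^'n. indicator (cball 0 r) x *\<^sub>R c)" for c :: real
    using emeasure_lborel_cball_finite[of 0 r] by (intro integrable_scaleR_left integrable_real_indicator) auto
  show "integrable lborel f"
    using r B order_trans[OF norm_ge_zero B]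
    by (intro Bochner_Integration.integrable_bound[OF i[of B]] AE_I2) (auto simp: indicator_def)
  have "integrable lborel (\<lambda>x. (norm (f x))\<^sup>2)"
    using r B order_trans[OF norm_ge_zero B]
    by (intro Bochner_Integration.integrable_bound[OF i[of "B\<^sup>2"]] AE_I2) (auto simp: indicator_def intro!: power_mono)
  then show "in_L2 f" by (simp add: in_L2_def)
qed

lemma
  assumes "test_function \<phi>"
  shows test_function_integrable: "integrable lborel (\<lambda>x. complex_of_real (\<phi> x))"
    and test_function_in_L2: "in_L2 (\<lambda>x. complex_of_real (\<phi> x))"
proof -
  obtain B r where *: "r > 0" "B > 0" "\<And>x. \<bar>\<phi> x\<bar> \<le> B" "\<And>x. \<phi> x \<noteq> 0 \<Longrightarrow> norm x \<le> r"
    using test_function_bounded_support[OF assms] by blast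
  note [measurable] = test_function_measurable[OF assms]
  show "integrable lborel (\<lambda>x. complex_of_real (\<phi> x))" "in_L2 (\<lambda>x. complex_of_real (\<phi> x))"
    by (rule integrable_bounded_support[where B=B and r=r]; use * in simp)+
qed

text \<open>Integration by parts: both sides are limits of the transforms of difference quotients.\<close>

lemma ft_partial:
  assumes t: "test_function \<phi>"
  shows "ft (\<lambda>x. complex_of_real (partials [j] \<phi> x)) \<xi> = \<i> * complex_of_real (\<xi> $ j) * ft (\<lambda>x. complex_of_real (\<phi> x)) \<xi>"
proof -
  define e :: "real^'a" where "e = axis j 1"
  define \<psi> where "\<psi> = partials [j] \<phi>"
  have \<psi>: "test_function \<psi>" unfolding \<psi>_def by (intro test_function_partials t)
  have norm_e: "norm e = 1" by (simp add: e_def)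
  obtain B r where B: "r > 0" "B > 0" "\<And>x. \<bar>\<psi> x\<bar> \<le> B" "\<And>x. \<psi> x \<noteq> 0 \<Longrightarrow> norm x \<le> r"
    using test_function_bounded_support[OF \<psi>] by blast
  obtain B' r' where B': "r' > 0" "B' > 0" "\<And>x. \<bar>\<phi> x\<bar> \<le> B'" "\<And>x. \<phi> x \<noteq> 0 \<Longrightarrow> norm x \<le> r'"
    using test_function_bounded_support[OF t] by blast
  define h where "h k = 1 / real (Suc k)" for k
  have h: "h k > 0" "h k \<le> 1" for k by (auto simp: h_def)
  have h_ne: "h k \<noteq> 0" for k by (simp add: h_def)
  have h0: "h \<longlonglongrightarrow> 0" unfolding h_def by (rule LIMSEQ_Suc[OF lim_1_over_n])
  define F where "F k x = complex_of_real ((\<phi> (x + h k *\<^sub>R e) - \<phi> x) / h k)" for k x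
  note [measurable] = test_function_measurable[OF t] test_function_measurable[OF \<psi>]
  have line: "((\<lambda>s. \<phi> (x + s *\<^sub>R e)) has_real_derivative \<psi> (x + s *\<^sub>R e)) (at s)" for x s
  proof -
    have "((\<lambda>s. x + s *\<^sub>R e) has_derivative (\<lambda>s. s *\<^sub>R e)) (at s)"
      by (auto intro!: derivative_eq_intros)
    from has_derivative_compose[OF this test_function_deriv[OF t]]
    have "((\<lambda>s. \<phi> (x + s *\<^sub>R e)) has_derivative (\<lambda>s'. frechet_derivative \<phi> (at (x + s *\<^sub>R e)) (s' *\<^sub>R e))) (at s)" .
    moreover have "frechet_derivative \<phi> (at (x + s *\<^sub>R e)) (s' *\<^sub>R e) = \<psi> (x + s *\<^sub>R e) * s'" for s'
      using linear_frechet_derivative[of \<phi> "at (x + s *\<^sub>R e)"] test_function_deriv[OF t, of "x + s *\<^sub>R e"]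
      by (simp add: linear_cmul differentiable_def \<psi>_def e_def mult.commute exI)
    ultimately show ?thesis by (simp add: has_field_derivative_def)
  qed
  have lim1: "(\<lambda>k. ft (F k) \<xi>) \<longlonglongrightarrow> ft (\<lambda>x. complex_of_real (\<psi> x)) \<xi>"
    unfolding ft_def
  \<comment> \<open>By the mean value theorem a difference quotient is a value of the derivative,
    hence at most \<open>B\<close>; the steps are at most 1, so the shifted support stays within
    radius \<open>r' + 1\<close>.\<close>
  proof (rule integral_dominated_convergence[where w="\<lambda>x. indicator (cball 0 (r' + 1)) x *\<^sub>R B"])
    show "integrable lborel (\<lambda>x::real^'a. indicator (cball 0 (r' + 1)) x *\<^sub>R B)"
      using emeasure_lborel_cball_finite[of "0::real^'a" "r' + 1"] by (intro integrable_scaleR_left integrable_real_indicator) auto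
    show "AE x in lborel. (\<lambda>k. cis (- (x \<bullet> \<xi>)) * F k x) \<longlonglongrightarrow> cis (- (x \<bullet> \<xi>)) * complex_of_real (\<psi> x)"
    proof (intro AE_I2 tendsto_mult tendsto_const)
      fix x
      have "((\<lambda>s. (\<phi> (x + s *\<^sub>R e) - \<phi> (x + 0 *\<^sub>R e)) / (s - 0)) \<longlongrightarrow> \<psi> (x + 0 *\<^sub>R e)) (at 0)"
        using line[of x 0] unfolding has_field_derivative_iff .
      then have "((\<lambda>s. (\<phi> (x + s *\<^sub>R e) - \<phi> x) / s) \<longlongrightarrow> \<psi> x) (at 0)" by simp
      moreover have "filterlim h (at 0) sequentially"
        using h0 by (rule filterlim_atI) (simp add: h_ne)
      ultimately have "(\<lambda>k. (\<phi> (x + h k *\<^sub>R e) - \<phi> x) / h k) \<longlonglongrightarrow> \<psi> x"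
        by (rule filterlim_compose)
      then show "(\<lambda>k. F k x) \<longlonglongrightarrow> complex_of_real (\<psi> x)"
        unfolding F_def by (rule tendsto_of_real)
    qed
    show "AE x in lborel. norm (cis (- (x \<bullet> \<xi>)) * F k x) \<le> indicator (cball 0 (r' + 1)) x *\<^sub>R B" for k
    proof (intro AE_I2)
      fix x
      show "norm (cis (- (x \<bullet> \<xi>)) * F k x) \<le> indicator (cball 0 (r' + 1)) x *\<^sub>R B"
      proof (cases "norm x \<le> r' + 1")
        case True
        obtain z where "\<phi> (x + h k *\<^sub>R e) - \<phi> (x + 0 *\<^sub>R e) = (h k - 0) * \<psi> (x + z *\<^sub>R e)"
          using MVT2[OF h(1)[of k], of "\<lambda>s. \<phi> (x + s *\<^sub>R e)" "\<lambda>s. \<psi> (x + s *\<^sub>R e)"] line by blast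
        then have "(\<phi> (x + h k *\<^sub>R e) - \<phi> x) / h k = \<psi> (x + z *\<^sub>R e)" using h(1)[of k] by (simp add: field_simps)
        then have "norm (F k x) \<le> B" using B(3) by (simp add: F_def flip: of_real_diff of_real_divide)
        then show ?thesis using True by (simp add: norm_mult)
      next
        case False
        have "norm x \<le> norm (x + h k *\<^sub>R e) + norm (h k *\<^sub>R e)" using norm_triangle_ineq4[of "x + h k *\<^sub>R e" "h k *\<^sub>R e"] by simp
        also have "norm (h k *\<^sub>R e) \<le> 1" using h[of k] by (simp add: norm_e)
        finally have "norm (x + h k *\<^sub>R e) > r'" using False by simp
        then have "\<phi> (x + h k *\<^sub>R e) = 0" "\<phi> x = 0" using B'(4)[of x] B'(4)[of "x + h k *\<^sub>R e"] False by fastforce+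
        then show ?thesis using B(2) by (simp add: F_def)
      qed
    qed
  qed (auto simp: F_def)
  have ftF: "ft (F k) \<xi> = (cis (h k * (\<xi> $ j)) - 1) / complex_of_real (h k) * ft (\<lambda>x. complex_of_real (\<phi> x)) \<xi>" for k
  proof -
    have "F k = (\<lambda>x. complex_of_real (1 / h k) * (complex_of_real (\<phi> (x + h k *\<^sub>R e)) - complex_of_real (\<phi> x)))"
      by (auto simp: F_def)
    then have "ft (F k) \<xi> = complex_of_real (1 / h k) * ft (\<lambda>x. complex_of_real (\<phi> (x + h k *\<^sub>R e)) - complex_of_real (\<phi> x)) \<xi>"
      by (simp only: ft_cmult)
    also have "ft (\<lambda>x. complex_of_real (\<phi> (x + h k *\<^sub>R e)) - complex_of_real (\<phi> x)) \<xi>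
       = cis ((h k *\<^sub>R e) \<bullet> \<xi>) * ft (\<lambda>x. complex_of_real (\<phi> x)) \<xi> - ft (\<lambda>x. complex_of_real (\<phi> x)) \<xi>"
      by (subst ft_diff) (auto intro!: test_function_integrable t integrable_lborel_shift[OF test_function_integrable[OF t]]
          simp: ft_shift[OF test_function_integrable[OF t]])
    also have "(h k *\<^sub>R e) \<bullet> \<xi> = h k * (\<xi> $ j)" by (simp add: e_def inner_axis')
    finally show ?thesis by (simp add: field_simps)
  qed
  have lim2: "(\<lambda>k. (cis (h k * (\<xi> $ j)) - 1) / complex_of_real (h k) * ft (\<lambda>x. complex_of_real (\<phi> x)) \<xi>)
     \<longlonglongrightarrow> (\<i> * complex_of_real (\<xi> $ j)) * ft (\<lambda>x. complex_of_real (\<phi> x)) \<xi>"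
  proof (intro tendsto_mult tendsto_const)
    have "((\<lambda>z. exp (\<i> * complex_of_real (\<xi> $ j) * z)) has_field_derivative \<i> * complex_of_real (\<xi> $ j)) (at 0)"
      by (auto intro!: derivative_eq_intros)
    then have "((\<lambda>z. (exp (\<i> * complex_of_real (\<xi> $ j) * z) - 1) / z) \<longlongrightarrow> \<i> * complex_of_real (\<xi> $ j)) (at 0)"
      by (simp add: has_field_derivative_iff)
    moreover have "filterlim (\<lambda>k. complex_of_real (h k)) (at 0) sequentially"
      using tendsto_of_real[OF h0, where 'a=complex] by (intro filterlim_atI) (simp_all add: h_ne)
    ultimately have "(\<lambda>k. (exp (\<i> * complex_of_real (\<xi> $ j) * complex_of_real (h k)) - 1) / complex_of_real (h k)) \<longlonglongrightarrow> \<i> * complex_of_real (\<xi> $ j)"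
      by (rule filterlim_compose)
    then show "(\<lambda>k. (cis (h k * (\<xi> $ j)) - 1) / complex_of_real (h k)) \<longlonglongrightarrow> \<i> * complex_of_real (\<xi> $ j)"
      by (simp add: cis_conv_exp mult_ac)
  qed
  from LIMSEQ_unique[OF lim1[unfolded ftF] lim2] show ?thesis by (simp only: \<psi>_def)
qed

definition symbol_monomial :: "'n list \<Rightarrow> real^'n \<Rightarrow> complex" where
  "symbol_monomial js \<xi> = (\<Prod>j\<leftarrow>js. \<i> * complex_of_real (\<xi> $ j))"

lemma symbol_monomial_Nil [simp]: "symbol_monomial [] \<xi> = 1"
  and symbol_monomial_Cons [simp]: "symbol_monomial (j # js) \<xi> = \<i> * complex_of_real (\<xi> $ j) * symbol_monomial js \<xi>"
  by (simp_all add: symbol_monomial_def)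

text \<open>Every factor is purely imaginary. The resulting sign cancels the one in
  \<open>is_weak_deriv\<close>.\<close>

lemma cnj_symbol_monomial: "cnj (symbol_monomial js \<xi>) = (-1) ^ length js * symbol_monomial js \<xi>"
  by (induction js) auto

lemma norm_symbol_monomial: "norm (symbol_monomial js \<xi>) \<le> norm \<xi> ^ length js"
  by (induction js) (auto simp: norm_mult component_le_norm_cart intro!: mult_mono)

lemma symbol_monomial_measurable [measurable]: "symbol_monomial js \<in> borel_measurable borel"
proof (induction js)
  case Nil then show ?case by (simp add: symbol_monomial_def[abs_def])
next
  case (Cons j js)
  have [measurable]: "(\<lambda>\<xi>::real^'a. \<xi> $ j) \<in> borel_measurable borel"
    by (intro borel_measurable_continuous_onI continuous_intros)
  note [measurable] = Cons
  have "symbol_monomial (j # js) = (\<lambda>\<xi>. \<i> * complex_of_real (\<xi> $ j) * symbol_monomial js \<xi>)" by auto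
  then show ?case by simp
qed

lemma ft_partials:
  assumes t: "test_function \<phi>"
  shows "ft (\<lambda>x. complex_of_real (partials js \<phi> x)) \<xi> = symbol_monomial js \<xi> * ft (\<lambda>x. complex_of_real (\<phi> x)) \<xi>"
proof (induction js)
  case (Cons j js)
  have "partials (j # js) \<phi> = partials [j] (partials js \<phi>)" by simp
  then show ?case
    using ft_partial[OF test_function_partials[OF t, of js], of j \<xi>] Cons by (simp only: symbol_monomial_Cons mult.assoc)
qed simp

section \<open>Weak derivatives as Fourier multipliers\<close>

lemma test_function_Parseval:
  fixes f :: "real^'n \<Rightarrow> complex"
  assumes f: "fourier_L2 f U" and t: "test_function \<phi>"
  shows "(LINT x|lborel. complex_of_real (\<phi> x) * f x)
     = (LINT \<xi>|lborel. U \<xi> * cnj (ft (\<lambda>x. complex_of_real (\<phi> x)) \<xi>)) / complex_of_real ((2 * pi) ^ CARD('n))"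
  using Plancherel_L2[OF f fourier_L2_L1[OF test_function_integrable[OF t] test_function_in_L2[OF t]]]
  by (simp add: mult.commute del: of_real_power)

text \<open>On the support of the bump |x \<bullet> \<xi>| is at most 1, which is below pi / 2, so
  the cosine is positive there and the real part of the transform is the integral of a nonnegative
  function that is positive on a ball. This permits division by the transform on bounded sets of
  frequencies.\<close>

lemma ft_bump_nonzero:
  fixes \<xi> :: "real^'n"
  assumes d: "d > norm \<xi>"
  shows "ft (\<lambda>x. complex_of_real (bump d 0 x)) \<xi> \<noteq> 0"
proof
  assume z: "ft (\<lambda>x. complex_of_real (bump d 0 x)) \<xi> = 0"
  have d0: "d > 0" using d norm_ge_zero[of \<xi>] by linarith
  note t = test_function_bump[OF d0, of "0::real^'n"]
  note [measurable] = test_function_measurable[OF t]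
  have i: "integrable lborel (\<lambda>x. cis (- (x \<bullet> \<xi>)) * complex_of_real (bump d 0 x))"
    by (intro integrable_cis_mult test_function_integrable t) simp
  have pos: "cos (x \<bullet> \<xi>) > 0" if "norm x < 1 / d" for x
  proof -
    have "\<bar>x \<bullet> \<xi>\<bar> \<le> norm x * norm \<xi>" by (rule Cauchy_Schwarz_ineq2)
    also have "\<dots> \<le> (1 / d) * d" using that d d0 by (intro mult_mono) auto
    also have "\<dots> = 1" using d0 by simp
    finally have "\<bar>x \<bullet> \<xi>\<bar> < pi / 2" using pi_gt3 by linarith
    then show ?thesis using cos_gt_zero_pi[of "x \<bullet> \<xi>"] by (simp add: abs_less_iff)
  qed
  have "(LINT x|lborel. cos (x \<bullet> \<xi>) * bump d 0 x) = Re (ft (\<lambda>x. complex_of_real (bump d 0 x)) \<xi>)"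
    unfolding ft_def by (subst integral_Re[OF i, symmetric]) simp
  then have "(LINT x|lborel. cos (x \<bullet> \<xi>) * bump d 0 x) = 0" using z by simp
  moreover have "integrable lborel (\<lambda>x. cos (x \<bullet> \<xi>) * bump d 0 x)"
    using integrable_Re[OF i] by simp
  moreover have nn: "0 \<le> cos (x \<bullet> \<xi>) * bump d 0 x" for x
    using pos[of x] bump_eq_0_iff[OF d0, of 0 x] bump_nonneg[of d 0 x] by (cases "norm x < 1 / d") auto
  ultimately have "AE x in lborel. cos (x \<bullet> \<xi>) * bump d 0 x = 0"
    by (subst (asm) integral_nonneg_eq_0_iff_AE) auto
  then have ae: "AE x in lborel. x \<notin> ball (0::real^'n) (1 / d)"
  proof eventually_elim
    case (elim x)
    then show ?case using pos[of x] bump_pos_iff[OF d0, of 0 x] by auto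
  qed
  then have "ball (0::real^'n) (1 / d) \<in> null_sets lborel"
    by (subst AE_iff_null_sets) auto
  then show False using open_not_negligible[of "ball (0::real^'n) (1 / d)"] d0
    by (auto simp: negligible_iff_null_sets null_sets_completionI)
qed

text \<open>Translates of a single bump are enough as test functions: translation multiplies the
  transform \<open>b\<close> by a character, so the tested identities say that the transform of
  \<open>cnj b\<close> times \<open>V - symbol_monomial js U\<close> vanishes at every point.
  Plancherel's theorem makes this product vanish almost everywhere, and \<open>b\<close> has no
  zeros on a ball. Countably many bumps cover all frequencies.\<close>

theorem weak_deriv_fourier:
  fixes f g :: "real^'n \<Rightarrow> complex"
  assumes f: "fourier_L2 f U" and g: "fourier_L2 g V"
    and weak: "\<And>\<phi>. test_function \<phi> \<Longrightarrow> (LINT x|lborel. complex_of_real (\<phi> x) * g x)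
        = (-1) ^ length js * (LINT x|lborel. complex_of_real (partials js \<phi> x) * f x)"
  shows "AE \<xi> in lborel. V \<xi> = symbol_monomial js \<xi> * U \<xi>"
proof -
  have L: "in_L2 U" "in_L2 V" using f g by (auto simp: fourier_L2_def)
  note [measurable] = L[THEN in_L2_measurable]
  have key: "(LINT \<xi>|lborel. V \<xi> * cnj (ft (\<lambda>x. complex_of_real (\<phi> x)) \<xi>))
     = (LINT \<xi>|lborel. symbol_monomial js \<xi> * U \<xi> * cnj (ft (\<lambda>x. complex_of_real (\<phi> x)) \<xi>))"
    if t: "test_function \<phi>" for \<phi>
  proof -
    have "(LINT \<xi>|lborel. V \<xi> * cnj (ft (\<lambda>x. complex_of_real (\<phi> x)) \<xi>))
      = (-1) ^ length js * (LINT \<xi>|lborel. U \<xi> * cnj (symbol_monomial js \<xi> * ft (\<lambda>x. complex_of_real (\<phi> x)) \<xi>))"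
      using weak[OF t] test_function_Parseval[OF g t] test_function_Parseval[OF f test_function_partials[OF t, of js]]
      by (simp add: ft_partials[OF t] del: of_real_power complex_cnj_mult)
    also have "\<dots> = (LINT \<xi>|lborel. (-1) ^ length js * (U \<xi> * cnj (symbol_monomial js \<xi> * ft (\<lambda>x. complex_of_real (\<phi> x)) \<xi>)))"
      by simp
    also have "\<dots> = (LINT \<xi>|lborel. symbol_monomial js \<xi> * U \<xi> * cnj (ft (\<lambda>x. complex_of_real (\<phi> x)) \<xi>))"
    proof (rule Bochner_Integration.integral_cong[OF refl])
      fix \<xi>
      have "(-1::complex) ^ length js * (-1) ^ length js = 1" by (simp flip: power_add power_mult_distrib)
      then show "(-1) ^ length js * (U \<xi> * cnj (symbol_monomial js \<xi> * ft (\<lambda>x. complex_of_real (\<phi> x)) \<xi>))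
          = symbol_monomial js \<xi> * U \<xi> * cnj (ft (\<lambda>x. complex_of_real (\<phi> x)) \<xi>)"
        by (simp add: cnj_symbol_monomial mult_ac)
    qed
    finally show ?thesis .
  qed
  have "AE \<xi> in lborel. cnj (ft (\<lambda>x. complex_of_real (bump (real (Suc k)) 0 x)) \<xi>) * (V \<xi> - symbol_monomial js \<xi> * U \<xi>) = 0" for k
  proof -
    define d where "d = real (Suc k)"
    have d: "d > 0" by (simp add: d_def)
    note t = test_function_bump[OF d, of "0 :: real^'n"]
    define b where "b = ft (\<lambda>x. complex_of_real (bump d (0::real^'n) x))"
    have mono_b: "symbol_monomial js \<xi> * b \<xi> = ft (\<lambda>x. complex_of_real (partials js (bump d 0) x)) \<xi>" for \<xi>
      unfolding b_def by (rule ft_partials[OF t, symmetric])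
    \<comment> \<open>The factor \<open>cnj b\<close> makes the difference both integrable and
      square integrable, so that \<open>L2_sq_ft\<close> applies to it.\<close>
    define G where "G \<xi> = cnj (b \<xi>) * (V \<xi> - symbol_monomial js \<xi> * U \<xi>)" for \<xi>
    \<comment> \<open>The unbounded monomial is absorbed into the bump: the product with
      \<open>b\<close> is, up to conjugation and sign, the transform of a derivative of the bump,
      hence bounded and in L2. The product with \<open>U\<close> alone is not known to be in
      L2.\<close>
    have cnj_mono: "cnj (b \<xi>) * symbol_monomial js \<xi> = (-1) ^ length js * cnj (symbol_monomial js \<xi> * b \<xi>)" for \<xi>
      by (simp add: cnj_symbol_monomial mult.assoc[symmetric] flip: power_add power_mult_distrib)
    have G: "G \<xi> = cnj (b \<xi>) * V \<xi> - (-1) ^ length js * (cnj (ft (\<lambda>x. complex_of_real (partials js (bump d 0) x)) \<xi>) * U \<xi>)" for \<xi>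
      unfolding G_def right_diff_distrib mult.assoc[symmetric] cnj_mono mono_b ..
    have L2: "in_L2 b" "in_L2 (ft (\<lambda>x. complex_of_real (partials js (bump d (0::real^'n)) x)))"
      unfolding b_def by (intro in_L2_ft test_function_integrable test_function_in_L2 test_function_partials t)+
    note [measurable] = L2[THEN in_L2_measurable]
    have L1G: "integrable lborel G"
      unfolding G by (intro Bochner_Integration.integrable_diff integrable_mult_right L2_prod_integrable in_L2_cnj L L2)
    have bdd: "\<exists>B. \<forall>\<xi>. norm (ft (\<lambda>x. complex_of_real (\<phi> x)) \<xi>) \<le> B" if "test_function \<phi>" for \<phi> :: "real^'n \<Rightarrow> real"
      using ft_bound[OF test_function_integrable[OF that]] by blast
    obtain B1 where B1: "\<And>\<xi>. norm (b \<xi>) \<le> B1" using bdd[OF t] unfolding b_def by blast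
    obtain B2 where B2: "\<And>\<xi>. norm (ft (\<lambda>x. complex_of_real (partials js (bump d (0::real^'n)) x)) \<xi>) \<le> B2"
      using bdd[OF test_function_partials[OF t]] by blast
    have L2G: "in_L2 G"
      unfolding G
    proof (intro in_L2_diff)
      show "in_L2 (\<lambda>\<xi>. cnj (b \<xi>) * V \<xi>)"
        by (rule in_L2_bound[OF L(2), where c=B1]) (auto simp: norm_mult intro!: mult_right_mono B1)
      show "in_L2 (\<lambda>\<xi>. (-1) ^ length js * (cnj (ft (\<lambda>x. complex_of_real (partials js (bump d 0) x)) \<xi>) * U \<xi>))"
        by (rule in_L2_bound[OF L(1), where c=B2]) (auto simp: norm_mult norm_power intro!: mult_right_mono B2)
    qed
    have "ft G a = 0" for a
    proof -
      have shift: "ft (\<lambda>x. complex_of_real (bump d (- a) x)) \<xi> = cis (a \<bullet> \<xi>) * b \<xi>" for \<xi>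
        using ft_shift[OF test_function_integrable[OF t], of a \<xi>] by (simp add: b_def bump_def)
      have ta: "test_function (bump d (- a))" by (intro test_function_bump d)
      have i1: "integrable lborel (\<lambda>\<xi>. cis (- (\<xi> \<bullet> a)) * (cnj (b \<xi>) * V \<xi>))"
        by (intro integrable_cis_mult L2_prod_integrable in_L2_cnj L L2) simp
      have i2: "integrable lborel (\<lambda>\<xi>. cis (- (\<xi> \<bullet> a)) * (cnj (b \<xi>) * symbol_monomial js \<xi> * U \<xi>))"
        unfolding cnj_mono mono_b mult.assoc
        by (intro integrable_cis_mult integrable_mult_right L2_prod_integrable in_L2_cnj L L2) simp
      have "ft G a = (LINT \<xi>|lborel. cis (- (\<xi> \<bullet> a)) * (cnj (b \<xi>) * V \<xi>)) - (LINT \<xi>|lborel. cis (- (\<xi> \<bullet> a)) * (cnj (b \<xi>) * symbol_monomial js \<xi> * U \<xi>))"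
        unfolding ft_def G_def Bochner_Integration.integral_diff[OF i1 i2, symmetric]
        by (intro Bochner_Integration.integral_cong refl) (simp add: algebra_simps)
      also have "\<dots> = 0"
        using key[OF ta] unfolding shift by (simp add: cis_cnj inner_commute mult_ac)
      finally show ?thesis .
    qed
    then have "L2_sq (ft G) = 0" by (simp add: L2_sq_def)
    then have "L2_sq G = 0" using L2_sq_ft[OF L1G L2G] by simp
    moreover have "G \<in> borel_measurable borel" using L2G by (simp add: in_L2_iff)
    ultimately have "AE \<xi> in lborel. G \<xi> = 0" by (simp add: L2_sq_def nn_integral_0_iff_AE)
    then show ?thesis by (simp add: G_def b_def d_def)
  qed
  then have "AE \<xi> in lborel. \<forall>k. cnj (ft (\<lambda>x. complex_of_real (bump (real (Suc k)) 0 x)) \<xi>) * (V \<xi> - symbol_monomial js \<xi> * U \<xi>) = 0"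
    by (subst AE_all_countable) blast
  then show ?thesis
  proof eventually_elim
    case (elim \<xi>)
    obtain k where "norm \<xi> < real k" using reals_Archimedean2 by blast
    then have "norm \<xi> < real (Suc k)" by simp
    from ft_bump_nonzero[OF this] elim show ?case by (auto simp del: of_nat_Suc)
  qed
qed

text \<open>The inverse transform is the forward one, reflected and divided by
  \<open>(2 * pi) ^ CARD('n)\<close>. It is characterised through pairings with test functions, the
  form in which weak derivatives use it.\<close>

lemma inverse_fourier_weak:
  fixes V :: "real^'n \<Rightarrow> complex"
  assumes V: "in_L2 V"
  shows "\<exists>v. in_L2 v \<and> (\<forall>\<phi>. test_function \<phi> \<longrightarrow> (LINT x|lborel. complex_of_real (\<phi> x) * v x)
     = (LINT \<xi>|lborel. V \<xi> * cnj (ft (\<lambda>x. complex_of_real (\<phi> x)) \<xi>)) / complex_of_real ((2 * pi) ^ CARD('n)))"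
proof -
  obtain W where W: "fourier_L2 V W" using fourier_L2_exists[OF V] by blast
  then have L: "in_L2 W" by (simp add: fourier_L2_def)
  then have [measurable]: "W \<in> borel_measurable borel" by (simp add: in_L2_iff)
  define v where "v x = W (- x) / complex_of_real ((2 * pi) ^ CARD('n))" for x
  have [measurable]: "v \<in> borel_measurable borel" unfolding v_def by measurable
  have refl_int: "(LINT x|lborel. h (- x)) = (LINT x|lborel. h x)" if "h \<in> borel_measurable borel" for h :: "real^'n \<Rightarrow> complex"
    using integral_lborel_affine[OF that, of "-1" 0] by simp
  show ?thesis
  proof (intro exI[of _ v] conjI allI impI)
    have "in_L2 (\<lambda>x. W (- x))"
      using L nn_integral_lborel_affine[of "\<lambda>x. ennreal ((norm (W x))\<^sup>2)" "-1" 0]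
      by (simp add: in_L2_iff L2_sq_def)
    then show "in_L2 v"
      by (rule in_L2_bound[where c="1 / (2 * pi) ^ CARD('n)"]) (auto simp: v_def norm_divide norm_power norm_mult)
    fix \<phi> :: "real^'n \<Rightarrow> real" assume t: "test_function \<phi>"
    let ?c = "\<lambda>x. complex_of_real (\<phi> x)"
    let ?g = "\<lambda>x. ?c (- x)"
    note [measurable] = test_function_measurable[OF t]
    have g: "integrable lborel ?g" using integrable_lborel_affine[OF test_function_integrable[OF t], of "-1" 0] by simp
    have g2: "in_L2 ?g"
      using test_function_in_L2[OF t] nn_integral_lborel_affine[of "\<lambda>x. ennreal ((norm (?c x))\<^sup>2)" "-1" 0]
      by (simp add: in_L2_iff L2_sq_def)
    have "ft ?g \<xi> = cnj (ft ?c \<xi>)" for \<xi>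
    proof -
      have "ft ?g \<xi> = (LINT x|lborel. cis (x \<bullet> \<xi>) * ?c x)"
        using refl_int[of "\<lambda>x. cis (x \<bullet> \<xi>) * ?c x"] by (simp add: ft_def)
      also have "\<dots> = ft (\<lambda>x. cnj (?c x)) (- \<xi>)" by (simp add: ft_def)
      finally show ?thesis unfolding ft_cnj by simp
    qed
    then have "(LINT \<xi>|lborel. V \<xi> * cnj (ft ?c \<xi>)) = (LINT x|lborel. ?g x * W x)"
      using fourier_L2_multiplication[OF W g g2] by (simp add: mult.commute)
    also have "\<dots> = (LINT x|lborel. ?c x * W (- x))"
      using refl_int[of "\<lambda>x. ?c x * W (- x)"] by simp
    finally show "(LINT x|lborel. ?c x * v x) = (LINT \<xi>|lborel. V \<xi> * cnj (ft ?c \<xi>)) / complex_of_real ((2 * pi) ^ CARD('n))"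
      by (simp add: v_def del: of_real_power)
  qed
qed

section \<open>Complexified matrices\<close>

text \<open>The definiteness conditions involve only real parts, so all later estimates can use the
  Euclidean inner product of the underlying real space.\<close>

lemma Re_cinner: "Re (cinner z w) = z \<bullet> w"
  by (simp add: cinner_def inner_vec_def inner_complex_def)

lemma nonneg_on_iff: "nonneg_on X V \<longleftrightarrow> (\<forall>z\<in>V. (X *v z) \<bullet> z \<ge> 0)"
  by (simp add: nonneg_on_def Re_cinner)

lemma pos_on_iff: "pos_on X V \<longleftrightarrow> (\<forall>z\<in>V. z \<noteq> 0 \<longrightarrow> (X *v z) \<bullet> z > 0)"
  by (simp add: pos_on_def Re_cinner)

lemma cmat_nth: "(cmat X *v z) $ i = (\<Sum>j\<in>UNIV. complex_of_real (X $ i $ j) * z $ j)"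
  by (simp add: matrix_vector_mult_def map_matrix_def)

lemma cmat_add_mv: "cmat (X + Y) *v z = cmat X *v z + cmat Y *v z"
  by (simp add: vec_eq_iff cmat_nth distrib_right sum.distrib)

lemma cmat_scaleR_mv: "cmat (c *\<^sub>R X) *v z = c *\<^sub>R (cmat X *v z)"
  by (simp add: vec_eq_iff cmat_nth scaleR_conv_of_real[where 'a=complex] sum_distrib_left mult.assoc)

lemma cmat_minus_mv: "cmat (- X) *v z = - (cmat X *v z)"
  using cmat_scaleR_mv[of "-1" X z] by simp

lemma cmat_diff_mv: "cmat (X - Y) *v z = cmat X *v z - cmat Y *v z"
  using cmat_add_mv[of X "- Y" z] by (simp add: cmat_minus_mv)

lemma cmat_0_mv [simp]: "cmat 0 *v z = 0"
  by (simp add: vec_eq_iff cmat_nth)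

lemma cmat_1_mv [simp]: "cmat (mat 1) *v z = z"
  by (simp add: vec_eq_iff cmat_nth mat_def if_distrib if_distribR cong: if_cong)

lemma cmat_mult_mv: "cmat (X ** Y) *v z = cmat X *v (cmat Y *v z)"
proof -
  have "(\<Sum>j\<in>UNIV. complex_of_real (\<Sum>k\<in>UNIV. X $ i $ k * Y $ k $ j) * z $ j)
     = (\<Sum>k\<in>UNIV. complex_of_real (X $ i $ k) * (\<Sum>j\<in>UNIV. complex_of_real (Y $ k $ j) * z $ j))" for i
    by (simp add: sum_distrib_left sum_distrib_right mult.assoc) (rule sum.swap)
  then show ?thesis by (simp add: vec_eq_iff cmat_nth matrix_matrix_mult_def)
qed

lemma cmat_mv_add: "cmat X *v (z + w) = cmat X *v z + cmat X *v w"
  by (rule matrix_vector_right_distrib)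

lemma cmat_mv_scaleR: "cmat X *v (c *\<^sub>R z) = c *\<^sub>R (cmat X *v z)"
  by (simp add: vec_eq_iff cmat_nth scaleR_conv_of_real[where 'a=complex] sum_distrib_left mult_ac)

lemma cmat_mv_minus: "cmat X *v (- z) = - (cmat X *v z)"
  using cmat_mv_scaleR[of X "-1" z] by simp

lemma cmat_mv_cmult: "cmat X *v (c *s z) = c *s (cmat X *v z)"
  by (simp add: vec_eq_iff cmat_nth sum_distrib_left mult_ac)

lemma cmat_mv_0 [simp]: "cmat X *v 0 = 0"
  by (simp add: vec_eq_iff cmat_nth)

lemma cmat_inner: "(cmat X *v z) \<bullet> w = z \<bullet> (cmat (transpose X) *v w)"
proof -
  have "(cmat X *v z) \<bullet> w = (\<Sum>i\<in>UNIV. \<Sum>j\<in>UNIV. X $ i $ j * (z $ j \<bullet> w $ i))"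
    by (simp add: inner_vec_def cmat_nth inner_complex_def sum_distrib_right sum.distrib mult.assoc distrib_left)
  also have "\<dots> = (\<Sum>j\<in>UNIV. \<Sum>i\<in>UNIV. X $ i $ j * (z $ j \<bullet> w $ i))" by (rule sum.swap)
  also have "\<dots> = z \<bullet> (cmat (transpose X) *v w)"
    by (simp add: inner_vec_def cmat_nth transpose_def inner_complex_def distrib_left sum_distrib_left sum.distrib mult_ac)
  finally show ?thesis .
qed

lemma cmat_inner_sym_part: "(cmat (sym_part X) *v z) \<bullet> z = (cmat X *v z) \<bullet> z"
proof -
  have "(cmat (transpose X) *v z) \<bullet> z = (cmat X *v z) \<bullet> z"
    using cmat_inner[of X z z] by (simp add: inner_commute)
  then show ?thesis by (simp add: sym_part_def cmat_scaleR_mv cmat_add_mv inner_add_left)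
qed

lemma transpose_sym_part: "transpose (sym_part X) = sym_part X"
  by (simp add: sym_part_def vec_eq_iff transpose_def add.commute)

lemma inner_i: "(\<i> *s z) \<bullet> w = - (z \<bullet> (\<i> *s w))" for z :: "complex^'m"
  by (simp add: inner_vec_def inner_complex_def sum_negf[symmetric])

lemma i_add: "\<i> *s (z + w) = \<i> *s z + \<i> *s w" for z :: "complex^'m"
  by (simp add: vec_eq_iff distrib_left)

lemma i_scaleR: "\<i> *s (c *\<^sub>R z) = c *\<^sub>R (\<i> *s z)" for z :: "complex^'m"
  by (simp add: vec_eq_iff scaleR_conv_of_real)

lemma norm_i [simp]: "norm (\<i> *s z) = norm z" for z :: "complex^'m"
  by (simp add: norm_vec_def L2_set_def norm_mult)

text \<open>Multiplication by the imaginary unit is skew for the real inner product and commutes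
  with real matrices, so its composition with a symmetric real matrix is again skew. This is why the
  first-order terms drop out of the energy.\<close>

lemma inner_i_symmetric:
  assumes "transpose X = X" shows "(\<i> *s (cmat X *v z)) \<bullet> z = 0"
  using inner_i[of "cmat X *v z" z] cmat_inner[of X z "\<i> *s z"] assms
  by (simp add: cmat_mv_cmult inner_commute)

text \<open>By the preceding lemma the symmetric part contributes nothing.\<close>

lemma inner_i_skew_part: "(\<i> *s (cmat (skew_part X) *v z)) \<bullet> z = (\<i> *s (cmat X *v z)) \<bullet> z"
proof -
  have "cmat X *v z = cmat (sym_part X) *v z + cmat (skew_part X) *v z"
    by (simp add: sym_part_def skew_part_def cmat_scaleR_mv cmat_add_mv cmat_diff_mv algebra_simps flip: scaleR_left.add)
  then show ?thesis
    using inner_i_symmetric[OF transpose_sym_part, of X z] by (simp add: i_add inner_add_left)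
qed

lemma i_map_matrix: "map_matrix (\<lambda>x. \<i> * complex_of_real x) X *v z = \<i> *s (cmat X *v z)"
  by (simp add: vec_eq_iff matrix_vector_mult_def map_matrix_def sum_distrib_left mult.assoc)

lemma bounded_bilinear_cmat: "bounded_bilinear (\<lambda>X z. cmat X *v z)"
  unfolding bilinear_conv_bounded_bilinear[symmetric] bilinear_def
  by (auto intro!: linearI simp: cmat_add_mv cmat_scaleR_mv cmat_mv_add cmat_mv_scaleR)

lemma bounded_linear_cmat: "bounded_linear (\<lambda>z. cmat X *v z)"
  by (rule bounded_bilinear.bounded_linear_right[OF bounded_bilinear_cmat])

lemma bounded_bilinear_matrix_mult: "bounded_bilinear (\<lambda>(X :: real^'b^'a) (Y :: real^'c^'b). X ** Y)"
  unfolding bilinear_conv_bounded_bilinear[symmetric] bilinear_def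
  by (auto intro!: linearI simp: vec_eq_iff matrix_matrix_mult_def distrib_left distrib_right sum.distrib sum_distrib_left mult_ac)

lemma linear_symbol: "linear (symbol A)"
  by (rule linearI) (simp_all add: symbol_def scaleR_left.add sum.distrib scaleR_sum_right)

lemma symbol_scaleR: "symbol A (c *\<^sub>R \<xi>) = c *\<^sub>R symbol A \<xi>"
  by (rule linear_cmul[OF linear_symbol])

lemma transpose_symbol: "(\<And>j. transpose (A j) = A j) \<Longrightarrow> transpose (symbol A \<xi>) = symbol A \<xi>"
  by (simp add: symbol_def vec_eq_iff transpose_def)

lemma continuous_on_symbol [continuous_intros]:
  "continuous_on S f \<Longrightarrow> continuous_on S (\<lambda>x. symbol A (f x))"
  by (intro bounded_linear.continuous_on[OF linear_conv_bounded_linear[THEN iffD1, OF linear_symbol]])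

subsection \<open>The projection onto the image of \<open>R\<close>\<close>

definition cvec :: "real^'m \<Rightarrow> complex^'m" where
  "cvec x = (\<chi> i. complex_of_real (x $ i))"

lemma cmat_cvec: "cmat X *v cvec x = cvec (X *v x)"
  by (simp add: vec_eq_iff cmat_nth cvec_def matrix_vector_mult_def)

lemma cvec_parts: "z = cvec (\<chi> i. Re (z $ i)) + \<i> *s cvec (\<chi> i. Im (z $ i))"
  by (simp add: vec_eq_iff cvec_def complex_eq_iff)

lemma cinner_add_left: "cinner (a + b) w = cinner a w + cinner b w"
  by (simp add: cinner_def distrib_right sum.distrib)

lemma cinner_add_right: "cinner w (a + b) = cinner w a + cinner w b"
  by (simp add: cinner_def distrib_left sum.distrib)

lemma cinner_cmult_left: "cinner (c *s a) w = c * cinner a w"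
  by (simp add: cinner_def sum_distrib_left mult.assoc)

lemma cinner_cmult_right: "cinner w (c *s a) = cnj c * cinner w a"
  by (simp add: cinner_def sum_distrib_left mult_ac)

lemma cinner_cvec: "cinner (cvec x) (cvec y) = complex_of_real (x \<bullet> y)"
  by (simp add: cinner_def cvec_def inner_vec_def)

text \<open>The columns are the projections of the standard basis vectors. Complexifying this real
  matrix gives the projection described by \<open>Pi1\<close>.\<close>

lemma orthogonal_projection_matrix:
  fixes R :: "real^'m^'p"
  shows "\<exists>P :: real^'p^'p. \<forall>x. P *v x \<in> range ((*v) R) \<and> (\<forall>y\<in>range ((*v) R). (x - P *v x) \<bullet> y = 0)"
proof -
  define V where "V = range ((*v) R)"
  have sub: "subspace V" unfolding V_def
    by (intro linear_subspace_image matrix_vector_mul_linear subspace_UNIV)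
  have "\<forall>j. \<exists>p. p \<in> V \<and> (\<forall>y\<in>V. (axis j 1 - p) \<bullet> y = 0)"
  proof
    fix j :: 'p
    obtain p q where pq: "p \<in> span V" "\<And>w. w \<in> span V \<Longrightarrow> orthogonal q w" "axis j 1 = p + q"
      using orthogonal_subspace_decomp_exists[of V "axis j 1"] by metis
    have sp: "span V = V" using sub by (simp add: span_eq_iff)
    show "\<exists>p. p \<in> V \<and> (\<forall>y\<in>V. (axis j 1 - p) \<bullet> y = 0)"
      using pq unfolding sp by (intro exI[of _ p]) (auto simp: orthogonal_def)
  qed
  then obtain p where p: "\<And>j. p j \<in> V" "\<And>j y. y \<in> V \<Longrightarrow> (axis j 1 - p j) \<bullet> y = 0" by metis
  define P :: "real^'p^'p" where "P = (\<chi> i j. p j $ i)"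
  have Px: "P *v x = (\<Sum>j\<in>UNIV. x $ j *\<^sub>R p j)" for x
    by (simp add: P_def matrix_vector_mult_def vec_eq_iff mult.commute)
  have xx: "x = (\<Sum>j\<in>UNIV. x $ j *\<^sub>R axis j 1)" for x :: "real^'p"
    using basis_expansion[of x] by (simp add: scalar_mult_eq_scaleR)
  have "P *v x \<in> V" for x
    unfolding Px by (intro subspace_sum[OF sub] subspace_scale[OF sub] p)
  moreover have "(x - P *v x) \<bullet> y = 0" if "y \<in> V" for x y
  proof -
    have "x - P *v x = (\<Sum>j\<in>UNIV. x $ j *\<^sub>R (axis j 1 - p j))"
      by (subst xx) (simp add: Px sum_subtractf scaleR_diff_right)
    then show ?thesis using p(2)[OF that] by (simp add: inner_sum_left)
  qed
  ultimately show ?thesis unfolding V_def by blast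
qed

text \<open>Since \<open>Pi1\<close> is a definite description, existence and uniqueness come first:
  the real projection acts separately on real and imaginary parts, and two candidates differ by a
  vector that is both in the image and orthogonal to it. The same argument shows that the residual
  of an image vector is 0.\<close>

lemma Pi1_image:
  fixes R :: "real^'m^'p"
  assumes w: "w \<in> imageC R" shows "cmat (Pi1 R) *v w = w"
proof -
  let ?D = "\<lambda>P. \<forall>y. cmat P *v y \<in> imageC R \<and> (\<forall>w\<in>imageC R. cinner (y - cmat P *v y) w = 0)"
  obtain P :: "real^'p^'p" where P: "\<And>x. P *v x \<in> range ((*v) R)"
    "\<And>x y. y \<in> range ((*v) R) \<Longrightarrow> (x - P *v x) \<bullet> y = 0"
    using orthogonal_projection_matrix[of R] by blast
  have image_add: "a + b \<in> imageC R" if ab: "a \<in> imageC R" "b \<in> imageC R" for a b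
  proof -
    obtain a' b' where "a = cmat R *v a'" "b = cmat R *v b'" using ab by (auto simp: imageC_def)
    then have "a + b = cmat R *v (a' + b')" by (simp add: cmat_mv_add)
    then show ?thesis unfolding imageC_def by blast
  qed
  have image_cmult: "c *s a \<in> imageC R" if a: "a \<in> imageC R" for a c
  proof -
    obtain a' where "a = cmat R *v a'" using a by (auto simp: imageC_def)
    then have "c *s a = cmat R *v (c *s a')" by (simp add: cmat_mv_cmult)
    then show ?thesis unfolding imageC_def by blast
  qed
  have D: "?D P"
  proof (intro allI conjI ballI)
    fix y :: "complex^'p"
    define a b where "a = (\<chi> i. Re (y $ i))" and "b = (\<chi> i. Im (y $ i))"
    have y: "y = cvec a + \<i> *s cvec b" unfolding a_def b_def by (rule cvec_parts)
    have Py: "cmat P *v y = cvec (P *v a) + \<i> *s cvec (P *v b)"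
      unfolding y by (simp add: cmat_mv_add cmat_mv_cmult cmat_cvec)
    have real_im: "cvec v \<in> imageC R" if "v \<in> range ((*v) R)" for v
      using that by (auto simp: imageC_def simp flip: cmat_cvec)
    show "cmat P *v y \<in> imageC R" unfolding Py by (intro image_add image_cmult real_im P)
    fix w assume "w \<in> imageC R"
    then obtain z where "w = cmat R *v z" by (auto simp: imageC_def)
    then obtain c d where w: "w = cvec (R *v c) + \<i> *s cvec (R *v d)"
      by (subst (asm) cvec_parts[of z]) (simp add: cmat_mv_add cmat_mv_cmult cmat_cvec)
    have "y - cmat P *v y = cvec (a - P *v a) + \<i> *s cvec (b - P *v b)"
      by (subst Py, subst y) (simp add: vec_eq_iff cvec_def algebra_simps)
    then show "cinner (y - cmat P *v y) w = 0"
      unfolding w by (simp add: cinner_add_left cinner_add_right cinner_cmult_left cinner_cmult_right cinner_cvec P)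
  qed
  have uniq: "P' = P" if D': "?D P'" for P'
  proof -
    have "cmat P' *v y = cmat P *v y" for y
    proof -
      define d where "d = cmat P' *v y - cmat P *v y"
      have "d = cmat P' *v y + (-1) *s (cmat P *v y)" by (simp add: d_def vec_eq_iff)
      then have dim: "d \<in> imageC R" using image_add image_cmult D D' by metis
      \<comment> \<open>\<open>d\<close> is the difference of the two residuals, each of which is
        orthogonal to the image and so to \<open>d\<close>.\<close>
      have "cinner d d = cinner (y - cmat P *v y) d + (-1) * cinner (y - cmat P' *v y) d"
        unfolding cinner_cmult_left[symmetric] cinner_add_left[symmetric]
        by (rule arg_cong[where f="\<lambda>v. cinner v d"]) (simp add: d_def vec_eq_iff)
      also have "\<dots> = 0" using D D' dim by simp
      finally have "d \<bullet> d = 0" using Re_cinner[of d d] by simp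
      then show ?thesis by (simp add: d_def)
    qed
    then have "cvec (P' *v x) = cvec (P *v x)" for x by (simp flip: cmat_cvec)
    then have "P' *v x = P *v x" for x by (simp add: vec_eq_iff cvec_def)
    then show ?thesis by (metis matrix_eq)
  qed
  have "Pi1 R = P" unfolding Pi1_def using D uniq by (rule the_equality)
  then have D1: "?D (Pi1 R)" using D by simp
  define d where "d = w - cmat (Pi1 R) *v w"
  have "d = w + (-1) *s (cmat (Pi1 R) *v w)" by (simp add: d_def vec_eq_iff)
  moreover have "cmat (Pi1 R) *v w \<in> imageC R" using D1 by blast
  ultimately have "d \<in> imageC R" by (simp only: image_add w image_cmult)
  then have "cinner d d = 0" using D1 unfolding d_def by blast
  then have "d \<bullet> d = 0" using Re_cinner[of d d] by simp
  then show ?thesis by (simp add: d_def)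
qed

section \<open>The Lyapunov functional\<close>

text \<open>Shared by the evolution operator, with \<open>A\<close> and \<open>L\<close>, and the
  rectangular constraint operator, with \<open>Q\<close> and \<open>R\<close>. Linearity of
  \<open>symbol\<close> absorbs |\<xi>| into the argument.\<close>

definition pencil :: "('n::finite \<Rightarrow> real^'m^'p) \<Rightarrow> real^'m^'p \<Rightarrow> real^'n \<Rightarrow> complex^'m \<Rightarrow> complex^'p" where
  "pencil A L \<xi> z = \<i> *s (cmat (symbol A \<xi>) *v z) + cmat L *v z"

lemma bounded_linear_pencil: "bounded_linear (pencil A L \<xi>)"
  unfolding linear_conv_bounded_linear[symmetric]
  by (rule linearI) (simp_all add: pencil_def cmat_mv_add i_add cmat_mv_scaleR i_scaleR scaleR_add_right)

section \<open>Algebraic and compactness facts behind the functional\<close>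

lemma condition_A_invertible:
  assumes A: "condition_A A0 A L"
  shows "matrix_inv A0 ** A0 = mat 1" "A0 ** matrix_inv A0 = mat 1"
proof -
  have "x = 0" if "A0 *v x = 0" for x
  proof (rule ccontr)
    assume "x \<noteq> 0"
    then have "cvec x \<noteq> 0" by (simp add: cvec_def vec_eq_iff)
    then have "(cmat A0 *v cvec x) \<bullet> cvec x > 0" using A by (simp add: condition_A_def pos_on_iff)
    moreover have "cmat A0 *v cvec x = 0" unfolding cmat_cvec that by (simp add: cvec_def zero_vec_def)
    ultimately show False by simp
  qed
  then obtain B where "B ** A0 = mat 1" using matrix_left_invertible_ker[of A0] by blast
  then have "invertible A0" using invertible_left_inverse by blast
  then show "matrix_inv A0 ** A0 = mat 1" "A0 ** matrix_inv A0 = mat 1"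
    unfolding invertible_def matrix_inv_def
    using someI_ex[of "\<lambda>B. A0 ** B = mat 1 \<and> B ** A0 = mat 1"] by blast+
qed

text \<open>With \<xi> = r \<omega> the product is a quadratic polynomial in r, and its three
  coefficients are, up to constants, the three expressions that vanish by condition (C).\<close>

lemma condition_C_pencil:
  assumes C: "condition_C A0 A L Q R"
  shows "pencil Q R \<xi> (cmat (matrix_inv A0) *v pencil A L \<xi> z) = 0"
proof -
  obtain r \<omega> where \<omega>: "norm \<omega> = 1" "\<xi> = r *\<^sub>R \<omega>"
  proof (cases "\<xi> = 0")
    case True then show ?thesis using that[of "axis undefined 1" 0] by simp
  next
    case False then show ?thesis using that[of "\<xi> /\<^sub>R norm \<xi>" "norm \<xi>"] by simp
  qed
  let ?B = "matrix_inv A0"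
  have c: "symbol Q \<omega> ** ?B ** symbol A \<omega> = 0" "R ** ?B ** L = 0" "symbol Q \<omega> ** ?B ** L + R ** ?B ** symbol A \<omega> = 0"
    using C \<omega>(1) by (auto simp: condition_C_def)
  define a b c where "a = cmat (symbol Q \<omega>) *v (cmat ?B *v (cmat (symbol A \<omega>) *v z))"
    and "b = cmat (symbol Q \<omega>) *v (cmat ?B *v (cmat L *v z))"
    and "c = cmat R *v (cmat ?B *v (cmat (symbol A \<omega>) *v z))"
  have "a = 0" using c(1) by (simp add: a_def flip: cmat_mult_mv) (simp add: matrix_mul_assoc)
  moreover have "cmat R *v (cmat ?B *v (cmat L *v z)) = 0" using c(2) by (simp flip: cmat_mult_mv) (simp add: matrix_mul_assoc)
  moreover have "b + c = 0"
  proof -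
    have "b + c = cmat (symbol Q \<omega> ** ?B ** L + R ** ?B ** symbol A \<omega>) *v z"
      by (simp add: b_def c_def cmat_add_mv cmat_mult_mv)
    then show ?thesis using c(3) by simp
  qed
  moreover have "pencil Q R \<xi> (cmat ?B *v pencil A L \<xi> z)
     = (- (r * r)) *\<^sub>R a + r *\<^sub>R (\<i> *s (b + c)) + cmat R *v (cmat ?B *v (cmat L *v z))"
    by (simp add: pencil_def \<omega>(2) symbol_scaleR cmat_scaleR_mv cmat_mv_add cmat_mv_scaleR cmat_mv_cmult i_add i_scaleR
      scaleR_add_right a_def b_def c_def)
  ultimately show ?thesis by simp
qed

text \<open>Nonnegativity of the form at \<open>z - s G z\<close> yields the inequality for small
  \<open>s\<close>; it is the Cauchy-Schwarz inequality of a semi-definite form in quantitative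
  shape.\<close>

lemma psd_cmat_bound:
  fixes G :: "real^'m^'m"
  assumes G: "transpose G = G" "nonneg_on (cmat G) UNIV"
  shows "\<exists>C>0. \<forall>z. (norm (cmat G *v z))\<^sup>2 \<le> C * ((cmat G *v z) \<bullet> z)"
proof -
  obtain C where C: "C > 0" "\<And>z. norm (cmat G *v z) \<le> norm z * C"
    using bounded_linear.pos_bounded[OF bounded_linear_cmat[of G]] by blast
  have nn: "(cmat G *v z) \<bullet> z \<ge> 0" for z using G(2) by (simp add: nonneg_on_iff)
  have "(norm (cmat G *v z))\<^sup>2 \<le> C * ((cmat G *v z) \<bullet> z)" for z
  proof -
    define y where "y = cmat G *v z"
    \<comment> \<open>This value minimises the coefficient \<open>- 2 s + C s^2\<close> of |y|^2 in
      the expansion below.\<close>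
    define s where "s = 1 / C"
    have Gy: "(cmat G *v y) \<bullet> z = y \<bullet> y"
      using cmat_inner[of G y z] G(1) by (simp add: y_def)
    have "0 \<le> (cmat G *v (z - s *\<^sub>R y)) \<bullet> (z - s *\<^sub>R y)" by (rule nn)
    also have "\<dots> = (y \<bullet> z) - 2 * s * (y \<bullet> y) + s * s * ((cmat G *v y) \<bullet> y)"
      using cmat_mv_add[of G z "- (s *\<^sub>R y)"]
      by (simp add: cmat_mv_minus cmat_mv_scaleR inner_diff_left inner_diff_right Gy y_def[symmetric] algebra_simps)
    also have "(cmat G *v y) \<bullet> y \<le> C * (y \<bullet> y)"
    proof -
      have "(cmat G *v y) \<bullet> y \<le> norm (cmat G *v y) * norm y" by (rule norm_cauchy_schwarz)
      also have "\<dots> \<le> norm y * C * norm y" by (intro mult_right_mono C) auto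
      finally show ?thesis by (simp add: dot_square_norm power2_eq_square mult_ac)
    qed
    then have "s * s * ((cmat G *v y) \<bullet> y) \<le> s * s * (C * (y \<bullet> y))" using C(1) by (intro mult_left_mono) (auto simp: s_def)
    finally have "s * (y \<bullet> y) \<le> y \<bullet> z" using C(1) by (simp add: s_def field_simps)
    then show ?thesis using C(1) by (simp add: s_def y_def dot_square_norm field_simps)
  qed
  then show ?thesis using C(1) by blast
qed

text \<open>On the orthogonal complement of its kernel \<open>G\<close> is bounded below, and the
  kernel component is invisible to both matrices.\<close>

lemma kernel_bound:
  fixes L G :: "real^'m^'m"
  assumes "kerC G \<subseteq> kerC L"
  shows "\<exists>C>0. \<forall>z. norm (cmat L *v z) \<le> C * norm (cmat G *v z)"
proof -
  define N where "N = {z. cmat G *v z = 0}"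
  have subN: "subspace N"
    unfolding N_def subspace_def by (auto simp: cmat_mv_add cmat_mv_scaleR)
  define V where "V = {z. \<forall>w\<in>N. orthogonal w z}"
  have subV: "subspace V" unfolding V_def by (rule subspace_orthogonal_to_vectors)
  have "\<exists>e>0. \<forall>x\<in>V. e * norm x \<le> norm (cmat G *v x)"
  proof (rule injective_imp_isometric[OF closed_subspace[OF subV] subV bounded_linear_cmat])
    show "\<forall>x\<in>V. cmat G *v x = 0 \<longrightarrow> x = 0"
      by (auto simp: V_def N_def orthogonal_def)
  qed
  then obtain e where e: "e > 0" "\<And>x. x \<in> V \<Longrightarrow> e * norm x \<le> norm (cmat G *v x)" by blast
  obtain C where C: "C > 0" "\<And>z. norm (cmat L *v z) \<le> norm z * C"
    using bounded_linear.pos_bounded[OF bounded_linear_cmat[of L]] by blast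
  have "norm (cmat L *v z) \<le> C / e * norm (cmat G *v z)" for z
  proof -
    obtain p q where pq: "p \<in> span N" "\<And>w. w \<in> span N \<Longrightarrow> orthogonal q w" "z = p + q"
      using orthogonal_subspace_decomp_exists[of N z] by metis
    have sp: "span N = N" using subN by (simp add: span_eq_iff)
    have p: "cmat G *v p = 0" "cmat L *v p = 0" using pq(1)[unfolded sp] assms by (auto simp: N_def kerC_def)
    have qV: "q \<in> V" using pq(2)[unfolded sp] by (auto simp: V_def orthogonal_commute)
    have "norm (cmat L *v z) = norm (cmat L *v q)" by (simp add: pq(3) cmat_mv_add p)
    also have "\<dots> \<le> norm q * C" by (rule C)
    also have "norm q \<le> norm (cmat G *v q) / e" using e(2)[OF qV] e(1) by (simp add: field_simps)
    then have "norm q * C \<le> norm (cmat G *v q) / e * C" using C(1) by (intro mult_right_mono) auto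
    also have "cmat G *v q = cmat G *v z" by (simp add: pq(3) cmat_mv_add p)
    finally show ?thesis by (simp add: mult_ac)
  qed
  then show ?thesis using C(1) e(1) by (intro exI[of _ "C / e"]) auto
qed

text \<open>Near the zero set of \<open>g\<close> the function \<open>f\<close> is bounded below by
  a positive number; away from it a large multiple of \<open>g\<close> outweighs the least value of
  \<open>f\<close>. Compactness makes both thresholds uniform.\<close>

lemma compact_compensation:
  fixes f g :: "'a::topological_space \<Rightarrow> real"
  assumes K: "compact K" and f: "continuous_on K f" and g: "continuous_on K g"
    and nn: "\<And>x. x \<in> K \<Longrightarrow> 0 \<le> g x" and pos: "\<And>x. x \<in> K \<Longrightarrow> g x = 0 \<Longrightarrow> 0 < f x"
  shows "\<exists>N>0. \<exists>c>0. \<forall>x\<in>K. c \<le> f x + N * g x"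
proof (cases "K = {}")
  case True then show ?thesis by (auto intro!: exI[of _ 1])
next
  case False
  \<comment> \<open>This function is positive on \<open>K\<close>, so its minimum \<mu> is positive;
    where \<open>g\<close> is below \<mu> / 2, the function \<open>f\<close> must exceed \<mu> /
    2.\<close>
  have "continuous_on K (\<lambda>x. max (f x) 0 + g x)" by (intro continuous_intros f g)
  then obtain x0 where x0: "x0 \<in> K" "\<And>x. x \<in> K \<Longrightarrow> max (f x0) 0 + g x0 \<le> max (f x) 0 + g x"
    using continuous_attains_inf[OF K False] by blast
  define \<mu> where "\<mu> = max (f x0) 0 + g x0"
  have \<mu>: "\<mu> > 0" using nn[OF x0(1)] pos[OF x0(1)] by (cases "g x0 = 0") (auto simp: \<mu>_def)
  obtain x1 where x1: "x1 \<in> K" "\<And>x. x \<in> K \<Longrightarrow> f x1 \<le> f x"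
    using continuous_attains_inf[OF K False f] by blast
  define F where "F = \<bar>f x1\<bar>"
  \<comment> \<open>Solves \<open>N * (\<mu> / 2) = F + \<mu> / 2\<close>, which pays for the lower
    bound \<open>- F\<close> of \<open>f\<close>.\<close>
  define N where "N = 2 * (F + \<mu> / 2) / \<mu>"
  have N: "N > 0" using \<mu> by (simp add: N_def F_def add_nonneg_pos)
  have "\<mu> / 2 \<le> f x + N * g x" if x: "x \<in> K" for x
  proof (cases "g x \<ge> \<mu> / 2")
    case True
    have "N * g x \<ge> N * (\<mu> / 2)" using N True by (intro mult_left_mono) auto
    also have "N * (\<mu> / 2) = F + \<mu> / 2" using \<mu> by (simp add: N_def)
    finally show ?thesis using x1(2)[OF x] by (simp add: F_def)
  next
    case False
    then have "f x > \<mu> / 2" using x0(2)[OF x] \<mu> by (simp add: \<mu>_def max_def split: if_splits)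
    moreover have "0 \<le> N * g x" using N nn[OF x] by simp
    ultimately show ?thesis by linarith
  qed
  then show ?thesis using N \<mu> by (intro exI[of _ N] conjI exI[of _ "\<mu> / 2"]) auto
qed

text \<open>\<open>psd_cmat_bound\<close> bounds |A0 z|^2 by the form, and the inverse of
  \<open>A0\<close> bounds |z| by |A0 z|.\<close>

lemma condition_A_coercive:
  assumes A: "condition_A A0 A L"
  shows "\<exists>a>0. \<forall>z. a * (norm z)\<^sup>2 \<le> (cmat A0 *v z) \<bullet> z"
proof -
  have nn: "nonneg_on (cmat A0) UNIV"
    using A unfolding condition_A_def nonneg_on_iff pos_on_iff by (metis UNIV_I cmat_mv_0 inner_zero_left less_le order_refl)
  obtain C where C: "C > 0" "\<And>z. (norm (cmat A0 *v z))\<^sup>2 \<le> C * ((cmat A0 *v z) \<bullet> z)"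
    using psd_cmat_bound[OF _ nn] A unfolding condition_A_def by blast
  obtain B where B: "B > 0" "\<And>z. norm (cmat (matrix_inv A0) *v z) \<le> norm z * B"
    using bounded_linear.pos_bounded[OF bounded_linear_cmat[of "matrix_inv A0"]] by blast
  have "1 / (B\<^sup>2 * C) * (norm z)\<^sup>2 \<le> (cmat A0 *v z) \<bullet> z" for z
  proof -
    have "norm z \<le> norm (cmat A0 *v z) * B"
      using B(2)[of "cmat A0 *v z"] by (simp add: condition_A_invertible[OF A] flip: cmat_mult_mv)
    then have "(norm z)\<^sup>2 \<le> (norm (cmat A0 *v z) * B)\<^sup>2" by (intro power_mono) auto
    also have "\<dots> \<le> C * ((cmat A0 *v z) \<bullet> z) * B\<^sup>2"
      unfolding power_mult_distrib by (intro mult_right_mono C) auto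
    finally show ?thesis using B(1) C(1) by (simp add: field_simps)
  qed
  then show ?thesis using B(1) C(1) by (intro exI[of _ "1 / (B\<^sup>2 * C)"]) auto
qed

lemma smooth_on_unit_sphere_continuous:
  assumes "smooth_on_unit_sphere K" shows "continuous_on (sphere 0 1) K"
proof -
  obtain U g where Ug: "open U" "sphere 0 1 \<subseteq> U" "smooth_on U g" "\<And>\<omega>. \<omega> \<in> sphere 0 1 \<Longrightarrow> g \<omega> = K \<omega>"
    using assms unfolding smooth_on_unit_sphere_def by blast
  have "Ck_on U g 0" using Ug(3) unfolding smooth_on_def by blast
  then have "continuous_on (sphere 0 1) g" using Ug(2) continuous_on_subset by auto
  then show ?thesis by (rule continuous_on_eq) (rule Ug(4))
qed

text \<open>\<open>B\<close> is the polarised functional and \<open>y\<close> stands for the time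
  derivative of \<open>x\<close>, so by symmetry \<open>2 * B y x\<close> is the derivative of
  \<open>B x x\<close> along the flow. The form depends on \<omega> and r, but \<open>b\<close> and
  \<open>c\<close> must not; hence all constants below are fixed before \<omega> and r are
  introduced.\<close>

theorem lyapunov_functional:
  fixes A0 L S :: "real^'m^'m" and A :: "'n::finite \<Rightarrow> real^'m^'m"
    and Q :: "'n \<Rightarrow> real^'m^'p" and R :: "real^'m^'p"
  assumes A: "condition_A A0 A L" and S: "condition_S S A0 L" and S2: "condition_S2 S A Q R"
    and K: "condition_K A0 A L Q R"
  shows "\<exists>b>0. \<exists>c>0. \<forall>\<omega> r. norm \<omega> = 1 \<longrightarrow> r \<ge> 0 \<longrightarrow>
    (\<exists>B :: complex^'m \<Rightarrow> complex^'m \<Rightarrow> real. bounded_bilinear B \<and> (\<forall>x y. B x y = B y x) \<and>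
      (\<forall>x. (norm x)\<^sup>2 \<le> B x x \<and> B x x \<le> b * (norm x)\<^sup>2) \<and>
      (\<forall>x y. cmat A0 *v y = - pencil A L (r *\<^sub>R \<omega>) x \<longrightarrow> pencil Q R (r *\<^sub>R \<omega>) x = 0 \<longrightarrow>
         B y x \<le> - c * (r\<^sup>2 / (1 + r\<^sup>2)) * B x x))"
proof -
  define G where "G = sym_part (S ** L) + sym_part L"
  \<comment> \<open>The dissipation that the \<open>A0\<close> term and the \<open>S\<close> term
    produce together; by condition (S) it vanishes exactly on the kernel of
    \<open>L\<close>.\<close>
  define g where "g x = (cmat G *v x) \<bullet> x" for x :: "complex^'m"
  have g_eq: "g x = (cmat (S ** L) *v x) \<bullet> x + (cmat L *v x) \<bullet> x" for x
    by (simp add: g_def G_def cmat_add_mv inner_add_left cmat_inner_sym_part)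
  have Gsym: "transpose G = G" using transpose_sym_part[of "S ** L"] transpose_sym_part[of L]
    by (simp add: G_def vec_eq_iff transpose_def)
  have Gnn: "nonneg_on (cmat G) UNIV" and Gker: "kerC G = kerC L"
    using S by (simp_all add: condition_S_def G_def)
  have g_nonneg: "g x \<ge> 0" for x using Gnn by (simp add: g_def nonneg_on_iff)
  obtain Cg where Cg: "Cg > 0" "\<And>x. (norm (cmat G *v x))\<^sup>2 \<le> Cg * g x"
    using psd_cmat_bound[OF Gsym Gnn] unfolding g_def by blast
  obtain CL where CL: "CL > 0" "\<And>x. norm (cmat L *v x) \<le> CL * norm (cmat G *v x)"
    using kernel_bound[of G L] Gker by blast
  define N' where "N' = CL\<^sup>2 * Cg"
  have N': "N' > 0" using CL Cg by (simp add: N'_def)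
  have L_g: "(norm (cmat L *v x))\<^sup>2 \<le> N' * g x" for x
  proof -
    have "(norm (cmat L *v x))\<^sup>2 \<le> (CL * norm (cmat G *v x))\<^sup>2" by (intro power_mono CL) auto
    also have "\<dots> \<le> CL\<^sup>2 * (Cg * g x)" unfolding power_mult_distrib by (intro mult_left_mono Cg) auto
    finally show ?thesis by (simp add: N'_def mult.assoc)
  qed
  obtain a where a: "a > 0" "\<And>z. a * (norm z)\<^sup>2 \<le> (cmat A0 *v z) \<bullet> z"
    using condition_A_coercive[OF A] by blast
  obtain a' where a': "a' > 0" "\<And>z. norm (cmat A0 *v z) \<le> norm z * a'"
    using bounded_linear.pos_bounded[OF bounded_linear_cmat[of A0]] by blast
  obtain s where s: "s > 0" "\<And>z. norm (cmat (S ** A0) *v z) \<le> norm z * s"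
    using bounded_linear.pos_bounded[OF bounded_linear_cmat[of "S ** A0"]] by blast
  have A0sym: "transpose A0 = A0" and Asym: "\<And>\<omega>. transpose (symbol A \<omega>) = symbol A \<omega>"
    and Lnn: "\<And>x. (cmat L *v x) \<bullet> x \<ge> 0"
    using A by (auto simp: condition_A_def nonneg_on_iff intro: transpose_symbol)
  have SAsym: "transpose (S ** A0) = S ** A0" using S by (simp add: condition_S_def)
  obtain K where Ks: "smooth_on_unit_sphere K"
    and Kskew: "\<And>\<omega>. norm \<omega> = 1 \<Longrightarrow> transpose (K \<omega> ** A0) = - (K \<omega> ** A0)"
    and Kpos: "\<And>\<omega>. norm \<omega> = 1 \<Longrightarrow> pos_on (cmat (sym_part (K \<omega> ** symbol A \<omega>))) (Xspace Q R \<omega> \<inter> kerC L)"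
    using K unfolding condition_K_def by auto
  have Kcont: "continuous_on (sphere 0 1) K" by (rule smooth_on_unit_sphere_continuous[OF Ks])
  have Kbound: "\<exists>k>0. \<forall>\<omega> z. norm \<omega> = 1 \<longrightarrow> norm (cmat (F \<omega>) *v z) \<le> k * norm z"
    if F: "continuous_on (sphere 0 1) F" for F :: "real^'n \<Rightarrow> real^'m^'m"
  proof -
    have "bounded (F ` sphere 0 1)" by (intro compact_imp_bounded compact_continuous_image F compact_sphere)
    then obtain k0 where k0: "k0 > 0" "\<And>\<omega>. norm \<omega> = 1 \<Longrightarrow> norm (F \<omega>) \<le> k0"
      unfolding bounded_pos by auto
    obtain k1 where k1: "k1 > 0" "\<And>X (z :: complex^'m). norm (cmat (X :: real^'m^'m) *v z) \<le> norm X * norm z * k1"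
      using bounded_bilinear.pos_bounded[OF bounded_bilinear_cmat] by blast
    have "norm (cmat (F \<omega>) *v z) \<le> (k0 * k1) * norm z" if "norm \<omega> = 1" for \<omega> z
    proof -
      have "norm (cmat (F \<omega>) *v z) \<le> norm (F \<omega>) * norm z * k1" by (rule k1)
      also have "\<dots> \<le> k0 * norm z * k1" using k1(1) by (intro mult_right_mono k0 that) auto
      finally show ?thesis by (simp add: mult_ac)
    qed
    then show ?thesis using k0(1) k1(1) by (intro exI[of _ "k0 * k1"]) auto
  qed
  obtain kk where kk: "kk > 0" "\<And>\<omega> z. norm \<omega> = 1 \<Longrightarrow> norm (cmat (K \<omega>) *v z) \<le> kk * norm z"
    using Kbound[OF Kcont] by blast
  obtain kA where kA: "kA > 0" "\<And>\<omega> z. norm \<omega> = 1 \<Longrightarrow> norm (cmat (K \<omega> ** A0) *v z) \<le> kA * norm z"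
    using Kbound[OF bounded_bilinear.continuous_on[OF bounded_bilinear_matrix_mult Kcont continuous_on_const[of _ A0]]] by blast
  define f where "f \<omega> x = (cmat (K \<omega> ** symbol A \<omega>) *v x) \<bullet> x" for \<omega> and x :: "complex^'m"
  \<comment> \<open>Pairs of a direction and a unit vector admissible for it. On this compact set
    \<open>f\<close> is positive wherever \<open>g\<close> vanishes, so
    \<open>compact_compensation\<close> gives constants uniform in the direction.\<close>
  define Z where "Z = {p \<in> sphere 0 1 \<times> sphere 0 1. cmat (Pi2 R ** symbol Q (fst p)) *v (snd p :: complex^'m) = 0}"
  have Z: "compact Z"
  proof -
    have "Z = (sphere 0 1 \<times> sphere 0 1) \<inter> (\<lambda>p. cmat (Pi2 R ** symbol Q (fst p)) *v (snd p)) -` {0}"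
      by (auto simp: Z_def)
    moreover have "closed \<dots>"
    proof (rule continuous_closed_preimage)
      have c1: "continuous_on (sphere 0 1 \<times> sphere 0 1) (\<lambda>p. symbol Q (fst p :: real^'n))"
        by (intro continuous_intros)
      have c2: "continuous_on (sphere 0 1 \<times> sphere 0 1) (\<lambda>p. Pi2 R ** symbol Q (fst p :: real^'n))"
        by (rule bounded_bilinear.continuous_on[OF bounded_bilinear_matrix_mult continuous_on_const c1])
      show "continuous_on (sphere 0 1 \<times> sphere 0 1) (\<lambda>p. cmat (Pi2 R ** symbol Q (fst p)) *v (snd p))"
        by (rule bounded_bilinear.continuous_on[OF bounded_bilinear_cmat c2]) (intro continuous_intros)
    qed (auto intro: closed_Times)
    moreover have "bounded Z" by (rule bounded_subset[of "sphere 0 1 \<times> sphere 0 1"]) (auto simp: Z_def bounded_Times)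
    ultimately show ?thesis by (simp add: compact_eq_bounded_closed)
  qed
  have "\<exists>N>0. \<exists>c>0. \<forall>p\<in>Z. c \<le> f (fst p) (snd p) + N * g (snd p)"
  proof (rule compact_compensation[OF Z])
    have "continuous_on Z (\<lambda>p. K (fst p))"
      by (rule continuous_on_compose2[OF Kcont]) (auto simp: Z_def intro!: continuous_intros)
    then show "continuous_on Z (\<lambda>p. f (fst p) (snd p))"
      unfolding f_def by (intro bounded_bilinear.continuous_on[OF bounded_bilinear_cmat]
        bounded_bilinear.continuous_on[OF bounded_bilinear_matrix_mult] continuous_intros)
    show "continuous_on Z (\<lambda>p. g (snd p))"
      unfolding g_def by (intro bounded_bilinear.continuous_on[OF bounded_bilinear_cmat] continuous_intros)
    show "0 \<le> g (snd p)" for p by (rule g_nonneg)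
    fix p assume p: "p \<in> Z" and g0: "g (snd p) = 0"
    have "cmat G *v snd p = 0" using Cg(2)[of "snd p"] g0 by simp
    then have "snd p \<in> kerC L" using Gker by (auto simp: kerC_def)
    then have p': "snd p \<in> Xspace Q R (fst p) \<inter> kerC L" "snd p \<noteq> 0" "norm (fst p) = 1"
      using p by (auto simp: Z_def Xspace_def)
    then have "0 < (cmat (sym_part (K (fst p) ** symbol A (fst p))) *v snd p) \<bullet> snd p"
      using Kpos[OF p'(3)] unfolding pos_on_iff by blast
    then show "0 < f (fst p) (snd p)" by (simp add: cmat_inner_sym_part f_def)
  qed
  then obtain N c1 where N: "N > 0" and c1: "c1 > 0" "\<And>p. p \<in> Z \<Longrightarrow> c1 \<le> f (fst p) (snd p) + N * g (snd p)"
    by blast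
  have f_lower: "c1 * (norm x)\<^sup>2 \<le> f \<omega> x + N * g x" if \<omega>: "norm \<omega> = 1" and x: "x \<in> Xspace Q R \<omega>" for \<omega> x
  proof (cases "x = 0")
    case True then show ?thesis by (simp add: f_def g_def)
  next
    case False
    define z where "z = (1 / norm x) *\<^sub>R x"
    have "(\<omega>, z) \<in> Z" using \<omega> x False by (simp add: Z_def Xspace_def z_def cmat_mv_scaleR)
    from c1(2)[OF this] have "c1 \<le> (1 / norm x)\<^sup>2 * (f \<omega> x + N * g x)"
      by (simp add: f_def g_def z_def cmat_mv_scaleR power2_eq_square algebra_simps)
    then show ?thesis using False by (simp add: field_simps power_divide)
  qed
  \<comment> \<open>Small enough for \<open>g\<close> to absorb two costs of the K-term: the
    multiple \<open>N * g\<close> from \<open>f_lower\<close>, and the part of the cross term with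
    \<open>L x\<close> that the AM-GM inequality leaves to \<open>g\<close>.\<close>
  define \<epsilon> where "\<epsilon> = 1 / (1 + N + kk\<^sup>2 * N' / (2 * c1))"
  have kn: "kk\<^sup>2 * N' / (2 * c1) > 0" using kk(1) N' c1(1) by simp
  have eps: "0 < \<epsilon>" "\<epsilon> \<le> 1" "\<epsilon> * (N + kk\<^sup>2 * N' / (2 * c1)) \<le> 1"
    using N kn by (auto simp: \<epsilon>_def field_simps)
  \<comment> \<open>Large enough for \<open>M A0\<close> to dominate the \<open>S\<close> and
    K-terms with |x|^2 to spare; the leading 1 ensures \<open>M \<ge> 1\<close>.\<close>
  define M where "M = 1 + (s + kA + 1) / a"
  have M: "M \<ge> 1" "M * a \<ge> s + kA + 1" using a(1) s(1) kA(1) by (auto simp: M_def field_simps)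
  define b where "b = M * a' + s + kA"
  have b: "b > 0" using M a'(1) s(1) kA(1) by (simp add: b_def add_pos_pos)
  \<comment> \<open>Half of \<epsilon> \<open>c1\<close> \<rho> |x|^2 survives, and |x|^2 is at
    least \<open>B x x / b\<close>.\<close>
  define c where "c = \<epsilon> * c1 / (2 * b)"
  have c: "c > 0" using eps c1 b by (simp add: c_def)
  show ?thesis
  proof (rule exI[of _ b], intro conjI b, rule exI[of _ c], intro conjI c allI impI)
    fix \<omega> :: "real^'n" and r :: real assume \<omega>: "norm \<omega> = 1" and r: "r \<ge> 0"
    \<comment> \<open>Bounded by 1, so the K-term stays a bounded perturbation, and
      \<open>q * r\<close> equals \<rho>.\<close>
    define q where "q = r / (1 + r\<^sup>2)"
    define \<rho> where "\<rho> = r\<^sup>2 / (1 + r\<^sup>2)"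
    have r1: "1 + r\<^sup>2 > 0" by (simp add: add_pos_nonneg)
    have q: "0 \<le> q" "q \<le> 1"
      using r r1 sum_squares_bound[of r 1] by (auto simp: q_def field_simps power2_eq_square)
    have \<rho>: "0 \<le> \<rho>" "\<rho> \<le> 1" using r1 by (auto simp: \<rho>_def field_simps)
    define T where "T x = M *\<^sub>R (cmat A0 *v x) + cmat (S ** A0) *v x - (\<epsilon> * q) *\<^sub>R (\<i> *s (cmat (K \<omega> ** A0) *v x))"
      for x :: "complex^'m"
    have Tlin: "bounded_linear T"
      unfolding linear_conv_bounded_linear[symmetric]
      by (rule linearI) (simp_all add: T_def cmat_mv_add i_add cmat_mv_scaleR i_scaleR algebra_simps)
    define B where "B x y = T x \<bullet> y" for x y
    show "\<exists>B :: complex^'m \<Rightarrow> complex^'m \<Rightarrow> real. bounded_bilinear B \<and> (\<forall>x y. B x y = B y x) \<and>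
      (\<forall>x. (norm x)\<^sup>2 \<le> B x x \<and> B x x \<le> b * (norm x)\<^sup>2) \<and>
      (\<forall>x y. cmat A0 *v y = - pencil A L (r *\<^sub>R \<omega>) x \<longrightarrow> pencil Q R (r *\<^sub>R \<omega>) x = 0 \<longrightarrow>
         B y x \<le> - c * (r\<^sup>2 / (1 + r\<^sup>2)) * B x x)"
    proof (intro exI[of _ B] conjI allI impI)
      show "bounded_bilinear B"
        unfolding B_def using bounded_bilinear.comp1[OF bounded_bilinear_inner Tlin] .
      show "B x y = B y x" for x y
      proof -
        have "(cmat A0 *v x) \<bullet> y = (cmat A0 *v y) \<bullet> x"
          using cmat_inner[of A0 x y] A0sym by (simp add: inner_commute)
        moreover have "(cmat (S ** A0) *v x) \<bullet> y = (cmat (S ** A0) *v y) \<bullet> x"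
          using cmat_inner[of "S ** A0" x y] SAsym by (simp add: inner_commute)
        moreover have "(\<i> *s (cmat (K \<omega> ** A0) *v x)) \<bullet> y = (\<i> *s (cmat (K \<omega> ** A0) *v y)) \<bullet> x"
        proof -
          have "(\<i> *s (cmat (K \<omega> ** A0) *v x)) \<bullet> y = - ((cmat (K \<omega> ** A0) *v x) \<bullet> (\<i> *s y))"
            by (rule inner_i)
          also have "\<dots> = x \<bullet> (\<i> *s (cmat (K \<omega> ** A0) *v y))"
            unfolding cmat_inner Kskew[OF \<omega>] by (simp add: cmat_minus_mv cmat_mv_cmult)
          finally show ?thesis by (simp add: inner_commute)
        qed
        ultimately show ?thesis by (simp add: B_def T_def inner_diff_left inner_add_left)
      qed
      fix x
      have sB: "\<bar>(cmat (S ** A0) *v x) \<bullet> x\<bar> \<le> s * (norm x)\<^sup>2"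
        using Cauchy_Schwarz_ineq2[of "cmat (S ** A0) *v x" x] mult_right_mono[OF s(2)[of x] norm_ge_zero[of x]]
        by (simp add: power2_eq_square mult_ac)
      have "\<bar>(\<i> *s (cmat (K \<omega> ** A0) *v x)) \<bullet> x\<bar> \<le> kA * (norm x)\<^sup>2"
        using Cauchy_Schwarz_ineq2[of "\<i> *s (cmat (K \<omega> ** A0) *v x)" x] mult_right_mono[OF kA(2)[OF \<omega>, of x] norm_ge_zero[of x]]
        by (simp add: power2_eq_square mult_ac)
      then have "\<bar>\<epsilon> * q\<bar> * \<bar>(\<i> *s (cmat (K \<omega> ** A0) *v x)) \<bullet> x\<bar> \<le> 1 * (kA * (norm x)\<^sup>2)"
        using eps q kA(1) by (intro mult_mono) (auto simp: abs_mult intro: mult_le_one)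
      then have KB: "\<bar>\<epsilon> * q * ((\<i> *s (cmat (K \<omega> ** A0) *v x)) \<bullet> x)\<bar> \<le> kA * (norm x)\<^sup>2"
        by (simp add: abs_mult)
      have Bxx: "B x x = M * ((cmat A0 *v x) \<bullet> x) + (cmat (S ** A0) *v x) \<bullet> x - \<epsilon> * q * ((\<i> *s (cmat (K \<omega> ** A0) *v x)) \<bullet> x)"
        by (simp add: B_def T_def inner_diff_left inner_add_left)
      have "(s + kA + 1) * (norm x)\<^sup>2 \<le> M * a * (norm x)\<^sup>2" by (intro mult_right_mono M) auto
      also have "\<dots> \<le> M * ((cmat A0 *v x) \<bullet> x)"
        unfolding mult.assoc using M by (intro mult_left_mono a) auto
      finally show "(norm x)\<^sup>2 \<le> B x x" using sB KB unfolding Bxx by (simp add: distrib_right abs_le_iff)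
      have "(cmat A0 *v x) \<bullet> x \<le> a' * (norm x)\<^sup>2"
        using norm_cauchy_schwarz[of "cmat A0 *v x" x] mult_right_mono[OF a'(2)[of x] norm_ge_zero[of x]]
        by (simp add: power2_eq_square mult_ac)
      then have "M * ((cmat A0 *v x) \<bullet> x) \<le> M * (a' * (norm x)\<^sup>2)" using M by (intro mult_left_mono) auto
      then show Bb: "B x x \<le> b * (norm x)\<^sup>2" using sB KB unfolding Bxx b_def by (simp add: distrib_right abs_le_iff)
      fix y
      assume y: "cmat A0 *v y = - pencil A L (r *\<^sub>R \<omega>) x" and con: "pencil Q R (r *\<^sub>R \<omega>) x = 0"
      have A0y: "cmat A0 *v y = - (r *\<^sub>R (\<i> *s (cmat (symbol A \<omega>) *v x))) - cmat L *v x"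
        unfolding y pencil_def by (simp add: symbol_scaleR cmat_scaleR_mv i_scaleR)
      have Rx: "r *\<^sub>R (\<i> *s (cmat (symbol Q \<omega>) *v x)) = - (cmat R *v x)"
        using con unfolding pencil_def by (simp add: symbol_scaleR cmat_scaleR_mv i_scaleR add_eq_0_iff)
      have Pi: "cmat (Pi1 R) *v (cmat R *v x) = cmat R *v x"
        by (rule Pi1_image) (simp add: imageC_def)
      have t1: "(cmat A0 *v y) \<bullet> x = - ((cmat L *v x) \<bullet> x)"
        unfolding A0y using inner_i_symmetric[OF Asym, of \<omega> x] by (simp add: inner_diff_left)
      \<comment> \<open>By the constraint \<open>r\<close> times the imaginary unit times
        \<open>Pi1 Q(\<omega>) x\<close> equals \<open>- R x\<close>, so the contribution of
        \<open>T_matrix\<close> becomes the nonnegative form of \<open>St\<close> at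
        \<open>R x\<close>. The condition on the skew part says that the contribution of
        \<open>S A(\<omega>)\<close> is at least as large.\<close>
      have t2: "(cmat (S ** A0) *v y) \<bullet> x \<le> - ((cmat (S ** L) *v x) \<bullet> x)"
      proof -
        obtain St :: "real^'p^'p" where St: "nonneg_on (cmat (sym_part St)) (imageC R)"
          and sk: "nonneg_on (map_matrix (\<lambda>x. \<i> * complex_of_real x) (skew_part (S ** symbol A \<omega> - T_matrix Q R St \<omega>))) UNIV"
          using S2 \<omega> unfolding condition_S2_def by auto
        have ge: "(\<i> *s (cmat (S ** symbol A \<omega>) *v x)) \<bullet> x \<ge> (\<i> *s (cmat (T_matrix Q R St \<omega>) *v x)) \<bullet> x"
        proof -
          have "0 \<le> (\<i> *s (cmat (S ** symbol A \<omega> - T_matrix Q R St \<omega>) *v x)) \<bullet> x"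
            using sk by (simp add: nonneg_on_iff i_map_matrix inner_i_skew_part)
          also have "\<dots> = (\<i> *s (cmat (S ** symbol A \<omega>) *v x)) \<bullet> x - (\<i> *s (cmat (T_matrix Q R St \<omega>) *v x)) \<bullet> x"
            using i_add[of "cmat (S ** symbol A \<omega>) *v x" "- (cmat (T_matrix Q R St \<omega>) *v x)"]
            by (simp add: cmat_diff_mv inner_diff_left)
          finally show ?thesis by simp
        qed
        define v where "v = cmat St *v (cmat R *v x)"
        define P where "P = Pi1 R ** symbol Q \<omega>"
        have "r *\<^sub>R (\<i> *s (cmat P *v x)) = cmat (Pi1 R) *v (r *\<^sub>R (\<i> *s (cmat (symbol Q \<omega>) *v x)))"
          by (simp add: P_def cmat_mult_mv cmat_mv_scaleR cmat_mv_cmult)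
        also have "\<dots> = - (cmat R *v x)" unfolding Rx by (simp add: cmat_mv_minus Pi)
        finally have rP: "r *\<^sub>R (\<i> *s (cmat P *v x)) = - (cmat R *v x)" .
        have "r * ((\<i> *s (cmat (T_matrix Q R St \<omega>) *v x)) \<bullet> x) = r * ((\<i> *s v) \<bullet> (cmat P *v x))"
          using cmat_inner[of "transpose P" "\<i> *s v" x]
          by (simp add: T_matrix_def P_def v_def cmat_mult_mv cmat_mv_cmult matrix_mul_assoc[symmetric])
        also have "\<dots> = - (v \<bullet> (r *\<^sub>R (\<i> *s (cmat P *v x))))" by (simp add: inner_i[of v])
        also have "\<dots> = v \<bullet> (cmat R *v x)" unfolding rP by simp
        also have "\<dots> = (cmat (sym_part St) *v (cmat R *v x)) \<bullet> (cmat R *v x)"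
          by (simp add: v_def cmat_inner_sym_part)
        also have "\<dots> \<ge> 0" using St by (simp add: nonneg_on_iff imageC_def)
        finally have "0 \<le> r * ((\<i> *s (cmat (T_matrix Q R St \<omega>) *v x)) \<bullet> x)" .
        also have "\<dots> \<le> r * ((\<i> *s (cmat (S ** symbol A \<omega>) *v x)) \<bullet> x)" by (intro mult_left_mono ge r)
        finally have "0 \<le> r * ((\<i> *s (cmat (S ** symbol A \<omega>) *v x)) \<bullet> x)" .
        moreover have "(cmat (S ** A0) *v y) \<bullet> x = - (r * ((\<i> *s (cmat (S ** symbol A \<omega>) *v x)) \<bullet> x)) - (cmat (S ** L) *v x) \<bullet> x"
          unfolding cmat_mult_mv A0y
          using cmat_mv_add[of S "- (r *\<^sub>R (\<i> *s (cmat (symbol A \<omega>) *v x)))" "- (cmat L *v x)"]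
          by (simp add: cmat_mv_minus cmat_mv_scaleR cmat_mv_cmult inner_diff_left)
        ultimately show ?thesis by simp
      qed
      have t3: "- ((\<i> *s (cmat (K \<omega> ** A0) *v y)) \<bullet> x) = - (r * f \<omega> x) + (\<i> *s (cmat (K \<omega>) *v (cmat L *v x))) \<bullet> x"
        unfolding cmat_mult_mv A0y f_def
        using cmat_mv_add[of "K \<omega>" "- (r *\<^sub>R (\<i> *s (cmat (symbol A \<omega>) *v x)))" "- (cmat L *v x)"]
          i_add[of "r *\<^sub>R (\<i> *s (cmat (K \<omega>) *v (cmat (symbol A \<omega>) *v x)))" "cmat (K \<omega>) *v (cmat L *v x)"]
        by (simp add: cmat_mv_minus cmat_mv_scaleR cmat_mv_cmult i_scaleR inner_add_left inner_diff_left
            minus_add_distrib[symmetric] del: minus_add_distrib)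
      have t4: "(\<i> *s (cmat (K \<omega>) *v (cmat L *v x))) \<bullet> x \<le> kk * norm (cmat L *v x) * norm x"
        using norm_cauchy_schwarz[of "\<i> *s (cmat (K \<omega>) *v (cmat L *v x))" x] mult_right_mono[OF kk(2)[OF \<omega>, of "cmat L *v x"] norm_ge_zero[of x]]
        by simp
      have qr: "q * r = \<rho>" by (simp add: q_def \<rho>_def power2_eq_square)
      have Byx: "B y x \<le> - g x - \<epsilon> * (\<rho> * f \<omega> x) + \<epsilon> * (q * (kk * norm (cmat L *v x) * norm x))"
      proof -
        have "B y x = M * ((cmat A0 *v y) \<bullet> x) + (cmat (S ** A0) *v y) \<bullet> x + \<epsilon> * q * (- ((\<i> *s (cmat (K \<omega> ** A0) *v y)) \<bullet> x))"
          by (simp add: B_def T_def inner_diff_left inner_add_left)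
        \<comment> \<open>As \<open>M \<ge> 1\<close>, at least one copy of the form of
          \<open>L\<close> survives; with the form of \<open>S L\<close> from \<open>t2\<close> it
          makes up \<open>g\<close>.\<close>
        also have "M * ((cmat A0 *v y) \<bullet> x) \<le> - ((cmat L *v x) \<bullet> x)"
          unfolding t1 using mult_right_mono[OF M(1) Lnn[of x]] by simp
        also have "\<epsilon> * q * (- ((\<i> *s (cmat (K \<omega> ** A0) *v y)) \<bullet> x)) \<le> \<epsilon> * q * (- (r * f \<omega> x) + kk * norm (cmat L *v x) * norm x)"
          unfolding t3 using eps q t4 by (intro mult_left_mono) auto
        also have "\<dots> = - \<epsilon> * (\<rho> * f \<omega> x) + \<epsilon> * (q * (kk * norm (cmat L *v x) * norm x))"
          by (simp add: qr[symmetric] algebra_simps)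
        finally show ?thesis using t2 unfolding g_eq by simp
      qed
      \<comment> \<open>\<open>Pi2 R\<close> applied to the constraint kills \<open>R x\<close>, so
        for nonzero \<open>r\<close> the vector lies in \<open>Xspace\<close> and
        \<open>f_lower\<close> applies. For \<open>r = 0\<close> the weight \<rho> vanishes.\<close>
      have f1: "\<rho> * (c1 * (norm x)\<^sup>2 - N * g x) \<le> \<rho> * f \<omega> x"
      proof (cases "r = 0")
        case True then show ?thesis by (simp add: \<rho>_def)
      next
        case False
        have "r *\<^sub>R (\<i> *s (cmat (Pi2 R ** symbol Q \<omega>) *v x)) = cmat (Pi2 R) *v (r *\<^sub>R (\<i> *s (cmat (symbol Q \<omega>) *v x)))"
          by (simp add: cmat_mult_mv cmat_mv_scaleR cmat_mv_cmult)
        also have "\<dots> = 0" unfolding Rx by (simp add: Pi2_def cmat_diff_mv cmat_mv_minus Pi)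
        finally have "norm (cmat (Pi2 R ** symbol Q \<omega>) *v x) = 0" using False
          by (metis norm_i norm_zero scaleR_eq_0_iff)
        then have "x \<in> Xspace Q R \<omega>" by (simp add: Xspace_def)
        from f_lower[OF \<omega> this] show ?thesis using \<rho>(1) by (intro mult_left_mono) auto
      qed
      have f2: "q * (kk * norm (cmat L *v x) * norm x) \<le> \<rho> * (c1 / 2 * (norm x)\<^sup>2) + kk\<^sup>2 * N' / (2 * c1) * g x"
      proof -
        \<comment> \<open>AM--GM for \<open>c1 * r * norm x\<close> and \<open>kk * norm (L x)\<close>\<close>
        have "2 * (c1 * (r * norm x)) * (kk * norm (cmat L *v x)) \<le> (c1 * (r * norm x))\<^sup>2 + (kk * norm (cmat L *v x))\<^sup>2"
          by (rule sum_squares_bound)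
        then have "r * (kk * norm (cmat L *v x) * norm x) \<le> r\<^sup>2 * (c1 / 2 * (norm x)\<^sup>2) + kk\<^sup>2 / (2 * c1) * (norm (cmat L *v x))\<^sup>2"
          using c1(1) by (simp add: field_simps power2_eq_square)
        also have "kk\<^sup>2 / (2 * c1) * (norm (cmat L *v x))\<^sup>2 \<le> kk\<^sup>2 / (2 * c1) * (N' * g x)"
          using c1(1) by (intro mult_left_mono L_g) auto
        \<comment> \<open>The factor \<open>1 + r^2\<close> anticipates the division by it, after
          which the coefficient of \<open>g x\<close> no longer depends on \<open>r\<close>.\<close>
        also have "kk\<^sup>2 / (2 * c1) * (N' * g x) \<le> (1 + r\<^sup>2) * (kk\<^sup>2 * N' / (2 * c1) * g x)"
        proof -
          have "0 \<le> kk\<^sup>2 * N' / (2 * c1) * g x" by (intro mult_nonneg_nonneg less_imp_le[OF kn] g_nonneg)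
          then have "1 * (kk\<^sup>2 * N' / (2 * c1) * g x) \<le> (1 + r\<^sup>2) * (kk\<^sup>2 * N' / (2 * c1) * g x)"
            by (intro mult_right_mono) auto
          then show ?thesis by simp
        qed
        finally have "r * (kk * norm (cmat L *v x) * norm x) / (1 + r\<^sup>2) \<le> (r\<^sup>2 * (c1 / 2 * (norm x)\<^sup>2) + (1 + r\<^sup>2) * (kk\<^sup>2 * N' / (2 * c1) * g x)) / (1 + r\<^sup>2)"
          using r1 by (intro divide_right_mono) auto
        also have "\<dots> = \<rho> * (c1 / 2 * (norm x)\<^sup>2) + kk\<^sup>2 * N' / (2 * c1) * g x"
          using r1 by (simp add: \<rho>_def add_divide_distrib)
        finally show ?thesis by (simp add: q_def)
      qed
      have "B y x \<le> - g x - \<epsilon> * (\<rho> * (c1 * (norm x)\<^sup>2 - N * g x)) + \<epsilon> * (\<rho> * (c1 / 2 * (norm x)\<^sup>2) + kk\<^sup>2 * N' / (2 * c1) * g x)"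
        using Byx mult_left_mono[OF f1, of \<epsilon>] mult_left_mono[OF f2, of \<epsilon>] eps(1) by linarith
      also have "\<dots> = - \<epsilon> * c1 / 2 * \<rho> * (norm x)\<^sup>2 - (1 - \<epsilon> * (\<rho> * N + kk\<^sup>2 * N' / (2 * c1))) * g x"
        by (simp add: field_simps)
      also have "\<dots> \<le> - \<epsilon> * c1 / 2 * \<rho> * (norm x)\<^sup>2"
      proof -
        have "\<epsilon> * (\<rho> * N + kk\<^sup>2 * N' / (2 * c1)) \<le> \<epsilon> * (N + kk\<^sup>2 * N' / (2 * c1))"
          using eps(1) \<rho> N by (intro mult_left_mono add_mono) (auto simp: mult_left_le_one_le)
        then have "0 \<le> (1 - \<epsilon> * (\<rho> * N + kk\<^sup>2 * N' / (2 * c1))) * g x"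
          using eps(3) g_nonneg by (intro mult_nonneg_nonneg) auto
        then show ?thesis by linarith
      qed
      also have "\<dots> = - (c * \<rho>) * (b * (norm x)\<^sup>2)" using b by (simp add: c_def)
      also have "\<dots> \<le> - (c * \<rho>) * B x x"
        using Bb c \<rho> by (intro mult_left_mono_neg) auto
      finally show "B y x \<le> - c * (r\<^sup>2 / (1 + r\<^sup>2)) * B x x" by (simp add: \<rho>_def)
    qed
  qed
qed

section \<open>Linear evolution equations\<close>

text \<open>The exponential of \<open>t M\<close> applied to \<open>w\<close>, summed as a series of
  vectors. It is defined for all real \<open>t\<close>, so derivatives at 0 are two-sided.\<close>

definition exp_orbit :: "(complex^'m \<Rightarrow> complex^'m) \<Rightarrow> complex^'m \<Rightarrow> real \<Rightarrow> complex^'m" where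
  "exp_orbit M w t = (\<Sum>k. (t ^ k / fact k) *\<^sub>R ((M ^^ k) w))"

lemma has_vector_derivative_vec:
  fixes f :: "real \<Rightarrow> ('b::real_normed_vector)^'m"
  assumes "\<And>i. ((\<lambda>t. f t $ i) has_vector_derivative D $ i) F"
  shows "(f has_vector_derivative D) F"
proof -
  have bl: "bounded_linear (\<lambda>x :: 'b. axis i x :: 'b^'m)" for i
  proof (rule bounded_linear_intro[where K=1])
    show "norm (axis i x :: 'b^'m) \<le> norm x * 1" for x :: 'b
    proof -
      have "(norm (axis i x :: 'b^'m))\<^sup>2 = (\<Sum>j\<in>UNIV. if j = i then (norm x)\<^sup>2 else 0)"
        unfolding norm_vec_sq by (intro sum.cong) (auto simp: axis_def)
      then have "(norm (axis i x :: 'b^'m))\<^sup>2 = (norm x)\<^sup>2" by simp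
      then show ?thesis by simp
    qed
  qed (simp_all add: vec_eq_iff axis_def)
  have ex: "(\<Sum>i\<in>UNIV. axis i (x $ i)) = x" for x :: "'b^'m"
    by (simp add: vec_eq_iff axis_def if_distrib cong: if_cong)
  have "((\<lambda>t. \<Sum>i\<in>UNIV. axis i (f t $ i)) has_vector_derivative (\<Sum>i\<in>UNIV. axis i (D $ i))) F"
    by (intro has_vector_derivative_sum bounded_linear.has_vector_derivative[OF bl] assms)
  then show ?thesis by (simp add: ex)
qed

text \<open>Each component is a complex power series in t with fixed coefficients taken from the
  vectors M^k w, and |M^k w| \<le> |w| B^k makes it converge everywhere; termwise differentiation
  does the rest. Only real linearity of \<open>M\<close> enters.\<close>

lemma
  assumes M: "bounded_linear M"
  shows exp_orbit_deriv: "(exp_orbit M w has_vector_derivative M (exp_orbit M w t)) (at t)"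
    and exp_orbit_0: "exp_orbit M w 0 = w"
proof -
  obtain B where B: "B > 0" "\<And>z. norm (M z) \<le> norm z * B"
    using bounded_linear.pos_bounded[OF M] by blast
  have pow: "norm ((M ^^ k) z) \<le> norm z * B ^ k" for k z
  proof (induction k)
    case (Suc k)
    have "norm ((M ^^ Suc k) z) \<le> norm ((M ^^ k) z) * B" using B(2) by simp
    also have "\<dots> \<le> norm z * B ^ k * B" using Suc B(1) by (intro mult_right_mono) auto
    finally show ?case by (simp add: mult_ac)
  qed simp
  have sumble: "summable (\<lambda>k. norm ((s ^ k / fact k) *\<^sub>R ((M ^^ k) z)))" for s z
  proof (rule summable_comparison_test'[where N=0])
    show "summable (\<lambda>k. norm z * ((\<bar>s\<bar> * B) ^ k /\<^sub>R fact k))"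
      by (intro summable_mult summable_exp_generic)
    show "norm (norm ((s ^ k / fact k) *\<^sub>R ((M ^^ k) z))) \<le> norm z * ((\<bar>s\<bar> * B) ^ k /\<^sub>R fact k)" for k
    proof -
      have "\<bar>s ^ k / fact k\<bar> * norm ((M ^^ k) z) \<le> \<bar>s ^ k / fact k\<bar> * (norm z * B ^ k)"
        by (intro mult_left_mono pow) auto
      then show ?thesis by (simp add: power_abs abs_mult power_mult_distrib field_simps)
    qed
  qed
  have sumb: "summable (\<lambda>k. (s ^ k / fact k) *\<^sub>R ((M ^^ k) z))" for s z
    by (rule summable_norm_cancel[OF sumble])
  show "exp_orbit M w 0 = w"
  proof -
    have "exp_orbit M w 0 = (\<Sum>k\<in>{0}. (0 ^ k / fact k) *\<^sub>R ((M ^^ k) w))"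
      unfolding exp_orbit_def by (rule suminf_finite) auto
    then show ?thesis by simp
  qed
  have Mexp: "M (exp_orbit M w t) = (\<Sum>k. (t ^ k / fact k) *\<^sub>R ((M ^^ Suc k) w))"
    unfolding exp_orbit_def
    by (subst bounded_linear.suminf[OF M sumb]) (simp add: linear_cmul[OF bounded_linear.linear[OF M]])
  show "(exp_orbit M w has_vector_derivative M (exp_orbit M w t)) (at t)"
  proof (rule has_vector_derivative_vec)
    fix i
    have comp: "(\<Sum>k. (s ^ k / fact k) *\<^sub>R z k) $ i = (\<Sum>k. (z k $ i / fact k) * complex_of_real s ^ k)"
      if "summable (\<lambda>k. (s ^ k / fact k) *\<^sub>R z k)" for s and z :: "nat \<Rightarrow> complex^'a"
    proof -
      have "(\<Sum>k. (s ^ k / fact k) *\<^sub>R z k) $ i = (\<Sum>k. ((s ^ k / fact k) *\<^sub>R z k) $ i)"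
        by (rule bounded_linear.suminf[OF bounded_linear_vec_nth that])
      also have "\<dots> = (\<Sum>k. (z k $ i / fact k) * complex_of_real s ^ k)"
        by (simp add: scaleR_conv_of_real[where 'a=complex] mult_ac)
      finally show ?thesis .
    qed
    define c where "c k = (M ^^ k) w $ i / fact k" for k
    have sc: "summable (\<lambda>k. c k * y ^ k)" for y
    proof (rule summable_norm_cancel, rule summable_comparison_test'[where N=0])
      show "summable (\<lambda>k. norm ((norm y ^ k / fact k) *\<^sub>R ((M ^^ k) w)))" by (rule sumble)
      show "norm (norm (c k * y ^ k)) \<le> norm ((norm y ^ k / fact k) *\<^sub>R ((M ^^ k) w))" for k
      proof -
        have "norm ((M ^^ k) w $ i) * (norm y ^ k / fact k) \<le> norm ((M ^^ k) w) * (norm y ^ k / fact k)"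
          by (intro mult_right_mono) (auto simp: norm_vec_def intro!: member_le_L2_set[of UNIV])
        then show ?thesis by (simp add: c_def norm_mult norm_divide norm_power mult_ac)
      qed
    qed
    have "((\<lambda>x. \<Sum>n. c n * x ^ n) has_field_derivative (\<Sum>n. diffs c n * complex_of_real t ^ n)) (at (complex_of_real t))"
      by (rule termdiffs_strong_converges_everywhere[OF sc])
    from has_vector_derivative_real_field[OF this]
    have "((\<lambda>s. \<Sum>n. c n * complex_of_real s ^ n) has_vector_derivative (\<Sum>n. diffs c n * complex_of_real t ^ n)) (at t)" .
    moreover have "exp_orbit M w s $ i = (\<Sum>n. c n * complex_of_real s ^ n)" for s
      unfolding exp_orbit_def comp[OF sumb] c_def ..
    moreover have "diffs c = (\<lambda>n. (M ^^ Suc n) w $ i / fact n)"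
      by (simp add: fun_eq_iff diffs_def c_def field_simps del: of_nat_Suc)
    moreover have "summable (\<lambda>k. (t ^ k / fact k) *\<^sub>R ((M ^^ Suc k) w))"
      using sumb[of t "M w"] by (simp add: funpow_swap1)
    from comp[OF this] have "M (exp_orbit M w t) $ i = (\<Sum>n. ((M ^^ Suc n) w $ i / fact n) * complex_of_real t ^ n)"
      unfolding Mexp .
    ultimately show "((\<lambda>t. exp_orbit M w t $ i) has_vector_derivative M (exp_orbit M w t) $ i) (at t)" by simp
  qed
qed

lemma unit_direction:
  fixes \<xi> :: "real^'n"
  obtains \<omega> where "norm \<omega> = 1" "\<xi> = norm \<xi> *\<^sub>R \<omega>"
proof (cases "\<xi> = 0")
  case True then show ?thesis using that[of "axis undefined 1"] by simp
next
  case False then show ?thesis using that[of "\<xi> /\<^sub>R norm \<xi>"] by simp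
qed

text \<open>\<open>condition_C_pencil\<close> says that the constraint operator annihilates the
  right-hand side of the equation, so the constraint value has derivative 0.\<close>

lemma constraint_conserved:
  fixes A0 L :: "real^'m^'m" and A :: "'n::finite \<Rightarrow> real^'m^'m"
    and Q :: "'n \<Rightarrow> real^'m^'p" and R :: "real^'m^'p"
  assumes A: "condition_A A0 A L" and C: "condition_C A0 A L Q R"
    and w: "\<And>t. (w has_vector_derivative w' t) (at t)" "\<And>t. cmat A0 *v w' t = - pencil A L \<xi> (w t)"
  shows "pencil Q R \<xi> (w t) = pencil Q R \<xi> (w 0)"
proof -
  have "pencil Q R \<xi> (w' t) = 0" for t
  proof -
    have "w' t = cmat (matrix_inv A0) *v (cmat A0 *v w' t)"
      by (simp add: condition_A_invertible[OF A] flip: cmat_mult_mv)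
    then have "w' t = - (cmat (matrix_inv A0) *v pencil A L \<xi> (w t))" by (simp add: w(2) cmat_mv_minus)
    then show ?thesis
      using condition_C_pencil[OF C, of \<xi> "w t"] linear_neg[OF bounded_linear.linear[OF bounded_linear_pencil[of Q R \<xi>]]] by simp
  qed
  then have d0: "((\<lambda>t. pencil Q R \<xi> (w t)) has_vector_derivative 0) (at t)" for t
    using bounded_linear.has_vector_derivative[OF bounded_linear_pencil w(1), of Q R \<xi> t] by simp
  show ?thesis
  proof (rule has_vector_derivative_zero_constant[OF convex_UNIV d0])
    fix c assume "\<And>t. t \<in> UNIV \<Longrightarrow> pencil Q R \<xi> (w t) = c"
    then show "pencil Q R \<xi> (w t) = pencil Q R \<xi> (w 0)" by simp
  qed
qed

text \<open>Along a constrained trajectory the derivative of \<open>B w w\<close> is at most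
  \<open>- 2 c \<rho>\<close> times \<open>B w w\<close>, so the exponentially weighted form
  \<open>F\<close> does not increase. Passing to the norm turns \<open>b\<close> into
  \<open>sqrt b\<close> and the rate \<open>2 c\<close> into \<open>c\<close>.\<close>

theorem fourier_decay:
  fixes A0 L S :: "real^'m^'m" and A :: "'n::finite \<Rightarrow> real^'m^'m"
    and Q :: "'n \<Rightarrow> real^'m^'p" and R :: "real^'m^'p"
  assumes A: "condition_A A0 A L" and C: "condition_C A0 A L Q R"
    and S: "condition_S S A0 L" and S2: "condition_S2 S A Q R" and K: "condition_K A0 A L Q R"
  shows "\<exists>C>0. \<exists>c>0. \<forall>\<xi> w w'. (\<forall>t. (w has_vector_derivative w' t) (at t)) \<longrightarrow>
     (\<forall>t. cmat A0 *v w' t = - pencil A L \<xi> (w t)) \<longrightarrow> pencil Q R \<xi> (w 0) = 0 \<longrightarrow>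
     (\<forall>t\<ge>0. norm (w t) \<le> C * exp (- c * rho \<xi> * t) * norm (w 0))"
proof -
  obtain b c where bc: "b > 0" "c > 0" and lyap: "\<And>\<omega> :: real^'n. \<And> r. norm \<omega> = 1 \<Longrightarrow> r \<ge> 0 \<Longrightarrow>
    (\<exists>B :: complex^'m \<Rightarrow> complex^'m \<Rightarrow> real. bounded_bilinear B \<and> (\<forall>x y. B x y = B y x) \<and>
      (\<forall>x. (norm x)\<^sup>2 \<le> B x x \<and> B x x \<le> b * (norm x)\<^sup>2) \<and>
      (\<forall>x y. cmat A0 *v y = - pencil A L (r *\<^sub>R \<omega>) x \<longrightarrow> pencil Q R (r *\<^sub>R \<omega>) x = 0 \<longrightarrow>
         B y x \<le> - c * (r\<^sup>2 / (1 + r\<^sup>2)) * B x x))"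
    using lyapunov_functional[OF A S S2 K] by blast
  have "norm (w t) \<le> sqrt b * exp (- c * rho \<xi> * t) * norm (w 0)"
    if w: "\<And>t. (w has_vector_derivative w' t) (at t)" "\<And>t. cmat A0 *v w' t = - pencil A L \<xi> (w t)"
      and con: "pencil Q R \<xi> (w 0) = 0" and t: "t \<ge> 0" for \<xi> :: "real^'n" and w w' t
  proof -
    obtain \<omega> :: "real^'n" where \<omega>: "norm \<omega> = 1" "\<xi> = norm \<xi> *\<^sub>R \<omega>" by (rule unit_direction)
    obtain B :: "complex^'m \<Rightarrow> complex^'m \<Rightarrow> real" where B: "bounded_bilinear B" "\<And>x y. B x y = B y x"
      "\<And>x. (norm x)\<^sup>2 \<le> B x x" "\<And>x. B x x \<le> b * (norm x)\<^sup>2"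
      "\<And>x y. cmat A0 *v y = - pencil A L \<xi> x \<Longrightarrow> pencil Q R \<xi> x = 0 \<Longrightarrow> B y x \<le> - c * rho \<xi> * B x x"
      using lyap[OF \<omega>(1), of "norm \<xi>"] unfolding \<omega>(2)[symmetric] rho_def by auto
    have con': "pencil Q R \<xi> (w s) = 0" for s using constraint_conserved[OF A C w] con by simp
    define F where "F s = exp (2 * c * rho \<xi> * s) * B (w s) (w s)" for s
    have "F t \<le> F 0"
    proof (rule DERIV_nonpos_imp_nonincreasing[OF t])
      fix s :: real
      have dB: "((\<lambda>s. B (w s) (w s)) has_real_derivative B (w s) (w' s) + B (w' s) (w s)) (at s)"
        unfolding has_real_derivative_iff_has_vector_derivative
        by (intro bounded_bilinear.has_vector_derivative[OF B(1)] w)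
      have dE: "((\<lambda>s. exp (2 * c * rho \<xi> * s)) has_real_derivative 2 * c * rho \<xi> * exp (2 * c * rho \<xi> * s)) (at s)"
        by (auto intro!: derivative_eq_intros)
      have "(F has_real_derivative
          2 * c * rho \<xi> * exp (2 * c * rho \<xi> * s) * B (w s) (w s) + (B (w s) (w' s) + B (w' s) (w s)) * exp (2 * c * rho \<xi> * s)) (at s)"
        unfolding F_def by (rule DERIV_mult[OF dE dB])
      moreover have "2 * c * rho \<xi> * exp (2 * c * rho \<xi> * s) * B (w s) (w s) + (B (w s) (w' s) + B (w' s) (w s)) * exp (2 * c * rho \<xi> * s) \<le> 0"
      proof -
        have "B (w' s) (w s) \<le> - c * rho \<xi> * B (w s) (w s)" by (rule B(5)[OF w(2) con'])
        then have "2 * (c * rho \<xi> * B (w s) (w s) + B (w' s) (w s)) * exp (2 * c * rho \<xi> * s) \<le> 0"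
          by (intro mult_nonpos_nonneg[OF mult_nonneg_nonpos]) auto
        then show ?thesis by (simp add: B(2)[of "w s" "w' s"] algebra_simps)
      qed
      ultimately show "\<exists>y. (F has_real_derivative y) (at s) \<and> y \<le> 0" by blast
    qed
    then have "exp (2 * c * rho \<xi> * t) * B (w t) (w t) \<le> B (w 0) (w 0)" by (simp add: F_def)
    moreover have "exp (2 * c * rho \<xi> * t) * (norm (w t))\<^sup>2 \<le> exp (2 * c * rho \<xi> * t) * B (w t) (w t)"
      by (intro mult_left_mono B) auto
    ultimately have "exp (2 * c * rho \<xi> * t) * (norm (w t))\<^sup>2 \<le> b * (norm (w 0))\<^sup>2"
      using B(4)[of "w 0"] by linarith
    moreover have "exp (2 * c * rho \<xi> * t) = (exp (c * rho \<xi> * t))\<^sup>2"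
      by (simp add: power2_eq_square flip: exp_add)
    ultimately have "(exp (c * rho \<xi> * t) * norm (w t))\<^sup>2 \<le> (sqrt b * norm (w 0))\<^sup>2"
      using bc by (simp add: power_mult_distrib)
    then have "exp (c * rho \<xi> * t) * norm (w t) \<le> sqrt b * norm (w 0)"
      by (rule power2_le_imp_le) (use bc in auto)
    then show ?thesis by (simp add: exp_minus field_simps)
  qed
  then show ?thesis using bc by (intro exI[of _ "sqrt b"] conjI exI[of _ c]) auto
qed

text \<open>The term with A(\<xi>) drops out of the energy and \<open>L\<close> only dissipates, so
  the constant is independent of \<xi>. Applied to differences it compares trajectories at two
  frequencies and the localised transforms with the exact flow.\<close>

lemma forced_energy_estimate:
  fixes A0 L :: "real^'m^'m" and A :: "'n::finite \<Rightarrow> real^'m^'m"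
  assumes A: "condition_A A0 A L"
  shows "\<exists>C>0. \<forall>\<xi> w w' e T. T \<ge> 0 \<longrightarrow> continuous_on {0..T} w \<longrightarrow> continuous_on {0..T} e \<longrightarrow>
    (\<forall>t. 0 < t \<longrightarrow> t < T \<longrightarrow> (w has_vector_derivative w' t) (at t) \<and> cmat A0 *v w' t = - pencil A L \<xi> (w t) + e t) \<longrightarrow>
    (norm (w T))\<^sup>2 \<le> C * exp T * ((norm (w 0))\<^sup>2 + integral {0..T} (\<lambda>s. (norm (e s))\<^sup>2))"
proof -
  obtain a where a: "a > 0" "\<And>z. a * (norm z)\<^sup>2 \<le> (cmat A0 *v z) \<bullet> z"
    using condition_A_coercive[OF A] by blast
  obtain a' where a': "a' > 0" "\<And>z. norm (cmat A0 *v z) \<le> norm z * a'"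
    using bounded_linear.pos_bounded[OF bounded_linear_cmat[of A0]] by blast
  have A0sym: "transpose A0 = A0" and Asym: "\<And>\<xi>. transpose (symbol A \<xi>) = symbol A \<xi>"
    and Lnn: "\<And>x. (cmat L *v x) \<bullet> x \<ge> 0"
    using A by (auto simp: condition_A_def nonneg_on_iff intro: transpose_symbol)
  define C where "C = (a' + 1 / a) / a"
  have C: "C > 0" using a(1) a'(1) by (simp add: C_def add_pos_pos)
  show ?thesis
  proof (rule exI[of _ C], intro conjI C allI impI)
    fix \<xi> and w w' e :: "real \<Rightarrow> complex^'m" and T :: real
    assume T: "T \<ge> 0" and cw: "continuous_on {0..T} w" and ce: "continuous_on {0..T} e"
      and ode: "\<forall>t. 0 < t \<longrightarrow> t < T \<longrightarrow> (w has_vector_derivative w' t) (at t) \<and> cmat A0 *v w' t = - pencil A L \<xi> (w t) + e t"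
    define N where "N z = (cmat A0 *v z) \<bullet> z" for z
    define I where "I s = integral {0..s} (\<lambda>s. (norm (e s))\<^sup>2)" for s
    \<comment> \<open>Young's inequality splits the work of the forcing into \<open>N w\<close> and
      \<open>|e|^2 / a\<close>; the exponential weight absorbs the first and the subtracted integral
      the second, so \<open>D\<close> does not increase.\<close>
    define D where "D s = exp (- s) * N (w s) - I s / a" for s
    have ce2: "continuous_on {0..T} (\<lambda>s. (norm (e s))\<^sup>2)" by (intro continuous_intros ce)
    have cI: "continuous_on {0..T} I"
      unfolding I_def by (intro indefinite_integral_continuous_1 integrable_continuous_interval ce2)
    have cA: "continuous_on {0..T} (\<lambda>s. cmat A0 *v w s)"
      by (rule bounded_linear.continuous_on[OF bounded_linear_cmat cw])
    have "D T \<le> D 0"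
    proof (rule DERIV_nonpos_imp_decreasing_open[OF T])
      show "continuous_on {0..T} D"
        unfolding D_def N_def using a(1) by (intro continuous_intros cI cw cA) auto
      fix t assume t: "0 < t" "t < T"
      have dw: "(w has_vector_derivative w' t) (at t)" and eq: "cmat A0 *v w' t = - pencil A L \<xi> (w t) + e t"
        using ode t by auto
      have "((\<lambda>s. N (w s)) has_real_derivative (cmat A0 *v w t) \<bullet> w' t + (cmat A0 *v w' t) \<bullet> w t) (at t)"
        unfolding N_def has_real_derivative_iff_has_vector_derivative
        by (intro bounded_bilinear.has_vector_derivative[OF bounded_bilinear_inner] dw
          bounded_linear.has_vector_derivative[OF bounded_linear_cmat dw])
      also have "(cmat A0 *v w t) \<bullet> w' t = (cmat A0 *v w' t) \<bullet> w t"
        using cmat_inner[of A0 "w t" "w' t"] A0sym by (simp add: inner_commute)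
      finally have dN: "((\<lambda>s. N (w s)) has_real_derivative 2 * ((cmat A0 *v w' t) \<bullet> w t)) (at t)" by simp
      have dI: "(I has_real_derivative (norm (e t))\<^sup>2) (at t)"
      proof -
        have "(I has_real_derivative (norm (e t))\<^sup>2) (at t within {0..T})"
          unfolding I_def using t by (intro integral_has_real_derivative ce2) auto
        moreover have "at t within {0..T} = at t" using t by (intro at_within_interior) auto
        ultimately show ?thesis by simp
      qed
      have "2 * ((cmat A0 *v w' t) \<bullet> w t) \<le> N (w t) + (norm (e t))\<^sup>2 / a"
      proof -
        have "(cmat A0 *v w' t) \<bullet> w t = - ((cmat L *v w t) \<bullet> w t) + e t \<bullet> w t"
          unfolding eq pencil_def using inner_i_symmetric[OF Asym, of \<xi> "w t"] by (simp add: inner_add_left inner_diff_left)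
        also have "\<dots> \<le> norm (e t) * norm (w t)" using Lnn[of "w t"] norm_cauchy_schwarz[of "e t" "w t"] by simp
        finally have "2 * a * ((cmat A0 *v w' t) \<bullet> w t) \<le> 2 * (a * norm (w t)) * norm (e t)"
          using a(1) by (simp add: mult_ac)
        also have "\<dots> \<le> (a * norm (w t))\<^sup>2 + (norm (e t))\<^sup>2" by (rule sum_squares_bound)
        also have "(a * norm (w t))\<^sup>2 \<le> a * N (w t)"
          using mult_left_mono[OF a(2)[of "w t"], of a] a(1) by (simp add: N_def power2_eq_square mult_ac)
        finally show ?thesis using a(1) by (simp add: field_simps)
      qed
      then have "exp (- t) * (2 * ((cmat A0 *v w' t) \<bullet> w t)) \<le> exp (- t) * (N (w t) + (norm (e t))\<^sup>2 / a)"
        by (intro mult_left_mono) auto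
      also have "\<dots> \<le> exp (- t) * N (w t) + (norm (e t))\<^sup>2 / a"
        using t a(1) mult_right_mono[of "exp (- t)" 1 "(norm (e t))\<^sup>2 / a"] by (simp add: distrib_left)
      finally have le: "- exp (- t) * N (w t) + 2 * ((cmat A0 *v w' t) \<bullet> w t) * exp (- t) - (norm (e t))\<^sup>2 / a \<le> 0"
        by (simp add: mult_ac)
      have "((\<lambda>s. exp (- s)) has_real_derivative - exp (- t)) (at t)" by (auto intro!: derivative_eq_intros)
      from DERIV_diff[OF DERIV_mult[OF this dN] DERIV_cdivide[OF dI]]
      have "(D has_real_derivative - exp (- t) * N (w t) + 2 * ((cmat A0 *v w' t) \<bullet> w t) * exp (- t) - (norm (e t))\<^sup>2 / a) (at t)"
        unfolding D_def .
      with le show "\<exists>y. (D has_real_derivative y) (at t) \<and> y \<le> 0" by blast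
    qed
    then have "exp (- T) * N (w T) \<le> N (w 0) + I T / a" by (simp add: D_def I_def)
    moreover have "exp T * exp (- T) = (1::real)" by (simp flip: exp_add)
    ultimately have "N (w T) \<le> exp T * (N (w 0) + I T / a)"
      using mult_left_mono[of "exp (- T) * N (w T)" "N (w 0) + I T / a" "exp T"] by (simp flip: mult.assoc)
    moreover have "N (w 0) \<le> a' * (norm (w 0))\<^sup>2"
      unfolding N_def using norm_cauchy_schwarz[of "cmat A0 *v w 0" "w 0"] mult_right_mono[OF a'(2)[of "w 0"] norm_ge_zero[of "w 0"]]
      by (simp add: power2_eq_square mult_ac)
    then have "exp T * (N (w 0) + I T / a) \<le> exp T * (a' * (norm (w 0))\<^sup>2 + I T / a)"
      by (intro mult_left_mono) auto
    ultimately have "a * (norm (w T))\<^sup>2 \<le> exp T * (a' * (norm (w 0))\<^sup>2 + I T / a)"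
      using a(2)[of "w T"] unfolding N_def by linarith
    also have "\<dots> \<le> exp T * ((a' + 1 / a) * ((norm (w 0))\<^sup>2 + I T))"
    proof (rule mult_left_mono)
      have "0 \<le> I T" unfolding I_def by (intro Henstock_Kurzweil_Integration.integral_nonneg integrable_continuous_interval ce2) auto
      then have "a' * (norm (w 0))\<^sup>2 + I T / a + (a' * I T + (norm (w 0))\<^sup>2 / a) \<ge> a' * (norm (w 0))\<^sup>2 + I T / a"
        using a(1) a'(1) by (simp add: add_nonneg_nonneg)
      then show "a' * (norm (w 0))\<^sup>2 + I T / a \<le> (a' + 1 / a) * ((norm (w 0))\<^sup>2 + I T)" by (simp add: algebra_simps)
    qed simp
    finally show "(norm (w T))\<^sup>2 \<le> C * exp T * ((norm (w 0))\<^sup>2 + integral {0..T} (\<lambda>s. (norm (e s))\<^sup>2))"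
      using a(1) by (simp add: C_def I_def field_simps)
  qed
qed

subsection \<open>The evolution on the Fourier side\<close>

definition evolution :: "real^'m^'m \<Rightarrow> ('n::finite \<Rightarrow> real^'m^'m) \<Rightarrow> real^'m^'m \<Rightarrow> (real^'n \<Rightarrow> complex^'m) \<Rightarrow> real \<Rightarrow> real^'n \<Rightarrow> complex^'m" where
  "evolution A0 A L U t \<xi> = exp_orbit (\<lambda>z. - (cmat (matrix_inv A0) *v pencil A L \<xi> z)) (U \<xi>) t"

lemma evolution_0: "evolution A0 A L U 0 \<xi> = U \<xi>"
  and evolution_deriv: "((\<lambda>t. evolution A0 A L U t \<xi>) has_vector_derivative
      - (cmat (matrix_inv A0) *v pencil A L \<xi> (evolution A0 A L U t \<xi>))) (at t)"
proof -
  have "bounded_linear (\<lambda>z. - (cmat (matrix_inv A0) *v pencil A L \<xi> z))"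
    by (intro bounded_linear_minus bounded_linear_compose[OF bounded_linear_cmat bounded_linear_pencil])
  from exp_orbit_0[OF this] exp_orbit_deriv[OF this]
  show "evolution A0 A L U 0 \<xi> = U \<xi>" "((\<lambda>t. evolution A0 A L U t \<xi>) has_vector_derivative
      - (cmat (matrix_inv A0) *v pencil A L \<xi> (evolution A0 A L U t \<xi>))) (at t)"
    by (simp_all add: evolution_def)
qed

lemma evolution_eq:
  assumes "condition_A A0 A L"
  shows "cmat A0 *v (- (cmat (matrix_inv A0) *v pencil A L \<xi> z)) = - pencil A L \<xi> z"
  by (simp add: cmat_mv_minus condition_A_invertible[OF assms] flip: cmat_mult_mv)

lemma evolution_continuous_time: "continuous_on T (\<lambda>t. evolution A0 A L U t \<xi>)"
  by (rule continuous_at_imp_continuous_on) (blast intro: has_vector_derivative_continuous evolution_deriv)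

text \<open>The difference of the trajectories at \<eta> and \<xi> solves the equation at \<eta>
  with forcing \<open>i A(\<xi> - \<eta>)\<close> applied to the trajectory at \<xi>, which is small
  by compactness of the time interval. Continuity yields both measurability and the representative
  used for the pointwise estimate.\<close>

lemma evolution_continuous:
  fixes A0 L :: "real^'m^'m" and A :: "'n::finite \<Rightarrow> real^'m^'m"
  assumes A: "condition_A A0 A L" and U: "continuous_on UNIV U" and t: "t \<ge> 0"
  shows "continuous_on UNIV (evolution A0 A L U t)"
proof (rule continuous_at_imp_continuous_on, rule ballI)
  fix \<xi> :: "real^'n"
  let ?W = "evolution A0 A L U"
  obtain C where C: "C > 0" "\<And>\<xi> w w' e T. T \<ge> 0 \<Longrightarrow> continuous_on {0..T} w \<Longrightarrow> continuous_on {0..T} e \<Longrightarrow>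
    (\<And>t. 0 < t \<Longrightarrow> t < T \<Longrightarrow> (w has_vector_derivative w' t) (at t) \<and> cmat A0 *v w' t = - pencil A L \<xi> (w t) + e t) \<Longrightarrow>
    (norm (w T))\<^sup>2 \<le> C * exp T * ((norm (w 0))\<^sup>2 + integral {0..T} (\<lambda>s. (norm (e s))\<^sup>2))"
    using forced_energy_estimate[OF A] by blast
  have pdiff: "pencil A L \<xi> z - pencil A L \<eta> z = \<i> *s (cmat (symbol A (\<xi> - \<eta>)) *v z)" for \<eta> z
    using i_add[of "cmat (symbol A \<xi>) *v z" "- (cmat (symbol A \<eta>) *v z)"]
    by (simp add: pencil_def linear_diff[OF linear_symbol] cmat_diff_mv)
  obtain k1 where k1: "k1 > 0" "\<And>X (z :: complex^'m). norm (cmat (X :: real^'m^'m) *v z) \<le> norm X * norm z * k1"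
    using bounded_bilinear.pos_bounded[OF bounded_bilinear_cmat] by blast
  obtain k2 where k2: "k2 > 0" "\<And>\<eta>. norm (symbol A \<eta>) \<le> norm \<eta> * k2"
    using bounded_linear.pos_bounded[OF linear_conv_bounded_linear[THEN iffD1, OF linear_symbol[of A]]] by blast
  have "compact ((\<lambda>s. ?W s \<xi>) ` {0..t})"
    by (intro compact_continuous_image evolution_continuous_time) simp
  from compact_imp_bounded[OF this] obtain B where "B > 0" "\<forall>z\<in>(\<lambda>s. ?W s \<xi>) ` {0..t}. norm z \<le> B"
    unfolding bounded_pos by blast
  then have B: "B > 0" "\<And>s. s \<in> {0..t} \<Longrightarrow> norm (?W s \<xi>) \<le> B" by auto
  have main: "(norm (?W t \<eta> - ?W t \<xi>))\<^sup>2 \<le> C * exp t * ((norm (U \<eta> - U \<xi>))\<^sup>2 + t * (norm (\<xi> - \<eta>) * k2 * B * k1)\<^sup>2)" for \<eta>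
  proof -
    define e where "e s = \<i> *s (cmat (symbol A (\<xi> - \<eta>)) *v ?W s \<xi>)" for s
    have blz: "bounded_linear (\<lambda>z. \<i> *s (cmat (symbol A (\<xi> - \<eta>)) *v z))"
      unfolding linear_conv_bounded_linear[symmetric]
      by (rule linearI) (simp_all add: cmat_mv_add i_add cmat_mv_scaleR i_scaleR)
    have ce: "continuous_on {0..t} e"
      unfolding e_def by (rule bounded_linear.continuous_on[OF blz evolution_continuous_time])
    have "(norm (?W t \<eta> - ?W t \<xi>))\<^sup>2 \<le> C * exp t * ((norm (?W 0 \<eta> - ?W 0 \<xi>))\<^sup>2 + integral {0..t} (\<lambda>s. (norm (e s))\<^sup>2))"
    proof (rule C(2)[OF t _ ce])
      show "continuous_on {0..t} (\<lambda>s. ?W s \<eta> - ?W s \<xi>)"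
        by (intro continuous_on_diff evolution_continuous_time)
      fix s
      let ?d = "\<lambda>\<zeta>. - (cmat (matrix_inv A0) *v pencil A L \<zeta> (?W s \<zeta>))"
      have "cmat A0 *v (?d \<eta> - ?d \<xi>) = - pencil A L \<eta> (?W s \<eta>) + pencil A L \<xi> (?W s \<xi>)"
        unfolding matrix_vector_mult_diff_distrib evolution_eq[OF A] by simp
      also have "\<dots> = - pencil A L \<eta> (?W s \<eta> - ?W s \<xi>) + e s"
        using pdiff[of "?W s \<xi>" \<eta>] linear_diff[OF bounded_linear.linear[OF bounded_linear_pencil[of A L \<eta>]], of "?W s \<eta>" "?W s \<xi>"]
        by (simp add: e_def diff_eq_eq add.commute)
      finally show "((\<lambda>s. ?W s \<eta> - ?W s \<xi>) has_vector_derivative (?d \<eta> - ?d \<xi>)) (at s) \<and>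
          cmat A0 *v (?d \<eta> - ?d \<xi>) = - pencil A L \<eta> (?W s \<eta> - ?W s \<xi>) + e s"
        by (intro conjI has_vector_derivative_diff evolution_deriv)
    qed
    also have "\<dots> \<le> C * exp t * ((norm (U \<eta> - U \<xi>))\<^sup>2 + t * (norm (\<xi> - \<eta>) * k2 * B * k1)\<^sup>2)"
    proof (intro mult_left_mono add_mono)
      have "norm (e s) \<le> norm (\<xi> - \<eta>) * k2 * B * k1" if "s \<in> {0..t}" for s
      proof -
        have "norm (e s) \<le> norm (symbol A (\<xi> - \<eta>)) * norm (?W s \<xi>) * k1" unfolding e_def norm_i by (rule k1)
        also have "\<dots> \<le> (norm (\<xi> - \<eta>) * k2) * B * k1"
          using k1(1) k2(1) by (intro mult_right_mono mult_mono k2 B that) auto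
        finally show ?thesis .
      qed
      then have "integral {0..t} (\<lambda>s. (norm (e s))\<^sup>2) \<le> integral {0..t} (\<lambda>s. (norm (\<xi> - \<eta>) * k2 * B * k1)\<^sup>2)"
        by (intro integral_le integrable_continuous_interval continuous_intros ce power_mono) auto
      then show "integral {0..t} (\<lambda>s. (norm (e s))\<^sup>2) \<le> t * (norm (\<xi> - \<eta>) * k2 * B * k1)\<^sup>2" using t by simp
    qed (use C(1) in \<open>auto simp: evolution_0\<close>)
    finally show ?thesis .
  qed
  have "((\<lambda>\<eta>. (norm (?W t \<eta> - ?W t \<xi>))\<^sup>2) \<longlongrightarrow> 0) (at \<xi>)"
  proof (rule real_tendsto_sandwich[where f="\<lambda>_. 0"])
    have "(U \<longlongrightarrow> U \<xi>) (at \<xi>)" using U by (simp add: continuous_on_eq_continuous_at isCont_def)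
    then show "((\<lambda>\<eta>. C * exp t * ((norm (U \<eta> - U \<xi>))\<^sup>2 + t * (norm (\<xi> - \<eta>) * k2 * B * k1)\<^sup>2)) \<longlongrightarrow> 0) (at \<xi>)"
      by (auto intro!: tendsto_eq_intros)
  qed (auto intro!: always_eventually main)
  from tendsto_real_sqrt[OF this] have "((\<lambda>\<eta>. norm (?W t \<eta> - ?W t \<xi>)) \<longlongrightarrow> 0) (at \<xi>)" by simp
  from LIM_zero_cancel[OF tendsto_norm_zero_cancel[OF this]] show "isCont (?W t) \<xi>"
    unfolding isCont_def .
qed

section \<open>The Fourier transform of vector-valued functions\<close>

lemma fourier_cvec: "fourier u \<xi> = (LINT x|lborel. cis (- (x \<bullet> \<xi>)) *s cvec (u x))"
  by (simp add: fourier_def cvec_def)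

lemma norm_cvec [simp]: "norm (cvec x) = norm x"
  by (simp add: norm_vec_def cvec_def)

lemma bounded_linear_cvec: "bounded_linear cvec"
  unfolding linear_conv_bounded_linear[symmetric]
  by (rule linearI) (simp_all add: cvec_def vec_eq_iff scaleR_conv_of_real[where 'a=complex])

lemma cvec_add: "cvec (a + b) = cvec a + cvec b"
  and cvec_diff: "cvec (a - b) = cvec a - cvec b"
  and cvec_scaleR: "cvec (c *\<^sub>R a) = c *\<^sub>R cvec a"
  and cvec_sum: "cvec (sum f I) = (\<Sum>i\<in>I. cvec (f i))"
  by (simp_all add: cvec_def vec_eq_iff scaleR_conv_of_real[where 'a=complex])

lemma cvec_measurable [measurable]: "cvec \<in> borel_measurable borel"
  by (intro borel_measurable_continuous_onI linear_continuous_on bounded_linear_cvec)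

lemma cmult_scaleR: "c *s (r *\<^sub>R z) = r *\<^sub>R (c *s z)" for z :: "complex^'m"
  by (simp add: vec_eq_iff)

lemma norm_cmult: "norm (c *s z) = norm c * norm z" for z :: "complex^'m"
  by (simp add: norm_vec_def norm_mult L2_set_right_distrib)

lemma cmult_measurable:
  assumes [measurable]: "f \<in> borel_measurable M" "g \<in> borel_measurable M"
  shows "(\<lambda>x. f x *s g x :: complex^'m) \<in> borel_measurable M"
proof -
  have "(\<lambda>x. g x $ i) \<in> borel_measurable M" for i
    using assms(2) by (simp add: borel_measurable_vec_iff)
  then show ?thesis by (simp add: borel_measurable_vec_iff)
qed

lemma fourier_integrand_integrable:
  fixes u :: "real^'n \<Rightarrow> real^'m"
  assumes u: "integrable lborel u"
  shows "integrable lborel (\<lambda>x. cis (- (x \<bullet> \<xi>)) *s cvec (u x))"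
proof (rule Bochner_Integration.integrable_bound[OF u])
  have [measurable]: "u \<in> borel_measurable borel" using u by auto
  show "(\<lambda>x. cis (- (x \<bullet> \<xi>)) *s cvec (u x)) \<in> borel_measurable lborel"
    by (intro cmult_measurable) measurable
qed (auto simp: norm_cmult)

lemma fourier_nth:
  fixes u :: "real^'n \<Rightarrow> real^'m"
  assumes u: "integrable lborel u"
  shows "fourier u \<xi> $ i = ft (\<lambda>x. complex_of_real (u x $ i)) \<xi>"
proof -
  have "fourier u \<xi> $ i = (LINT x|lborel. (cis (- (x \<bullet> \<xi>)) *s cvec (u x)) $ i)"
    unfolding fourier_cvec by (rule integral_bounded_linear[OF bounded_linear_vec_nth fourier_integrand_integrable[OF u], symmetric])
  then show ?thesis by (simp add: ft_def cvec_def)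
qed

lemma integrable_component:
  fixes u :: "real^'n \<Rightarrow> real^'m"
  assumes "integrable lborel u" shows "integrable lborel (\<lambda>x. complex_of_real (u x $ i))"
  using integrable_bounded_linear[OF bounded_linear_vec_nth assms] by simp

lemma in_L2_component:
  fixes u :: "real^'n \<Rightarrow> real^'m"
  assumes "in_L2 u" shows "in_L2 (\<lambda>x. complex_of_real (u x $ i))"
proof -
  have "in_L2 (\<lambda>x. u x $ i)" using assms in_L2_vec_iff by blast
  then show ?thesis by (auto simp: in_L2_iff L2_sq_def)
qed

lemma L2_sq_components:
  fixes u :: "real^'n \<Rightarrow> real^'m"
  assumes "in_L2 u" shows "L2_sq u = (\<Sum>i\<in>UNIV. L2_sq (\<lambda>x. complex_of_real (u x $ i)))"
proof -
  have "L2_sq u = (\<Sum>i\<in>UNIV. L2_sq (\<lambda>x. u x $ i))"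
    using assms by (intro L2_sq_vec) (simp add: in_L2_iff borel_measurable_vec_iff)
  then show ?thesis by (simp add: L2_sq_def)
qed

lemma fourier_measurable:
  fixes u :: "real^'n \<Rightarrow> real^'m"
  assumes "integrable lborel u" shows "fourier u \<in> borel_measurable borel"
  unfolding borel_measurable_vec_iff using ft_measurable[OF integrable_component[OF assms]]
  by (simp add: fourier_nth[OF assms])

lemma continuous_on_fourier:
  fixes u :: "real^'n \<Rightarrow> real^'m"
  assumes "integrable lborel u" shows "continuous_on UNIV (fourier u)"
proof -
  have "fourier u = (\<lambda>\<xi>. \<chi> i. ft (\<lambda>x. complex_of_real (u x $ i)) \<xi>)"
    by (simp add: fun_eq_iff vec_eq_iff fourier_nth[OF assms])
  then show ?thesis
    by (simp add: continuous_on_vec_lambda continuous_on_ft[OF integrable_component[OF assms]])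
qed

lemma fourier_bound:
  assumes u: "integrable lborel u" shows "norm (fourier u \<xi>) \<le> L1_norm u"
  unfolding fourier_cvec L1_norm_def by (rule order_trans[OF integral_norm_bound]) (simp add: norm_cmult)

lemma fourier_diff:
  assumes "integrable lborel u" "integrable lborel v"
  shows "fourier (\<lambda>x. u x - v x) \<xi> = fourier u \<xi> - fourier v \<xi>"
  unfolding fourier_cvec
  by (subst Bochner_Integration.integral_diff[symmetric])
    (auto intro!: fourier_integrand_integrable assms Bochner_Integration.integral_cong simp: cvec_diff vec_eq_iff right_diff_distrib)

lemma fourier_sum:
  assumes "\<And>i. i \<in> I \<Longrightarrow> integrable lborel (f i)"
  shows "fourier (\<lambda>x. \<Sum>i\<in>I. f i x) \<xi> = (\<Sum>i\<in>I. fourier (f i) \<xi>)"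
  unfolding fourier_cvec
  by (subst Bochner_Integration.integral_sum[symmetric])
    (auto intro!: fourier_integrand_integrable assms simp: cvec_sum vec.scale_sum_right)

lemma fourier_matrix:
  assumes "integrable lborel u"
  shows "fourier (\<lambda>x. X *v u x) \<xi> = cmat X *v fourier u \<xi>"
  unfolding fourier_cvec
  by (subst integral_bounded_linear[OF bounded_linear_cmat fourier_integrand_integrable[OF assms], symmetric])
    (simp add: cmat_mv_cmult cmat_cvec)

lemma L2_sq_fourier:
  fixes u :: "real^'n \<Rightarrow> real^'m"
  assumes u: "integrable lborel u" "in_L2 u"
  shows "L2_sq (fourier u) = ennreal ((2 * pi) ^ CARD('n)) * L2_sq u" "in_L2 (fourier u)"
proof -
  have m: "(\<lambda>\<xi>. fourier u \<xi> $ i) \<in> borel_measurable borel" for i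
    using fourier_measurable[OF u(1)] by (simp add: borel_measurable_vec_iff)
  show *: "L2_sq (fourier u) = ennreal ((2 * pi) ^ CARD('n)) * L2_sq u"
    unfolding L2_sq_vec[OF m] L2_sq_components[OF u(2)] fourier_nth[OF u(1)]
    by (simp add: L2_sq_ft[OF integrable_component[OF u(1)] in_L2_component[OF u(2)]] sum_distrib_left)
  show "in_L2 (fourier u)"
    using fourier_measurable[OF u(1)] in_L2_finite[OF u(2)] unfolding in_L2_iff * by (simp add: ennreal_mult_less_top)
qed

lemma L2_sq_fourier_diff:
  fixes u v :: "real^'n \<Rightarrow> real^'m"
  assumes u: "integrable lborel u" "in_L2 u" and v: "integrable lborel v" "in_L2 v"
  shows "L2_sq (\<lambda>\<xi>. fourier u \<xi> - fourier v \<xi>) = ennreal ((2 * pi) ^ CARD('n)) * L2_sq (\<lambda>x. u x - v x)"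
  unfolding fourier_diff[OF u(1) v(1), symmetric]
  by (intro L2_sq_fourier Bochner_Integration.integrable_diff in_L2_diff u v)

text \<open>Truncations at integer radii serve as the approximating sequence; in each component they
  converge because they do so as vectors.\<close>

lemma is_L2_fourier_components:
  fixes u :: "real^'n \<Rightarrow> real^'m"
  assumes u: "in_L2 u" and V: "is_L2_fourier u V"
  shows "fourier_L2 (\<lambda>x. complex_of_real (u x $ i)) (\<lambda>\<xi>. V \<xi> $ i)"
proof -
  define g where "g k x = indicator (cball 0 (real k)) x *\<^sub>R u x" for k x
  have g: "integrable lborel (g k)" "in_L2 (g k)" for k
    unfolding g_def by (intro integrable_truncate in_L2_truncate u; simp)+
  have L2V: "in_L2 V" and lim: "(\<lambda>k. L2_sq (\<lambda>\<xi>. fourier (g k) \<xi> - V \<xi>)) \<longlonglongrightarrow> 0"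
    using V filterlim_compose[OF _ filterlim_real_sequentially]
    unfolding is_L2_fourier_def L2_tendsto_L2_sq g_def by blast+
  show ?thesis
    unfolding fourier_L2_def
  proof (intro conjI exI[of _ "\<lambda>k x. complex_of_real (g k x $ i)"] allI integrable_component in_L2_component u g)
    show "in_L2 (\<lambda>\<xi>. V \<xi> $ i)" using L2V in_L2_vec_iff by blast
    have *: "L2_sq (\<lambda>x. f x $ i) \<le> L2_sq f" for f :: "real^'n \<Rightarrow> complex^'m"
      by (rule L2_sq_mono) (auto simp: norm_vec_def intro: member_le_L2_set[of UNIV])
    show "(\<lambda>k. L2_sq (\<lambda>\<xi>. ft (\<lambda>x. complex_of_real (g k x $ i)) \<xi> - V \<xi> $ i)) \<longlonglongrightarrow> 0"
    proof (rule tendsto_0_ennreal_squeeze[OF _ lim], intro always_eventually allI)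
      fix k
      show "L2_sq (\<lambda>\<xi>. ft (\<lambda>x. complex_of_real (g k x $ i)) \<xi> - V \<xi> $ i) \<le> L2_sq (\<lambda>\<xi>. fourier (g k) \<xi> - V \<xi>)"
        using *[of "\<lambda>\<xi>. fourier (g k) \<xi> - V \<xi>"] by (simp add: fourier_nth[OF g(1)])
    qed
    have lim': "(\<lambda>k. L2_sq (\<lambda>x. g k x - u x)) \<longlonglongrightarrow> 0"
      using filterlim_compose[OF L2_truncate[OF u] filterlim_real_sequentially] by (simp add: g_def)
    show "(\<lambda>k. L2_sq (\<lambda>x. complex_of_real (g k x $ i) - complex_of_real (u x $ i))) \<longlonglongrightarrow> 0"
    proof (rule tendsto_0_ennreal_squeeze[OF _ lim'], intro always_eventually allI)
      fix k
      have "norm (complex_of_real (g k x $ i) - complex_of_real (u x $ i)) \<le> norm (g k x - u x)" for x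
        using component_le_norm_cart[of "g k x - u x" i] by (simp flip: of_real_diff)
      then show "L2_sq (\<lambda>x. complex_of_real (g k x $ i) - complex_of_real (u x $ i)) \<le> L2_sq (\<lambda>x. g k x - u x)"
        unfolding L2_sq_def by (intro nn_integral_mono ennreal_leI power_mono) auto
    qed
  qed
qed

section \<open>Localised Fourier transforms\<close>

lemma
  fixes v :: "real^'n \<Rightarrow> 'b::euclidean_space"
  assumes t: "test_function \<phi>" and v: "in_L2 v"
  shows integrable_test_mult: "integrable lborel (\<lambda>x. \<phi> x *\<^sub>R v x)"
    and in_L2_test_mult: "in_L2 (\<lambda>x. \<phi> x *\<^sub>R v x)"
proof -
  obtain B r where B: "r > 0" "B > 0" "\<And>x. \<bar>\<phi> x\<bar> \<le> B" "\<And>x. \<phi> x \<noteq> 0 \<Longrightarrow> norm x \<le> r"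
    using test_function_bounded_support[OF t] by blast
  have [measurable]: "v \<in> borel_measurable borel" using v by (simp add: in_L2_iff)
  note [measurable] = test_function_measurable[OF t]
  have i: "integrable lborel (\<lambda>x. indicator (cball 0 r) x *\<^sub>R v x)" by (intro integrable_truncate v) auto
  then have i: "integrable lborel (\<lambda>x. B *\<^sub>R (indicator (cball 0 r) x *\<^sub>R v x))" by (rule integrable_scaleR_right)
  show "integrable lborel (\<lambda>x. \<phi> x *\<^sub>R v x)"
  proof (rule Bochner_Integration.integrable_bound[OF i _ AE_I2])
    fix x show "norm (\<phi> x *\<^sub>R v x) \<le> norm (B *\<^sub>R (indicator (cball 0 r) x *\<^sub>R v x))"
      using B(2) B(3)[of x] B(4)[of x] by (cases "\<phi> x = 0") (auto intro!: mult_right_mono)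
  qed simp
  show "in_L2 (\<lambda>x. \<phi> x *\<^sub>R v x)"
    by (rule in_L2_bound[OF v, where c=B]) (use B in \<open>auto intro!: mult_right_mono\<close>)
qed

lemma in_L2_matrix:
  fixes v :: "real^'n \<Rightarrow> real^'m" and X :: "real^'m^'p"
  assumes v: "in_L2 v" shows "in_L2 (\<lambda>x. X *v v x)"
proof -
  have bl: "bounded_linear ((*v) X)" by (rule matrix_vector_mul_bounded_linear)
  obtain B where B: "\<And>z. norm (X *v z) \<le> norm z * B" using bounded_linear.bounded[OF bl] by blast
  have [measurable]: "v \<in> borel_measurable borel" using v by (simp add: in_L2_iff)
  show ?thesis
  proof (rule in_L2_bound[OF v, where c=B])
    show "(\<lambda>x. X *v v x) \<in> borel_measurable borel"
      by (rule measurable_compose[of v borel borel]) (auto intro!: borel_measurable_continuous_onI linear_continuous_on bl)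
  qed (use B in \<open>simp add: mult.commute\<close>)
qed

text \<open>The factor \<open>exp 1\<close> normalises the value at the centre to 1, where the bump
  equals \<open>exp (- 1)\<close>.\<close>

definition cutoff :: "real \<Rightarrow> real^'n \<Rightarrow> real" where
  "cutoff d x = exp 1 * bump d 0 x"

lemma cutoff_test: "d > 0 \<Longrightarrow> test_function (cutoff d)"
  unfolding cutoff_def by (rule test_function_mult_bump[OF smooth_alg.const])

lemma cutoff_bounds: "0 \<le> cutoff d x" "cutoff d x \<le> 1"
proof -
  show "0 \<le> cutoff d x" by (simp add: cutoff_def bump_nonneg)
  have "bump_profile 0 t \<le> exp (- 1)" if "t \<le> 1" for t
    using that by (auto simp: bump_profile_def)
  from this[of "1 - d\<^sup>2 * (x \<bullet> x)"] have "bump d 0 x \<le> exp (- 1)" by (simp add: bump_def)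
  then have "exp 1 * bump d 0 x \<le> exp 1 * exp (- 1)" by (intro mult_left_mono) auto
  then show "cutoff d x \<le> 1" by (simp add: cutoff_def flip: exp_add)
qed

lemma cutoff_scale: "cutoff d x = cutoff 1 (d *\<^sub>R x)"
  by (simp add: cutoff_def bump_def power2_eq_square mult_ac)

lemma cutoff_tendsto:
  assumes "h \<longlonglongrightarrow> 0" shows "(\<lambda>k::nat. cutoff (h k) x) \<longlonglongrightarrow> 1"
proof -
  have c: "isCont (cutoff 1) (0 :: real^'a)"
    by (rule continuous_on_interior[OF test_function_continuous[OF cutoff_test]]) simp_all
  have "(\<lambda>k. h k *\<^sub>R x) \<longlonglongrightarrow> 0" using tendsto_scaleR[OF assms tendsto_const[of x]] by simp
  from isCont_tendsto_compose[OF c this] have "(\<lambda>k. cutoff (h k) x) \<longlonglongrightarrow> cutoff 1 (0 :: real^'a)"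
    by (simp only: cutoff_scale[of "h _"])
  moreover have "cutoff 1 (0 :: real^'a) = 1" by (simp add: cutoff_def bump_def bump_profile_def flip: exp_add)
  ultimately show ?thesis by simp
qed

text \<open>\<open>cutoff d x\<close> is \<open>cutoff 1\<close> at \<open>d x\<close>, so
  differentiation produces a factor \<open>d\<close>. This is the source of all smallness in the
  localisation errors.\<close>

lemma cutoff_partial_bound:
  "\<exists>b>0. \<forall>j d. \<forall>x :: real^'n. d > 0 \<longrightarrow> \<bar>partials [j] (cutoff d) x\<bar> \<le> b * d"
proof -
  have "\<exists>b>0. \<forall>x. \<bar>partials [j] (cutoff 1) x\<bar> \<le> b" for j :: 'n
    using test_function_bounded_support[OF test_function_partials[OF cutoff_test[of 1], of "[j]"]] by auto
  then obtain b where b: "\<And>j :: 'n. b j > 0" "\<And>j x. \<bar>partials [j] (cutoff 1) x\<bar> \<le> b j" by metis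
  define M where "M = (\<Sum>j\<in>UNIV. b j)"
  have M: "b j \<le> M" for j unfolding M_def using b(1) by (intro member_le_sum) (auto intro: less_imp_le)
  have "\<bar>partials [j] (cutoff d) x\<bar> \<le> M * d" if d: "d > 0" for j d and x :: "real^'n"
  proof -
    have "((\<lambda>x. d *\<^sub>R x) has_derivative (\<lambda>h. d *\<^sub>R h)) (at x)" by (auto intro!: derivative_eq_intros)
    from has_derivative_compose[OF this test_function_deriv[OF cutoff_test]]
    have "(cutoff d has_derivative (\<lambda>h. frechet_derivative (cutoff 1) (at (d *\<^sub>R x)) (d *\<^sub>R h))) (at x)"
      unfolding cutoff_scale[of d, abs_def] by simp
    from frechet_derivative_at[OF this, symmetric]
    have "partials [j] (cutoff d) x = frechet_derivative (cutoff 1) (at (d *\<^sub>R x)) (d *\<^sub>R axis j 1)"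
      by simp
    also have "\<dots> = d * partials [j] (cutoff 1) (d *\<^sub>R x)"
      using linear_cmul[OF has_derivative_linear[OF test_function_deriv[OF cutoff_test[of 1], of "d *\<^sub>R x"]]] by simp
    also have "\<bar>\<dots>\<bar> \<le> d * M" using d b(2)[of j "d *\<^sub>R x"] M[of j] by (simp add: abs_mult)
    finally show ?thesis by (simp add: mult.commute)
  qed
  moreover have "M > 0" unfolding M_def using b(1) by (intro sum_pos) auto
  ultimately show ?thesis by blast
qed

text \<open>Test functions are real, so the localised exponential \<open>exp(-i x \<xi>)\<close> has
  to be represented by its real and imaginary parts.\<close>

definition cutoff_cos :: "real \<Rightarrow> real^'n \<Rightarrow> real^'n \<Rightarrow> real" where
  "cutoff_cos d \<xi> x = cos (x \<bullet> \<xi>) * cutoff d x"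

definition cutoff_sin :: "real \<Rightarrow> real^'n \<Rightarrow> real^'n \<Rightarrow> real" where
  "cutoff_sin d \<xi> x = sin (x \<bullet> \<xi>) * cutoff d x"

lemma cutoff_cos_sin_test:
  assumes "d > 0" shows "test_function (cutoff_cos d \<xi>)" "test_function (cutoff_sin d \<xi>)"
proof -
  have "(\<lambda>x. cos (x \<bullet> \<xi>) * exp 1) \<in> smooth_alg" "(\<lambda>x. sin (x \<bullet> \<xi>) * exp 1) \<in> smooth_alg"
    by (intro smooth_alg.intros)+
  from this[THEN test_function_mult_bump, OF assms, of 0]
  show "test_function (cutoff_cos d \<xi>)" "test_function (cutoff_sin d \<xi>)"
    by (simp_all add: cutoff_cos_def[abs_def] cutoff_sin_def[abs_def] cutoff_def mult.assoc)
qed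

lemma partials_cutoff_cos_sin:
  assumes d: "d > 0"
  shows "partials [j] (cutoff_cos d \<xi>) x = - (\<xi> $ j) * cutoff_sin d \<xi> x + cos (x \<bullet> \<xi>) * partials [j] (cutoff d) x"
    and "partials [j] (cutoff_sin d \<xi>) x = \<xi> $ j * cutoff_cos d \<xi> x + sin (x \<bullet> \<xi>) * partials [j] (cutoff d) x"
proof -
  note D = test_function_deriv[OF cutoff_test[OF d], of x]
  have c: "((\<lambda>x. cos (x \<bullet> \<xi>)) has_derivative (\<lambda>v. - (v \<bullet> \<xi>) * sin (x \<bullet> \<xi>))) (at x)"
    and s: "((\<lambda>x. sin (x \<bullet> \<xi>)) has_derivative (\<lambda>v. (v \<bullet> \<xi>) * cos (x \<bullet> \<xi>))) (at x)"
    by (auto intro!: derivative_eq_intros)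
  have "(cutoff_cos d \<xi> has_derivative (\<lambda>v. cos (x \<bullet> \<xi>) * frechet_derivative (cutoff d) (at x) v + - (v \<bullet> \<xi>) * sin (x \<bullet> \<xi>) * cutoff d x)) (at x)"
    unfolding cutoff_cos_def[abs_def] by (rule has_derivative_mult[OF c D])
  from frechet_derivative_at[OF this, symmetric]
  show "partials [j] (cutoff_cos d \<xi>) x = - (\<xi> $ j) * cutoff_sin d \<xi> x + cos (x \<bullet> \<xi>) * partials [j] (cutoff d) x"
    by (simp add: inner_axis' cutoff_sin_def)
  have "(cutoff_sin d \<xi> has_derivative (\<lambda>v. sin (x \<bullet> \<xi>) * frechet_derivative (cutoff d) (at x) v + (v \<bullet> \<xi>) * cos (x \<bullet> \<xi>) * cutoff d x)) (at x)"
    unfolding cutoff_sin_def[abs_def] by (rule has_derivative_mult[OF s D])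
  from frechet_derivative_at[OF this, symmetric]
  show "partials [j] (cutoff_sin d \<xi>) x = \<xi> $ j * cutoff_cos d \<xi> x + sin (x \<bullet> \<xi>) * partials [j] (cutoff d) x"
    by (simp add: inner_axis' cutoff_cos_def)
qed

lemma cis_cvec: "cis (- t) *s cvec v = cvec (cos t *\<^sub>R v) - \<i> *s cvec (sin t *\<^sub>R v)"
  by (simp add: vec_eq_iff cvec_def complex_eq_iff)

lemma fourier_cutoff:
  fixes v :: "real^'n \<Rightarrow> real^'m"
  assumes d: "d > 0" and v: "in_L2 v"
  shows "fourier (\<lambda>x. cutoff d x *\<^sub>R v x) \<xi>
     = cvec (LINT x|lborel. cutoff_cos d \<xi> x *\<^sub>R v x) - \<i> *s cvec (LINT x|lborel. cutoff_sin d \<xi> x *\<^sub>R v x)"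
proof -
  note i = integrable_test_mult[OF cutoff_cos_sin_test(1)[OF d, of \<xi>] v] integrable_test_mult[OF cutoff_cos_sin_test(2)[OF d, of \<xi>] v]
  have bl: "bounded_linear (\<lambda>z. \<i> *s cvec z)"
    unfolding linear_conv_bounded_linear[symmetric] by (rule linearI) (simp_all add: cvec_add i_add cvec_scaleR i_scaleR)
  have "fourier (\<lambda>x. cutoff d x *\<^sub>R v x) \<xi> = (LINT x|lborel. cvec (cutoff_cos d \<xi> x *\<^sub>R v x) - \<i> *s cvec (cutoff_sin d \<xi> x *\<^sub>R v x))"
    unfolding fourier_cvec by (intro Bochner_Integration.integral_cong refl)
      (simp add: cis_cvec[of _ "cutoff d _ *\<^sub>R v _"] cutoff_cos_def cutoff_sin_def)
  also have "\<dots> = (LINT x|lborel. cvec (cutoff_cos d \<xi> x *\<^sub>R v x)) - (LINT x|lborel. \<i> *s cvec (cutoff_sin d \<xi> x *\<^sub>R v x))"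
    by (intro Bochner_Integration.integral_diff integrable_bounded_linear[OF bounded_linear_cvec] integrable_bounded_linear[OF bl] i)
  also have "\<dots> = cvec (LINT x|lborel. cutoff_cos d \<xi> x *\<^sub>R v x) - \<i> *s cvec (LINT x|lborel. cutoff_sin d \<xi> x *\<^sub>R v x)"
    by (simp only: integral_bounded_linear[OF bounded_linear_cvec i(1)] integral_bounded_linear[OF bl i(2)])
  finally show ?thesis .
qed

text \<open>Testing a first-order operator with \<open>exp(-i x \<xi>)\<close> times a cut-off produces its symbol
  and an error supported by the gradient of the cut-off.\<close>

definition cutoff_error :: "('n::finite \<Rightarrow> real^'m^'p) \<Rightarrow> real \<Rightarrow> (real^'n \<Rightarrow> real^'m) \<Rightarrow> real^'n \<Rightarrow> real^'p" where
  "cutoff_error Q d v x = (\<Sum>j\<in>UNIV. partials [j] (cutoff d) x *\<^sub>R (Q j *v v x))"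

definition tested :: "('n::finite \<Rightarrow> real^'m^'p) \<Rightarrow> real^'m^'p \<Rightarrow> (real^'n \<Rightarrow> real^'m) \<Rightarrow> (real^'n \<Rightarrow> real) \<Rightarrow> real^'p" where
  "tested Q R v \<phi> = (LINT x|lborel. (\<Sum>j\<in>UNIV. partials [j] \<phi> x *\<^sub>R (Q j *v v x)) - \<phi> x *\<^sub>R (R *v v x))"

lemma cutoff_error_integrable:
  fixes v :: "real^'n \<Rightarrow> real^'m"
  assumes d: "d > 0" and v: "in_L2 v"
  shows "integrable lborel (cutoff_error Q d v)" "in_L2 (cutoff_error Q d v)"
  unfolding cutoff_error_def[abs_def]
  by (intro Bochner_Integration.integrable_sum in_L2_sum finite integrable_test_mult in_L2_test_mult test_function_partials cutoff_test d in_L2_matrix v)+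

lemma tested_integrable:
  fixes v :: "real^'n \<Rightarrow> real^'m"
  assumes t: "test_function \<phi>" and v: "in_L2 v"
  shows "integrable lborel (\<lambda>x. (\<Sum>j\<in>UNIV. partials [j] \<phi> x *\<^sub>R (Q j *v v x)) - \<phi> x *\<^sub>R (R *v v x))"
  by (intro Bochner_Integration.integrable_diff Bochner_Integration.integrable_sum integrable_test_mult test_function_partials in_L2_matrix t v)

lemma symbol_cvec: "cmat (symbol Q \<xi>) *v cvec v = (\<Sum>j\<in>UNIV. \<xi> $ j *\<^sub>R cvec (Q j *v v))"
proof -
  have "symbol Q \<xi> *v v = (\<Sum>j\<in>UNIV. \<xi> $ j *\<^sub>R (Q j *v v))"
    unfolding symbol_def by (simp add: vec_eq_iff matrix_vector_mult_def sum_distrib_left sum_distrib_right mult.assoc) (intro allI sum.swap)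
  then show ?thesis by (simp add: cmat_cvec cvec_sum cvec_scaleR)
qed

lemma tested_cutoff:
  fixes v :: "real^'n \<Rightarrow> real^'m" and Q :: "'n \<Rightarrow> real^'m^'p"
  assumes d: "d > 0" and v: "in_L2 v"
  shows "cvec (tested Q R v (cutoff_cos d \<xi>)) - \<i> *s cvec (tested Q R v (cutoff_sin d \<xi>))
    = - pencil Q R \<xi> (fourier (\<lambda>x. cutoff d x *\<^sub>R v x) \<xi>) + fourier (cutoff_error Q d v) \<xi>"
proof -
  define G where "G \<phi> x = (\<Sum>j\<in>UNIV. partials [j] \<phi> x *\<^sub>R (Q j *v v x)) - \<phi> x *\<^sub>R (R *v v x)" for \<phi> x
  note t = cutoff_cos_sin_test[OF d, of \<xi>]
  have i: "integrable lborel (G (cutoff_cos d \<xi>))" "integrable lborel (G (cutoff_sin d \<xi>))"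
    unfolding G_def by (intro tested_integrable t v)+
  have bl: "bounded_linear (\<lambda>z. \<i> *s cvec z)"
    unfolding linear_conv_bounded_linear[symmetric] by (rule linearI) (simp_all add: cvec_add i_add cvec_scaleR i_scaleR)
  have iF: "integrable lborel (\<lambda>x. cis (- (x \<bullet> \<xi>)) *s cvec (cutoff d x *\<^sub>R v x))"
    by (intro fourier_integrand_integrable integrable_test_mult cutoff_test d v)
  have iE: "integrable lborel (\<lambda>x. cis (- (x \<bullet> \<xi>)) *s cvec (cutoff_error Q d v x))"
    by (intro fourier_integrand_integrable cutoff_error_integrable d v)
  have blp: "bounded_linear (\<lambda>z. - pencil Q R \<xi> z)" by (intro bounded_linear_minus bounded_linear_pencil)
  \<comment> \<open>The identity already holds under the integral sign: cosine and sine recombine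
    into \<open>cis\<close>, and differentiating the trigonometric factor produces the
    symbol.\<close>
  have pt: "cvec (G (cutoff_cos d \<xi>) x) - \<i> *s cvec (G (cutoff_sin d \<xi>) x)
     = - pencil Q R \<xi> (cis (- (x \<bullet> \<xi>)) *s cvec (cutoff d x *\<^sub>R v x)) + cis (- (x \<bullet> \<xi>)) *s cvec (cutoff_error Q d v x)" for x
  proof -
    define c s \<eta> where "c = cos (x \<bullet> \<xi>)" and "s = sin (x \<bullet> \<xi>)" and "\<eta> = cutoff d x"
    define Y where "Y = (\<Sum>j\<in>UNIV. \<xi> $ j *\<^sub>R cvec (Q j *v v x))"
    define Z where "Z = cvec (cutoff_error Q d v x)"
    define W where "W = cvec (R *v v x)"
    have Gc: "cvec (G (cutoff_cos d \<xi>) x) = - (s * \<eta>) *\<^sub>R Y + c *\<^sub>R Z - (c * \<eta>) *\<^sub>R W"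
      unfolding G_def partials_cutoff_cos_sin[OF d] Y_def Z_def W_def cutoff_error_def c_def s_def \<eta>_def
      by (simp add: cvec_diff cvec_add cvec_sum cvec_scaleR scaleR_left.add scaleR_left.diff sum.distrib sum_subtractf scaleR_sum_right cutoff_cos_def cutoff_sin_def mult_ac sum_negf)
    have Gs: "cvec (G (cutoff_sin d \<xi>) x) = (c * \<eta>) *\<^sub>R Y + s *\<^sub>R Z - (s * \<eta>) *\<^sub>R W"
      unfolding G_def partials_cutoff_cos_sin[OF d] Y_def Z_def W_def cutoff_error_def c_def s_def \<eta>_def
      by (simp add: cvec_diff cvec_add cvec_sum cvec_scaleR scaleR_left.add sum.distrib scaleR_sum_right cutoff_cos_def cutoff_sin_def mult_ac)
    have P: "pencil Q R \<xi> (cis (- (x \<bullet> \<xi>)) *s cvec (cutoff d x *\<^sub>R v x))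
      = cis (- (x \<bullet> \<xi>)) *s (\<eta> *\<^sub>R (\<i> *s Y + W))"
      unfolding pencil_def cmat_mv_cmult cvec_scaleR cmat_mv_scaleR symbol_cvec Y_def W_def \<eta>_def cmat_cvec[symmetric]
      by (simp add: vec_eq_iff scaleR_conv_of_real[where 'a=complex] algebra_simps)
    show ?thesis
      unfolding P Gc Gs Z_def[symmetric]
      by (simp add: vec_eq_iff complex_eq_iff c_def[symmetric] s_def[symmetric] algebra_simps)
  qed
  have "cvec (tested Q R v (cutoff_cos d \<xi>)) - \<i> *s cvec (tested Q R v (cutoff_sin d \<xi>))
     = (LINT x|lborel. cvec (G (cutoff_cos d \<xi>) x)) - (LINT x|lborel. \<i> *s cvec (G (cutoff_sin d \<xi>) x))"
    unfolding tested_def G_def[symmetric]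
    by (simp only: integral_bounded_linear[OF bounded_linear_cvec i(1)] integral_bounded_linear[OF bl i(2)])
  also have "\<dots> = (LINT x|lborel. cvec (G (cutoff_cos d \<xi>) x) - \<i> *s cvec (G (cutoff_sin d \<xi>) x))"
    by (intro Bochner_Integration.integral_diff[symmetric] integrable_bounded_linear[OF bounded_linear_cvec] integrable_bounded_linear[OF bl] i)
  also have "\<dots> = (LINT x|lborel. - pencil Q R \<xi> (cis (- (x \<bullet> \<xi>)) *s cvec (cutoff d x *\<^sub>R v x))) + (LINT x|lborel. cis (- (x \<bullet> \<xi>)) *s cvec (cutoff_error Q d v x))"
    unfolding pt by (intro Bochner_Integration.integral_add integrable_bounded_linear[OF blp] iF iE)
  also have "\<dots> = - pencil Q R \<xi> (fourier (\<lambda>x. cutoff d x *\<^sub>R v x) \<xi>) + fourier (cutoff_error Q d v) \<xi>"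
    unfolding fourier_cvec by (simp only: integral_bounded_linear[OF blp iF])
  finally show ?thesis .
qed

lemma cutoff_error_bound:
  fixes Q :: "'n::finite \<Rightarrow> real^'m^'p"
  shows "\<exists>b>0. \<forall>d>0. \<forall>v x. norm (cutoff_error Q d v x) \<le> b * d * norm (v x)"
proof -
  obtain b where b: "b > 0" "\<And>j d. \<And>x :: real^'n. d > 0 \<Longrightarrow> \<bar>partials [j] (cutoff d) x\<bar> \<le> b * d"
    using cutoff_partial_bound by blast
  have "\<exists>q>0. \<forall>z. norm (Q j *v z) \<le> norm z * q" for j
    by (rule bounded_linear.pos_bounded) (rule matrix_vector_mul_bounded_linear)
  then obtain q where q: "\<And>j. q j > 0" "\<And>j z. norm (Q j *v z) \<le> norm z * q j" by metis
  have "norm (cutoff_error Q d v x) \<le> (\<Sum>j\<in>UNIV. b * q j) * d * norm (v x)" if d: "d > 0" for d v x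
  proof -
    have "norm (cutoff_error Q d v x) \<le> (\<Sum>j\<in>UNIV. b * d * (norm (v x) * q j))"
      unfolding cutoff_error_def
    proof (rule sum_norm_le)
      fix j
      have "\<bar>partials [j] (cutoff d) x\<bar> * norm (Q j *v v x) \<le> (b * d) * (norm (v x) * q j)"
        using b(1) d by (intro mult_mono b q) auto
      then show "norm (partials [j] (cutoff d) x *\<^sub>R (Q j *v v x)) \<le> b * d * (norm (v x) * q j)" by simp
    qed
    also have "\<dots> = (\<Sum>j\<in>UNIV. b * q j) * d * norm (v x)"
      by (simp add: sum_distrib_left sum_distrib_right mult_ac)
    finally show ?thesis .
  qed
  moreover have "(\<Sum>j\<in>UNIV. b * q j) > 0" using b(1) q(1) by (intro sum_pos) auto
  ultimately show ?thesis by blast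
qed

lemma L2_cutoff_tendsto:
  fixes v :: "real^'n \<Rightarrow> 'b::euclidean_space"
  assumes v: "in_L2 v" and h: "h \<longlonglongrightarrow> 0" "\<And>k. h k > 0"
  shows "(\<lambda>k::nat. L2_sq (\<lambda>x. cutoff (h k) x *\<^sub>R v x - v x)) \<longlonglongrightarrow> 0"
proof (rule L2_sq_dominated[OF _ v, where c=1])
  have [measurable]: "v \<in> borel_measurable borel" using v by (simp add: in_L2_iff)
  have [measurable]: "cutoff (h k) \<in> borel_measurable borel" for k by (intro test_function_measurable cutoff_test h)
  show "(\<lambda>x. cutoff (h k) x *\<^sub>R v x - v x) \<in> borel_measurable borel" for k by measurable
  show "AE x in lborel. (\<lambda>k. cutoff (h k) x *\<^sub>R v x - v x) \<longlonglongrightarrow> 0"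
  proof (intro AE_I2)
    fix x :: "real^'n"
    have "(\<lambda>k. cutoff (h k) x *\<^sub>R v x - v x) \<longlonglongrightarrow> 1 *\<^sub>R v x - v x"
      by (intro tendsto_intros cutoff_tendsto h)
    then show "(\<lambda>k. cutoff (h k) x *\<^sub>R v x - v x) \<longlonglongrightarrow> 0" by simp
  qed
  fix k x
  have "norm ((cutoff (h k) x - 1) *\<^sub>R v x) \<le> 1 * norm (v x)"
    unfolding norm_scaleR using cutoff_bounds[of "h k" x] by (intro mult_right_mono) auto
  then show "norm (cutoff (h k) x *\<^sub>R v x - v x) \<le> 1 * norm (v x)" by (simp add: scaleR_left_diff_distrib)
qed

text \<open>As \<open>u\<close> is integrable, the localised transforms converge at every frequency,
  and the error is at most a multiple of \<open>h k\<close> times the L1 norm. The identity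
  therefore holds everywhere, as the flow at a fixed frequency requires.\<close>

lemma constraint_fourier:
  fixes Q :: "'n::finite \<Rightarrow> real^'m^'p" and R :: "real^'m^'p"
  assumes u: "integrable lborel u" "in_L2 u" and con: "satisfies_constraint Q R u"
  shows "pencil Q R \<xi> (fourier u \<xi>) = 0"
proof -
  have [measurable]: "u \<in> borel_measurable borel" using u by (simp add: in_L2_iff)
  define h where "h k = 1 / real (Suc k)" for k
  have h: "h k > 0" for k by (simp add: h_def)
  have h0: "h \<longlonglongrightarrow> 0" unfolding h_def by (rule LIMSEQ_Suc[OF lim_1_over_n])
  have tested0: "tested Q R u \<phi> = 0" if t: "test_function \<phi>" for \<phi>
  proof -
    have "tested Q R u \<phi> = (LINT x|lborel. - (\<phi> x *\<^sub>R (R *v u x) - (\<Sum>j\<in>UNIV. partials [j] \<phi> x *\<^sub>R (Q j *v u x))))"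
      unfolding tested_def by (intro Bochner_Integration.integral_cong) auto
    also have "\<dots> = 0" using con t by (simp only: Bochner_Integration.integral_minus satisfies_constraint_def) simp
    finally show ?thesis .
  qed
  have eq: "pencil Q R \<xi> (fourier (\<lambda>x. cutoff (h k) x *\<^sub>R u x) \<xi>) = fourier (cutoff_error Q (h k) u) \<xi>" for k
    using tested_cutoff[OF h[of k] u(2), where Q=Q and R=R and \<xi>=\<xi>] by (simp add: tested0 cutoff_cos_sin_test h cvec_def vec_eq_iff)
  have "(\<lambda>k. fourier (\<lambda>x. cutoff (h k) x *\<^sub>R u x) \<xi>) \<longlonglongrightarrow> fourier u \<xi>"
    unfolding fourier_cvec
  proof (rule integral_dominated_convergence[where w="\<lambda>x. norm (u x)"])
    have [measurable]: "cutoff (h k) \<in> borel_measurable borel" for k by (intro test_function_measurable cutoff_test h)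
    show "(\<lambda>x. cis (- (x \<bullet> \<xi>)) *s cvec (u x)) \<in> borel_measurable lborel" by (intro cmult_measurable) measurable
    show "(\<lambda>x. cis (- (x \<bullet> \<xi>)) *s cvec (cutoff (h k) x *\<^sub>R u x)) \<in> borel_measurable lborel" for k by (intro cmult_measurable) measurable
    show "integrable lborel (\<lambda>x. norm (u x))" using u by auto
    show "AE x in lborel. (\<lambda>k. cis (- (x \<bullet> \<xi>)) *s cvec (cutoff (h k) x *\<^sub>R u x)) \<longlonglongrightarrow> cis (- (x \<bullet> \<xi>)) *s cvec (u x)"
    proof (intro AE_I2)
      fix x
      have "(\<lambda>k. cutoff (h k) x *\<^sub>R (cis (- (x \<bullet> \<xi>)) *s cvec (u x))) \<longlonglongrightarrow> 1 *\<^sub>R (cis (- (x \<bullet> \<xi>)) *s cvec (u x))"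
        by (intro tendsto_intros cutoff_tendsto h0)
      then show "(\<lambda>k. cis (- (x \<bullet> \<xi>)) *s cvec (cutoff (h k) x *\<^sub>R u x)) \<longlonglongrightarrow> cis (- (x \<bullet> \<xi>)) *s cvec (u x)"
        by (simp add: cvec_scaleR cmult_scaleR)
    qed
    show "AE x in lborel. norm (cis (- (x \<bullet> \<xi>)) *s cvec (cutoff (h k) x *\<^sub>R u x)) \<le> norm (u x)" for k
    proof (intro AE_I2)
      fix x
      have "\<bar>cutoff (h k) x\<bar> * norm (u x) \<le> 1 * norm (u x)"
        using cutoff_bounds[of "h k" x] by (intro mult_right_mono) auto
      then show "norm (cis (- (x \<bullet> \<xi>)) *s cvec (cutoff (h k) x *\<^sub>R u x)) \<le> norm (u x)" by (simp add: norm_cmult)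
    qed
  qed
  from bounded_linear.tendsto[OF bounded_linear_pencil[of Q R \<xi>] this]
  have 1: "(\<lambda>k. fourier (cutoff_error Q (h k) u) \<xi>) \<longlonglongrightarrow> pencil Q R \<xi> (fourier u \<xi>)" unfolding eq .
  obtain b where b: "b > 0" "\<And>d v x. d > 0 \<Longrightarrow> norm (cutoff_error Q d v x) \<le> b * d * norm (v x)"
    using cutoff_error_bound[of Q] by blast
  have "(\<lambda>k. fourier (cutoff_error Q (h k) u) \<xi>) \<longlonglongrightarrow> 0"
  proof (rule Lim_null_comparison[OF always_eventually[OF allI]])
    fix k
    have "norm (fourier (cutoff_error Q (h k) u) \<xi>) \<le> L1_norm (cutoff_error Q (h k) u)"
      by (intro fourier_bound cutoff_error_integrable h u)
    also have "\<dots> \<le> (LINT x|lborel. b * h k * norm (u x))"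
      unfolding L1_norm_def using u(1)
      by (intro integral_mono b h integrable_norm cutoff_error_integrable u integrable_mult_right)
    finally show "norm (fourier (cutoff_error Q (h k) u) \<xi>) \<le> b * h k * L1_norm u" by (simp add: L1_norm_def)
  next
    have "(\<lambda>k. b * h k * L1_norm u) \<longlonglongrightarrow> b * 0 * L1_norm u" by (intro tendsto_intros h0)
    then show "(\<lambda>k. b * h k * L1_norm u) \<longlonglongrightarrow> 0" by simp
  qed
  from LIMSEQ_unique[OF 1 this] show ?thesis .
qed

section \<open>The solution on the Fourier side\<close>

text \<open>Cauchy-Schwarz gives a bound uniform in the frequency, through which L2 continuity in
  time reaches the localised transforms.\<close>

lemma fourier_test_bound:
  fixes v :: "real^'n \<Rightarrow> real^'m"
  assumes t: "test_function \<phi>" and v: "in_L2 v"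
  shows "norm (fourier (\<lambda>x. \<phi> x *\<^sub>R v x) \<xi>) \<le> L2_norm \<phi> * L2_norm v"
proof -
  have [measurable]: "v \<in> borel_measurable borel" using v by (simp add: in_L2_iff)
  note [measurable] = test_function_measurable[OF t]
  let ?N = "L1_norm (\<lambda>x. \<phi> x *\<^sub>R v x)"
  have phi2: "in_L2 \<phi>"
    using test_function_in_L2[OF t] by (auto simp: in_L2_iff L2_sq_def)
  have "(LINT x|lborel. complex_of_real \<bar>\<phi> x\<bar> * complex_of_real (norm (v x))) = complex_of_real ?N"
    unfolding L1_norm_def by (simp flip: of_real_mult)
  then have "ennreal (?N\<^sup>2) \<le> L2_sq (\<lambda>x. complex_of_real \<bar>\<phi> x\<bar>) * L2_sq (\<lambda>x. complex_of_real (norm (v x)))"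
    using L2_Cauchy_Schwarz[of "\<lambda>x. complex_of_real \<bar>\<phi> x\<bar>" "\<lambda>x. complex_of_real (norm (v x))"] by simp
  also have "L2_sq (\<lambda>x. complex_of_real \<bar>\<phi> x\<bar>) = ennreal ((L2_norm \<phi>)\<^sup>2)"
    using L2_norm_sq[OF phi2] by (simp add: L2_sq_def)
  also have "L2_sq (\<lambda>x. complex_of_real (norm (v x))) = ennreal ((L2_norm v)\<^sup>2)"
    using L2_norm_sq[OF v] by (simp add: L2_sq_def)
  finally have "?N\<^sup>2 \<le> (L2_norm \<phi> * L2_norm v)\<^sup>2"
    by (simp add: power_mult_distrib flip: ennreal_mult)
  then have "?N \<le> L2_norm \<phi> * L2_norm v" by (rule power2_le_imp_le) simp
  moreover have "norm (fourier (\<lambda>x. \<phi> x *\<^sub>R v x) \<xi>) \<le> ?N"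
    by (intro fourier_bound integrable_test_mult t v)
  ultimately show ?thesis by linarith
qed

text \<open>Rewrites the error through transforms of test functions times \<open>v\<close>, the form
  in which joint continuity in time and frequency is available.\<close>

lemma cutoff_error_fourier:
  fixes v :: "real^'n \<Rightarrow> real^'m" and Q :: "'n \<Rightarrow> real^'m^'p"
  assumes d: "d > 0" and v: "in_L2 v"
  shows "fourier (cutoff_error Q d v) \<xi> = (\<Sum>j\<in>UNIV. cmat (Q j) *v fourier (\<lambda>x. partials [j] (cutoff d) x *\<^sub>R v x) \<xi>)"
proof -
  note t = test_function_partials[OF cutoff_test[OF d]]
  have "fourier (cutoff_error Q d v) \<xi> = (\<Sum>j\<in>UNIV. fourier (\<lambda>x. partials [j] (cutoff d) x *\<^sub>R (Q j *v v x)) \<xi>)"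
    unfolding cutoff_error_def[abs_def] by (intro fourier_sum integrable_test_mult t in_L2_matrix v)
  moreover have "fourier (\<lambda>x. partials [j] (cutoff d) x *\<^sub>R (Q j *v v x)) \<xi> = cmat (Q j) *v fourier (\<lambda>x. partials [j] (cutoff d) x *\<^sub>R v x) \<xi>" for j
    using fourier_matrix[OF integrable_test_mult[OF t[of "[j]"] v], of "Q j" \<xi>]
    by (simp add: matrix_vector_mult_scaleR)
  ultimately show ?thesis by simp
qed

text \<open>Testing the equation with the cut-off cosine and sine differentiates the localised
  transform of \<open>A0 u\<close>; the inverse of \<open>A0\<close> recovers that of
  \<open>u\<close>. The gradient of the cut-off becomes a forcing term.\<close>

lemma solution_cutoff_ode:
  fixes A0 L :: "real^'m^'m" and A :: "'n::finite \<Rightarrow> real^'m^'m"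
  assumes A: "condition_A A0 A L" and sol: "is_solution A0 A L u0 u" and d: "d > 0" and t: "t > 0"
  shows "\<exists>w'. ((\<lambda>\<tau>. fourier (\<lambda>x. cutoff d x *\<^sub>R u \<tau> x) \<xi>) has_vector_derivative w') (at t) \<and>
     cmat A0 *v w' = - pencil A L \<xi> (fourier (\<lambda>x. cutoff d x *\<^sub>R u t x) \<xi>) + fourier (cutoff_error A d (u t)) \<xi>"
proof -
  have L2u: "in_L2 (u s)" if "s \<ge> 0" for s using sol that by (auto simp: is_solution_def)
  have weak: "((\<lambda>\<tau>. LINT x|lborel. \<phi> x *\<^sub>R (A0 *v u \<tau> x)) has_vector_derivative tested A L (u t) \<phi>) (at t)"
    if "test_function \<phi>" for \<phi>
    using sol that t by (auto simp: is_solution_def tested_def)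
  note tst = cutoff_cos_sin_test[OF d, of \<xi>]
  define y where "y \<tau> = cvec (LINT x|lborel. cutoff_cos d \<xi> x *\<^sub>R (A0 *v u \<tau> x)) - \<i> *s cvec (LINT x|lborel. cutoff_sin d \<xi> x *\<^sub>R (A0 *v u \<tau> x))" for \<tau>
  define D where "D = cvec (tested A L (u t) (cutoff_cos d \<xi>)) - \<i> *s cvec (tested A L (u t) (cutoff_sin d \<xi>))"
  have bl: "bounded_linear (\<lambda>z. \<i> *s cvec z)"
    unfolding linear_conv_bounded_linear[symmetric] by (rule linearI) (simp_all add: cvec_add i_add cvec_scaleR i_scaleR)
  have "(y has_vector_derivative D) (at t)"
    unfolding y_def D_def
    by (intro has_vector_derivative_diff bounded_linear.has_vector_derivative[OF bounded_linear_cvec]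
      bounded_linear.has_vector_derivative[OF bl] weak tst)
  then have "((\<lambda>\<tau>. cmat (matrix_inv A0) *v y \<tau>) has_vector_derivative cmat (matrix_inv A0) *v D) (at t)"
    by (rule bounded_linear.has_vector_derivative[OF bounded_linear_cmat])
  then have "((\<lambda>\<tau>. fourier (\<lambda>x. cutoff d x *\<^sub>R u \<tau> x) \<xi>) has_vector_derivative cmat (matrix_inv A0) *v D) (at t)"
  proof (rule has_vector_derivative_transform_within_open[of _ _ _ "{0<..}"])
    fix \<tau> :: real assume \<tau>: "\<tau> \<in> {0<..}"
    have "y \<tau> = fourier (\<lambda>x. cutoff d x *\<^sub>R (A0 *v u \<tau> x)) \<xi>"
      unfolding y_def using \<tau> by (intro fourier_cutoff[OF d, symmetric] in_L2_matrix L2u) simp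
    also have "\<dots> = cmat A0 *v fourier (\<lambda>x. cutoff d x *\<^sub>R u \<tau> x) \<xi>"
      using fourier_matrix[OF integrable_test_mult[OF cutoff_test[OF d] L2u[of \<tau>]], of A0 \<xi>] \<tau>
      by (simp add: matrix_vector_mult_scaleR)
    finally show "cmat (matrix_inv A0) *v y \<tau> = fourier (\<lambda>x. cutoff d x *\<^sub>R u \<tau> x) \<xi>"
      by (simp add: condition_A_invertible[OF A] flip: cmat_mult_mv)
  qed (use t in auto)
  moreover have "cmat A0 *v (cmat (matrix_inv A0) *v D) = D"
    by (simp add: condition_A_invertible[OF A] flip: cmat_mult_mv)
  moreover have "D = - pencil A L \<xi> (fourier (\<lambda>x. cutoff d x *\<^sub>R u t x) \<xi>) + fourier (cutoff_error A d (u t)) \<xi>"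
    unfolding D_def using t by (intro tested_cutoff d L2u) simp
  ultimately show ?thesis by (intro exI[of _ "cmat (matrix_inv A0) *v D"]) simp
qed

lemma solution_time_continuity:
  fixes u :: "real \<Rightarrow> real^'n \<Rightarrow> real^'m"
  assumes sol: "is_solution A0 A L u0 u" and s: "\<And>k. s k \<ge> 0" "s \<longlonglongrightarrow> s0" "s0 \<ge> 0"
  shows "(\<lambda>k. L2_norm (\<lambda>x. u (s k) x - u s0 x)) \<longlonglongrightarrow> 0"
proof -
  have L2u: "in_L2 (u s)" if "s \<ge> 0" for s using sol that by (auto simp: is_solution_def)
  define g where "g \<tau> = L2_norm (\<lambda>x. u \<tau> x - u s0 x)" for \<tau>
  have g_eq: "ennreal ((g \<tau>)\<^sup>2) = L2_sq (\<lambda>x. u \<tau> x - u s0 x)" if "\<tau> \<ge> 0" for \<tau>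
    unfolding g_def by (intro L2_norm_sq in_L2_diff L2u that s)
  have "((\<lambda>\<tau>. L2_sq (\<lambda>x. u \<tau> x - u s0 x)) \<longlongrightarrow> 0) (at s0 within {0..})"
    using sol s(3) unfolding is_solution_def L2_tendsto_L2_sq by blast
  moreover have "eventually (\<lambda>\<tau>. L2_sq (\<lambda>x. u \<tau> x - u s0 x) = ennreal ((g \<tau>)\<^sup>2)) (at s0 within {0..})"
    unfolding eventually_at_filter by (auto simp: g_eq intro!: always_eventually)
  ultimately have "((\<lambda>\<tau>. ennreal ((g \<tau>)\<^sup>2)) \<longlongrightarrow> ennreal 0) (at s0 within {0..})"
    by (simp add: tendsto_cong)
  then have "((\<lambda>\<tau>. (g \<tau>)\<^sup>2) \<longlongrightarrow> 0) (at s0 within {0..})"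
    by (subst (asm) tendsto_ennreal_iff) auto
  moreover have "\<bar>g \<tau>\<bar> = g \<tau>" for \<tau> by (simp add: g_def)
  ultimately have "(g \<longlongrightarrow> 0) (at s0 within {0..})"
    using tendsto_real_sqrt[of "\<lambda>\<tau>. (g \<tau>)\<^sup>2" 0] by simp
  moreover have g0: "g s0 = 0" by (simp add: g_def L2_norm_def)
  ultimately have "continuous (at s0 within {0..}) g" by (simp add: continuous_within)
  then have "(g \<circ> s) \<longlonglongrightarrow> g s0"
    using s unfolding continuous_within_sequentially by auto
  then show ?thesis unfolding g0 by (simp only: o_def g_def)
qed

text \<open>A continuous function on a compact interval is bounded; the contradiction is drawn along
  a convergent subsequence of times because continuity is known as L2 convergence.\<close>

lemma solution_bounded:
  fixes u :: "real \<Rightarrow> real^'n \<Rightarrow> real^'m"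
  assumes sol: "is_solution A0 A L u0 u"
  shows "\<exists>B>0. \<forall>s\<in>{0..T}. L2_norm (u s) \<le> B"
proof (rule ccontr)
  have L2u: "in_L2 (u s)" if "s \<ge> 0" for s using sol that by (auto simp: is_solution_def)
  assume "\<not> ?thesis"
  then have "\<exists>s\<in>{0..T}. L2_norm (u s) > real (Suc k)" for k
    by (metis not_le of_nat_0_less_iff zero_less_Suc)
  then obtain s where s: "\<And>k. s k \<in> {0..T}" "\<And>k. L2_norm (u (s k)) > real (Suc k)" by metis
  obtain l r where l: "l \<in> {0..T}" and r: "strict_mono r" "(s \<circ> r) \<longlonglongrightarrow> l"
    using seq_compactE[OF compact_imp_seq_compact[OF compact_Icc[of 0 T]], of s] s(1) by auto
  have "(\<lambda>k. L2_norm (\<lambda>x. u (s (r k)) x - u l x)) \<longlonglongrightarrow> 0"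
    using r(2) s(1) l by (intro solution_time_continuity[OF sol]) (auto simp: o_def)
  then have ev: "eventually (\<lambda>k. L2_norm (\<lambda>x. u (s (r k)) x - u l x) < 1) sequentially"
    by (rule order_tendstoD) simp
  obtain N where N: "2 + 2 * (L2_norm (u l))\<^sup>2 < real N" using reals_Archimedean2 by blast
  from ev have "eventually (\<lambda>k. L2_norm (\<lambda>x. u (s (r k)) x - u l x) < 1 \<and> k \<ge> N) sequentially"
    using eventually_ge_at_top[of N] by eventually_elim simp
  then obtain k where k: "L2_norm (\<lambda>x. u (s (r k)) x - u l x) < 1" "k \<ge> N" by (auto simp: eventually_sequentially)
  have lk: "in_L2 (u (s (r k)))" "in_L2 (u l)" using s(1)[of "r k"] l L2u by auto
  have "ennreal ((L2_norm (u (s (r k))))\<^sup>2) = L2_sq (\<lambda>x. (u (s (r k)) x - u l x) + u l x)" using lk by (simp add: L2_norm_sq)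
  also have "\<dots> \<le> 2 * L2_sq (\<lambda>x. u (s (r k)) x - u l x) + 2 * L2_sq (u l)"
    using lk in_L2_diff[OF lk] by (intro L2_sq_add_le in_L2_measurable)
  also have "\<dots> = 2 * ennreal ((L2_norm (\<lambda>x. u (s (r k)) x - u l x))\<^sup>2) + 2 * ennreal ((L2_norm (u l))\<^sup>2)"
    by (simp add: L2_norm_sq[OF in_L2_diff[OF lk]] L2_norm_sq[OF lk(2)])
  also have "\<dots> = ennreal (2 * (L2_norm (\<lambda>x. u (s (r k)) x - u l x))\<^sup>2 + 2 * (L2_norm (u l))\<^sup>2)"
    by (simp add: ennreal_mult')
  finally have "(L2_norm (u (s (r k))))\<^sup>2 \<le> 2 * (L2_norm (\<lambda>x. u (s (r k)) x - u l x))\<^sup>2 + 2 * (L2_norm (u l))\<^sup>2"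
    by (subst (asm) ennreal_le_iff) auto
  also have "(L2_norm (\<lambda>x. u (s (r k)) x - u l x))\<^sup>2 \<le> 1" using k(1) by (simp add: power_le_one less_imp_le)
  finally have le: "(L2_norm (u (s (r k))))\<^sup>2 < real N" using N by simp
  have "real N \<le> real (Suc (r k))" using k(2) seq_suble[OF r(1), of k] by simp
  also have "\<dots> \<le> L2_norm (u (s (r k)))" using s(2)[of "r k"] by simp
  also have "\<dots> \<le> (L2_norm (u (s (r k))))\<^sup>2"
    using s(2)[of "r k"] by (simp add: power2_eq_square)
  finally show False using le by simp
qed

text \<open>Continuity in time is uniform in the frequency by \<open>fourier_test_bound\<close>, so
  it combines with continuity in the frequency at the limit time. Joint continuity is what the
  exchange of time and frequency integrals uses.\<close>

lemma solution_test_continuous: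
  fixes u :: "real \<Rightarrow> real^'n \<Rightarrow> real^'m"
  assumes sol: "is_solution A0 A L u0 u" and t: "test_function \<phi>"
  shows "continuous_on ({0..} \<times> UNIV) (\<lambda>p. fourier (\<lambda>x. \<phi> x *\<^sub>R u (fst p) x) (snd p))"
  unfolding continuous_on_sequentially
proof (intro allI ballI impI, elim conjE)
  fix p :: "nat \<Rightarrow> real \<times> (real^'n)" and q assume q: "q \<in> {0..} \<times> UNIV" and p: "\<forall>n. p n \<in> {0..} \<times> UNIV" and lim: "p \<longlonglongrightarrow> q"
  have L2u: "in_L2 (u s)" if "s \<ge> 0" for s using sol that by (auto simp: is_solution_def)
  have q0: "fst q \<ge> 0" and p0: "fst (p n) \<ge> 0" for n using q p by (auto simp: mem_Times_iff)
  let ?F = "\<lambda>s \<xi>. fourier (\<lambda>x. \<phi> x *\<^sub>R u s x) \<xi>"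
  have "(\<lambda>n. ?F (fst (p n)) (snd (p n)) - ?F (fst q) (snd q)) \<longlonglongrightarrow> 0"
  proof (rule Lim_null_comparison[OF always_eventually[OF allI]])
    fix n
    have "?F (fst (p n)) (snd (p n)) - ?F (fst q) (snd (p n)) = fourier (\<lambda>x. \<phi> x *\<^sub>R (u (fst (p n)) x - u (fst q) x)) (snd (p n))"
      unfolding scaleR_diff_right by (intro fourier_diff[symmetric] integrable_test_mult t L2u p0 q0)
    then have "norm (?F (fst (p n)) (snd (p n)) - ?F (fst q) (snd (p n))) \<le> L2_norm \<phi> * L2_norm (\<lambda>x. u (fst (p n)) x - u (fst q) x)"
      using fourier_test_bound[OF t in_L2_diff[OF L2u[OF p0[of n]] L2u[OF q0]]] by simp
    then show "norm (?F (fst (p n)) (snd (p n)) - ?F (fst q) (snd q)) \<le>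
        L2_norm \<phi> * L2_norm (\<lambda>x. u (fst (p n)) x - u (fst q) x) + norm (?F (fst q) (snd (p n)) - ?F (fst q) (snd q))"
      using norm_triangle_ineq[of "?F (fst (p n)) (snd (p n)) - ?F (fst q) (snd (p n))" "?F (fst q) (snd (p n)) - ?F (fst q) (snd q)"] by simp
  next
    have 1: "(\<lambda>n. L2_norm (\<lambda>x. u (fst (p n)) x - u (fst q) x)) \<longlonglongrightarrow> 0"
      by (intro solution_time_continuity[OF sol] p0 q0 tendsto_fst lim)
    have "isCont (?F (fst q)) (snd q)"
      using continuous_on_fourier[OF integrable_test_mult[OF t L2u[OF q0]]] by (simp add: continuous_on_eq_continuous_at)
    then have 2: "(\<lambda>n. ?F (fst q) (snd (p n))) \<longlonglongrightarrow> ?F (fst q) (snd q)"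
      by (rule isCont_tendsto_compose) (intro tendsto_snd lim)
    show "(\<lambda>n. L2_norm \<phi> * L2_norm (\<lambda>x. u (fst (p n)) x - u (fst q) x) + norm (?F (fst q) (snd (p n)) - ?F (fst q) (snd q))) \<longlonglongrightarrow> 0"
      using tendsto_add[OF tendsto_mult[OF tendsto_const[of "L2_norm \<phi>"] 1] tendsto_norm[OF tendsto_diff[OF 2 tendsto_const[of "?F (fst q) (snd q)"]]]]
      by simp
  qed
  then show "((\<lambda>p. ?F (fst p) (snd p)) \<circ> p) \<longlonglongrightarrow> ?F (fst q) (snd q)"
    unfolding o_def by (rule LIM_zero_cancel)
qed

text \<open>The energy estimate integrates over time in the sense of Henstock and Kurzweil; on
  continuous nonnegative data this agrees with the Lebesgue integral, and Tonelli's theorem applies.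
  Plancherel's theorem can then be used at each fixed time.\<close>

lemma nn_integral_interval_swap:
  fixes e :: "real \<Rightarrow> real^'n \<Rightarrow> real"
  assumes cont: "continuous_on ({0..T} \<times> UNIV) (\<lambda>p. e (fst p) (snd p))" and nn: "\<And>s \<xi>. 0 \<le> e s \<xi>" and T: "T \<ge> 0"
  shows "(\<integral>\<^sup>+\<xi>. ennreal (integral {0..T} (\<lambda>s. e s \<xi>)) \<partial>lborel) = (\<integral>\<^sup>+s. indicator {0..T} s * (\<integral>\<^sup>+\<xi>. ennreal (e s \<xi>) \<partial>lborel) \<partial>lborel)"
proof -
  have "(\<lambda>p. indicator ({0..T} \<times> UNIV) p *\<^sub>R e (fst p) (snd p)) \<in> borel_measurable borel"
    by (rule borel_measurable_continuous_on_indicator[OF _ cont]) (auto intro: borel_closed closed_Times)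
  then have m: "(\<lambda>p. ennreal (indicator ({0..T} \<times> UNIV) p *\<^sub>R e (fst p) (snd p))) \<in> borel_measurable (lborel \<Otimes>\<^sub>M lborel)"
    by (simp add: lborel_prod)
  have "(\<integral>\<^sup>+\<xi>. ennreal (integral {0..T} (\<lambda>s. e s \<xi>)) \<partial>lborel)
      = (\<integral>\<^sup>+\<xi>. (\<integral>\<^sup>+s. ennreal (indicator ({0..T} \<times> UNIV) (s, \<xi>) *\<^sub>R e s \<xi>) \<partial>lborel) \<partial>lborel)"
  proof (intro nn_integral_cong)
    fix \<xi> :: "real^'n"
    have c: "continuous_on {0..T} (\<lambda>s. e s \<xi>)"
    proof -
      have "continuous_on {0..T} (\<lambda>s. (s, \<xi>))" by (intro continuous_intros)
      from continuous_on_compose2[OF cont this] show ?thesis by auto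
    qed
    have si: "set_integrable lborel {0..T} (\<lambda>s. e s \<xi>)"
      by (rule borel_integrable_atLeastAtMost'[OF c])
    have "integral {0..T} (\<lambda>s. e s \<xi>) = (LINT s|lborel. indicator {0..T} s *\<^sub>R e s \<xi>)"
      using set_borel_integral_eq_integral(2)[OF si] by (simp add: set_lebesgue_integral_def)
    also have "ennreal \<dots> = (\<integral>\<^sup>+s. ennreal (indicator {0..T} s *\<^sub>R e s \<xi>) \<partial>lborel)"
      using si nn by (intro nn_integral_eq_integral[symmetric]) (auto simp: set_integrable_def)
    finally show "ennreal (integral {0..T} (\<lambda>s. e s \<xi>)) = (\<integral>\<^sup>+s. ennreal (indicator ({0..T} \<times> UNIV) (s, \<xi>) *\<^sub>R e s \<xi>) \<partial>lborel)"
      by (simp add: indicator_times)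
  qed
  also have "\<dots> = (\<integral>\<^sup>+s. (\<integral>\<^sup>+\<xi>. ennreal (indicator ({0..T} \<times> UNIV) (s, \<xi>) *\<^sub>R e s \<xi>) \<partial>lborel) \<partial>lborel)"
    using lborel_pair.Fubini'[of "\<lambda>s \<xi>. ennreal (indicator ({0..T} \<times> UNIV) (s, \<xi>) *\<^sub>R e s \<xi>)"] m by (simp add: case_prod_unfold)
  also have "\<dots> = (\<integral>\<^sup>+s. indicator {0..T} s * (\<integral>\<^sup>+\<xi>. ennreal (e s \<xi>) \<partial>lborel) \<partial>lborel)"
    by (intro nn_integral_cong) (auto simp: indicator_def)
  finally show ?thesis .
qed

text \<open>At each frequency the localised transform minus the flow solves a forced equation. The
  energy estimate, integrated over frequencies, reduces the distance to two L2 quantities in space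
  that vanish as the cut-off widens. This also shows that every solution in the class has the same
  transform.\<close>

theorem solution_fourier:
  fixes A0 L :: "real^'m^'m" and A :: "'n::finite \<Rightarrow> real^'m^'m"
  assumes A: "condition_A A0 A L" and sol: "is_solution A0 A L u0 u"
    and u0: "integrable lborel u0" "in_L2 u0" and T: "T \<ge> 0"
  shows "is_L2_fourier (u T) (evolution A0 A L (fourier u0) T)"
proof -
  let ?W = "\<lambda>t \<xi>. evolution A0 A L (fourier u0) t \<xi>"
  define \<kappa> where "\<kappa> = ennreal ((2 * pi) ^ CARD('n))"
  have \<kappa>: "\<kappa> < \<infinity>" by (simp add: \<kappa>_def)
  have L2u: "in_L2 (u s)" if "s \<ge> 0" for s using sol that by (auto simp: is_solution_def)
  have init: "AE x in lborel. u 0 x = u0 x" using sol by (simp add: is_solution_def)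
  obtain C where C: "C > 0" "\<And>\<xi> w w' e T. T \<ge> 0 \<Longrightarrow> continuous_on {0..T} w \<Longrightarrow> continuous_on {0..T} e \<Longrightarrow>
    (\<And>t. 0 < t \<Longrightarrow> t < T \<Longrightarrow> (w has_vector_derivative w' t) (at t) \<and> cmat A0 *v w' t = - pencil A L \<xi> (w t) + e t) \<Longrightarrow>
    (norm (w T))\<^sup>2 \<le> C * exp T * ((norm (w 0))\<^sup>2 + integral {0..T} (\<lambda>s. (norm (e s))\<^sup>2))"
    using forced_energy_estimate[OF A] by blast
  have Wm [measurable]: "?W T \<in> borel_measurable borel"
    by (intro borel_measurable_continuous_onI evolution_continuous A continuous_on_fourier u0 T)
  \<comment> \<open>The energy estimate with zero forcing bounds the flow by the initial transform
    at every frequency.\<close>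
  have L2W: "in_L2 (?W T)"
  proof (rule in_L2_bound[OF L2_sq_fourier(2)[OF u0] Wm])
    fix \<xi>
    have "(norm (?W T \<xi>))\<^sup>2 \<le> C * exp T * ((norm (?W 0 \<xi>))\<^sup>2 + integral {0..T} (\<lambda>s. (norm (0 :: complex^'m))\<^sup>2))"
      by (rule C(2)[OF T, where e="\<lambda>_. 0", OF evolution_continuous_time continuous_on_const])
        (use evolution_deriv evolution_eq[OF A] in auto)
    then have "(norm (?W T \<xi>))\<^sup>2 \<le> (sqrt (C * exp T) * norm (fourier u0 \<xi>))\<^sup>2"
      using C(1) by (simp add: evolution_0 power_mult_distrib)
    then show "norm (?W T \<xi>) \<le> sqrt (C * exp T) * norm (fourier u0 \<xi>)"
      by (rule power2_le_imp_le) (use C(1) in simp)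
  qed
  obtain B where B: "B > 0" "\<And>s. s \<in> {0..T} \<Longrightarrow> L2_norm (u s) \<le> B" using solution_bounded[OF sol] by blast
  obtain b where b: "b > 0" "\<And>d v x. d > 0 \<Longrightarrow> norm (cutoff_error A d v x) \<le> b * d * norm (v x)"
    using cutoff_error_bound[of A] by blast
  define h where "h k = 1 / real (Suc k)" for k
  have h: "h k > 0" for k by (simp add: h_def)
  have h0: "h \<longlonglongrightarrow> 0" unfolding h_def by (rule LIMSEQ_Suc[OF lim_1_over_n])
  define z where "z k t \<xi> = fourier (\<lambda>x. cutoff (h k) x *\<^sub>R u t x) \<xi>" for k t \<xi>
  \<comment> \<open>Initial localisation error plus accumulated forcing: the gradient of the cut-off
    contributes \<open>b * h k\<close>, and \<open>B\<close> bounds the solution on the time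
    interval.\<close>
  define \<delta> where "\<delta> k = ennreal (C * exp T) * (\<kappa> * L2_sq (\<lambda>x. cutoff (h k) x *\<^sub>R u0 x - u0 x) + ennreal T * (\<kappa> * ennreal ((b * h k * B)\<^sup>2)))" for k
  have cut_int: "integrable lborel (\<lambda>x. cutoff (h k) x *\<^sub>R v x)" "in_L2 (\<lambda>x. cutoff (h k) x *\<^sub>R v x)"
    if "in_L2 v" for k and v :: "real^'n \<Rightarrow> real^'m"
    using integrable_test_mult[OF cutoff_test[OF h]] in_L2_test_mult[OF cutoff_test[OF h]] that by auto
  have zW: "L2_sq (\<lambda>\<xi>. z k T \<xi> - ?W T \<xi>) \<le> \<delta> k" for k
  proof -
    define e where "e s \<xi> = fourier (cutoff_error A (h k) (u s)) \<xi>" for s \<xi>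
    have zc: "continuous_on ({0..T} \<times> UNIV) (\<lambda>p. z k (fst p) (snd p))"
      unfolding z_def by (rule continuous_on_subset[OF solution_test_continuous[OF sol cutoff_test[OF h]]]) auto
    have ec: "continuous_on ({0..T} \<times> UNIV) (\<lambda>p. e (fst p) (snd p))"
    proof -
      have "continuous_on ({0..T} \<times> UNIV) (\<lambda>p. \<Sum>j\<in>UNIV. cmat (A j) *v fourier (\<lambda>x. partials [j] (cutoff (h k)) x *\<^sub>R u (fst p) x) (snd p))"
        by (intro continuous_on_sum bounded_linear.continuous_on[OF bounded_linear_cmat]
          continuous_on_subset[OF solution_test_continuous[OF sol test_function_partials[OF cutoff_test[OF h]]]]) auto
      then show ?thesis
        by (rule continuous_on_eq) (auto simp: e_def cutoff_error_fourier[OF h L2u])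
    qed
    have slice: "continuous_on {0..T} (\<lambda>s. F s \<xi>)" if "continuous_on ({0..T} \<times> UNIV) (\<lambda>p. F (fst p) (snd p))"
      for F :: "real \<Rightarrow> real^'n \<Rightarrow> complex^'m" and \<xi>
    proof -
      have "continuous_on {0..T} (\<lambda>s. (s, \<xi>))" by (intro continuous_intros)
      from continuous_on_compose2[OF that this] show ?thesis by auto
    qed
    have point: "(norm (z k T \<xi> - ?W T \<xi>))\<^sup>2 \<le> C * exp T * ((norm (z k 0 \<xi> - fourier u0 \<xi>))\<^sup>2 + integral {0..T} (\<lambda>s. (norm (e s \<xi>))\<^sup>2))" for \<xi>
    proof -
      have "\<exists>w'. \<forall>t. t > 0 \<longrightarrow> ((\<lambda>\<tau>. z k \<tau> \<xi>) has_vector_derivative w' t) (at t) \<and> cmat A0 *v w' t = - pencil A L \<xi> (z k t \<xi>) + e t \<xi>"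
        unfolding z_def e_def by (intro choice allI) (use solution_cutoff_ode[OF A sol h] in blast)
      then obtain w' where w': "\<And>t. t > 0 \<Longrightarrow> ((\<lambda>\<tau>. z k \<tau> \<xi>) has_vector_derivative w' t) (at t)"
        "\<And>t. t > 0 \<Longrightarrow> cmat A0 *v w' t = - pencil A L \<xi> (z k t \<xi>) + e t \<xi>" by blast
      have "(norm (z k T \<xi> - ?W T \<xi>))\<^sup>2 \<le> C * exp T * ((norm (z k 0 \<xi> - ?W 0 \<xi>))\<^sup>2 + integral {0..T} (\<lambda>s. (norm (e s \<xi>))\<^sup>2))"
      proof (rule C(2)[OF T])
        show "continuous_on {0..T} (\<lambda>t. z k t \<xi> - ?W t \<xi>)"
          by (intro continuous_on_diff slice zc evolution_continuous_time)
        show "continuous_on {0..T} (\<lambda>t. e t \<xi>)" by (intro slice ec)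
        fix t :: real assume t: "0 < t"
        let ?d = "- (cmat (matrix_inv A0) *v pencil A L \<xi> (?W t \<xi>))"
        have "cmat A0 *v (w' t - ?d) = - pencil A L \<xi> (z k t \<xi>) + e t \<xi> + pencil A L \<xi> (?W t \<xi>)"
          unfolding matrix_vector_mult_diff_distrib evolution_eq[OF A] w'(2)[OF t] by simp
        also have "\<dots> = - pencil A L \<xi> (z k t \<xi> - ?W t \<xi>) + e t \<xi>"
          by (simp add: linear_diff[OF bounded_linear.linear[OF bounded_linear_pencil]])
        finally show "((\<lambda>t. z k t \<xi> - ?W t \<xi>) has_vector_derivative (w' t - ?d)) (at t) \<and>
          cmat A0 *v (w' t - ?d) = - pencil A L \<xi> (z k t \<xi> - ?W t \<xi>) + e t \<xi>"
          by (intro conjI has_vector_derivative_diff evolution_deriv w' t)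
      qed
      then show ?thesis by (simp add: evolution_0)
    qed
    \<comment> \<open>The initial value is attained only almost everywhere, which the integral does
      not see.\<close>
    have z0: "z k 0 \<xi> = fourier (\<lambda>x. cutoff (h k) x *\<^sub>R u0 x) \<xi>" for \<xi>
      unfolding z_def fourier_cvec
    proof (rule integral_cong_AE)
      show "(\<lambda>x. cis (- (x \<bullet> \<xi>)) *s cvec (cutoff (h k) x *\<^sub>R u 0 x)) \<in> borel_measurable lborel"
        "(\<lambda>x. cis (- (x \<bullet> \<xi>)) *s cvec (cutoff (h k) x *\<^sub>R u0 x)) \<in> borel_measurable lborel"
        using fourier_integrand_integrable[OF cut_int(1)[OF L2u[of 0]]] fourier_integrand_integrable[OF cut_int(1)[OF u0(2)]] by auto
    qed (use init in auto)
    have ez: "L2_sq (\<lambda>\<xi>. e s \<xi>) \<le> \<kappa> * ennreal ((b * h k * B)\<^sup>2)" if s: "s \<in> {0..T}" for s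
    proof -
      have L2us: "in_L2 (u s)" using s L2u by auto
      have "L2_sq (\<lambda>\<xi>. e s \<xi>) = \<kappa> * L2_sq (cutoff_error A (h k) (u s))"
        unfolding e_def \<kappa>_def by (intro L2_sq_fourier cutoff_error_integrable h L2us)
      also have "\<dots> \<le> \<kappa> * (ennreal ((b * h k)\<^sup>2) * L2_sq (u s))"
        using L2us h by (intro mult_left_mono L2_sq_mono_scale b) (auto simp: in_L2_iff)
      also have "L2_sq (u s) \<le> ennreal (B\<^sup>2)"
        using B(2)[OF s] by (simp add: L2_norm_sq[OF L2us, symmetric] ennreal_leI power_mono)
      then have "\<kappa> * (ennreal ((b * h k)\<^sup>2) * L2_sq (u s)) \<le> \<kappa> * (ennreal ((b * h k)\<^sup>2) * ennreal (B\<^sup>2))"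
        by (intro mult_left_mono) auto
      finally show ?thesis by (simp add: power_mult_distrib flip: ennreal_mult)
    qed
    have zm: "(\<lambda>\<xi>. z k 0 \<xi> - fourier u0 \<xi>) \<in> borel_measurable borel"
      unfolding z0 by (intro borel_measurable_diff fourier_measurable cut_int u0)
    have Im: "(\<lambda>\<xi>. integral {0..T} (\<lambda>s. (norm (e s \<xi>))\<^sup>2)) \<in> borel_measurable borel"
    proof -
      have "continuous_on (UNIV \<times> {0..T}) (\<lambda>p::(real^'n) \<times> real. (snd p, fst p))" by (intro continuous_intros)
      from continuous_on_compose2[OF ec this] have "continuous_on (UNIV \<times> {0..T}) (\<lambda>p. e (snd p) (fst p))"
        by fastforce
      then have "continuous_on (UNIV \<times> {0..T}) (\<lambda>p. (norm (e (snd p) (fst p)))\<^sup>2)"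
        by (intro continuous_intros)
      then have "(\<lambda>p. indicator (UNIV \<times> {0..T}) p *\<^sub>R (norm (e (snd p) (fst p)))\<^sup>2) \<in> borel_measurable borel"
        by (intro borel_measurable_continuous_on_indicator) (auto intro!: borel_closed closed_Times)
      then have "(\<lambda>(\<xi>, s). indicator ({0..T} \<times> UNIV) (s, \<xi>) *\<^sub>R (norm (e s \<xi>))\<^sup>2) \<in> borel_measurable (lborel \<Otimes>\<^sub>M lborel)"
        by (simp add: lborel_prod case_prod_unfold indicator_times mult.commute)
      then have "(\<lambda>\<xi>. LINT s|lborel. indicator ({0..T} \<times> UNIV) (s, \<xi>) *\<^sub>R (norm (e s \<xi>))\<^sup>2) \<in> borel_measurable borel"
        using lborel.borel_measurable_lebesgue_integral[of "\<lambda>\<xi> s. indicator ({0..T} \<times> UNIV) (s, \<xi>) *\<^sub>R (norm (e s \<xi>))\<^sup>2" lborel]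
        by simp
      moreover have "(LINT s|lborel. indicator ({0..T} \<times> UNIV) (s, \<xi>) *\<^sub>R (norm (e s \<xi>))\<^sup>2) = integral {0..T} (\<lambda>s. (norm (e s \<xi>))\<^sup>2)" for \<xi>
      proof -
        have si: "set_integrable lborel {0..T} (\<lambda>s. (norm (e s \<xi>))\<^sup>2)"
          by (intro borel_integrable_atLeastAtMost' continuous_intros slice ec)
        then show ?thesis
          using set_borel_integral_eq_integral(2)[OF si] by (simp add: set_lebesgue_integral_def indicator_times)
      qed
      ultimately show ?thesis by simp
    qed
    have "L2_sq (\<lambda>\<xi>. z k T \<xi> - ?W T \<xi>)
       \<le> (\<integral>\<^sup>+\<xi>. ennreal (C * exp T) * (ennreal ((norm (z k 0 \<xi> - fourier u0 \<xi>))\<^sup>2) + ennreal (integral {0..T} (\<lambda>s. (norm (e s \<xi>))\<^sup>2))) \<partial>lborel)"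
      unfolding L2_sq_def
    proof (intro nn_integral_mono)
      fix \<xi>
      have I0: "0 \<le> integral {0..T} (\<lambda>s. (norm (e s \<xi>))\<^sup>2)"
        by (intro Henstock_Kurzweil_Integration.integral_nonneg integrable_continuous_interval continuous_intros slice ec) auto
      have "ennreal ((norm (z k T \<xi> - ?W T \<xi>))\<^sup>2) \<le> ennreal (C * exp T * ((norm (z k 0 \<xi> - fourier u0 \<xi>))\<^sup>2 + integral {0..T} (\<lambda>s. (norm (e s \<xi>))\<^sup>2)))"
        by (intro ennreal_leI point)
      also have "\<dots> = ennreal (C * exp T) * (ennreal ((norm (z k 0 \<xi> - fourier u0 \<xi>))\<^sup>2) + ennreal (integral {0..T} (\<lambda>s. (norm (e s \<xi>))\<^sup>2)))"
        using I0 C(1) by (simp add: ennreal_mult ennreal_plus)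
      finally show "ennreal ((norm (z k T \<xi> - ?W T \<xi>))\<^sup>2) \<le> ennreal (C * exp T) * (ennreal ((norm (z k 0 \<xi> - fourier u0 \<xi>))\<^sup>2) + ennreal (integral {0..T} (\<lambda>s. (norm (e s \<xi>))\<^sup>2)))" .
    qed
    also have "\<dots> = ennreal (C * exp T) * (L2_sq (\<lambda>\<xi>. z k 0 \<xi> - fourier u0 \<xi>) + (\<integral>\<^sup>+\<xi>. ennreal (integral {0..T} (\<lambda>s. (norm (e s \<xi>))\<^sup>2)) \<partial>lborel))"
      using zm Im by (simp add: nn_integral_cmult nn_integral_add L2_sq_def)
    also have "L2_sq (\<lambda>\<xi>. z k 0 \<xi> - fourier u0 \<xi>) = \<kappa> * L2_sq (\<lambda>x. cutoff (h k) x *\<^sub>R u0 x - u0 x)"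
      unfolding z0 \<kappa>_def by (intro L2_sq_fourier_diff cut_int u0)
    also have "(\<integral>\<^sup>+\<xi>. ennreal (integral {0..T} (\<lambda>s. (norm (e s \<xi>))\<^sup>2)) \<partial>lborel) = (\<integral>\<^sup>+s. indicator {0..T} s * L2_sq (\<lambda>\<xi>. e s \<xi>) \<partial>lborel)"
      unfolding L2_sq_def by (rule nn_integral_interval_swap[OF _ _ T]) (auto intro!: continuous_intros ec)
    also have "\<dots> \<le> (\<integral>\<^sup>+s. (\<kappa> * ennreal ((b * h k * B)\<^sup>2)) * indicator {0..T} s \<partial>lborel)"
      using ez by (intro nn_integral_mono) (auto simp: indicator_def)
    also have "\<dots> = ennreal T * (\<kappa> * ennreal ((b * h k * B)\<^sup>2))"
      by (subst nn_integral_cmult_indicator) (use T in \<open>simp_all add: mult.commute\<close>)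
    finally show ?thesis unfolding \<delta>_def by (simp add: mult_left_mono add_left_mono)
  qed
  have \<delta>_lim: "\<delta> \<longlonglongrightarrow> 0"
  proof -
    have 1: "(\<lambda>k. \<kappa> * L2_sq (\<lambda>x. cutoff (h k) x *\<^sub>R u0 x - u0 x)) \<longlonglongrightarrow> 0"
      by (intro tendsto_0_ennreal_cmult L2_cutoff_tendsto u0 h h0 \<kappa>)
    have "(\<lambda>k. (b * h k * B)\<^sup>2) \<longlonglongrightarrow> (b * 0 * B)\<^sup>2" by (intro tendsto_intros h0)
    from tendsto_ennrealI[OF this] have "(\<lambda>k. ennreal ((b * h k * B)\<^sup>2)) \<longlonglongrightarrow> 0" by simp
    then have 2: "(\<lambda>k. ennreal T * (\<kappa> * ennreal ((b * h k * B)\<^sup>2))) \<longlonglongrightarrow> 0"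
      by (intro tendsto_0_ennreal_cmult \<kappa>) auto
    from tendsto_add[OF 1 2] show ?thesis
      unfolding \<delta>_def by (intro tendsto_0_ennreal_cmult) auto
  qed
  \<comment> \<open>Cut-offs and truncations both approximate \<open>u T\<close>. The estimate holds
    for every \<open>k\<close> while its left side is free of \<open>k\<close>, so in the limit only
    the truncation error remains.\<close>
  have trunc: "L2_sq (\<lambda>\<xi>. fourier (\<lambda>x. indicator (cball 0 r) x *\<^sub>R u T x) \<xi> - ?W T \<xi>)
      \<le> 4 * (\<kappa> * L2_sq (\<lambda>x. indicator (cball 0 r) x *\<^sub>R u T x - u T x))" for r
  proof -
    let ?g = "\<lambda>x. indicator (cball 0 r) x *\<^sub>R u T x"
    have g: "integrable lborel ?g" "in_L2 ?g" by (intro integrable_truncate in_L2_truncate L2u T; simp)+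
    note [measurable] = L2u[OF T, THEN in_L2_measurable] fourier_measurable[OF g(1)]
    have bound: "L2_sq (\<lambda>\<xi>. fourier ?g \<xi> - ?W T \<xi>)
       \<le> 4 * (\<kappa> * L2_sq (\<lambda>x. ?g x - u T x)) + (4 * (\<kappa> * L2_sq (\<lambda>x. cutoff (h k) x *\<^sub>R u T x - u T x)) + 2 * \<delta> k)" for k
    proof -
      note c = cut_int[OF L2u[OF T], of k]
      have zm: "(\<lambda>\<xi>. z k T \<xi>) \<in> borel_measurable borel" unfolding z_def by (intro fourier_measurable c)
      note [measurable] = zm c(2)[THEN in_L2_measurable]
      have "L2_sq (\<lambda>\<xi>. fourier ?g \<xi> - ?W T \<xi>) \<le> 2 * L2_sq (\<lambda>\<xi>. fourier ?g \<xi> - z k T \<xi>) + 2 * L2_sq (\<lambda>\<xi>. z k T \<xi> - ?W T \<xi>)"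
        using L2_sq_add_le[of "\<lambda>\<xi>. fourier ?g \<xi> - z k T \<xi>" "\<lambda>\<xi>. z k T \<xi> - ?W T \<xi>"] by simp
      also have "L2_sq (\<lambda>\<xi>. fourier ?g \<xi> - z k T \<xi>) = \<kappa> * L2_sq (\<lambda>x. ?g x - cutoff (h k) x *\<^sub>R u T x)"
        unfolding z_def \<kappa>_def by (intro L2_sq_fourier_diff g c)
      also have "2 * (\<kappa> * L2_sq (\<lambda>x. ?g x - cutoff (h k) x *\<^sub>R u T x)) + 2 * L2_sq (\<lambda>\<xi>. z k T \<xi> - ?W T \<xi>)
         \<le> 2 * (\<kappa> * (2 * L2_sq (\<lambda>x. ?g x - u T x) + 2 * L2_sq (\<lambda>x. cutoff (h k) x *\<^sub>R u T x - u T x))) + 2 * \<delta> k"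
      proof (intro add_mono mult_left_mono zW)
        show "L2_sq (\<lambda>x. ?g x - cutoff (h k) x *\<^sub>R u T x) \<le> 2 * L2_sq (\<lambda>x. ?g x - u T x) + 2 * L2_sq (\<lambda>x. cutoff (h k) x *\<^sub>R u T x - u T x)"
          using L2_sq_diff_le[OF in_L2_diff[OF g(2) L2u[OF T], THEN in_L2_measurable] in_L2_diff[OF c(2) L2u[OF T], THEN in_L2_measurable]] by simp
      qed auto
      also have "\<dots> = 4 * (\<kappa> * L2_sq (\<lambda>x. ?g x - u T x)) + (4 * (\<kappa> * L2_sq (\<lambda>x. cutoff (h k) x *\<^sub>R u T x - u T x)) + 2 * \<delta> k)"
      proof -
        have four: "(4 :: ennreal) = 2 * 2" by simp
        show ?thesis unfolding four by (simp only: distrib_left add.assoc mult.assoc mult.left_commute[of \<kappa> 2])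
      qed
      finally show ?thesis .
    qed
    have "(\<lambda>k. 4 * (\<kappa> * L2_sq (\<lambda>x. cutoff (h k) x *\<^sub>R u T x - u T x)) + 2 * \<delta> k) \<longlonglongrightarrow> 0 + 0"
      by (intro tendsto_add tendsto_0_ennreal_cmult L2_cutoff_tendsto L2u T h h0 \<kappa> \<delta>_lim) auto
    from tendsto_add[OF tendsto_const[of "4 * (\<kappa> * L2_sq (\<lambda>x. ?g x - u T x))"] this]
    show ?thesis
      by (rule LIMSEQ_le_const[THEN order_trans]) (use bound in auto)
  qed
  have "((\<lambda>r. 4 * (\<kappa> * L2_sq (\<lambda>x. indicator (cball 0 r) x *\<^sub>R u T x - u T x))) \<longlongrightarrow> 0) at_top"
    by (intro tendsto_0_ennreal_cmult L2_truncate L2u T \<kappa>) auto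
  then have "((\<lambda>r. L2_sq (\<lambda>\<xi>. fourier (\<lambda>x. indicator (cball 0 r) x *\<^sub>R u T x) \<xi> - ?W T \<xi>)) \<longlongrightarrow> 0) at_top"
    by (rule tendsto_0_ennreal_squeeze[OF always_eventually[OF allI[OF trunc]]])
  then show ?thesis using L2W by (simp add: is_L2_fourier_def L2_tendsto_L2_sq)
qed

section \<open>Sobolev norms and decay\<close>

lemma integral_test_nth:
  fixes v :: "real^'n \<Rightarrow> real^'m"
  assumes t: "test_function \<phi>" and v: "in_L2 v"
  shows "complex_of_real ((LINT x|lborel. \<phi> x *\<^sub>R v x) $ i) = (LINT x|lborel. complex_of_real (\<phi> x) * complex_of_real (v x $ i))"
proof -
  have "(LINT x|lborel. \<phi> x *\<^sub>R v x) $ i = (LINT x|lborel. (\<phi> x *\<^sub>R v x) $ i)"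
    by (rule integral_bounded_linear[OF bounded_linear_vec_nth integrable_test_mult[OF t v], symmetric])
  then show ?thesis by (simp flip: of_real_mult)
qed

text \<open>The norm of a weak derivative is expressed through the transform alone, hence is
  independent of the representative that \<open>weak_deriv\<close> picks.\<close>

lemma weak_deriv_fourier_vec:
  fixes u v :: "real^'n \<Rightarrow> real^'m"
  assumes u: "in_L2 u" and v: "in_L2 v" and V: "\<And>i. fourier_L2 (\<lambda>x. complex_of_real (u x $ i)) (\<lambda>\<xi>. V \<xi> $ i)"
    and weak: "is_weak_deriv js u v"
  shows "in_L2 (\<lambda>\<xi>. symbol_monomial js \<xi> *s V \<xi>)"
    and "L2_sq (\<lambda>\<xi>. symbol_monomial js \<xi> *s V \<xi>) = ennreal ((2 * pi) ^ CARD('n)) * L2_sq v"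
proof -
  have "\<exists>W. \<forall>i. fourier_L2 (\<lambda>x. complex_of_real (v x $ i)) (W i)"
    by (intro choice allI fourier_L2_exists in_L2_component v)
  then obtain W where W: "\<And>i. fourier_L2 (\<lambda>x. complex_of_real (v x $ i)) (W i)" by blast
  have [measurable]: "(\<lambda>\<xi>. V \<xi> $ i) \<in> borel_measurable borel" "W i \<in> borel_measurable borel" for i
    using V[of i] W[of i] by (auto simp: fourier_L2_def in_L2_iff)
  have ae: "AE \<xi> in lborel. W i \<xi> = symbol_monomial js \<xi> * V \<xi> $ i" for i
  proof (rule weak_deriv_fourier[OF V W])
    fix \<phi> :: "real^'n \<Rightarrow> real" assume t: "test_function \<phi>"
    have eq: "(LINT x|lborel. \<phi> x *\<^sub>R v x) = (-1) ^ length js *\<^sub>R (LINT x|lborel. partials js \<phi> x *\<^sub>R u x)"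
      using weak t by (simp add: is_weak_deriv_def)
    have "complex_of_real ((LINT x|lborel. \<phi> x *\<^sub>R v x) $ i) = (-1) ^ length js * complex_of_real ((LINT x|lborel. partials js \<phi> x *\<^sub>R u x) $ i)"
      unfolding eq by simp
    then show "(LINT x|lborel. complex_of_real (\<phi> x) * complex_of_real (v x $ i)) =
        (-1) ^ length js * (LINT x|lborel. complex_of_real (partials js \<phi> x) * complex_of_real (u x $ i))"
      unfolding integral_test_nth[OF t v] integral_test_nth[OF test_function_partials[OF t] u] .
  qed
  have eq: "L2_sq (\<lambda>\<xi>. (symbol_monomial js \<xi> *s V \<xi>) $ i) = ennreal ((2 * pi) ^ CARD('n)) * L2_sq (\<lambda>x. complex_of_real (v x $ i))" for i
    using L2_sq_cong_AE[OF ae[of i]] L2_sq_fourier_L2[OF W[of i]] by simp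
  have m: "(\<lambda>\<xi>. (symbol_monomial js \<xi> *s V \<xi>) $ i) \<in> borel_measurable borel" for i by simp
  show "L2_sq (\<lambda>\<xi>. symbol_monomial js \<xi> *s V \<xi>) = ennreal ((2 * pi) ^ CARD('n)) * L2_sq v"
    unfolding L2_sq_vec[OF m] eq L2_sq_components[OF v] by (simp add: sum_distrib_left)
  then show "in_L2 (\<lambda>\<xi>. symbol_monomial js \<xi> *s V \<xi>)"
    using in_L2_finite[OF v] m by (simp add: in_L2_iff ennreal_mult_less_top borel_measurable_vec_iff)
qed

text \<open>Parseval's formula and the inverse transform of the multiplied symbol produce a complex
  candidate; this converse direction yields the Sobolev regularity of the solution.\<close>

lemma weak_deriv_exists:
  fixes u :: "real^'n \<Rightarrow> real^'m"
  assumes u: "in_L2 u" and V: "\<And>i. fourier_L2 (\<lambda>x. complex_of_real (u x $ i)) (\<lambda>\<xi>. V \<xi> $ i)"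
    and L2: "in_L2 (\<lambda>\<xi>. symbol_monomial js \<xi> *s V \<xi>)"
  shows "\<exists>v. in_L2 v \<and> is_weak_deriv js u v"
proof -
  define \<kappa> where "\<kappa> = complex_of_real ((2 * pi) ^ CARD('n))"
  have comp: "in_L2 (\<lambda>\<xi>. symbol_monomial js \<xi> * V \<xi> $ i)" for i
    using L2[unfolded in_L2_vec_iff, rule_format, of i] by simp
  have "\<exists>w. \<forall>i. in_L2 (w i) \<and> (\<forall>\<phi>. test_function \<phi> \<longrightarrow> (LINT x|lborel. complex_of_real (\<phi> x) * w i x)
     = (LINT \<xi>|lborel. symbol_monomial js \<xi> * V \<xi> $ i * cnj (ft (\<lambda>x. complex_of_real (\<phi> x)) \<xi>)) / \<kappa>)"
    unfolding \<kappa>_def by (intro choice allI inverse_fourier_weak comp)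
  then obtain w where w: "\<And>i. in_L2 (w i)" and w_eq: "\<And>i \<phi>. test_function \<phi> \<Longrightarrow> (LINT x|lborel. complex_of_real (\<phi> x) * w i x)
     = (LINT \<xi>|lborel. symbol_monomial js \<xi> * V \<xi> $ i * cnj (ft (\<lambda>x. complex_of_real (\<phi> x)) \<xi>)) / \<kappa>" by blast
  \<comment> \<open>Since \<open>u\<close> and the test functions are real, the tested identity is
    real and survives taking real parts.\<close>
  define v where "v x = (\<chi> i. Re (w i x))" for x
  have v: "in_L2 v"
    unfolding in_L2_vec_iff
  proof
    fix i
    have [measurable]: "w i \<in> borel_measurable borel" using w[of i] by (simp add: in_L2_iff)
    show "in_L2 (\<lambda>x. v x $ i)"
      by (rule in_L2_bound[OF w[of i], where c=1]) (auto simp: v_def abs_Re_le_cmod)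
  qed
  have "is_weak_deriv js u v"
    unfolding is_weak_deriv_def
  proof (intro allI impI)
    fix \<phi> :: "real^'n \<Rightarrow> real" assume t: "test_function \<phi>"
    note tp = test_function_partials[OF t, of js]
    let ?c = "ft (\<lambda>x. complex_of_real (\<phi> x))"
    show "(LINT x|lborel. \<phi> x *\<^sub>R v x) = (-1) ^ length js *\<^sub>R (LINT x|lborel. partials js \<phi> x *\<^sub>R u x)"
    proof (rule vec_eq_iff[THEN iffD2], rule allI)
      fix i
      have "complex_of_real ((LINT x|lborel. partials js \<phi> x *\<^sub>R u x) $ i)
        = (LINT \<xi>|lborel. V \<xi> $ i * cnj (symbol_monomial js \<xi> * ?c \<xi>)) / \<kappa>"
        unfolding integral_test_nth[OF tp u] test_function_Parseval[OF V tp] ft_partials[OF t] \<kappa>_def ..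
      also have "(LINT \<xi>|lborel. V \<xi> $ i * cnj (symbol_monomial js \<xi> * ?c \<xi>)) = (LINT \<xi>|lborel. (-1) ^ length js * (symbol_monomial js \<xi> * V \<xi> $ i * cnj (?c \<xi>)))"
        by (intro Bochner_Integration.integral_cong refl) (simp add: cnj_symbol_monomial mult_ac)
      finally have "(-1) ^ length js * complex_of_real ((LINT x|lborel. partials js \<phi> x *\<^sub>R u x) $ i)
         = ((-1) ^ length js * (-1) ^ length js) * ((LINT \<xi>|lborel. symbol_monomial js \<xi> * V \<xi> $ i * cnj (?c \<xi>)) / \<kappa>)"
        by simp
      also have "(-1::complex) ^ length js * (-1) ^ length js = 1" by (simp flip: power_add power_mult_distrib)
      also have "1 * ((LINT \<xi>|lborel. symbol_monomial js \<xi> * V \<xi> $ i * cnj (?c \<xi>)) / \<kappa>) = (LINT x|lborel. complex_of_real (\<phi> x) * w i x)"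
        using w_eq[OF t] by simp
      finally have "Re ((-1) ^ length js * complex_of_real ((LINT x|lborel. partials js \<phi> x *\<^sub>R u x) $ i)) = Re (LINT x|lborel. complex_of_real (\<phi> x) * w i x)"
        by (rule arg_cong)
      also have "Re (LINT x|lborel. complex_of_real (\<phi> x) * w i x) = (LINT x|lborel. Re (complex_of_real (\<phi> x) * w i x))"
        by (rule integral_Re[symmetric]) (intro L2_prod_integrable test_function_in_L2 t w)
      also have "\<dots> = (LINT x|lborel. (\<phi> x *\<^sub>R v x) $ i)" by (simp add: v_def)
      also have "\<dots> = (LINT x|lborel. \<phi> x *\<^sub>R v x) $ i"
        by (rule integral_bounded_linear[OF bounded_linear_vec_nth integrable_test_mult[OF t v]])
      also have "(-1) ^ length js * complex_of_real ((LINT x|lborel. partials js \<phi> x *\<^sub>R u x) $ i)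
         = complex_of_real ((-1) ^ length js * (LINT x|lborel. partials js \<phi> x *\<^sub>R u x) $ i)" by simp
      finally show "(LINT x|lborel. \<phi> x *\<^sub>R v x) $ i = ((-1) ^ length js *\<^sub>R (LINT x|lborel. partials js \<phi> x *\<^sub>R u x)) $ i"
        unfolding Re_complex_of_real by simp
    qed
  qed
  with v show ?thesis by blast
qed

lemma integrable_vec:
  fixes f :: "'a \<Rightarrow> complex^'m"
  assumes "\<And>i. integrable M (\<lambda>x. f x $ i)" shows "integrable M f"
proof -
  have bl: "bounded_linear (\<lambda>x :: complex. axis i x :: complex^'m)" for i
    unfolding linear_conv_bounded_linear[symmetric] by (rule linearI) (simp_all add: vec_eq_iff axis_def)
  have ex: "(\<Sum>i\<in>UNIV. axis i (z $ i)) = z" for z :: "complex^'m"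
    by (simp add: vec_eq_iff axis_def if_distrib cong: if_cong)
  have "integrable M (\<lambda>x. \<Sum>i\<in>UNIV. axis i (f x $ i) :: complex^'m)"
    by (intro Bochner_Integration.integrable_sum integrable_bounded_linear[OF bl] assms)
  then show ?thesis by (simp add: ex)
qed

text \<open>By Parseval's formula the tested constraint is, up to a constant, the integral of the
  conjugated transform of the test function times the constraint operator applied to
  \<open>V\<close>.\<close>

lemma constraint_from_fourier:
  fixes u :: "real^'n \<Rightarrow> real^'m" and Q :: "'n \<Rightarrow> real^'m^'p" and R :: "real^'m^'p"
  assumes u: "in_L2 u" and V: "\<And>i. fourier_L2 (\<lambda>x. complex_of_real (u x $ i)) (\<lambda>\<xi>. V \<xi> $ i)"
    and con: "\<And>\<xi>. pencil Q R \<xi> (V \<xi>) = 0"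
  shows "satisfies_constraint Q R u"
  unfolding satisfies_constraint_def
proof (intro allI impI)
  fix \<phi> :: "real^'n \<Rightarrow> real" assume t: "test_function \<phi>"
  define \<kappa> where "\<kappa> = complex_of_real ((2 * pi) ^ CARD('n))"
  note tp = test_function_partials[OF t]
  have LV: "in_L2 (\<lambda>\<xi>. V \<xi> $ i)" for i using V[of i] by (simp add: fourier_L2_def)
  define F where "F \<psi> \<xi> = cnj (ft (\<lambda>x. complex_of_real (\<psi> x)) \<xi>) *s V \<xi>" for \<psi> \<xi>
  have F: "integrable lborel (F \<psi>)" if "test_function \<psi>" for \<psi>
  proof (rule integrable_vec)
    show "integrable lborel (\<lambda>\<xi>. F \<psi> \<xi> $ i)" for i
      unfolding F_def vector_smult_component
      by (intro L2_prod_integrable in_L2_cnj in_L2_ft test_function_integrable test_function_in_L2 that LV)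
  qed
  have cF: "cvec (LINT x|lborel. \<psi> x *\<^sub>R u x) = (1 / \<kappa>) *s (LINT \<xi>|lborel. F \<psi> \<xi>)" if tt: "test_function \<psi>" for \<psi>
  proof (rule vec_eq_iff[THEN iffD2], rule allI)
    fix i
    have "cvec (LINT x|lborel. \<psi> x *\<^sub>R u x) $ i = (LINT \<xi>|lborel. V \<xi> $ i * cnj (ft (\<lambda>x. complex_of_real (\<psi> x)) \<xi>)) / \<kappa>"
      using integral_test_nth[OF tt u] test_function_Parseval[OF V tt] by (simp add: cvec_def \<kappa>_def)
    also have "(LINT \<xi>|lborel. V \<xi> $ i * cnj (ft (\<lambda>x. complex_of_real (\<psi> x)) \<xi>)) = (LINT \<xi>|lborel. F \<psi> \<xi> $ i)"
      by (simp add: F_def mult.commute)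
    also have "\<dots> = (LINT \<xi>|lborel. F \<psi> \<xi>) $ i"
      by (rule integral_bounded_linear[OF bounded_linear_vec_nth F[OF tt]])
    finally show "cvec (LINT x|lborel. \<psi> x *\<^sub>R u x) $ i = ((1 / \<kappa>) *s (LINT \<xi>|lborel. F \<psi> \<xi>)) $ i" by simp
  qed
  have mat: "(LINT x|lborel. \<psi> x *\<^sub>R (X *v u x)) = X *v (LINT x|lborel. \<psi> x *\<^sub>R u x)" if tt: "test_function \<psi>" for \<psi> and X :: "real^'m^'p"
    using integral_bounded_linear[OF matrix_vector_mul_bounded_linear[of X] integrable_test_mult[OF tt u]]
    by (simp add: matrix_vector_mult_scaleR)
  have Fj: "F (partials [j] \<phi>) \<xi> = - ((\<i> * complex_of_real (\<xi> $ j)) *s F \<phi> \<xi>)" for j \<xi>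
    unfolding F_def using ft_partial[OF t, of j \<xi>] by (simp add: vec_eq_iff mult.assoc)
  have "(LINT x|lborel. \<phi> x *\<^sub>R (R *v u x) - (\<Sum>j\<in>UNIV. partials [j] \<phi> x *\<^sub>R (Q j *v u x)))
     = (LINT x|lborel. \<phi> x *\<^sub>R (R *v u x)) - (\<Sum>j\<in>UNIV. LINT x|lborel. partials [j] \<phi> x *\<^sub>R (Q j *v u x))"
    by (subst Bochner_Integration.integral_diff, intro integrable_test_mult t in_L2_matrix u,
        intro Bochner_Integration.integrable_sum integrable_test_mult tp in_L2_matrix u,
        subst Bochner_Integration.integral_sum, intro integrable_test_mult tp in_L2_matrix u, rule refl)
  also have "\<dots> = R *v (LINT x|lborel. \<phi> x *\<^sub>R u x) - (\<Sum>j\<in>UNIV. Q j *v (LINT x|lborel. partials [j] \<phi> x *\<^sub>R u x))"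
    using mat[OF t] mat[OF tp] by (simp only:)
  finally have eq: "(LINT x|lborel. \<phi> x *\<^sub>R (R *v u x) - (\<Sum>j\<in>UNIV. partials [j] \<phi> x *\<^sub>R (Q j *v u x)))
     = R *v (LINT x|lborel. \<phi> x *\<^sub>R u x) - (\<Sum>j\<in>UNIV. Q j *v (LINT x|lborel. partials [j] \<phi> x *\<^sub>R u x))" .
  have "cvec (R *v (LINT x|lborel. \<phi> x *\<^sub>R u x) - (\<Sum>j\<in>UNIV. Q j *v (LINT x|lborel. partials [j] \<phi> x *\<^sub>R u x)))
     = cmat R *v ((1 / \<kappa>) *s (LINT \<xi>|lborel. F \<phi> \<xi>)) - (\<Sum>j\<in>UNIV. cmat (Q j) *v ((1 / \<kappa>) *s (LINT \<xi>|lborel. F (partials [j] \<phi>) \<xi>)))"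
    unfolding cvec_diff cvec_sum cmat_cvec[symmetric] cF[OF t] cF[OF tp] ..
  also have "\<dots> = (1 / \<kappa>) *s ((LINT \<xi>|lborel. cmat R *v F \<phi> \<xi>) - (\<Sum>j\<in>UNIV. LINT \<xi>|lborel. cmat (Q j) *v F (partials [j] \<phi>) \<xi>))"
    unfolding cmat_mv_cmult integral_bounded_linear[OF bounded_linear_cmat F[OF t]] integral_bounded_linear[OF bounded_linear_cmat F[OF tp]]
    by (simp add: vec.scale_right_diff_distrib vec.scale_sum_right)
  also have "(LINT \<xi>|lborel. cmat R *v F \<phi> \<xi>) - (\<Sum>j\<in>UNIV. LINT \<xi>|lborel. cmat (Q j) *v F (partials [j] \<phi>) \<xi>)
     = (LINT \<xi>|lborel. cmat R *v F \<phi> \<xi> - (\<Sum>j\<in>UNIV. cmat (Q j) *v F (partials [j] \<phi>) \<xi>))"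
    by (subst Bochner_Integration.integral_diff, intro integrable_bounded_linear[OF bounded_linear_cmat] F t,
        intro Bochner_Integration.integrable_sum integrable_bounded_linear[OF bounded_linear_cmat] F tp,
        subst Bochner_Integration.integral_sum, intro integrable_bounded_linear[OF bounded_linear_cmat] F tp, rule refl)
  also have "\<dots> = (LINT \<xi>::real^'n|lborel. (0 :: complex^'p))"
  proof (rule Bochner_Integration.integral_cong[OF refl])
    fix \<xi>
    have "cmat (symbol Q \<xi>) *v z = (\<Sum>j\<in>UNIV. \<xi> $ j *\<^sub>R (cmat (Q j) *v z))" for z
      by (simp add: symbol_def vec_eq_iff cmat_nth sum_distrib_right scaleR_sum_right scaleR_conv_of_real[where 'a=complex] sum_distrib_left mult.assoc)
        (intro allI sum.swap)
    then have "pencil Q R \<xi> (F \<phi> \<xi>) = cmat R *v F \<phi> \<xi> - (\<Sum>j\<in>UNIV. cmat (Q j) *v F (partials [j] \<phi>) \<xi>)"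
      unfolding pencil_def Fj cmat_mv_minus cmat_mv_cmult
      by (simp add: vec_eq_iff sum_distrib_left sum_negf scaleR_conv_of_real[where 'a=complex] mult.assoc)
    moreover have "pencil Q R \<xi> (F \<phi> \<xi>) = cnj (ft (\<lambda>x. complex_of_real (\<phi> x)) \<xi>) *s pencil Q R \<xi> (V \<xi>)"
      unfolding pencil_def F_def cmat_mv_cmult by (simp add: vec_eq_iff algebra_simps)
    ultimately show "cmat R *v F \<phi> \<xi> - (\<Sum>j\<in>UNIV. cmat (Q j) *v F (partials [j] \<phi>) \<xi>) = 0" by (simp add: con)
  qed
  finally have "cvec (R *v (LINT x|lborel. \<phi> x *\<^sub>R u x) - (\<Sum>j\<in>UNIV. Q j *v (LINT x|lborel. partials [j] \<phi> x *\<^sub>R u x))) = 0" by simp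
  then show "(LINT x|lborel. \<phi> x *\<^sub>R (R *v u x) - (\<Sum>j\<in>UNIV. partials [j] \<phi> x *\<^sub>R (Q j *v u x))) = 0"
    unfolding eq by (subst norm_eq_zero[symmetric], subst norm_cvec[symmetric]) simp
qed

section \<open>Frequency integrals and decay rates\<close>

lemma power_exp_bound:
  fixes y :: real assumes "y \<ge> 0" shows "y ^ k \<le> fact k * exp y"
proof -
  have "y ^ k / fact k \<le> exp y"
    using sum_le_suminf[OF summable_exp_generic[of y], of "{k}"] assms
    by (simp add: exp_def divide_inverse_commute)
  then show ?thesis by (simp add: field_simps)
qed

text \<open>The substitution that scales \<xi> by \<open>(1 + t) powr (- 1 / 2)\<close> removes the
  time from the exponential. The Jacobian and the monomial together give the power
  \<open>- n / 2 - k\<close>, the square of the rate in the theorem.\<close>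

lemma heat_moment:
  assumes c: "c > 0"
  shows "\<exists>J\<ge>0. \<forall>t\<ge>0. (\<integral>\<^sup>+(\<xi>::real^'n). ennreal (norm \<xi> ^ (2 * k) * exp (- c * (1 + t) * (norm \<xi>)\<^sup>2)) \<partial>lborel)
    \<le> ennreal (J * ((1 + t) powr (- real CARD('n) / 4 - real k / 2))\<^sup>2)"
proof -
  define I where "I = (\<integral>\<^sup>+(\<xi>::real^'n). ennreal (norm \<xi> ^ (2 * k) * exp (- c * (norm \<xi>)\<^sup>2)) \<partial>lborel)"
  define D where "D = (2 / c) ^ k * fact k * sqrt (2 * pi) ^ CARD('n)"
  have le: "norm \<xi> ^ (2 * k) * exp (- c * (norm \<xi>)\<^sup>2) \<le> D * gauss (sqrt c *\<^sub>R \<xi>)" for \<xi> :: "real^'n"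
  proof -
    \<comment> \<open>Half of the Gaussian exponent is spent on absorbing the power of the norm; the
      other half leaves an integrable Gaussian.\<close>
    define y where "y = c * (norm \<xi>)\<^sup>2 / 2"
    have "norm \<xi> ^ (2 * k) = (2 / c) ^ k * y ^ k"
      using c by (simp add: y_def power_mult power_mult_distrib[symmetric])
    also have "\<dots> \<le> (2 / c) ^ k * (fact k * exp y)"
      using c by (intro mult_left_mono power_exp_bound) (auto simp: y_def)
    finally have "norm \<xi> ^ (2 * k) * exp (- c * (norm \<xi>)\<^sup>2) \<le> (2 / c) ^ k * (fact k * exp y) * exp (- c * (norm \<xi>)\<^sup>2)"
      by (intro mult_right_mono) auto
    also have "\<dots> = (2 / c) ^ k * fact k * (exp y * exp (- c * (norm \<xi>)\<^sup>2))" by simp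
    also have "exp y * exp (- c * (norm \<xi>)\<^sup>2) = exp (- y)" by (simp add: y_def flip: exp_add)
    also have "exp (- y) = sqrt (2 * pi) ^ CARD('n) * gauss (sqrt c *\<^sub>R \<xi>)"
      using c by (simp add: gauss_def y_def power_mult_distrib power_one_over)
    finally show ?thesis by (simp add: D_def mult.assoc)
  qed
  have fin: "I < \<infinity>"
  proof -
    have "integrable lborel (\<lambda>\<xi>::real^'n. D * gauss (sqrt c *\<^sub>R \<xi>))"
      using integrable_lborel_affine[OF integrable_gauss, of "sqrt c" 0] c by (intro integrable_mult_right) simp
    then have "(\<integral>\<^sup>+(\<xi>::real^'n). ennreal (norm (D * gauss (sqrt c *\<^sub>R \<xi>))) \<partial>lborel) < \<infinity>"
      unfolding integrable_iff_bounded by blast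
    moreover have "I \<le> (\<integral>\<^sup>+(\<xi>::real^'n). ennreal (norm (D * gauss (sqrt c *\<^sub>R \<xi>))) \<partial>lborel)"
      unfolding I_def using le by (intro nn_integral_mono ennreal_leI) (simp add: order_trans[OF _ abs_ge_self])
    ultimately show ?thesis by (rule order.strict_trans1[rotated])
  qed
  show ?thesis
  proof (intro exI[of _ "enn2real I"] conjI allI impI)
    fix t :: real assume t: "t \<ge> 0"
    define a where "a = (1 + t) powr (- 1 / 2)"
    have a: "a > 0" using t by (simp add: a_def)
    have a2: "a\<^sup>2 * (1 + t) = 1"
      using t by (simp add: a_def powr_power powr_minus field_simps)
    let ?F = "\<lambda>\<xi>::real^'n. ennreal (norm \<xi> ^ (2 * k) * exp (- c * (1 + t) * (norm \<xi>)\<^sup>2))"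
    have "(\<integral>\<^sup>+\<xi>. ?F \<xi> \<partial>lborel) = ennreal (\<bar>a\<bar> ^ DIM(real^'n)) * (\<integral>\<^sup>+\<xi>. ?F (0 + a *\<^sub>R \<xi>) \<partial>lborel)"
      using a by (intro nn_integral_lborel_affine) auto
    also have "(\<integral>\<^sup>+\<xi>. ?F (0 + a *\<^sub>R \<xi>) \<partial>lborel) = (\<integral>\<^sup>+(\<xi>::real^'n). ennreal (a ^ (2 * k)) * ennreal (norm \<xi> ^ (2 * k) * exp (- c * (norm \<xi>)\<^sup>2)) \<partial>lborel)"
    proof (intro nn_integral_cong)
      fix \<xi> :: "real^'n"
      have "(1 + t) * (norm (a *\<^sub>R \<xi>))\<^sup>2 = (a\<^sup>2 * (1 + t)) * (norm \<xi>)\<^sup>2" by (simp add: power_mult_distrib mult_ac)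
      then have e: "(1 + t) * (norm (a *\<^sub>R \<xi>))\<^sup>2 = (norm \<xi>)\<^sup>2" unfolding a2 by simp
      have "norm (0 + a *\<^sub>R \<xi>) ^ (2 * k) * exp (- c * (1 + t) * (norm (0 + a *\<^sub>R \<xi>))\<^sup>2)
        = norm (a *\<^sub>R \<xi>) ^ (2 * k) * exp (- c * ((1 + t) * (norm (a *\<^sub>R \<xi>))\<^sup>2))" by (simp add: mult.assoc)
      also have "\<dots> = a ^ (2 * k) * (norm \<xi> ^ (2 * k) * exp (- c * (norm \<xi>)\<^sup>2))"
        unfolding e using a by (simp add: power_mult_distrib mult.assoc)
      finally have "?F (0 + a *\<^sub>R \<xi>) = ennreal (a ^ (2 * k) * (norm \<xi> ^ (2 * k) * exp (- c * (norm \<xi>)\<^sup>2)))" by simp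
      then show "?F (0 + a *\<^sub>R \<xi>) = ennreal (a ^ (2 * k)) * ennreal (norm \<xi> ^ (2 * k) * exp (- c * (norm \<xi>)\<^sup>2))"
        using a by (simp add: ennreal_mult)
    qed
    also have "\<dots> = ennreal (a ^ (2 * k)) * I" unfolding I_def by (intro nn_integral_cmult) simp
    also have "I = ennreal (enn2real I)" using fin by (simp add: less_top)
    also have "ennreal (\<bar>a\<bar> ^ DIM(real^'n)) * (ennreal (a ^ (2 * k)) * ennreal (enn2real I)) = ennreal (enn2real I * (a ^ CARD('n) * a ^ (2 * k)))"
      using a by (simp add: mult_ac flip: ennreal_mult)
    also have "a ^ CARD('n) * a ^ (2 * k) = ((1 + t) powr (- real CARD('n) / 4 - real k / 2))\<^sup>2"
      using t by (simp add: a_def powr_power flip: powr_add)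
    finally show "(\<integral>\<^sup>+\<xi>. ?F \<xi> \<partial>lborel) \<le> ennreal (enn2real I * ((1 + t) powr (- real CARD('n) / 4 - real k / 2))\<^sup>2)" by simp
  qed simp
qed

text \<open>For |\<xi>| \<le> 1 one has \<rho> \<ge> |\<xi>|^2 / 2, so the squared flow is bounded
  by a heat kernel and the L1 bound on \<open>U\<close>; the factor \<open>exp c\<close> pays for
  writing \<open>1 + t\<close> in place of \<open>t\<close>. For |\<xi>| > 1 one has \<rho> \<ge> 1
  / 2, which gives exponential decay without any loss of derivatives.\<close>

lemma frequency_split:
  fixes U W :: "real^'n \<Rightarrow> complex^'m"
  assumes c: "c > 0" and C: "C > 0" and t: "t \<ge> 0"
    and W: "\<And>\<xi>. norm (W \<xi>) \<le> C * exp (- c * rho \<xi> * t) * norm (U \<xi>)" and U: "\<And>\<xi>. norm (U \<xi>) \<le> M"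
    and L2: "in_L2 (\<lambda>\<xi>. symbol_monomial js \<xi> *s U \<xi>)"
  shows "L2_sq (\<lambda>\<xi>. symbol_monomial js \<xi> *s W \<xi>)
    \<le> ennreal (C\<^sup>2 * exp c * M\<^sup>2) * (\<integral>\<^sup>+(\<xi>::real^'n). ennreal (norm \<xi> ^ (2 * length js) * exp (- c * (1 + t) * (norm \<xi>)\<^sup>2)) \<partial>lborel)
      + ennreal (C\<^sup>2 * exp (- c * t)) * L2_sq (\<lambda>\<xi>. symbol_monomial js \<xi> *s U \<xi>)"
proof -
  let ?m = "symbol_monomial js"
  let ?h = "\<lambda>\<xi>::real^'n. norm \<xi> ^ (2 * length js) * exp (- c * (1 + t) * (norm \<xi>)\<^sup>2)"
  have M: "M \<ge> 0" using order_trans[OF norm_ge_zero U] .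
  have point: "(norm (?m \<xi> *s W \<xi>))\<^sup>2 \<le> C\<^sup>2 * exp c * M\<^sup>2 * ?h \<xi> + C\<^sup>2 * exp (- c * t) * (norm (?m \<xi> *s U \<xi>))\<^sup>2" for \<xi>
  proof -
    define q where "q = norm \<xi>"
    have W2: "(norm (W \<xi>))\<^sup>2 \<le> C\<^sup>2 * exp (- 2 * c * rho \<xi> * t) * (norm (U \<xi>))\<^sup>2"
    proof -
      have "(norm (W \<xi>))\<^sup>2 \<le> (C * exp (- c * rho \<xi> * t) * norm (U \<xi>))\<^sup>2" by (intro power_mono W) auto
      also have "\<dots> = C\<^sup>2 * exp (- 2 * c * rho \<xi> * t) * (norm (U \<xi>))\<^sup>2"
        by (simp add: power_mult_distrib exp_double[symmetric] mult_ac)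
      finally show ?thesis .
    qed
    have q1: "1 + q\<^sup>2 > 0" by (simp add: add_pos_nonneg)
    show ?thesis
    proof (cases "q \<le> 1")
      case True
      have q2: "q\<^sup>2 \<le> 1" using True by (simp add: q_def power_le_one)
      have "q\<^sup>2 / 2 \<le> rho \<xi>"
        unfolding rho_def q_def[symmetric] using q2 by (intro divide_left_mono) (auto simp: add_pos_nonneg)
      then have "c * t * q\<^sup>2 \<le> c * t * (2 * rho \<xi>)" using c t by (intro mult_left_mono) auto
      moreover have "c * q\<^sup>2 \<le> c" using c q2 by (simp add: mult_left_le)
      ultimately have "exp (- 2 * c * rho \<xi> * t) \<le> exp (c + - c * (1 + t) * q\<^sup>2)" by (simp add: algebra_simps)
      then have e: "exp (- 2 * c * rho \<xi> * t) \<le> exp c * exp (- c * (1 + t) * q\<^sup>2)" by (simp only: exp_add)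
      have "(norm (?m \<xi> *s W \<xi>))\<^sup>2 = (norm (?m \<xi>))\<^sup>2 * (norm (W \<xi>))\<^sup>2" by (simp add: norm_cmult power_mult_distrib)
      also have "\<dots> \<le> (q ^ length js)\<^sup>2 * (C\<^sup>2 * (exp c * exp (- c * (1 + t) * q\<^sup>2)) * M\<^sup>2)"
        unfolding q_def
      proof (intro mult_mono power_mono norm_symbol_monomial)
        have "C\<^sup>2 * exp (- 2 * c * rho \<xi> * t) * (norm (U \<xi>))\<^sup>2 \<le> C\<^sup>2 * (exp c * exp (- c * (1 + t) * (norm \<xi>)\<^sup>2)) * M\<^sup>2"
          using e C unfolding q_def by (intro mult_mono power_mono U) auto
        then show "(norm (W \<xi>))\<^sup>2 \<le> C\<^sup>2 * (exp c * exp (- c * (1 + t) * (norm \<xi>)\<^sup>2)) * M\<^sup>2" using W2 by linarith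
      qed auto
      also have "\<dots> = C\<^sup>2 * exp c * M\<^sup>2 * ?h \<xi>" by (simp add: q_def power_mult[symmetric] mult_ac)
      also have "\<dots> \<le> C\<^sup>2 * exp c * M\<^sup>2 * ?h \<xi> + C\<^sup>2 * exp (- c * t) * (norm (?m \<xi> *s U \<xi>))\<^sup>2" by simp
      finally show ?thesis .
    next
      case False
      then have "1 \<le> q\<^sup>2" by (simp add: one_le_power)
      then have "1 \<le> 2 * rho \<xi>" unfolding rho_def q_def[symmetric] using q1 by (simp add: field_simps)
      then have "c * t * 1 \<le> c * t * (2 * rho \<xi>)" using c t by (intro mult_left_mono) auto
      then have e: "exp (- 2 * c * rho \<xi> * t) \<le> exp (- c * t)" by (simp add: mult_ac)
      have "(norm (?m \<xi> *s W \<xi>))\<^sup>2 = (norm (?m \<xi>))\<^sup>2 * (norm (W \<xi>))\<^sup>2" by (simp add: norm_cmult power_mult_distrib)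
      also have "\<dots> \<le> (norm (?m \<xi>))\<^sup>2 * (C\<^sup>2 * exp (- c * t) * (norm (U \<xi>))\<^sup>2)"
      proof (intro mult_left_mono)
        have "C\<^sup>2 * exp (- 2 * c * rho \<xi> * t) * (norm (U \<xi>))\<^sup>2 \<le> C\<^sup>2 * exp (- c * t) * (norm (U \<xi>))\<^sup>2"
          using e by (intro mult_right_mono mult_left_mono) auto
        then show "(norm (W \<xi>))\<^sup>2 \<le> C\<^sup>2 * exp (- c * t) * (norm (U \<xi>))\<^sup>2" using W2 by linarith
      qed simp
      also have "\<dots> = C\<^sup>2 * exp (- c * t) * (norm (?m \<xi> *s U \<xi>))\<^sup>2" by (simp add: norm_cmult power_mult_distrib mult_ac)
      also have "\<dots> \<le> C\<^sup>2 * exp c * M\<^sup>2 * ?h \<xi> + C\<^sup>2 * exp (- c * t) * (norm (?m \<xi> *s U \<xi>))\<^sup>2" by simp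
      finally show ?thesis .
    qed
  qed
  have [measurable]: "(\<lambda>\<xi>. ?m \<xi> *s U \<xi>) \<in> borel_measurable borel" using L2 by (simp add: in_L2_iff)
  have "L2_sq (\<lambda>\<xi>. ?m \<xi> *s W \<xi>) \<le> (\<integral>\<^sup>+\<xi>. ennreal (C\<^sup>2 * exp c * M\<^sup>2) * ennreal (?h \<xi>) + ennreal (C\<^sup>2 * exp (- c * t)) * ennreal ((norm (?m \<xi> *s U \<xi>))\<^sup>2) \<partial>lborel)"
    unfolding L2_sq_def
  proof (intro nn_integral_mono)
    fix \<xi>
    have "ennreal ((norm (?m \<xi> *s W \<xi>))\<^sup>2) \<le> ennreal (C\<^sup>2 * exp c * M\<^sup>2 * ?h \<xi> + C\<^sup>2 * exp (- c * t) * (norm (?m \<xi> *s U \<xi>))\<^sup>2)"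
      by (intro ennreal_leI point)
    also have "\<dots> = ennreal (C\<^sup>2 * exp c * M\<^sup>2) * ennreal (?h \<xi>) + ennreal (C\<^sup>2 * exp (- c * t)) * ennreal ((norm (?m \<xi> *s U \<xi>))\<^sup>2)"
      by (subst ennreal_plus) (auto simp: ennreal_mult')
    finally show "ennreal ((norm (?m \<xi> *s W \<xi>))\<^sup>2) \<le> ennreal (C\<^sup>2 * exp c * M\<^sup>2) * ennreal (?h \<xi>) + ennreal (C\<^sup>2 * exp (- c * t)) * ennreal ((norm (?m \<xi> *s U \<xi>))\<^sup>2)" .
  qed
  also have "\<dots> = ennreal (C\<^sup>2 * exp c * M\<^sup>2) * (\<integral>\<^sup>+\<xi>. ennreal (?h \<xi>) \<partial>lborel) + ennreal (C\<^sup>2 * exp (- c * t)) * L2_sq (\<lambda>\<xi>. ?m \<xi> *s U \<xi>)"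
    by (simp add: nn_integral_add nn_integral_cmult L2_sq_def)
  finally show ?thesis .
qed

lemma weak_deriv_works:
  assumes "in_Hs s u" "length js \<le> s"
  shows "in_L2 (weak_deriv js u)" "is_weak_deriv js u (weak_deriv js u)"
  using someI_ex[of "\<lambda>v. in_L2 v \<and> is_weak_deriv js u v"] assms
  unfolding in_Hs_def weak_deriv_def by blast+

lemma L2_norm_weak_deriv:
  fixes u :: "real^'n \<Rightarrow> real^'m"
  assumes u: "in_Hs s u" and js: "length js \<le> s" and V: "\<And>i. fourier_L2 (\<lambda>x. complex_of_real (u x $ i)) (\<lambda>\<xi>. V \<xi> $ i)"
  shows "in_L2 (\<lambda>\<xi>. symbol_monomial js \<xi> *s V \<xi>)"
    "L2_sq (\<lambda>\<xi>. symbol_monomial js \<xi> *s V \<xi>) = ennreal ((2 * pi) ^ CARD('n) * (L2_norm (weak_deriv js u))\<^sup>2)"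
proof -
  note w = weak_deriv_works[OF u js]
  have u2: "in_L2 u" using u by (simp add: in_Hs_def)
  show "in_L2 (\<lambda>\<xi>. symbol_monomial js \<xi> *s V \<xi>)"
    by (rule weak_deriv_fourier_vec[OF u2 w(1) V w(2)])
  show "L2_sq (\<lambda>\<xi>. symbol_monomial js \<xi> *s V \<xi>) = ennreal ((2 * pi) ^ CARD('n) * (L2_norm (weak_deriv js u))\<^sup>2)"
    unfolding weak_deriv_fourier_vec(2)[OF u2 w(1) V w(2)] L2_norm_sq[OF w(1), symmetric] by (simp add: ennreal_mult)
qed

text \<open>Both terms of \<open>frequency_split\<close> are sums of squares over the index lists,
  so subadditivity of the square root separates them. It also halves the exponent
  \<open>c\<close>.\<close>

lemma deriv_decay:
  assumes c: "c > 0" and C: "C > 0"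
  shows "\<exists>K\<ge>0. \<forall>(u0 :: real^'n \<Rightarrow> real^'m) (u :: real^'n \<Rightarrow> real^'m) U W t s. in_Hs s u0 \<longrightarrow> in_Hs s u \<longrightarrow> k \<le> s \<longrightarrow> t \<ge> 0 \<longrightarrow>
    (\<forall>i. fourier_L2 (\<lambda>x. complex_of_real (u0 x $ i)) (\<lambda>\<xi>. U \<xi> $ i)) \<longrightarrow>
    (\<forall>i. fourier_L2 (\<lambda>x. complex_of_real (u x $ i)) (\<lambda>\<xi>. W \<xi> $ i)) \<longrightarrow>
    (\<forall>\<xi>. norm (W \<xi>) \<le> C * exp (- c * rho \<xi> * t) * norm (U \<xi>)) \<longrightarrow> (\<forall>\<xi>. norm (U \<xi>) \<le> L1_norm u0) \<longrightarrow>
    deriv_L2_norm k u \<le> K * (1 + t) powr (- real CARD('n) / 4 - real k / 2) * L1_norm u0 + C * exp (- (c / 2) * t) * deriv_L2_norm k u0"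
proof -
  obtain J where J: "J \<ge> 0" "\<And>t. t \<ge> 0 \<Longrightarrow> (\<integral>\<^sup>+(\<xi>::real^'n). ennreal (norm \<xi> ^ (2 * k) * exp (- c * (1 + t) * (norm \<xi>)\<^sup>2)) \<partial>lborel)
    \<le> ennreal (J * ((1 + t) powr (- real CARD('n) / 4 - real k / 2))\<^sup>2)"
    using heat_moment[OF c, of k, where 'n='n] by blast
  define \<kappa> where "\<kappa> = (2 * pi) ^ CARD('n)"
  have \<kappa>: "\<kappa> > 0" by (simp add: \<kappa>_def)
  define N where "N = real (card {js :: 'n list. length js = k})"
  \<comment> \<open>\<open>N\<close> counts the k-th order derivatives, each of which carries the
    same low-frequency bound; division by \<kappa> undoes Plancherel's constant.\<close>
  define K where "K = sqrt (N * (C\<^sup>2 * exp c * J / \<kappa>))"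
  have K: "K \<ge> 0" by (simp add: K_def N_def J(1) less_imp_le[OF \<kappa>])
  show ?thesis
  proof (intro exI[of _ K] conjI K allI impI)
    fix u0 u :: "real^'n \<Rightarrow> real^'m" and U W t s
    assume u0: "in_Hs s u0" and u: "in_Hs s u" and ks: "k \<le> s" and t: "t \<ge> 0"
      and U: "\<forall>i. fourier_L2 (\<lambda>x. complex_of_real (u0 x $ i)) (\<lambda>\<xi>. U \<xi> $ i)"
      and W: "\<forall>i. fourier_L2 (\<lambda>x. complex_of_real (u x $ i)) (\<lambda>\<xi>. W \<xi> $ i)"
      and WU: "\<forall>\<xi>. norm (W \<xi>) \<le> C * exp (- c * rho \<xi> * t) * norm (U \<xi>)" and UM: "\<forall>\<xi>. norm (U \<xi>) \<le> L1_norm u0"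
    define p where "p = (1 + t) powr (- real CARD('n) / 4 - real k / 2)"
    define M where "M = L1_norm u0"
    have M: "M \<ge> 0" using order_trans[OF norm_ge_zero] UM unfolding M_def by blast
    have p: "p \<ge> 0" by (simp add: p_def)
    have each: "(L2_norm (weak_deriv js u))\<^sup>2 \<le> C\<^sup>2 * exp c * J / \<kappa> * (p * M)\<^sup>2 + C\<^sup>2 * exp (- c * t) * (L2_norm (weak_deriv js u0))\<^sup>2"
      if js: "length js = k" for js
    proof -
      have jss: "length js \<le> s" using js ks by simp
      note n0 = L2_norm_weak_deriv[OF u0 jss, of U, OF U[rule_format]]
      note n1 = L2_norm_weak_deriv[OF u jss, of W, OF W[rule_format]]
      have "ennreal (\<kappa> * (L2_norm (weak_deriv js u))\<^sup>2) = L2_sq (\<lambda>\<xi>. symbol_monomial js \<xi> *s W \<xi>)"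
        using n1(2) by (simp add: \<kappa>_def)
      also have "\<dots> \<le> ennreal (C\<^sup>2 * exp c * M\<^sup>2) * (\<integral>\<^sup>+(\<xi>::real^'n). ennreal (norm \<xi> ^ (2 * length js) * exp (- c * (1 + t) * (norm \<xi>)\<^sup>2)) \<partial>lborel)
          + ennreal (C\<^sup>2 * exp (- c * t)) * L2_sq (\<lambda>\<xi>. symbol_monomial js \<xi> *s U \<xi>)"
        using WU UM unfolding M_def by (intro frequency_split c C t n0(1)) auto
      also have "\<dots> \<le> ennreal (C\<^sup>2 * exp c * M\<^sup>2) * ennreal (J * p\<^sup>2) + ennreal (C\<^sup>2 * exp (- c * t)) * ennreal (\<kappa> * (L2_norm (weak_deriv js u0))\<^sup>2)"
        using J(2)[OF t] n0(2) unfolding js p_def \<kappa>_def by (intro add_mono mult_left_mono) auto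
      also have "\<dots> = ennreal (C\<^sup>2 * exp c * M\<^sup>2 * (J * p\<^sup>2) + C\<^sup>2 * exp (- c * t) * (\<kappa> * (L2_norm (weak_deriv js u0))\<^sup>2))"
        using J(1) \<kappa> by (subst ennreal_plus) (auto simp: ennreal_mult')
      finally have "\<kappa> * (L2_norm (weak_deriv js u))\<^sup>2 \<le> C\<^sup>2 * exp c * M\<^sup>2 * (J * p\<^sup>2) + C\<^sup>2 * exp (- c * t) * (\<kappa> * (L2_norm (weak_deriv js u0))\<^sup>2)"
        using J(1) \<kappa> by (subst (asm) ennreal_le_iff) (auto intro!: add_nonneg_nonneg mult_nonneg_nonneg)
      then show ?thesis using \<kappa> by (simp add: field_simps power_mult_distrib)
    qed
    have fin: "finite {js :: 'n list. length js = k}"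
      using finite_lists_length_eq[of "UNIV :: 'n set" k] by simp
    have "(\<Sum>js | length js = k. (L2_norm (weak_deriv js u))\<^sup>2)
        \<le> (\<Sum>js | length js = k. C\<^sup>2 * exp c * J / \<kappa> * (p * M)\<^sup>2 + C\<^sup>2 * exp (- c * t) * (L2_norm (weak_deriv js u0))\<^sup>2)"
      by (intro sum_mono each) simp
    also have "\<dots> = N * (C\<^sup>2 * exp c * J / \<kappa>) * (p * M)\<^sup>2 + C\<^sup>2 * exp (- c * t) * (\<Sum>js | length js = k. (L2_norm (weak_deriv js u0))\<^sup>2)"
      by (simp add: sum.distrib sum_distrib_left N_def)
    finally have "deriv_L2_norm k u \<le> sqrt (N * (C\<^sup>2 * exp c * J / \<kappa>) * (p * M)\<^sup>2 + C\<^sup>2 * exp (- c * t) * (\<Sum>js | length js = k. (L2_norm (weak_deriv js u0))\<^sup>2))"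
      unfolding deriv_L2_norm_def by (rule real_sqrt_le_mono)
    also have "\<dots> \<le> sqrt (N * (C\<^sup>2 * exp c * J / \<kappa>) * (p * M)\<^sup>2) + sqrt (C\<^sup>2 * exp (- c * t) * (\<Sum>js | length js = k. (L2_norm (weak_deriv js u0))\<^sup>2))"
      using J(1) \<kappa> by (intro sqrt_add_le_add_sqrt) (auto simp: N_def intro!: mult_nonneg_nonneg sum_nonneg)
    also have "sqrt (N * (C\<^sup>2 * exp c * J / \<kappa>) * (p * M)\<^sup>2) = K * p * M"
    proof -
      have "sqrt (x * y\<^sup>2) = sqrt x * y" if "y \<ge> 0" for x y :: real
        using that by (simp add: real_sqrt_mult)
      from this[of "p * M"] show ?thesis using p M unfolding K_def mult.assoc[of "sqrt _"] by (meson mult_nonneg_nonneg)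
    qed
    also have "sqrt (C\<^sup>2 * exp (- c * t) * (\<Sum>js | length js = k. (L2_norm (weak_deriv js u0))\<^sup>2)) = C * exp (- (c / 2) * t) * deriv_L2_norm k u0"
    proof -
      have "exp (- c * t) = (exp (- (c / 2) * t))\<^sup>2" by (simp add: exp_double[symmetric])
      then show ?thesis using C by (simp add: real_sqrt_mult deriv_L2_norm_def)
    qed
    finally show "deriv_L2_norm k u \<le> K * (1 + t) powr (- real CARD('n) / 4 - real k / 2) * L1_norm u0 + C * exp (- (c / 2) * t) * deriv_L2_norm k u0"
      by (simp add: p_def M_def)
  qed
qed

theorem theorem5p2:
  fixes A0 L S :: "real^'m^'m" and A :: "'n::finite \<Rightarrow> real^'m^'m"
    and Q :: "'n \<Rightarrow> real^'m^'p" and R :: "real^'m^'p" and s :: nat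
  assumes "CARD('p) < CARD('m)"
    and "condition_A A0 A L"
    and "condition_C A0 A L Q R"
    and "condition_S S A0 L"
    and "condition_S2 S A Q R"
    and "condition_K A0 A L Q R"
  shows
    "(\<forall>u0 u. in_Hs s u0 \<and> integrable lborel u0 \<and> satisfies_constraint Q R u0 \<and>
             is_solution A0 A L u0 u \<longrightarrow>
        (\<forall>t>0. satisfies_constraint Q R (u t))) \<and>
     (\<exists>C>0. \<exists>c>0.
        \<forall>u0 u. in_Hs s u0 \<and> integrable lborel u0 \<and> satisfies_constraint Q R u0 \<and>
               is_solution A0 A L u0 u \<longrightarrow>
          (\<exists>uh. (\<forall>t\<ge>0. is_L2_fourier (u t) (uh t) \<and> continuous_on UNIV (uh t)) \<and>
                (\<forall>t\<ge>0. \<forall>\<xi>. norm (uh t \<xi>) \<le> C * exp (- c * rho \<xi> * t) * norm (fourier u0 \<xi>))) \<and>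
          (\<forall>t\<ge>0. in_Hs s (u t) \<and>
             (\<forall>k\<le>s. deriv_L2_norm k (u t)
                \<le> C * (1 + t) powr (- real CARD('n) / 4 - real k / 2) * L1_norm u0
                   + C * exp (- c * t) * deriv_L2_norm k u0)))"
proof -
  note A = assms(2) and Cc = assms(3)
  obtain C c where C: "C > 0" and c: "c > 0" and decay: "\<And>\<xi> w w'. (\<And>t. (w has_vector_derivative w' t) (at t)) \<Longrightarrow>
     (\<And>t. cmat A0 *v w' t = - pencil A L \<xi> (w t)) \<Longrightarrow> pencil Q R \<xi> (w 0) = 0 \<Longrightarrow>
     (\<forall>t\<ge>0. norm (w t) \<le> C * exp (- c * rho \<xi> * t) * norm (w 0))"
    using fourier_decay[OF assms(2-6)] by blast
  have "\<exists>K. \<forall>k. K k \<ge> 0 \<and> (\<forall>(u0 :: real^'n \<Rightarrow> real^'m) (u :: real^'n \<Rightarrow> real^'m) U W t s. in_Hs s u0 \<longrightarrow> in_Hs s u \<longrightarrow> k \<le> s \<longrightarrow> t \<ge> 0 \<longrightarrow>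
    (\<forall>i. fourier_L2 (\<lambda>x. complex_of_real (u0 x $ i)) (\<lambda>\<xi>. U \<xi> $ i)) \<longrightarrow>
    (\<forall>i. fourier_L2 (\<lambda>x. complex_of_real (u x $ i)) (\<lambda>\<xi>. W \<xi> $ i)) \<longrightarrow>
    (\<forall>\<xi>. norm (W \<xi>) \<le> C * exp (- c * rho \<xi> * t) * norm (U \<xi>)) \<longrightarrow> (\<forall>\<xi>. norm (U \<xi>) \<le> L1_norm u0) \<longrightarrow>
    deriv_L2_norm k u \<le> K k * (1 + t) powr (- real CARD('n) / 4 - real k / 2) * L1_norm u0 + C * exp (- (c / 2) * t) * deriv_L2_norm k u0)"
    by (intro choice allI deriv_decay[OF c C])
  then obtain K where K0: "\<And>k. K k \<ge> 0" and K: "\<And>k (u0 :: real^'n \<Rightarrow> real^'m) (u :: real^'n \<Rightarrow> real^'m) U W t s. in_Hs s u0 \<Longrightarrow> in_Hs s u \<Longrightarrow> k \<le> s \<Longrightarrow> t \<ge> 0 \<Longrightarrow>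
    (\<And>i. fourier_L2 (\<lambda>x. complex_of_real (u0 x $ i)) (\<lambda>\<xi>. U \<xi> $ i)) \<Longrightarrow>
    (\<And>i. fourier_L2 (\<lambda>x. complex_of_real (u x $ i)) (\<lambda>\<xi>. W \<xi> $ i)) \<Longrightarrow>
    (\<And>\<xi>. norm (W \<xi>) \<le> C * exp (- c * rho \<xi> * t) * norm (U \<xi>)) \<Longrightarrow> (\<And>\<xi>. norm (U \<xi>) \<le> L1_norm u0) \<Longrightarrow>
    deriv_L2_norm k u \<le> K k * (1 + t) powr (- real CARD('n) / 4 - real k / 2) * L1_norm u0 + C * exp (- (c / 2) * t) * deriv_L2_norm k u0"
    by blast
  \<comment> \<open>One constant for the pointwise bound and for all orders up to \<open>s\<close>;
    it dominates \<open>C\<close> and each of these \<open>K k\<close>.\<close>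
  define C' where "C' = C + (\<Sum>k\<le>s. K k)"
  have C': "C' > 0" "C \<le> C'" using C K0 by (auto simp: C'_def add_pos_nonneg sum_nonneg)
  have K': "K k \<le> C'" if "k \<le> s" for k
    using member_le_sum[of k "{..s}" K] K0 that C by (simp add: C'_def)
  \<comment> \<open>The flow of the continuous transform of \<open>u0\<close>; it serves as the
    continuous representative for which the estimate holds at every frequency.\<close>
  let ?W = "\<lambda>u0. evolution A0 A L (fourier u0)"
  have sol: "is_L2_fourier (u t) (?W u0 t)" "continuous_on UNIV (?W u0 t)" "pencil Q R \<xi> (?W u0 t \<xi>) = 0"
      "norm (?W u0 t \<xi>) \<le> C * exp (- c * rho \<xi> * t) * norm (fourier u0 \<xi>)"
    if u: "in_Hs s u0" "integrable lborel u0" "satisfies_constraint Q R u0" "is_solution A0 A L u0 u" and t: "t \<ge> 0"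
    for u0 :: "real^'n \<Rightarrow> real^'m" and u t \<xi>
  proof -
    have u0: "in_L2 u0" using u(1) by (simp add: in_Hs_def)
    show "is_L2_fourier (u t) (?W u0 t)" by (rule solution_fourier[OF A u(4,2) u0 t])
    show "continuous_on UNIV (?W u0 t)" by (intro evolution_continuous A continuous_on_fourier u t)
    have con0: "pencil Q R \<xi> (?W u0 0 \<xi>) = 0" using constraint_fourier[OF u(2) u0 u(3)] by (simp add: evolution_0)
    show "pencil Q R \<xi> (?W u0 t \<xi>) = 0"
      by (rule trans[OF constraint_conserved[OF A Cc evolution_deriv evolution_eq[OF A]] con0])
    show "norm (?W u0 t \<xi>) \<le> C * exp (- c * rho \<xi> * t) * norm (fourier u0 \<xi>)"
      using decay[OF evolution_deriv evolution_eq[OF A] con0] t by (simp add: evolution_0)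
  qed
  have L2u: "in_L2 (u t)" if "is_solution A0 A L u0 u" "t \<ge> 0" for u0 u t
    using that by (simp add: is_solution_def)
  show ?thesis
  proof (intro conjI)
    show "\<forall>u0 u. in_Hs s u0 \<and> integrable lborel u0 \<and> satisfies_constraint Q R u0 \<and> is_solution A0 A L u0 u \<longrightarrow>
        (\<forall>t>0. satisfies_constraint Q R (u t))"
    proof (intro allI impI, elim conjE)
      fix u0 :: "real^'n \<Rightarrow> real^'m" and u and t :: real
      assume u: "in_Hs s u0" "integrable lborel u0" "satisfies_constraint Q R u0" "is_solution A0 A L u0 u" and t: "t > 0"
      have t0: "t \<ge> 0" using t by simp
      show "satisfies_constraint Q R (u t)"
        by (rule constraint_from_fourier[OF L2u[OF u(4) t0] is_L2_fourier_components[OF L2u[OF u(4) t0] sol(1)[OF u t0]] sol(3)[OF u t0]])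
    qed
    show "\<exists>C>0. \<exists>c>0. \<forall>u0 u. in_Hs s u0 \<and> integrable lborel u0 \<and> satisfies_constraint Q R u0 \<and> is_solution A0 A L u0 u \<longrightarrow>
          (\<exists>uh. (\<forall>t\<ge>0. is_L2_fourier (u t) (uh t) \<and> continuous_on UNIV (uh t)) \<and>
                (\<forall>t\<ge>0. \<forall>\<xi>. norm (uh t \<xi>) \<le> C * exp (- c * rho \<xi> * t) * norm (fourier u0 \<xi>))) \<and>
          (\<forall>t\<ge>0. in_Hs s (u t) \<and>
             (\<forall>k\<le>s. deriv_L2_norm k (u t)
                \<le> C * (1 + t) powr (- real CARD('n) / 4 - real k / 2) * L1_norm u0
                   + C * exp (- c * t) * deriv_L2_norm k u0))"
    \<comment> \<open>At high frequencies only \<rho> \<ge> 1 / 2 is available, so the exponential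
      rate drops to \<open>c / 2\<close>; the pointwise bound holds at the smaller rate as
      well.\<close>
    proof (rule exI[of _ C'], intro conjI C', rule exI[of _ "c / 2"], intro conjI allI impI, use c in simp, elim conjE)
      fix u0 :: "real^'n \<Rightarrow> real^'m" and u
      assume u: "in_Hs s u0" "integrable lborel u0" "satisfies_constraint Q R u0" "is_solution A0 A L u0 u"
      have "norm (?W u0 t \<xi>) \<le> C' * exp (- (c / 2) * rho \<xi> * t) * norm (fourier u0 \<xi>)" if t: "t \<ge> 0" for t \<xi>
      proof -
        have "0 \<le> rho \<xi>" by (simp add: rho_def)
        then have "0 \<le> c * (t * rho \<xi>)" using c t by simp
        then have "C * exp (- c * rho \<xi> * t) * norm (fourier u0 \<xi>) \<le> C' * exp (- (c / 2) * rho \<xi> * t) * norm (fourier u0 \<xi>)"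
          using C C' by (intro mult_right_mono mult_mono) (auto simp: mult_ac)
        then show ?thesis using sol(4)[OF u t, of \<xi>] by linarith
      qed
      then show "\<exists>uh. (\<forall>t\<ge>0. is_L2_fourier (u t) (uh t) \<and> continuous_on UNIV (uh t)) \<and>
                (\<forall>t\<ge>0. \<forall>\<xi>. norm (uh t \<xi>) \<le> C' * exp (- (c / 2) * rho \<xi> * t) * norm (fourier u0 \<xi>))"
        using sol(1,2)[OF u] by (intro exI[of _ "?W u0"]) auto
    next
      fix u0 :: "real^'n \<Rightarrow> real^'m" and u and t :: real
      assume t: "t \<ge> 0" and "in_Hs s u0 \<and> integrable lborel u0 \<and> satisfies_constraint Q R u0 \<and> is_solution A0 A L u0 u"
      then have u: "in_Hs s u0" "integrable lborel u0" "satisfies_constraint Q R u0" "is_solution A0 A L u0 u" by auto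
      have u0: "in_L2 u0" using u(1) by (simp add: in_Hs_def)
      note ut = L2u[OF u(4) t]
      have U: "fourier_L2 (\<lambda>x. complex_of_real (u0 x $ i)) (\<lambda>\<xi>. fourier u0 \<xi> $ i)" for i
        unfolding fourier_nth[OF u(2)] by (intro fourier_L2_L1 integrable_component in_L2_component u u0)
      note W = is_L2_fourier_components[OF ut sol(1)[OF u t]]
      have Wm: "?W u0 t \<in> borel_measurable borel" by (intro borel_measurable_continuous_onI sol(2)[OF u t])
      \<comment> \<open>Solutions are only assumed to lie in L2. The flow is bounded by
        \<open>C\<close> times the initial transform at every frequency, so the monomial weights
        stay in L2 and the weak derivatives exist.\<close>
      have Hs: "in_Hs s (u t)"
        unfolding in_Hs_def
      proof (intro conjI ut allI impI)
        fix js :: "'n list" assume js: "length js \<le> s"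
        have "in_L2 (\<lambda>\<xi>. symbol_monomial js \<xi> *s ?W u0 t \<xi>)"
        proof (rule in_L2_bound[OF L2_norm_weak_deriv(1)[OF u(1) js U], where c=C])
          show "(\<lambda>\<xi>. symbol_monomial js \<xi> *s ?W u0 t \<xi>) \<in> borel_measurable borel"
            by (intro cmult_measurable Wm) simp
          fix \<xi> :: "real^'n"
          have "0 \<le> rho \<xi>" by (simp add: rho_def)
          then have "exp (- c * rho \<xi> * t) \<le> 1" using c t by simp
          then have "C * exp (- c * rho \<xi> * t) * norm (fourier u0 \<xi>) \<le> C * 1 * norm (fourier u0 \<xi>)"
            using C by (intro mult_right_mono mult_left_mono) auto
          then have "norm (?W u0 t \<xi>) \<le> C * norm (fourier u0 \<xi>)" using sol(4)[OF u t, of \<xi>] by simp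
          then have "norm (symbol_monomial js \<xi>) * norm (?W u0 t \<xi>) \<le> norm (symbol_monomial js \<xi>) * (C * norm (fourier u0 \<xi>))"
            by (intro mult_left_mono) auto
          then show "norm (symbol_monomial js \<xi> *s ?W u0 t \<xi>) \<le> C * norm (symbol_monomial js \<xi> *s fourier u0 \<xi>)"
            by (simp add: norm_cmult mult_ac)
        qed
        then show "\<exists>v. in_L2 v \<and> is_weak_deriv js (u t) v" by (rule weak_deriv_exists[OF ut W])
      qed
      then show "in_Hs s (u t)" .
      fix k assume k: "k \<le> s"
      have "deriv_L2_norm k (u t) \<le> K k * (1 + t) powr (- real CARD('n) / 4 - real k / 2) * L1_norm u0 + C * exp (- (c / 2) * t) * deriv_L2_norm k u0"
        by (rule K[OF u(1) Hs k t U W sol(4)[OF u t] fourier_bound[OF u(2)]])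
      also have "\<dots> \<le> C' * (1 + t) powr (- real CARD('n) / 4 - real k / 2) * L1_norm u0 + C' * exp (- (c / 2) * t) * deriv_L2_norm k u0"
        using K'[OF k] C'(2) by (intro add_mono mult_right_mono) (auto simp: L1_norm_def deriv_L2_norm_def sum_nonneg)
      finally show "deriv_L2_norm k (u t) \<le> C' * (1 + t) powr (- real CARD('n) / 4 - real k / 2) * L1_norm u0 + C' * exp (- (c / 2) * t) * deriv_L2_norm k u0" .
    qed
  qed
qed

end
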